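(* The category of connected complex graded bundles and the category of connected nice complex homogeneity structures are equivalent. At the level of objects the equivalence is provided by the following two constructions: (1) with every complex graded bundle $\tau:E\to M$ one associates the nice complex homogeneity structure $(E,h^E)$, where $h^E:\mathbb C\times E\to E$ is the action by homotheties of $E$; (2) given a nice complex homogeneity structure $(M,h)$, the map $h_0:M\to M_0:=h_0(M)$, $h_0=h(0,\cdot)$, provides $M$ with a canonical structure of a complex graded bundle (over $M_0$) such that $h$ is the related action by homotheties. At the level of morphisms: every morphism of complex graded bundles is a morphism of the related nice complex homogeneity structures and, conversely, every morphism of nice complex homogeneity structures is a morphism of the related canonical complex graded bundles.
   Context: Graded spaces (real and complex). Let $\mathbb K=\mathbb R$ or $\mathbb C$. Let $\mathbf d=(d_1,\dots,d_k)$ be a sequence of non-negative integers, $|\mathbf d|=d_1+\dots+d_k$, $I$ a set with $|\mathbf d|$ elements and $I\ni\alpha\mapsto w^\alpha\in\mathbb Z_{+}$ (positive integers) a map with $d_i=\#\{\alpha:w^\alpha=i\}$. A (real) graded space ($\mathbb K=\mathbb R$), respectively complex graded space ($\mathbb K=\mathbb C$), of rank $\mathbf d$ is a smooth manifold diffeomorphic to $\mathbb R^{|\mathbf d|}$, respectively a complex manifold biholomorphic to $\mathbb C^{|\mathbf d|}$, equipped with an equivalence class of systems of graded coordinates, i.e. global smooth (resp. holomorphic) coordinate systems $(z^\alpha)_{\alpha\in I}$ with values in $\mathbb K^{|\mathbf d|}$ and with weight $w^\alpha$ assigned to $z^\alpha$. Two such systems are equivalent if each new coordinate $\underline z^\alpha$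 of weight $\underline w^\alpha$ is a polynomial $\sum_{j\ge 1}\sum c^\alpha_{\alpha_1\dots\alpha_j}z^{\alpha_1}\cdots z^{\alpha_j}$ with coefficients in $\mathbb K$, summed over indices with $w^{\alpha_1}+\dots+w^{\alpha_j}=\underline w^\alpha$. The degree is the highest $i$ with $d_i\neq0$. Morphisms of graded spaces are smooth (resp. holomorphic) maps given in graded coordinates by polynomials homogeneous with respect to the weights. The action by homotheties is $h(\xi,(z^\alpha))=(\xi^{w^\alpha}z^\alpha)$, $\xi\in\mathbb K$. Graded bundles. A (real) graded bundle, resp. complex graded bundle, of rank $\mathbf d$ is a smooth fiber bundle $\tau:E\to M$ over a real smooth manifold $M$ with typical fiber $\mathbb K^{\mathbf d}$, considered as a (real, resp. complex) graded space of rank $\mathbf d$, admitting local trivializations whose transition functions at $q$ are isomorphisms of (real, resp. complex) graded spaces depending smoothly on the base point $q$. Its degree is the degree of the typical fiber. Morphisms are fiber-bundle morphisms which are morphisms of (real, resp. complex) graded spaces on fibers. Homotheties of the fibers define the action by homotheties $h^E:\mathbb K\times E\to E$. Homogeneity structures. A (real) homogeneity structure, resp. complex homogeneity structure, on a smooth manifold $M$ is a smooth action $h:\mathbb K\times M\to M$ of the multiplicative monoid $(\mathbb K,\cdot)$, $\mathbb K=\mathbb R$, resp. $\mathbb K=\mathbb C$: $h_\xi\circ h_\eta=h_{\xi\eta}$ and $h_1=\mathrm{id}$, where $h_\xi=h(\xi,\cdot)$. Morphisms are smooth maps intertwining the actions. It is known (Grabowski–Rotkiewicz) that every real homogeneity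 structure $(M,h)$ on a connected manifold makes $h_0:M\to h_0(M)$ a real graded bundle whose homotheties are $h$, and that smooth maps intertwining real homogeneity structures are exactly the morphisms of the corresponding real graded bundles. Tower and cores. For a real graded bundle $E^k\to M$ of degree $k$ and $0\le j\le k$, let $E^j$ be the quotient of $E^k$ obtained by keeping only the coordinates of weight $\le j$ (a graded bundle over $M$ of degree at most $j$); this gives the tower $E^k\to E^{k-1}\to\dots\to E^1\to M$. The core $\widehat{E^j}\subset E^j$ is the submanifold on which all fiber coordinates of weight less than $j$ vanish; it is a vector bundle over $M$ with linear fiber coordinates the weight $j$ coordinates. Morphisms of graded bundles induce morphisms of the towers and vector bundle morphisms of the cores. Nice structures. Let $h:\mathbb C\times E^k\to E^k$ be a complex homogeneity structure such that $h_0:E^k\to M$ is the real graded bundle of degree $k$ associated with $h|_{\mathbb R\times E^k}$. Each $h_\xi$, $\xi\in\mathbb C$, commutes with the real homotheties, hence is a real graded bundle morphism and induces maps on each $E^j$ and on each core $\widehat{E^j}$, $j=1,\dots,k$. Put $\varepsilon_{2j}=e^{2\pi\sqrt{-1}/(2j)}$ and $J_{2j}=h(\varepsilon_{2j},\cdot)$. The structure $h$ is called nice if $J_{2j}$ acts as minus identity on the core bundle $\widehat{E^j}$ for every $j=1,\dots,k$. Nice complex homogeneity structures form a full subcategory of complex homogeneity structures. "Connected" refers to connectedness of the manifold on which the action is defined (the total space). *)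

theory Defs
  imports "HOL-Analysis.Analysis"
begin

section \<open>Smooth functions on open subsets of \<open>\<real>\<^sup>n\<close>\<close>

text \<open>
  Dimensions vary inside the statement, so \<open>\<real>\<^sup>n\<close> is the library's \<^const>\<open>Euclidean_space\<close> \<open>n\<close>: the
  functions \<open>nat \<Rightarrow> real\<close> vanishing from index \<open>n\<close> on.  \<open>D i\<close> below is the \<open>i\<close>-th partial derivative.
\<close>

primrec Ck_on :: "nat \<Rightarrow> nat \<Rightarrow> (nat \<Rightarrow> real) set \<Rightarrow> ((nat \<Rightarrow> real) \<Rightarrow> real) \<Rightarrow> bool" where
  "Ck_on 0 n U f \<longleftrightarrow> continuous_map (subtopology (Euclidean_space n) U) euclideanreal f"
| "Ck_on (Suc k) n U f \<longleftrightarrow>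
     continuous_map (subtopology (Euclidean_space n) U) euclideanreal f \<and>
     (\<exists>D. \<forall>i<n. (\<forall>x\<in>U. ((\<lambda>t. f (x(i := t))) has_real_derivative D i x) (at (x i))) \<and>
                 Ck_on k n U (D i))"

definition smooth_on_coords ::
    "nat \<Rightarrow> nat \<Rightarrow> (nat \<Rightarrow> real) set \<Rightarrow> ((nat \<Rightarrow> real) \<Rightarrow> (nat \<Rightarrow> real)) \<Rightarrow> bool" where
  "smooth_on_coords n m U f \<longleftrightarrow> openin (Euclidean_space n) U \<and> (\<forall>j<m. \<forall>k. Ck_on k n U (\<lambda>x. f x j))"


section \<open>Smooth manifolds\<close>

text \<open>
  A manifold carries its maximal atlas.  A chart is a pair of its domain and a coordinate map; the
  values of the coordinate map outside of the domain are irrelevant, and a maximal atlas contains a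
  chart together with all its variants outside of the domain.
\<close>

type_synonym 'a chart = "'a set \<times> ('a \<Rightarrow> nat \<Rightarrow> real)"

record 'a manifold =
  mtop :: "'a topology"
  mdim :: nat
  matlas :: "'a chart set"

abbreviation mcarrier :: "'a manifold \<Rightarrow> 'a set" where
  "mcarrier M \<equiv> topspace (mtop M)"

definition is_chart :: "'a topology \<Rightarrow> nat \<Rightarrow> 'a chart \<Rightarrow> bool" where
  "is_chart X n c \<longleftrightarrow> (case c of (U, \<phi>) \<Rightarrow>
     openin X U \<and> openin (Euclidean_space n) (\<phi> ` U) \<and>
     homeomorphic_map (subtopology X U) (subtopology (Euclidean_space n) (\<phi> ` U)) \<phi>)"

definition charts_compatible :: "nat \<Rightarrow> 'a chart \<Rightarrow> 'a chart \<Rightarrow> bool" where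
  "charts_compatible n c c' \<longleftrightarrow> (case c of (U, \<phi>) \<Rightarrow> case c' of (V, \<psi>) \<Rightarrow>
     smooth_on_coords n n (\<phi> ` (U \<inter> V)) (\<psi> \<circ> inv_into U \<phi>) \<and>
     smooth_on_coords n n (\<psi> ` (U \<inter> V)) (\<phi> \<circ> inv_into V \<psi>))"

definition smooth_manifold :: "'a manifold \<Rightarrow> bool" where
  "smooth_manifold M \<longleftrightarrow>
     Hausdorff_space (mtop M) \<and> second_countable (mtop M) \<and>
     (\<forall>c\<in>matlas M. is_chart (mtop M) (mdim M) c) \<and>
     \<Union> (fst ` matlas M) = mcarrier M \<and>
     (\<forall>c\<in>matlas M. \<forall>c'\<in>matlas M. charts_compatible (mdim M) c c') \<and>
     (\<forall>c. is_chart (mtop M) (mdim M) c \<and> (\<forall>c'\<in>matlas M. charts_compatible (mdim M) c c')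
        \<longrightarrow> c \<in> matlas M)"

text \<open>The empty space is not regarded as connected.\<close>

definition connected_manifold :: "'a manifold \<Rightarrow> bool" where
  "connected_manifold M \<longleftrightarrow> connected_space (mtop M) \<and> mcarrier M \<noteq> {}"

definition generated_manifold :: "'a topology \<Rightarrow> nat \<Rightarrow> 'a chart set \<Rightarrow> 'a manifold" where
  "generated_manifold X n A =
     \<lparr>mtop = X, mdim = n, matlas = {c. is_chart X n c \<and> (\<forall>c'\<in>A. charts_compatible n c c')}\<rparr>"

definition open_submanifold :: "'a manifold \<Rightarrow> 'a set \<Rightarrow> 'a manifold" where
  "open_submanifold M U =
     \<lparr>mtop = subtopology (mtop M) U, mdim = mdim M, matlas = {c \<in> matlas M. fst c \<subseteq> U}\<rparr>"

definition append_coords :: "nat \<Rightarrow> (nat \<Rightarrow> real) \<Rightarrow> (nat \<Rightarrow> real) \<Rightarrow> nat \<Rightarrow> real" where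
  "append_coords m x y = (\<lambda>i. if i < m then x i else y (i - m))"

definition product_manifold :: "'a manifold \<Rightarrow> 'b manifold \<Rightarrow> ('a \<times> 'b) manifold" where
  "product_manifold M N =
     generated_manifold (prod_topology (mtop M) (mtop N)) (mdim M + mdim N)
       {(U \<times> V, \<lambda>(p, q). append_coords (mdim M) (\<phi> p) (\<psi> q)) | U \<phi> V \<psi>.
          (U, \<phi>) \<in> matlas M \<and> (V, \<psi>) \<in> matlas N}"

definition smooth_map :: "'a manifold \<Rightarrow> 'b manifold \<Rightarrow> ('a \<Rightarrow> 'b) \<Rightarrow> bool" where
  "smooth_map M N f \<longleftrightarrow>
     continuous_map (mtop M) (mtop N) f \<and>
     (\<forall>(U, \<phi>)\<in>matlas M. \<forall>(V, \<psi>)\<in>matlas N.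
        smooth_on_coords (mdim M) (mdim N) (\<phi> ` (U \<inter> f -` V)) (\<psi> \<circ> f \<circ> inv_into U \<phi>))"

definition diffeomorphism :: "'a manifold \<Rightarrow> 'b manifold \<Rightarrow> ('a \<Rightarrow> 'b) \<Rightarrow> bool" where
  "diffeomorphism M N f \<longleftrightarrow> smooth_map M N f \<and>
     (\<exists>g. smooth_map N M g \<and> (\<forall>p\<in>mcarrier M. g (f p) = p) \<and> (\<forall>q\<in>mcarrier N. f (g q) = q))"


section \<open>The spaces \<open>\<bbbK>\<close> and \<open>\<bbbK>\<^sup>N\<close> as smooth manifolds\<close>

text \<open>
  The field \<open>\<bbbK>\<close> is a type in the sort \<open>{real_normed_field, euclidean_space}\<close>, which is used at the
  types \<^typ>\<open>real\<close> and \<^typ>\<open>complex\<close> only.  The smooth structures below do not depend on the chosen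
  enumeration of the real basis of \<open>\<bbbK>\<close>.
\<close>

definition basis_enum :: "nat \<Rightarrow> 'k::euclidean_space" where
  "basis_enum = (SOME b. bij_betw b {..<DIM('k)} Basis)"

definition field_manifold :: "'k::euclidean_space manifold" where
  "field_manifold = generated_manifold euclidean DIM('k)
     {(UNIV, \<lambda>z i. if i < DIM('k) then z \<bullet> basis_enum i else 0)}"

definition Kspace :: "nat \<Rightarrow> (nat \<Rightarrow> 'k::zero) set" where
  "Kspace N = {z. \<forall>i\<ge>N. z i = 0}"

definition Kspace_manifold :: "nat \<Rightarrow> (nat \<Rightarrow> 'k::euclidean_space) manifold" where
  "Kspace_manifold N =
     generated_manifold (subtopology (product_topology (\<lambda>_. euclidean) UNIV) (Kspace N)) (N * DIM('k))
       {(Kspace N, \<lambda>z i. if i < N * DIM('k) then z (i div DIM('k)) \<bullet> basis_enum (i mod DIM('k)) else 0)}"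


section \<open>Graded spaces\<close>

text \<open>
  A rank \<open>(d\<^sub>1,\<dots>,d\<^sub>k)\<close> is encoded by the sorted list \<open>ws\<close> of weights containing each \<open>i \<ge> 1\<close> exactly
  \<open>d\<^sub>i\<close> times; thus \<open>I = {..<length ws}\<close> and the coordinate \<open>z \<alpha>\<close> has the weight \<open>ws ! \<alpha>\<close>.  The sequences
  \<open>(d\<^sub>1,\<dots>,d\<^sub>k)\<close> and \<open>(d\<^sub>1,\<dots>,d\<^sub>k,0)\<close> are identified.
\<close>

definition is_weights :: "nat list \<Rightarrow> bool" where
  "is_weights ws \<longleftrightarrow> sorted ws \<and> (\<forall>w\<in>set ws. 1 \<le> w)"

definition weights_degree :: "nat list \<Rightarrow> nat" where
  "weights_degree ws = Max (insert 0 (set ws))"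

definition homogeneous_polynomial ::
    "nat list \<Rightarrow> nat \<Rightarrow> ((nat \<Rightarrow> 'k::comm_ring_1) \<Rightarrow> 'k) \<Rightarrow> bool" where
  "homogeneous_polynomial ws w f \<longleftrightarrow>
     (\<exists>c. \<forall>z\<in>Kspace (length ws).
        f z = (\<Sum>as | as \<noteq> [] \<and> set as \<subseteq> {..<length ws} \<and> (\<Sum>a\<leftarrow>as. ws ! a) = w.
                 c as * (\<Prod>a\<leftarrow>as. z a)))"

definition graded_space_morphism ::
    "nat list \<Rightarrow> nat list \<Rightarrow> ((nat \<Rightarrow> 'k::comm_ring_1) \<Rightarrow> (nat \<Rightarrow> 'k)) \<Rightarrow> bool" where
  "graded_space_morphism ws ws' f \<longleftrightarrow>
     f ` Kspace (length ws) \<subseteq> Kspace (length ws') \<and>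
     (\<forall>b<length ws'. homogeneous_polynomial ws (ws' ! b) (\<lambda>z. f z b))"

definition graded_space_isomorphism ::
    "nat list \<Rightarrow> nat list \<Rightarrow> ((nat \<Rightarrow> 'k::comm_ring_1) \<Rightarrow> (nat \<Rightarrow> 'k)) \<Rightarrow> bool" where
  "graded_space_isomorphism ws ws' f \<longleftrightarrow> graded_space_morphism ws ws' f \<and>
     (\<exists>g. graded_space_morphism ws' ws g \<and>
        (\<forall>z\<in>Kspace (length ws). g (f z) = z) \<and> (\<forall>z\<in>Kspace (length ws'). f (g z) = z))"

definition graded_scale :: "nat list \<Rightarrow> 'k::comm_ring_1 \<Rightarrow> (nat \<Rightarrow> 'k) \<Rightarrow> nat \<Rightarrow> 'k" where
  "graded_scale ws \<xi> z = (\<lambda>a. if a < length ws then \<xi> ^ (ws ! a) * z a else 0)"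


section \<open>Graded bundles\<close>

text \<open>
  A graded bundle carries its maximal graded atlas: \<open>trivs\<close> consists of all pairs \<open>(U, \<psi>)\<close> such that
  \<open>p \<mapsto> (\<tau> p, \<psi> p)\<close> is an admissible local trivialization over the open set \<open>U\<close>.  Smooth dependence
  of the transition functions on the base point is contained in the fact that local trivializations
  are diffeomorphisms onto \<open>U \<times> \<bbbK>\<^sup>N\<close>.
\<close>

record ('e, 'b, 'k) graded_bundle =
  tot :: "'e manifold"
  base :: "'b manifold"
  proj :: "'e \<Rightarrow> 'b"
  weights :: "nat list"
  trivs :: "('b set \<times> ('e \<Rightarrow> nat \<Rightarrow> 'k)) set"

definition fiber :: "('e, 'b, 'k) graded_bundle \<Rightarrow> 'b \<Rightarrow> 'e set" where
  "fiber E q = {p \<in> mcarrier (tot E). proj E p = q}"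

definition local_trivialization ::
    "('e, 'b, 'k::euclidean_space) graded_bundle \<Rightarrow> 'b set \<times> ('e \<Rightarrow> nat \<Rightarrow> 'k) \<Rightarrow> bool" where
  "local_trivialization E t \<longleftrightarrow> (case t of (U, \<psi>) \<Rightarrow>
     openin (mtop (base E)) U \<and>
     diffeomorphism
       (open_submanifold (tot E) {p \<in> mcarrier (tot E). proj E p \<in> U})
       (product_manifold (open_submanifold (base E) U) (Kspace_manifold (length (weights E))))
       (\<lambda>p. (proj E p, \<psi> p)))"

definition trivs_compatible ::
    "('e, 'b, 'k::comm_ring_1) graded_bundle \<Rightarrow> 'b set \<times> ('e \<Rightarrow> nat \<Rightarrow> 'k)
       \<Rightarrow> 'b set \<times> ('e \<Rightarrow> nat \<Rightarrow> 'k) \<Rightarrow> bool" where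
  "trivs_compatible E t t' \<longleftrightarrow> (case t of (U, \<psi>) \<Rightarrow> case t' of (V, \<theta>) \<Rightarrow>
     (\<forall>q\<in>U \<inter> V. \<exists>g. graded_space_isomorphism (weights E) (weights E) g \<and>
                     (\<forall>p\<in>fiber E q. \<theta> p = g (\<psi> p))))"

definition is_graded_bundle ::
    "('e, 'b, 'k::{real_normed_field, euclidean_space}) graded_bundle \<Rightarrow> bool" where
  "is_graded_bundle E \<longleftrightarrow>
     smooth_manifold (tot E) \<and> smooth_manifold (base E) \<and>
     smooth_map (tot E) (base E) (proj E) \<and> proj E ` mcarrier (tot E) = mcarrier (base E) \<and>
     proj E \<in> extensional (mcarrier (tot E)) \<and>
     is_weights (weights E) \<and>
     (\<forall>t\<in>trivs E. local_trivialization E t) \<and>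
     \<Union> (fst ` trivs E) = mcarrier (base E) \<and>
     (\<forall>t\<in>trivs E. \<forall>t'\<in>trivs E. trivs_compatible E t t') \<and>
     (\<forall>t. local_trivialization E t \<and> (\<forall>t'\<in>trivs E. trivs_compatible E t t') \<longrightarrow> t \<in> trivs E)"

definition bundle_degree :: "('e, 'b, 'k) graded_bundle \<Rightarrow> nat" where
  "bundle_degree E = weights_degree (weights E)"

text \<open>
  Morphisms are pairs of the map of total spaces and the map of bases; to have equality of morphisms,
  maps are \<^const>\<open>undefined\<close> outside of their domains (\<^const>\<open>extensional\<close>), here and for actions below.
\<close>

definition graded_bundle_hom ::
    "('e, 'b, 'k::{real_normed_field, euclidean_space}) graded_bundle \<Rightarrow> ('e2, 'b2, 'k) graded_bundle
       \<Rightarrow> (('e \<Rightarrow> 'e2) \<times> ('b \<Rightarrow> 'b2)) set" where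
  "graded_bundle_hom E E' = {(\<Phi>, \<phi>).
     smooth_map (tot E) (tot E') \<Phi> \<and> \<Phi> \<in> extensional (mcarrier (tot E)) \<and>
     smooth_map (base E) (base E') \<phi> \<and> \<phi> \<in> extensional (mcarrier (base E)) \<and>
     (\<forall>p\<in>mcarrier (tot E). proj E' (\<Phi> p) = \<phi> (proj E p)) \<and>
     (\<forall>q\<in>mcarrier (base E). \<forall>(U, \<psi>)\<in>trivs E. \<forall>(V, \<theta>)\<in>trivs E'. q \<in> U \<and> \<phi> q \<in> V \<longrightarrow>
        (\<exists>g. graded_space_morphism (weights E) (weights E') g \<and>
             (\<forall>p\<in>fiber E q. \<theta> (\<Phi> p) = g (\<psi> p))))}"

definition homothety :: "('e, 'b, 'k::comm_ring_1) graded_bundle \<Rightarrow> 'k \<Rightarrow> 'e \<Rightarrow> 'e" where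
  "homothety E \<xi> = (\<lambda>p\<in>mcarrier (tot E). THE p'. p' \<in> fiber E (proj E p) \<and>
     (\<forall>(U, \<psi>)\<in>trivs E. proj E p \<in> U \<longrightarrow> \<psi> p' = graded_scale (weights E) \<xi> (\<psi> p)))"


section \<open>The tower of a graded bundle and its cores\<close>

text \<open>
  \<open>E\<^sup>j\<close> is the quotient of \<open>E\<close> by the relation ``same base point and same coordinates of weight at
  most \<open>j\<close>''; its points are equivalence classes.
\<close>

definition tower_rel :: "('e, 'b, 'k) graded_bundle \<Rightarrow> nat \<Rightarrow> ('e \<times> 'e) set" where
  "tower_rel E j = {(p, p'). p \<in> mcarrier (tot E) \<and> p' \<in> fiber E (proj E p) \<and>
     (\<forall>(U, \<psi>)\<in>trivs E. proj E p \<in> U \<longrightarrow>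
        (\<forall>a<length (weights E). weights E ! a \<le> j \<longrightarrow> \<psi> p a = \<psi> p' a))}"

definition tower :: "('e, 'b, 'k) graded_bundle \<Rightarrow> nat \<Rightarrow> 'e set set" where
  "tower E j = mcarrier (tot E) // tower_rel E j"

definition tower_map :: "('e, 'b, 'k) graded_bundle \<Rightarrow> nat \<Rightarrow> ('e \<Rightarrow> 'e) \<Rightarrow> 'e set \<Rightarrow> 'e set" where
  "tower_map E j f x = tower_rel E j `` (f ` x)"

definition core :: "('e, 'b, 'k::zero) graded_bundle \<Rightarrow> nat \<Rightarrow> 'e set set" where
  "core E j = {x \<in> tower E j. \<forall>p\<in>x. \<forall>(U, \<psi>)\<in>trivs E. proj E p \<in> U \<longrightarrow>
     (\<forall>a<length (weights E). weights E ! a < j \<longrightarrow> \<psi> p a = 0)}"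

text \<open>Minus identity of the core, a vector bundle whose linear coordinates are those of weight \<open>j\<close>.\<close>

definition core_uminus :: "('e, 'b, 'k::ab_group_add) graded_bundle \<Rightarrow> nat \<Rightarrow> 'e set \<Rightarrow> 'e set" where
  "core_uminus E j x = (THE y. y \<in> core E j \<and>
     (\<forall>p\<in>x. \<forall>p'\<in>y. proj E p' = proj E p \<and> (\<forall>(U, \<psi>)\<in>trivs E. proj E p \<in> U \<longrightarrow>
        (\<forall>a<length (weights E). weights E ! a = j \<longrightarrow> \<psi> p' a = - \<psi> p a))))"


section \<open>Homogeneity structures\<close>

definition homogeneity_structure ::
    "'a manifold \<Rightarrow> ('k::{real_normed_field, euclidean_space} \<Rightarrow> 'a \<Rightarrow> 'a) \<Rightarrow> bool" where
  "homogeneity_structure M h \<longleftrightarrow>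
     smooth_manifold M \<and>
     smooth_map (product_manifold field_manifold M) M (\<lambda>(\<xi>, p). h \<xi> p) \<and>
     (\<forall>\<xi>. h \<xi> \<in> extensional (mcarrier M)) \<and>
     (\<forall>p\<in>mcarrier M. h 1 p = p) \<and>
     (\<forall>\<xi> \<eta>. \<forall>p\<in>mcarrier M. h \<xi> (h \<eta> p) = h (\<xi> * \<eta>) p)"

definition homogeneity_hom ::
    "'a manifold \<times> ('k \<Rightarrow> 'a \<Rightarrow> 'a) \<Rightarrow> 'b manifold \<times> ('k \<Rightarrow> 'b \<Rightarrow> 'b) \<Rightarrow> ('a \<Rightarrow> 'b) set" where
  "homogeneity_hom X Y = {f. smooth_map (fst X) (fst Y) f \<and> f \<in> extensional (mcarrier (fst X)) \<and>
     (\<forall>\<xi>. \<forall>p\<in>mcarrier (fst X). f (snd X \<xi> p) = snd Y \<xi> (f p))}"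

text \<open>
  \<open>bundle_of_structure M h E\<close>: \<open>h 0\<close>, as a map from \<open>M\<close> onto its image, is the projection of the
  graded bundle \<open>E\<close> and \<open>h\<close> is the action by homotheties of \<open>E\<close>.
\<close>

definition bundle_of_structure ::
    "'a manifold \<Rightarrow> ('k::{real_normed_field, euclidean_space} \<Rightarrow> 'a \<Rightarrow> 'a)
       \<Rightarrow> ('a, 'a, 'k) graded_bundle \<Rightarrow> bool" where
  "bundle_of_structure M h E \<longleftrightarrow> is_graded_bundle E \<and> tot E = M \<and>
     mcarrier (base E) = h 0 ` mcarrier M \<and> proj E = h 0 \<and> homothety E = h"

definition restrict_real :: "(complex \<Rightarrow> 'a \<Rightarrow> 'a) \<Rightarrow> real \<Rightarrow> 'a \<Rightarrow> 'a" where
  "restrict_real h = (\<lambda>r. h (complex_of_real r))"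

text \<open>
  \<open>R\<close> is the real graded bundle associated with the restriction of \<open>h\<close> to the real numbers.  For a
  connected \<open>M\<close> there is exactly one such \<open>R\<close>.
\<close>

definition nice_structure :: "'a manifold \<Rightarrow> (complex \<Rightarrow> 'a \<Rightarrow> 'a) \<Rightarrow> bool" where
  "nice_structure M h \<longleftrightarrow> homogeneity_structure M h \<and>
     (\<exists>R :: ('a, 'a, real) graded_bundle. bundle_of_structure M (restrict_real h) R \<and>
        (\<forall>j\<in>{1..bundle_degree R}. \<forall>x\<in>core R j.
           tower_map R j (h (exp (2 * of_real pi * \<i> / of_nat (2 * j)))) x = core_uminus R j x))"

definition canonical_bundle ::
    "'a manifold \<Rightarrow> (complex \<Rightarrow> 'a \<Rightarrow> 'a) \<Rightarrow> ('a, 'a, complex) graded_bundle" where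
  "canonical_bundle M h = (THE E. bundle_of_structure M h E)"


section \<open>Categories\<close>

text \<open>
  Hom-sets of different pairs of objects need not be disjoint, so composition and the action of
  functors on morphisms take the objects as arguments: \<open>Comp C a b c g f\<close> is the composite
  of \<open>f : a \<rightarrow> b\<close> and \<open>g : b \<rightarrow> c\<close>.
\<close>

record ('o, 'm) cat =
  Obj :: "'o set"
  Hom :: "'o \<Rightarrow> 'o \<Rightarrow> 'm set"
  Ident :: "'o \<Rightarrow> 'm"
  Comp :: "'o \<Rightarrow> 'o \<Rightarrow> 'o \<Rightarrow> 'm \<Rightarrow> 'm \<Rightarrow> 'm"

definition is_category :: "('o, 'm) cat \<Rightarrow> bool" where
  "is_category C \<longleftrightarrow>
     (\<forall>a\<in>Obj C. Ident C a \<in> Hom C a a) \<and>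
     (\<forall>a\<in>Obj C. \<forall>b\<in>Obj C. \<forall>c\<in>Obj C. \<forall>f\<in>Hom C a b. \<forall>g\<in>Hom C b c. Comp C a b c g f \<in> Hom C a c) \<and>
     (\<forall>a\<in>Obj C. \<forall>b\<in>Obj C. \<forall>f\<in>Hom C a b.
        Comp C a a b f (Ident C a) = f \<and> Comp C a b b (Ident C b) f = f) \<and>
     (\<forall>a\<in>Obj C. \<forall>b\<in>Obj C. \<forall>c\<in>Obj C. \<forall>d\<in>Obj C. \<forall>f\<in>Hom C a b. \<forall>g\<in>Hom C b c. \<forall>k\<in>Hom C c d.
        Comp C a c d k (Comp C a b c g f) = Comp C a b d (Comp C b c d k g) f)"

definition iso_in :: "('o, 'm) cat \<Rightarrow> 'o \<Rightarrow> 'o \<Rightarrow> 'm \<Rightarrow> bool" where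
  "iso_in C a b f \<longleftrightarrow> f \<in> Hom C a b \<and>
     (\<exists>g\<in>Hom C b a. Comp C a b a g f = Ident C a \<and> Comp C b a b f g = Ident C b)"

record ('o, 'm, 'p, 'n) cat_functor =
  on_obj :: "'o \<Rightarrow> 'p"
  on_hom :: "'o \<Rightarrow> 'o \<Rightarrow> 'm \<Rightarrow> 'n"

definition is_functor :: "('o, 'm) cat \<Rightarrow> ('p, 'n) cat \<Rightarrow> ('o, 'm, 'p, 'n) cat_functor \<Rightarrow> bool" where
  "is_functor C D F \<longleftrightarrow>
     (\<forall>a\<in>Obj C. on_obj F a \<in> Obj D) \<and>
     (\<forall>a\<in>Obj C. \<forall>b\<in>Obj C. \<forall>f\<in>Hom C a b. on_hom F a b f \<in> Hom D (on_obj F a) (on_obj F b)) \<and>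
     (\<forall>a\<in>Obj C. on_hom F a a (Ident C a) = Ident D (on_obj F a)) \<and>
     (\<forall>a\<in>Obj C. \<forall>b\<in>Obj C. \<forall>c\<in>Obj C. \<forall>f\<in>Hom C a b. \<forall>g\<in>Hom C b c.
        on_hom F a c (Comp C a b c g f) =
          Comp D (on_obj F a) (on_obj F b) (on_obj F c) (on_hom F b c g) (on_hom F a b f))"

definition id_functor :: "('o, 'm, 'o, 'm) cat_functor" where
  "id_functor = \<lparr>on_obj = (\<lambda>a. a), on_hom = (\<lambda>_ _ f. f)\<rparr>"

definition comp_functor ::
    "('p, 'n, 'q, 'l) cat_functor \<Rightarrow> ('o, 'm, 'p, 'n) cat_functor \<Rightarrow> ('o, 'm, 'q, 'l) cat_functor" where
  "comp_functor G F = \<lparr>on_obj = (\<lambda>a. on_obj G (on_obj F a)),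
     on_hom = (\<lambda>a b f. on_hom G (on_obj F a) (on_obj F b) (on_hom F a b f))\<rparr>"

definition natural_isomorphism ::
    "('o, 'm) cat \<Rightarrow> ('p, 'n) cat \<Rightarrow> ('o, 'm, 'p, 'n) cat_functor \<Rightarrow> ('o, 'm, 'p, 'n) cat_functor
       \<Rightarrow> ('o \<Rightarrow> 'n) \<Rightarrow> bool" where
  "natural_isomorphism C D F G \<eta> \<longleftrightarrow>
     (\<forall>a\<in>Obj C. iso_in D (on_obj F a) (on_obj G a) (\<eta> a)) \<and>
     (\<forall>a\<in>Obj C. \<forall>b\<in>Obj C. \<forall>f\<in>Hom C a b.
        Comp D (on_obj F a) (on_obj F b) (on_obj G b) (\<eta> b) (on_hom F a b f) =
        Comp D (on_obj F a) (on_obj G a) (on_obj G b) (on_hom G a b f) (\<eta> a))"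

definition equivalence_of_categories ::
    "('o, 'm) cat \<Rightarrow> ('p, 'n) cat \<Rightarrow> ('o, 'm, 'p, 'n) cat_functor \<Rightarrow> ('p, 'n, 'o, 'm) cat_functor \<Rightarrow> bool" where
  "equivalence_of_categories C D F G \<longleftrightarrow>
     is_category C \<and> is_category D \<and> is_functor C D F \<and> is_functor D C G \<and>
     (\<exists>\<eta>. natural_isomorphism C C id_functor (comp_functor G F) \<eta>) \<and>
     (\<exists>\<epsilon>. natural_isomorphism D D (comp_functor F G) id_functor \<epsilon>)"

text \<open>The type \<open>'a\<close> is the universe of points, for total spaces as well as for bases.\<close>

definition connected_complex_graded_bundles ::
    "(('a, 'a, complex) graded_bundle, ('a \<Rightarrow> 'a) \<times> ('a \<Rightarrow> 'a)) cat" where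
  "connected_complex_graded_bundles =
     \<lparr>Obj = {E. is_graded_bundle E \<and> connected_manifold (tot E)},
      Hom = graded_bundle_hom,
      Ident = (\<lambda>E. (\<lambda>p\<in>mcarrier (tot E). p, \<lambda>q\<in>mcarrier (base E). q)),
      Comp = (\<lambda>E _ _ (\<Psi>, \<psi>) (\<Phi>, \<phi>). (compose (mcarrier (tot E)) \<Psi> \<Phi>, compose (mcarrier (base E)) \<psi> \<phi>))\<rparr>"

definition connected_nice_structures ::
    "('a manifold \<times> (complex \<Rightarrow> 'a \<Rightarrow> 'a), 'a \<Rightarrow> 'a) cat" where
  "connected_nice_structures =
     \<lparr>Obj = {(M, h). nice_structure M h \<and> connected_manifold M},
      Hom = homogeneity_hom,
      Ident = (\<lambda>(M, h). \<lambda>p\<in>mcarrier M. p),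
      Comp = (\<lambda>(M, h) _ _ g f. compose (mcarrier M) g f)\<rparr>"

definition homothety_functor ::
    "(('a, 'a, complex) graded_bundle, ('a \<Rightarrow> 'a) \<times> ('a \<Rightarrow> 'a),
      'a manifold \<times> (complex \<Rightarrow> 'a \<Rightarrow> 'a), 'a \<Rightarrow> 'a) cat_functor" where
  "homothety_functor = \<lparr>on_obj = (\<lambda>E. (tot E, homothety E)), on_hom = (\<lambda>_ _ (\<Phi>, \<phi>). \<Phi>)\<rparr>"

definition canonical_bundle_functor ::
    "('a manifold \<times> (complex \<Rightarrow> 'a \<Rightarrow> 'a), 'a \<Rightarrow> 'a,
      ('a, 'a, complex) graded_bundle, ('a \<Rightarrow> 'a) \<times> ('a \<Rightarrow> 'a)) cat_functor" where
  "canonical_bundle_functor =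
     \<lparr>on_obj = (\<lambda>(M, h). canonical_bundle M h),
      on_hom = (\<lambda>(M, h) _ f. (f, restrict f (h 0 ` mcarrier M)))\<rparr>"

end

theory Submission
  imports Defs
begin

text \<open>
  A smooth function which is homogeneous of positive weight with respect to the real homotheties is
  polynomial on the fibers; over the complex numbers, the action of the unit circle moreover excludes
  conjugates. Hence the homotheties determine the graded structure, and the morphisms are exactly the
  smooth maps which intertwine the homotheties.

  For a nice structure \<open>H\<close>, complex coordinates are constructed from the real ones, in the order of
  their weights. If \<open>y\<close> is a real coordinate of weight \<open>j\<close>, then \<open>y (H \<xi> p)\<close> is a polynomial in \<open>\<xi>\<close>
  and \<open>cnj \<xi>\<close> of total degree \<open>j\<close>, and its coefficient \<open>z p\<close> at \<open>\<xi> ^ j\<close> satisfies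
  \<open>z (H \<xi> p) = \<xi> ^ j * z p\<close>. On the core, the root of unity \<open>exp (\<i> * pi / j)\<close> multiplies the
  coefficient at \<open>\<xi> ^ k * cnj \<xi> ^ (j - k)\<close> by \<open>- exp (2 * \<i> * pi * k / j)\<close>, which is \<open>- 1\<close> only for
  \<open>k = 0\<close> and \<open>k = j\<close>. So niceness leaves only \<open>y = 2 * Re z\<close> on the core, and therefore pairs of real
  coordinates of weight \<open>j\<close> can be exchanged for \<open>Re z\<close> and \<open>Im z\<close>.
\<close>


section \<open>Smooth functions of finitely many coordinates\<close>

text \<open>The base of a graded bundle may be any manifold, whereas the canonical bundle lives over
  the image of \<open>h 0\<close> inside the total space. So the two constructions are not mutually
  inverse: a bundle is first moved along its zero section, and the composite functor on bundles is
  only isomorphic to the identity. Uniqueness of the canonical bundle has to recover every component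
  of the record: the smooth structure of the base, because the zero section of one candidate
  followed by the projection of another is smooth; the list of weights, by traces of linear parts;
  the graded atlas, because by maximality it consists of all trivializations that are homogeneous
  for \<open>h\<close>. The coefficient at \<open>\<xi> ^ j\<close> has to depend smoothly on the
  point. It is written as a finite average over roots of unity, for which smoothness is immediate.
  Coordinates are exchanged inside one weight, where homogeneous functions are affine in each
  coordinate, with a slope that depends on the base point only; so a nonzero slope at one point
  replaces the inverse function theorem.\<close>

definition pd :: "nat \<Rightarrow> ((nat \<Rightarrow> real) \<Rightarrow> real) \<Rightarrow> (nat \<Rightarrow> real) \<Rightarrow> real" where
  "pd i f x = deriv (\<lambda>t. f (x(i := t))) (x i)"

text \<open>Open sets of \<open>Euclidean_space m\<close> come from an infinite product. Only the
  first \<open>m\<close> coordinates can vary, so the least of finitely many radii gives a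
  box.\<close>

lemma Euclidean_space_box:
  assumes "openin (Euclidean_space m) U" "x \<in> U"
  shows "\<exists>e>0. \<forall>y. (\<forall>i<m. \<bar>y i - x i\<bar> < e) \<and> (\<forall>i\<ge>m. y i = 0) \<longrightarrow> y \<in> U"
proof -
  obtain T where T: "openin (powertop_real UNIV) T" "U = T \<inter> {x. \<forall>i\<ge>m. x i = 0}"
    using assms(1) by (auto simp: Euclidean_space_def openin_subtopology)
  have x0: "\<And>i. i \<ge> m \<Longrightarrow> x i = 0" using assms T by auto
  obtain X where X: "x \<in> (\<Pi>\<^sub>E i\<in>UNIV. X i)" "\<And>i. open (X i)" "(\<Pi>\<^sub>E i\<in>UNIV. X i) \<subseteq> T"
    using product_topology_open_contains_basis[OF T(1), of x] assms(2) T(2) by auto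
  have "\<forall>i. \<exists>e>0. ball (x i) e \<subseteq> X i" using X(1,2) by (auto simp: open_contains_ball)
  then obtain e where e: "\<And>i. e i > 0" "\<And>i. ball (x i) (e i) \<subseteq> X i" by metis
  define d where "d = Min (insert 1 (e ` {..<m}))"
  have d0: "d > 0" unfolding d_def using e(1) by (subst Min_gr_iff) auto
  have dle: "d \<le> e i" if "i < m" for i unfolding d_def using that by (intro Min_le) auto
  have "y \<in> U" if y: "\<forall>i<m. \<bar>y i - x i\<bar> < d" "\<forall>i\<ge>m. y i = 0" for y
  proof -
    have "y i \<in> X i" for i
    proof (cases "i < m")
      case True
      then have "y i \<in> ball (x i) (e i)" using y(1) dle[OF True] by (force simp: dist_real_def abs_minus_commute)
      then show ?thesis using e(2) by blast
    next
      case False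
      then have "y i = x i" using y(2) x0 by auto
      then show ?thesis using X(1) by auto
    qed
    then show ?thesis using X(3) y(2) T(2) by auto
  qed
  then show ?thesis using d0 by blast
qed

lemma openin_Euclidean_space_zero:
  "openin (Euclidean_space m) U \<Longrightarrow> x \<in> U \<Longrightarrow> i \<ge> m \<Longrightarrow> x i = 0"
  using openin_subset[of "Euclidean_space m" U] by (auto simp: topspace_Euclidean_space)

text \<open>Continuity and openness restated for limits along an arbitrary filter \<open>F\<close>:
  convergence of the first \<open>m\<close> coordinates suffices, the remaining ones being zero.
  Difference quotients are handled in this form.\<close>

lemma Euclidean_space_tendsto:
  assumes U: "openin (Euclidean_space m) U" "x \<in> U"
    and g: "continuous_map (subtopology (Euclidean_space m) U) euclideanreal g"
    and y0: "\<And>t i. i \<ge> m \<Longrightarrow> y t i = 0"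
    and lim: "\<And>i. i < m \<Longrightarrow> ((\<lambda>t. y t i) \<longlongrightarrow> x i) F"
  shows "((\<lambda>t. g (y t)) \<longlongrightarrow> g x) F" "eventually (\<lambda>t. y t \<in> U) F"
proof -
  have ev: "eventually (\<lambda>t. y t \<in> V) F" if V: "openin (Euclidean_space m) V" "x \<in> V" for V
  proof -
    obtain e where e: "e > 0" "\<And>y. (\<forall>i<m. \<bar>y i - x i\<bar> < e) \<Longrightarrow> (\<forall>i\<ge>m. y i = 0) \<Longrightarrow> y \<in> V"
      using Euclidean_space_box[OF V] by auto
    have "eventually (\<lambda>t. \<forall>i\<in>{..<m}. \<bar>y t i - x i\<bar> < e) F"
      by (rule eventually_ball_finite) (use lim e(1) in \<open>auto simp: tendsto_iff dist_real_def\<close>)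
    then show ?thesis by eventually_elim (use e(2) y0 in auto)
  qed
  show "eventually (\<lambda>t. y t \<in> U) F" using ev U by auto
  show "((\<lambda>t. g (y t)) \<longlongrightarrow> g x) F"
    unfolding tendsto_iff
  proof (intro allI impI)
    fix e :: real assume e: "e > 0"
    define V where "V = {z \<in> topspace (subtopology (Euclidean_space m) U). g z \<in> ball (g x) e}"
    have "openin (subtopology (Euclidean_space m) U) V"
      unfolding V_def using g by (rule openin_continuous_map_preimage) (simp flip: open_openin)
    then have "openin (Euclidean_space m) V" using U(1) by (metis openin_trans_full)
    moreover have "x \<in> V" unfolding V_def using U openin_subset[OF U(1)] e by auto
    ultimately have "eventually (\<lambda>t. y t \<in> V) F" by (rule ev)
    then show "eventually (\<lambda>t. dist (g (y t)) (g x) < e) F"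
      by eventually_elim (auto simp: V_def dist_commute)
  qed
qed

lemma Euclidean_space_line_open:
  assumes "openin (Euclidean_space n) U" "x \<in> U" "i < n"
  shows "eventually (\<lambda>t. x(i := t) \<in> U) (nhds (x i))"
proof -
  have c: "continuous_map (subtopology (Euclidean_space n) U) euclideanreal (\<lambda>_. 0)" by simp
  have "eventually (\<lambda>t. x(i := t) \<in> U) (nhds (x i))"
  proof (rule Euclidean_space_tendsto(2)[OF assms(1,2) c])
    show "(x(i := t)) j = 0" if "n \<le> j" for t j
      using assms that openin_Euclidean_space_zero[OF assms(1,2)] by auto
    show "((\<lambda>t. (x(i := t)) j) \<longlongrightarrow> x j) (nhds (x i))" if "j < n" for j
      by (cases "j = i") (auto simp: tendsto_ident_at intro: filterlim_ident)
  qed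
  then show ?thesis .
qed

lemma has_derivative_line_cong:
  assumes "openin (Euclidean_space n) U" "x \<in> U" "i < n" "\<And>x. x \<in> U \<Longrightarrow> f x = g x"
  shows "((\<lambda>t. f (x(i := t))) has_real_derivative d) (at (x i)) \<longleftrightarrow>
         ((\<lambda>t. g (x(i := t))) has_real_derivative d) (at (x i))"
proof -
  have ev: "eventually (\<lambda>t. f (x(i := t)) = g (x(i := t))) (nhds (x i))"
    using Euclidean_space_line_open[OF assms(1-3)] by eventually_elim (use assms in auto)
  show ?thesis by (rule DERIV_cong_ev[OF refl ev refl])
qed

lemma continuous_map_cong_Eu:
  assumes "openin (Euclidean_space n) U" "\<And>x. x \<in> U \<Longrightarrow> f x = g x"
    "continuous_map (subtopology (Euclidean_space n) U) euclideanreal f"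
  shows "continuous_map (subtopology (Euclidean_space n) U) euclideanreal g"
  using assms(3) by (rule continuous_map_eq) (use assms in auto)

section \<open>Locality and closure properties of the classes \<open>Ck_on\<close>\<close>

lemma Ck_on_cong:
  assumes "openin (Euclidean_space n) U" "\<And>x. x \<in> U \<Longrightarrow> f x = g x" "Ck_on k n U f"
  shows "Ck_on k n U g"
proof (cases k)
  case 0
  then show ?thesis using assms continuous_map_cong_Eu[OF assms(1,2)] by auto
next
  case (Suc l)
  then obtain D where D: "\<And>i x. i < n \<Longrightarrow> x \<in> U \<Longrightarrow> ((\<lambda>t. f (x(i := t))) has_real_derivative D i x) (at (x i))"
    "\<And>i. i < n \<Longrightarrow> Ck_on l n U (D i)" using assms(3) by auto
  have "((\<lambda>t. g (x(i := t))) has_real_derivative D i x) (at (x i))" if "i < n" "x \<in> U" for i x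
    using has_derivative_line_cong[OF assms(1) that(2,1), of f g] assms(2) D(1)[OF that] by blast
  then show ?thesis using D(2) assms continuous_map_cong_Eu[OF assms(1,2)] Suc by auto
qed

lemma Ck_on_continuous:
  "Ck_on k n U f \<Longrightarrow> continuous_map (subtopology (Euclidean_space n) U) euclideanreal f"
  by (cases k) auto

lemma Ck_on_SucI:
  assumes "openin (Euclidean_space n) U"
    "continuous_map (subtopology (Euclidean_space n) U) euclideanreal f"
    "\<And>i x. i < n \<Longrightarrow> x \<in> U \<Longrightarrow> ((\<lambda>t. f (x(i := t))) has_real_derivative D i x) (at (x i))"
    "\<And>i. i < n \<Longrightarrow> Ck_on k n U (D i)"
  shows "Ck_on (Suc k) n U f"
  using assms by auto

text \<open>\<open>Ck_on\<close> only asserts that some functions \<open>D i\<close> exist.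
  Derivatives being unique, these agree on \<open>U\<close> with \<open>pd i f\<close>; so the
  partial derivatives become functions independent of \<open>U\<close>, and inductions on the order
  can pass to subsets and glue.\<close>

lemma Ck_on_Suc_iff:
  assumes "openin (Euclidean_space n) U"
  shows "Ck_on (Suc k) n U f \<longleftrightarrow>
    continuous_map (subtopology (Euclidean_space n) U) euclideanreal f \<and>
    (\<forall>i<n. (\<forall>x\<in>U. ((\<lambda>t. f (x(i := t))) has_real_derivative pd i f x) (at (x i))) \<and> Ck_on k n U (pd i f))"
    (is "?L \<longleftrightarrow> ?R")
proof
  assume ?R then show ?L unfolding Ck_on.simps by (intro conjI exI[of _ "\<lambda>i. pd i f"]) auto
next
  assume L: ?L
  then obtain D where D: "\<And>i x. i < n \<Longrightarrow> x \<in> U \<Longrightarrow> ((\<lambda>t. f (x(i := t))) has_real_derivative D i x) (at (x i))"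
    "\<And>i. i < n \<Longrightarrow> Ck_on k n U (D i)" by auto
  have eq: "D i x = pd i f x" if "i < n" "x \<in> U" for i x
    unfolding pd_def using D(1)[OF that] by (simp add: DERIV_imp_deriv)
  have "Ck_on k n U (pd i f)" if "i < n" for i
    by (rule Ck_on_cong[OF assms _ D(2)[OF that]]) (rule eq[OF that])
  then show ?R using L D(1) eq by simp
qed

lemma Ck_on_SucD: "openin (Euclidean_space n) U \<Longrightarrow> Ck_on (Suc k) n U f \<Longrightarrow> Ck_on k n U f"
proof (induction k arbitrary: f)
  case 0 then show ?case by (simp add: Ck_on_continuous)
next
  case (Suc k)
  have f: "Ck_on (Suc (Suc k)) n U f" by fact
  show ?case
    using f[unfolded Ck_on_Suc_iff[OF Suc.prems(1), of "Suc k"]] Suc.IH[OF Suc.prems(1)]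
    unfolding Ck_on_Suc_iff[OF Suc.prems(1), of k] by simp
qed

lemma continuous_map_subset_Eu:
  "continuous_map (subtopology X U) Y f \<Longrightarrow> V \<subseteq> U \<Longrightarrow> continuous_map (subtopology X V) Y f"
  by (rule continuous_map_from_subtopology_mono)

lemma Ck_on_subset:
  assumes "openin (Euclidean_space n) U" "openin (Euclidean_space n) V" "V \<subseteq> U" "Ck_on k n U f"
  shows "Ck_on k n V f"
  using assms(4)
proof (induction k arbitrary: f)
  case 0 then show ?case using continuous_map_subset_Eu[OF _ assms(3)] by auto
next
  case (Suc k)
  show ?case
    using Suc.prems[unfolded Ck_on_Suc_iff[OF assms(1)]] Suc.IH assms(3)
      continuous_map_subset_Eu[OF _ assms(3), of "Euclidean_space n" euclideanreal f]
    unfolding Ck_on_Suc_iff[OF assms(2)] by (simp add: subset_iff)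
qed

lemma continuous_map_local:
  assumes "\<And>x. x \<in> U \<Longrightarrow> \<exists>V. openin X V \<and> x \<in> V \<and> V \<subseteq> U \<and> continuous_map (subtopology X V) Y f"
  shows "continuous_map (subtopology X U) Y f"
  unfolding continuous_map_def
proof (intro conjI allI impI)
  show "f \<in> topspace (subtopology X U) \<rightarrow> topspace Y"
  proof
    fix x assume x: "x \<in> topspace (subtopology X U)"
    then obtain V where V: "x \<in> V" "continuous_map (subtopology X V) Y f" using assms by auto
    show "f x \<in> topspace Y" using continuous_map_image_subset_topspace[OF V(2)] V(1) x by auto
  qed
next
  fix W assume W: "openin Y W"
  define S where "S = {x \<in> topspace (subtopology X U). f x \<in> W}"
  have "\<exists>T. openin (subtopology X U) T \<and> x \<in> T \<and> T \<subseteq> S" if x: "x \<in> S" for x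
  proof -
    have xU: "x \<in> U" using x by (auto simp: S_def)
    obtain V where V: "openin X V" "x \<in> V" "V \<subseteq> U" "continuous_map (subtopology X V) Y f"
      using assms[OF xU] by blast
    define T where "T = {x \<in> topspace (subtopology X V). f x \<in> W}"
    have "openin (subtopology X V) T"
      unfolding T_def using V(4) W by (rule openin_continuous_map_preimage)
    then have "openin X T" using V(1) by (metis openin_trans_full)
    moreover have "T \<subseteq> U" using V(3) by (auto simp: T_def)
    ultimately have "openin (subtopology X U) T" by (rule subset_openin_subtopology)
    moreover have "x \<in> T" using x V(2) by (auto simp: T_def S_def)
    moreover have "T \<subseteq> S" using V(3) by (auto simp: T_def S_def)
    ultimately show ?thesis by blast
  qed
  then have "openin (subtopology X U) S" by (subst openin_subopen) blast
  then show "openin (subtopology X U) {x \<in> topspace (subtopology X U). f x \<in> W}" by (simp add: S_def)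
qed

text \<open>Local derivatives glue because all of them are the same globally defined
  \<open>pd i f\<close>.\<close>

lemma Ck_on_local:
  assumes U: "openin (Euclidean_space n) U"
    and "\<And>x. x \<in> U \<Longrightarrow> \<exists>V. openin (Euclidean_space n) V \<and> x \<in> V \<and> V \<subseteq> U \<and> Ck_on k n V f"
  shows "Ck_on k n U f"
  using assms(2)
proof (induction k arbitrary: f)
  case 0 then show ?case by (simp add: continuous_map_local)
next
  case (Suc k)
  have c: "continuous_map (subtopology (Euclidean_space n) U) euclideanreal f"
    by (rule continuous_map_local) (use Suc.prems Ck_on_continuous in meson)
  have loc: "\<exists>V. openin (Euclidean_space n) V \<and> x \<in> V \<and> V \<subseteq> U \<and>
      (\<forall>i<n. Ck_on k n V (pd i f) \<and> ((\<lambda>t. f (x(i := t))) has_real_derivative pd i f x) (at (x i)))"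
    if x: "x \<in> U" for x
  proof -
    obtain V where V: "openin (Euclidean_space n) V" "x \<in> V" "V \<subseteq> U" "Ck_on (Suc k) n V f"
      using Suc.prems[OF x] by blast
    show ?thesis using V(1-3) V(4)[unfolded Ck_on_Suc_iff[OF V(1)]] by (intro exI[of _ V]) simp
  qed
  have "Ck_on k n U (pd i f)" if "i < n" for i
    by (rule Suc.IH) (use loc that in meson)
  moreover have "((\<lambda>t. f (x(i := t))) has_real_derivative pd i f x) (at (x i))" if "i < n" "x \<in> U" for i x
    using loc[OF that(2)] that(1) by (auto simp del: fun_upd_apply)
  ultimately show ?case using c unfolding Ck_on_Suc_iff[OF U] by (simp del: fun_upd_apply)
qed

lemma Ck_on_const: "openin (Euclidean_space n) U \<Longrightarrow> Ck_on k n U (\<lambda>_. c)"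
proof (induction k arbitrary: c)
  case (Suc k)
  show ?case by (rule Ck_on_SucI[where D = "\<lambda>_ _. 0"]) (use Suc in auto)
qed simp

lemma continuous_map_Eu_coord:
  "continuous_map (subtopology (Euclidean_space n) U) euclideanreal (\<lambda>x. x i)"
  unfolding Euclidean_space_def subtopology_subtopology
  by (rule continuous_map_from_subtopology) (rule continuous_map_product_projection, simp)

lemma Ck_on_coord: "openin (Euclidean_space n) U \<Longrightarrow> Ck_on k n U (\<lambda>x. x i)"
proof (cases k)
  case (Suc l)
  assume U: "openin (Euclidean_space n) U"
  show ?thesis unfolding Suc
  proof (rule Ck_on_SucI[OF U continuous_map_Eu_coord])
    show "((\<lambda>t. (x(j := t)) i) has_real_derivative (if i = j then 1 else 0)) (at (x j))" for x j
      by auto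
  qed (use Ck_on_const[OF U] in auto)
qed (simp add: continuous_map_Eu_coord)

lemma Ck_on_add:
  assumes U: "openin (Euclidean_space n) U"
  shows "Ck_on k n U f \<Longrightarrow> Ck_on k n U g \<Longrightarrow> Ck_on k n U (\<lambda>x. f x + g x)"
proof (induction k arbitrary: f g)
  case 0 then show ?case by (auto intro!: continuous_intros)
next
  case (Suc k)
  note f = Suc.prems(1)[unfolded Ck_on_Suc_iff[OF U]] and g = Suc.prems(2)[unfolded Ck_on_Suc_iff[OF U]]
  show ?case
  proof (rule Ck_on_SucI[OF U, where D = "\<lambda>i x. pd i f x + pd i g x"])
    show "((\<lambda>t. f (x(i := t)) + g (x(i := t))) has_real_derivative pd i f x + pd i g x) (at (x i))"
      if "i < n" "x \<in> U" for i x
      by (rule DERIV_add) (use f g that in auto)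
  qed (use f g Suc.IH in \<open>auto intro!: continuous_intros\<close>)
qed

text \<open>The product rule contains \<open>f\<close> and \<open>g\<close> themselves beside their
  derivatives; \<open>Ck_on_SucD\<close> lowers their order for the induction.\<close>

lemma Ck_on_mult:
  assumes U: "openin (Euclidean_space n) U"
  shows "Ck_on k n U f \<Longrightarrow> Ck_on k n U g \<Longrightarrow> Ck_on k n U (\<lambda>x. f x * g x)"
proof (induction k arbitrary: f g)
  case 0 then show ?case by (auto intro!: continuous_intros)
next
  case (Suc k)
  note f = Suc.prems(1)[unfolded Ck_on_Suc_iff[OF U]] and g = Suc.prems(2)[unfolded Ck_on_Suc_iff[OF U]]
  note f' = Ck_on_SucD[OF U Suc.prems(1)] and g' = Ck_on_SucD[OF U Suc.prems(2)]
  show ?case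
  proof (rule Ck_on_SucI[OF U, where D = "\<lambda>i x. pd i f x * g x + pd i g x * f x"])
    show "((\<lambda>t. f (x(i := t)) * g (x(i := t))) has_real_derivative pd i f x * g x + pd i g x * f x) (at (x i))"
      if "i < n" "x \<in> U" for i x
      using DERIV_mult[of "\<lambda>t. f (x(i := t))" "pd i f x" "x i" UNIV "\<lambda>t. g (x(i := t))" "pd i g x"] f g that
      by (simp del: fun_upd_apply)
    show "Ck_on k n U (\<lambda>x. pd i f x * g x + pd i g x * f x)" if "i < n" for i
      using f g f' g' that Suc.IH by (intro Ck_on_add[OF U]) auto
  qed (use f g in \<open>auto intro!: continuous_intros\<close>)
qed

text \<open>The derivative of the inverse is a product that contains the inverse again, one order
  lower; hence the induction runs with \<open>f\<close> fixed.\<close>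

lemma Ck_on_inverse:
  assumes U: "openin (Euclidean_space n) U" and nz: "\<And>x. x \<in> U \<Longrightarrow> f x \<noteq> 0"
  shows "Ck_on k n U f \<Longrightarrow> Ck_on k n U (\<lambda>x. inverse (f x))"
proof (induction k)
  case 0 then show ?case using nz by (auto intro!: continuous_map_real_inverse)
next
  case (Suc k)
  note f = Suc.prems[unfolded Ck_on_Suc_iff[OF U]]
  note i = Suc.IH[OF Ck_on_SucD[OF U Suc.prems]]
  show ?case
  proof (rule Ck_on_SucI[OF U, where D = "\<lambda>i x. (-1) * (inverse (f x) * (pd i f x * inverse (f x)))"])
    show "continuous_map (subtopology (Euclidean_space n) U) euclideanreal (\<lambda>x. inverse (f x))"
      using Ck_on_continuous[OF i] .
    show "((\<lambda>t. inverse (f (x(i := t)))) has_real_derivative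
          (-1) * (inverse (f x) * (pd i f x * inverse (f x)))) (at (x i))" if "i < n" "x \<in> U" for i x
      using DERIV_inverse_fun[of "\<lambda>t. f (x(i := t))" "pd i f x" "x i" UNIV] f that nz
      by (simp add: mult_ac)
    show "Ck_on k n U (\<lambda>x. (-1) * (inverse (f x) * (pd i f x * inverse (f x))))" if "i < n" for i
      using f i that by (intro Ck_on_mult[OF U] Ck_on_const[OF U]) auto
  qed
qed

lemma Ck_on_sum:
  assumes U: "openin (Euclidean_space n) U"
  shows "(\<And>i. i \<in> A \<Longrightarrow> Ck_on k n U (f i)) \<Longrightarrow> Ck_on k n U (\<lambda>x. \<Sum>i\<in>A. f i x)"
  by (induction A rule: infinite_finite_induct) (auto simp: Ck_on_const[OF U] intro!: Ck_on_add[OF U])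

text \<open>The difference is telescoped over the coordinates and the mean value theorem applied to each step.\<close>

lemma curve_chain_rule:
  assumes U: "openin (Euclidean_space m) U"
    and D: "\<And>j x. j < m \<Longrightarrow> x \<in> U \<Longrightarrow> ((\<lambda>t. f (x(j := t))) has_real_derivative D j x) (at (x j))"
    and Dc: "\<And>j. j < m \<Longrightarrow> continuous_map (subtopology (Euclidean_space m) U) euclideanreal (D j)"
    and c0: "\<And>t j. j \<ge> m \<Longrightarrow> c t j = 0" and cU: "c t0 \<in> U"
    and c': "\<And>j. j < m \<Longrightarrow> ((\<lambda>t. c t j) has_real_derivative c' j) (at t0)"
  shows "((\<lambda>t. f (c t)) has_real_derivative (\<Sum>j<m. D j (c t0) * c' j)) (at t0)"
proof -
  define x where "x = c t0"
  have xU: "x \<in> U" and x0: "\<And>j. j \<ge> m \<Longrightarrow> x j = 0" using cU c0 by (auto simp: x_def)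
  obtain e where e: "e > 0" "\<And>y. (\<forall>i<m. \<bar>y i - x i\<bar> < e) \<Longrightarrow> (\<forall>i\<ge>m. y i = 0) \<Longrightarrow> y \<in> U"
    using Euclidean_space_box[OF U xU] by auto
  \<comment> \<open>\<open>H j t s\<close> already has the coordinates of \<open>c t\<close> below
    \<open>j\<close>, still those of \<open>x\<close> above, and the free value \<open>s\<close> in
    place \<open>j\<close>: it runs along the \<open>j\<close>-th edge of the path from
    \<open>x\<close> to \<open>c t\<close>.\<close>
  define H where "H = (\<lambda>j t s i. if i < j then c t i else if i = j then s else x i)"
  have lim: "((\<lambda>t. c t i) \<longlongrightarrow> x i) (at t0)" if "i < m" for i
    using DERIV_isCont[OF c'[OF that]] by (simp add: isCont_def x_def)
  have ev: "eventually (\<lambda>t. \<forall>i\<in>{..<m}. \<bar>c t i - x i\<bar> < e) (at t0)"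
    by (rule eventually_ball_finite) (use lim e(1) in \<open>auto simp: tendsto_iff dist_real_def\<close>)
  have mvt: "\<exists>s. \<bar>s - x j\<bar> \<le> \<bar>c t j - x j\<bar> \<and>
       f (H j t (c t j)) - f (H j t (x j)) = D j (H j t s) * (c t j - x j)"
    if t: "\<forall>i\<in>{..<m}. \<bar>c t i - x i\<bar> < e" and j: "j < m" for t j
  proof -
    have inU: "H j t s \<in> U" if "\<bar>s - x j\<bar> \<le> \<bar>c t j - x j\<bar>" for s
    proof (rule e(2))
      show "\<forall>i<m. \<bar>H j t s i - x i\<bar> < e"
        using t that e(1) by (auto simp: H_def intro: le_less_trans)
    qed (use j in \<open>auto simp: H_def x0\<close>)
    have upd: "(H j t s)(j := r) = H j t r" for s r by (auto simp: H_def)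
    have der: "((\<lambda>s. f (H j t s)) has_real_derivative D j (H j t s)) (at s)"
      if "\<bar>s - x j\<bar> \<le> \<bar>c t j - x j\<bar>" for s
      using D[OF j inU[OF that]] unfolding upd by (simp add: H_def)
    consider "c t j = x j" | "c t j > x j" | "c t j < x j" by linarith
    then show ?thesis
    proof cases
      case 1 then show ?thesis by auto
    next
      case 2
      obtain s where "s > x j" "s < c t j" "f (H j t (c t j)) - f (H j t (x j)) = (c t j - x j) * D j (H j t s)"
        using MVT2[OF 2, of "\<lambda>s. f (H j t s)" "\<lambda>s. D j (H j t s)"] der by auto
      then show ?thesis by (intro exI[of _ s]) auto
    next
      case 3
      obtain s where "s < x j" "s > c t j" "f (H j t (x j)) - f (H j t (c t j)) = (x j - c t j) * D j (H j t s)"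
        using MVT2[OF 3, of "\<lambda>s. f (H j t s)" "\<lambda>s. D j (H j t s)"] der by auto
      then show ?thesis by (intro exI[of _ s]) (auto simp: algebra_simps)
    qed
  qed
  \<comment> \<open>Outside of the box no intermediate point is available. The default
    \<open>x j\<close> keeps the bound on \<open>s j t - x j\<close> valid for every
    \<open>t\<close>, so its limit needs no case distinction.\<close>
  define s where "s = (\<lambda>j t. if (\<forall>i\<in>{..<m}. \<bar>c t i - x i\<bar> < e) then
      (SOME s. \<bar>s - x j\<bar> \<le> \<bar>c t j - x j\<bar> \<and>
       f (H j t (c t j)) - f (H j t (x j)) = D j (H j t s) * (c t j - x j)) else x j)"
  have s: "\<bar>s j t - x j\<bar> \<le> \<bar>c t j - x j\<bar>" if "j < m" for j t
    using someI_ex[OF mvt[OF _ that]] by (auto simp: s_def)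
  have s2: "f (H j t (c t j)) - f (H j t (x j)) = D j (H j t (s j t)) * (c t j - x j)"
    if "\<forall>i\<in>{..<m}. \<bar>c t i - x i\<bar> < e" "j < m" for j t
    using someI_ex[OF mvt[OF that]] that by (auto simp: s_def)
  have slim: "((\<lambda>t. s j t) \<longlongrightarrow> x j) (at t0)" if j: "j < m" for j
  proof (rule LIM_zero_cancel)
    show "((\<lambda>t. s j t - x j) \<longlongrightarrow> 0) (at t0)"
      by (rule Lim_null_comparison[where g = "\<lambda>t. \<bar>c t j - x j\<bar>"])
        (use s[OF j] lim[OF j] in \<open>auto intro!: always_eventually tendsto_eq_intros\<close>)
  qed
  have Dlim: "((\<lambda>t. D j (H j t (s j t))) \<longlongrightarrow> D j x) (at t0)" if j: "j < m" for j
  proof (rule Euclidean_space_tendsto(1)[OF U xU Dc[OF j]])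
    show "H j t (s j t) i = 0" if "i \<ge> m" for t i using that j x0 by (auto simp: H_def)
    show "((\<lambda>t. H j t (s j t) i) \<longlongrightarrow> x i) (at t0)" if "i < m" for i
      using lim[OF that] slim[OF j] by (cases "i < j"; cases "i = j") (auto simp: H_def)
  qed
  have tel: "f (c t) - f x = (\<Sum>j<m. D j (H j t (s j t)) * (c t j - x j))"
    if t: "\<forall>i\<in>{..<m}. \<bar>c t i - x i\<bar> < e" for t
  proof -
    define G where "G = (\<lambda>j i. if i < j then c t i else x i)"
    have 1: "H j t (c t j) = G (Suc j)" "H j t (x j) = G j" for j
      by (auto simp: H_def G_def fun_eq_iff less_Suc_eq)
    have "f (G m) - f (G 0) = (\<Sum>j<m. f (G (Suc j)) - f (G j))"
      by (rule sum_lessThan_telescope[symmetric])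
    moreover have "G m = c t" "G 0 = x" using c0 x0 by (auto simp: G_def fun_eq_iff)
    ultimately show ?thesis using s2[OF t] unfolding 1 by auto
  qed
  have "((\<lambda>t. \<Sum>j<m. D j (H j t (s j t)) * ((c t j - x j) / (t - t0))) \<longlongrightarrow> (\<Sum>j<m. D j x * c' j)) (at t0)"
    using c' Dlim by (intro tendsto_sum tendsto_mult) (auto simp: has_field_derivative_iff x_def)
  then have "((\<lambda>t. (f (c t) - f (c t0)) / (t - t0)) \<longlongrightarrow> (\<Sum>j<m. D j x * c' j)) (at t0)"
    by (rule Lim_transform_eventually)
      (use ev in eventually_elim, use tel in \<open>auto simp: x_def sum_divide_distrib\<close>)
  then show ?thesis by (simp add: has_field_derivative_iff x_def)
qed

lemma continuous_map_Eu_compose: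
  assumes "openin (Euclidean_space n) U" "openin (Euclidean_space m) V"
    and F: "continuous_map (subtopology (Euclidean_space m) V) euclideanreal F"
    and G: "\<And>j. j < m \<Longrightarrow> continuous_map (subtopology (Euclidean_space n) U) euclideanreal (\<lambda>x. G x j)"
    and GV: "\<And>x. x \<in> U \<Longrightarrow> G x \<in> V"
  shows "continuous_map (subtopology (Euclidean_space n) U) euclideanreal (\<lambda>x. F (G x))"
proof -
  have "continuous_map (subtopology (Euclidean_space n) U) euclideanreal (\<lambda>x. G x j)" for j
  proof (cases "j < m")
    case False
    have "continuous_map (subtopology (Euclidean_space n) U) euclideanreal (\<lambda>x. 0)" by simp
    then show ?thesis
      by (rule continuous_map_eq) (use False GV openin_Euclidean_space_zero[OF assms(2)] in auto)
  qed (use G in auto)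
  then have "continuous_map (subtopology (Euclidean_space n) U) (powertop_real UNIV) G"
    by (simp add: continuous_map_componentwise_UNIV)
  then have "continuous_map (subtopology (Euclidean_space n) U) (subtopology (Euclidean_space m) V) G"
    unfolding Euclidean_space_def[of m] subtopology_subtopology
    by (rule continuous_map_into_subtopology)
      (use GV openin_Euclidean_space_zero[OF assms(2)] in auto)
  from continuous_map_compose[OF this F] show ?thesis by (simp add: o_def)
qed

text \<open>Induction on the order: the chain rule writes the derivatives of the composite as sums
  of products of \<open>pd j F\<close> after \<open>G\<close> with derivatives of \<open>G\<close>,
  and both factors have one order less.\<close>

lemma Ck_on_compose:
  assumes U: "openin (Euclidean_space n) U" and V: "openin (Euclidean_space m) V"
  shows "Ck_on k m V F \<Longrightarrow> (\<And>j. j < m \<Longrightarrow> Ck_on k n U (\<lambda>x. G x j)) \<Longrightarrow> (\<And>x. x \<in> U \<Longrightarrow> G x \<in> V)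
    \<Longrightarrow> Ck_on k n U (\<lambda>x. F (G x))"
proof (induction k arbitrary: F)
  case 0 then show ?case using continuous_map_Eu_compose[OF U V, of F G] by simp
next
  case (Suc k)
  \<comment> \<open>\<open>curve_chain_rule\<close> wants curves whose coordinates from
    \<open>m\<close> on vanish at every parameter, but \<open>G\<close> is controlled on
    \<open>U\<close> only. Outside of \<open>U\<close> it is replaced by zero.\<close>
  define G' where "G' = (\<lambda>x. if x \<in> U then G x else (\<lambda>_. 0))"
  have G'C: "Ck_on (Suc k) n U (\<lambda>x. G' x j)" if "j < m" for j
    by (rule Ck_on_cong[OF U _ Suc.prems(2)[OF that]]) (simp add: G'_def)
  have G'V: "G' x \<in> V" if "x \<in> U" for x using Suc.prems(3) that by (simp add: G'_def)
  have G'0: "G' x j = 0" if "j \<ge> m" for x j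
    using G'V openin_Euclidean_space_zero[OF V] that by (auto simp: G'_def)
  note F = Suc.prems(1)[unfolded Ck_on_Suc_iff[OF V]]
  have G'D: "((\<lambda>t. G' (x(i := t)) j) has_real_derivative pd i (\<lambda>x. G' x j) x) (at (x i))"
    and G'k: "Ck_on k n U (pd i (\<lambda>x. G' x j))" if "i < n" "j < m" "x \<in> U" for i j x
    using G'C[OF that(2), unfolded Ck_on_Suc_iff[OF U]] that by auto
  have "Ck_on (Suc k) n U (\<lambda>x. F (G' x))"
  proof (rule Ck_on_SucI[OF U, where D = "\<lambda>i x. \<Sum>j<m. pd j F (G' x) * pd i (\<lambda>x. G' x j) x"])
    show "continuous_map (subtopology (Euclidean_space n) U) euclideanreal (\<lambda>x. F (G' x))"
      by (rule continuous_map_Eu_compose[OF U V]) (use F Ck_on_continuous[OF G'C] G'V in auto)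
    show "((\<lambda>t. F (G' (x(i := t)))) has_real_derivative (\<Sum>j<m. pd j F (G' x) * pd i (\<lambda>x. G' x j) x)) (at (x i))"
      if i: "i < n" and x: "x \<in> U" for i x
    proof -
      have "((\<lambda>t. F (G' (x(i := t)))) has_real_derivative
          (\<Sum>j<m. pd j F (G' (x(i := x i))) * pd i (\<lambda>x. G' x j) x)) (at (x i))"
      proof (rule curve_chain_rule[OF V])
        show "((\<lambda>t. F (y(j := t))) has_real_derivative pd j F y) (at (y j))" if "j < m" "y \<in> V" for j y
          using F that by auto
        show "continuous_map (subtopology (Euclidean_space m) V) euclideanreal (pd j F)" if "j < m" for j
          using F that Ck_on_continuous[of k m V "pd j F"] by simp
        show "G' (x(i := x i)) \<in> V" using G'V x by simp
      qed (use G'0 G'D[OF i _ x] in \<open>auto simp del: fun_upd_apply\<close>)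
      then show ?thesis by simp
    qed
    show "Ck_on k n U (\<lambda>x. \<Sum>j<m. pd j F (G' x) * pd i (\<lambda>x. G' x j) x)" if i: "i < n" for i
    \<comment> \<open>The fact \<open>G'k\<close> is only available with a point of \<open>U\<close>
      at hand.\<close>
    proof (cases "U = {}")
      case True
      have "Ck_on k n U (\<lambda>_. 0)" using Ck_on_const[OF U] .
      then show ?thesis by (rule Ck_on_cong[OF U, rotated]) (use True in auto)
    next
      case False
      have "Ck_on k n U (\<lambda>x. pd j F (G x))" if "j < m" for j
        by (rule Suc.IH) (use F that Suc.prems Ck_on_SucD[OF U] in auto)
      then have "Ck_on k n U (\<lambda>x. pd j F (G' x))" if "j < m" for j
        by (rule Ck_on_cong[OF U, rotated]) (use that in \<open>auto simp: G'_def\<close>)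
      then show ?thesis using G'k i False by (intro Ck_on_sum[OF U] Ck_on_mult[OF U]) auto
    qed
  qed
  then show ?case by (rule Ck_on_cong[OF U, rotated]) (simp add: G'_def)
qed

section \<open>Monomials of given weight and smooth homogeneous functions on real coordinate
  spaces\<close>

definition index_lists :: "nat \<Rightarrow> (nat \<Rightarrow> nat) \<Rightarrow> nat \<Rightarrow> nat list set" where
  "index_lists n w m = {as. set as \<subseteq> {..<n} \<and> (\<Sum>a\<leftarrow>as. w a) = m}"

lemma index_lists_zero:
  assumes "\<And>i. i < n \<Longrightarrow> 1 \<le> w i"
  shows "index_lists n w 0 = {[]}"
proof -
  have "as = []" if "as \<in> index_lists n w 0" for as
    using that assms by (cases as) (force simp: index_lists_def)+
  then show ?thesis by (auto simp: index_lists_def)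
qed

text \<open>Removing the first letter of a word lowers the weight by that of the letter; this is the
  shape in which Euler's formula produces monomials.\<close>

lemma index_lists_Suc:
  assumes "m > 0"
  shows "index_lists n w m = (\<Union>i\<in>{i. i < n \<and> w i \<le> m}. (#) i ` index_lists n w (m - w i))"
proof -
  have "as \<in> (\<Union>i\<in>{i. i < n \<and> w i \<le> m}. (#) i ` index_lists n w (m - w i))"
    if "as \<in> index_lists n w m" for as
    using that assms by (cases as) (auto simp: index_lists_def)
  then show ?thesis by (auto simp: index_lists_def)
qed

text \<open>As every letter weighs at least 1, the weight bounds the length. Finiteness matters: a
  sum over an infinite index set would be zero by convention.\<close>

lemma finite_index_lists:
  assumes "\<And>i. i < n \<Longrightarrow> 1 \<le> w i"
  shows "finite (index_lists n w m)"
proof -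
  have "length as \<le> (\<Sum>a\<leftarrow>as. w a)" if "set as \<subseteq> {..<n}" for as
    using that
  proof (induction as)
    case (Cons a as)
    then show ?case using assms[of a] by simp
  qed simp
  then have "index_lists n w m \<subseteq> {as. set as \<subseteq> {..<n} \<and> length as \<le> m}"
    by (auto simp: index_lists_def)
  then show ?thesis using finite_lists_length_le[of "{..<n}" m] finite_subset by blast
qed

lemma sum_index_lists_Suc:
  assumes "\<And>i. i < n \<Longrightarrow> 1 \<le> w i" "m > 0"
  shows "(\<Sum>as\<in>index_lists n w m. f as) =
    (\<Sum>i | i < n \<and> w i \<le> m. \<Sum>as\<in>index_lists n w (m - w i). f (i # as))"
  unfolding index_lists_Suc[OF assms(2)]
  by (subst sum.UNION_disjoint)
    (auto simp: finite_index_lists[OF assms(1)] sum.reindex)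

text \<open>Euler's formula expresses a homogeneous function by its partial derivatives, which are homogeneous
  of lower weight, or vanish if their weight would be negative.\<close>

lemma smooth_homogeneous_polynomial:
  fixes w :: "nat \<Rightarrow> nat"
  assumes w: "\<And>i. i < n \<Longrightarrow> 1 \<le> w i"
  shows "(\<And>k. Ck_on k n (topspace (Euclidean_space n)) F) \<Longrightarrow>
    (\<And>t x. t > 0 \<Longrightarrow> x \<in> topspace (Euclidean_space n) \<Longrightarrow> F (\<lambda>i. t ^ w i * x i) = t ^ m * F x) \<Longrightarrow>
    \<exists>c. \<forall>x\<in>topspace (Euclidean_space n). F x = (\<Sum>as\<in>index_lists n w m. c as * (\<Prod>a\<leftarrow>as. x a))"
proof (induction m arbitrary: F rule: less_induct)
  case (less m)
  define E where "E = topspace (Euclidean_space n)"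
  have Eo: "openin (Euclidean_space n) E" by (simp add: E_def)
  define \<delta> where "\<delta> = (\<lambda>t (x :: nat \<Rightarrow> real) i. t ^ w i * x i)"
  have E: "x \<in> E \<longleftrightarrow> (\<forall>i\<ge>n. x i = 0)" for x by (auto simp: E_def topspace_Euclidean_space)
  have \<delta>E: "\<delta> t x \<in> E" if "x \<in> E" for t x using that by (simp add: E \<delta>_def)
  have hom: "F (\<delta> t x) = t ^ m * F x" if "t > 0" "x \<in> E" for t x
    using less.prems(2) that by (auto simp: E_def \<delta>_def)
  \<comment> \<open>As \<open>t\<close> tends to 0 from the right, the dilations contract everything
    to the origin, so values at the origin control a homogeneous function.\<close>
  have zero_lim: "((\<lambda>t. g (\<delta> t x)) \<longlongrightarrow> g (\<lambda>_. 0)) (at_right 0)"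
    if "continuous_map (subtopology (Euclidean_space n) E) euclideanreal g" "x \<in> E" for g x
  proof (rule Euclidean_space_tendsto(1)[OF Eo _ that(1)])
    show "(\<lambda>_. 0) \<in> E" by (simp add: E)
    show "((\<lambda>t. \<delta> t x i) \<longlongrightarrow> 0) (at_right 0)" if "i < n" for i
    proof -
      have "((\<lambda>t. t ^ w i * x i) \<longlongrightarrow> 0 ^ w i * x i) (at_right 0)"
        by (intro tendsto_mult tendsto_power tendsto_ident_at tendsto_const)
      then show ?thesis using w[OF that] by (simp add: \<delta>_def power_0_left)
    qed
  qed (use that \<delta>E E in auto)
  have C: "Ck_on k n E F" for k using less.prems(1) by (simp add: E_def)
  note F = C[of "Suc _", unfolded Ck_on_Suc_iff[OF Eo]]
  have const: "F x = F (\<lambda>_. 0)" if "m = 0" "x \<in> E" for x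
  proof -
    have ev: "eventually (\<lambda>t. F (\<delta> t x) = F x) (at_right (0::real))"
      unfolding eventually_at_right_field using hom that by (auto intro!: exI[of _ 1])
    have "((\<lambda>t. F (\<delta> t x)) \<longlongrightarrow> F x) (at_right 0)"
      using ev by (rule tendsto_eventually)
    then show ?thesis using zero_lim[OF Ck_on_continuous[OF C[of 0]] that(2)]
      by (intro tendsto_unique) auto
  qed
  show ?case
  proof (cases "m = 0")
    case True
    then show ?thesis using const index_lists_zero[of n w] w
      by (intro exI[of _ "\<lambda>_. F (\<lambda>_. 0)"]) (auto simp: E_def)
  next
    case False
    \<comment> \<open>Differentiating the homogeneity of \<open>F\<close> in direction
      \<open>i\<close> gives \<open>pd i F\<close> the weight \<open>m - w i\<close>. The factor
      \<open>t ^ w i\<close> stays on the left, since this difference may be negative.\<close>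
    have dhom: "pd i F (\<delta> t x) * t ^ w i = t ^ m * pd i F x" if i: "i < n" and t: "t > 0" and x: "x \<in> E" for i t x
    proof -
      have eq: "F ((\<delta> t x)(i := t ^ w i * s)) = t ^ m * F (x(i := s))" for s
      proof -
        have "(\<delta> t x)(i := t ^ w i * s) = \<delta> t (x(i := s))" by (auto simp: \<delta>_def)
        moreover have "x(i := s) \<in> E" using x i by (auto simp: E)
        ultimately show ?thesis using hom t by simp
      qed
      have 1: "((\<lambda>s. t ^ m * F (x(i := s))) has_real_derivative t ^ m * pd i F x) (at (x i))"
        by (rule DERIV_cmult) (use F[of 0] i x in \<open>simp del: fun_upd_apply\<close>)
      have d: "((\<lambda>r. F ((\<delta> t x)(i := r))) has_real_derivative pd i F (\<delta> t x)) (at (\<delta> t x i))"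
        using F[of 0] i \<delta>E[OF x] by (simp del: fun_upd_apply)
      have "((\<lambda>s. t ^ w i * s) has_real_derivative t ^ w i) (at (x i))"
        by (auto intro!: derivative_eq_intros)
      from DERIV_chain2[OF _ this, of "\<lambda>r. F ((\<delta> t x)(i := r))" "pd i F (\<delta> t x)"] d
      have "((\<lambda>s. F ((\<delta> t x)(i := t ^ w i * s))) has_real_derivative pd i F (\<delta> t x) * t ^ w i) (at (x i))"
        by (simp add: \<delta>_def)
      then show ?thesis using DERIV_unique[OF 1] unfolding eq by simp
    qed
    have pdC: "Ck_on k n E (pd i F)" if "i < n" for i k using F[of k] that by simp
    \<comment> \<open>In negative weight, \<open>pd i F x\<close> is a positive power of
      \<open>t\<close> times values that converge as \<open>t\<close> tends to 0.\<close>
    have pd0: "pd i F x = 0" if i: "i < n" and wi: "w i > m" and x: "x \<in> E" for i x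
    proof -
      have "pd i F x = t ^ (w i - m) * pd i F (\<delta> t x)" if "t > 0" for t
      proof -
        have "t ^ w i = t ^ m * t ^ (w i - m)" using wi by (simp flip: power_add)
        then have "t ^ m * (t ^ (w i - m) * pd i F (\<delta> t x)) = t ^ m * pd i F x"
          using dhom[OF i that x] by (simp add: mult_ac)
        then show ?thesis using that by simp
      qed
      then have "eventually (\<lambda>t. t ^ (w i - m) * pd i F (\<delta> t x) = pd i F x) (at_right 0)"
        unfolding eventually_at_right_field by (auto intro!: exI[of _ 1])
      then have "((\<lambda>t. t ^ (w i - m) * pd i F (\<delta> t x)) \<longlongrightarrow> pd i F x) (at_right 0)"
        by (rule tendsto_eventually)
      moreover have "((\<lambda>t. t ^ (w i - m) * pd i F (\<delta> t x)) \<longlongrightarrow> 0 ^ (w i - m) * pd i F (\<lambda>_. 0)) (at_right 0)"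
        by (intro tendsto_mult tendsto_power tendsto_ident_at zero_lim[OF Ck_on_continuous[OF pdC[OF i, of 0]] x])
      ultimately have "pd i F x = 0 ^ (w i - m) * pd i F (\<lambda>_. 0)"
        by (intro tendsto_unique) auto
      then show ?thesis using wi by simp
    qed
    have "\<exists>c. \<forall>x\<in>E. pd i F x = (\<Sum>as\<in>index_lists n w (m - w i). c as * (\<Prod>a\<leftarrow>as. x a))"
      if i: "i < n" and wi: "w i \<le> m" for i
      unfolding E_def
    proof (rule less.IH)
      show "m - w i < m" using False w[OF i] by auto
      show "Ck_on k n (topspace (Euclidean_space n)) (pd i F)" for k using pdC i by (simp add: E_def)
      fix t :: real and x assume t: "t > 0" and x: "x \<in> topspace (Euclidean_space n)"
      have "t ^ m = t ^ w i * t ^ (m - w i)" using wi by (simp flip: power_add)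
      then have "t ^ w i * pd i F (\<delta> t x) = t ^ w i * (t ^ (m - w i) * pd i F x)"
        using dhom[OF i t, of x] x by (simp add: E_def mult_ac)
      then show "pd i F (\<lambda>i. t ^ w i * x i) = t ^ (m - w i) * pd i F x"
        using t by (simp add: \<delta>_def)
    qed
    then obtain c where c: "\<And>i x. i < n \<Longrightarrow> w i \<le> m \<Longrightarrow> x \<in> E \<Longrightarrow>
        pd i F x = (\<Sum>as\<in>index_lists n w (m - w i). c i as * (\<Prod>a\<leftarrow>as. x a))"
      by metis
    \<comment> \<open>Euler's formula \<open>m * F x = (\<Sum>i<n. w i * x i * pd i F x)\<close>
      prepends the letter \<open>i\<close> to the monomials of \<open>pd i F\<close>, with the
      factor \<open>w i / m\<close>. The empty word does not have positive weight, so its value is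
      arbitrary.\<close>
    define c' where "c' = (\<lambda>as. case as of [] \<Rightarrow> 0 | i # bs \<Rightarrow> w i / m * c i bs)"
    have "F x = (\<Sum>as\<in>index_lists n w m. c' as * (\<Prod>a\<leftarrow>as. x a))" if x: "x \<in> E" for x
    proof -
      \<comment> \<open>The derivative of \<open>F\<close> along the dilation orbit at
        \<open>t = 1\<close>, computed here by the chain rule and afterwards from the
        homogeneity.\<close>
      have "((\<lambda>t. F (\<delta> t x)) has_real_derivative (\<Sum>i<n. pd i F (\<delta> 1 x) * (w i * x i))) (at 1)"
      proof (rule curve_chain_rule[OF Eo])
        show "((\<lambda>t. F (y(j := t))) has_real_derivative pd j F y) (at (y j))" if "j < n" "y \<in> E" for j y
          using F[of 0] that by (simp del: fun_upd_apply)
        show "continuous_map (subtopology (Euclidean_space n) E) euclideanreal (pd j F)" if "j < n" for j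
          using Ck_on_continuous[OF pdC[OF that, of 0]] .
        show "((\<lambda>t. \<delta> t x j) has_real_derivative w j * x j) (at 1)" for j
          unfolding \<delta>_def by (auto intro!: derivative_eq_intros)
      qed (use \<delta>E[OF x] E in auto)
      moreover have "((\<lambda>t. F (\<delta> t x)) has_real_derivative m * F x) (at 1)"
      proof -
        have ev: "eventually (\<lambda>t::real. t ^ m * F x = F (\<delta> t x)) (nhds 1)"
          using eventually_nhds_in_open[of "{0<..}" "1::real"] by (auto elim!: eventually_mono simp: hom x)
        have "((\<lambda>t. t ^ m * F x) has_real_derivative m * F x) (at 1)"
          by (auto intro!: derivative_eq_intros)
        then show ?thesis using DERIV_cong_ev[OF refl ev refl] by blast
      qed
      ultimately have "m * F x = (\<Sum>i<n. pd i F x * (w i * x i))"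
        using DERIV_unique[of "\<lambda>t. F (\<delta> t x)"] by (simp add: \<delta>_def)
      also have "\<dots> = (\<Sum>i | i < n \<and> w i \<le> m. pd i F x * (w i * x i))"
        by (rule sum.mono_neutral_right) (use pd0 x in \<open>auto simp: not_le\<close>)
      also have "\<dots> = (\<Sum>i | i < n \<and> w i \<le> m. \<Sum>as\<in>index_lists n w (m - w i).
          m * (c' (i # as) * (\<Prod>a\<leftarrow>i # as. x a)))"
        using c x False by (intro sum.cong) (auto simp: c'_def sum_distrib_left mult_ac)
      also have "\<dots> = m * (\<Sum>as\<in>index_lists n w m. c' as * (\<Prod>a\<leftarrow>as. x a))"
        using False w by (subst sum_index_lists_Suc) (auto simp: sum_distrib_left)
      finally show ?thesis using False by simp
    qed
    then show ?thesis by (auto simp: E_def)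
  qed
qed

section \<open>Manifolds and smooth maps\<close>

text \<open>A chart is restated through open sets of \<open>X\<close> and of
  \<open>Euclidean_space n\<close> themselves, so that no subspace topologies have to be carried
  along.\<close>

lemma is_chart_iff:
  "is_chart X n (U, \<phi>) \<longleftrightarrow> openin X U \<and> inj_on \<phi> U \<and>
     (\<forall>W. openin X W \<and> W \<subseteq> U \<longrightarrow> openin (Euclidean_space n) (\<phi> ` W)) \<and>
     (\<forall>V. openin (Euclidean_space n) V \<longrightarrow> openin X (U \<inter> \<phi> -` V))" (is "?L \<longleftrightarrow> ?R")
proof
  assume ?L
  then have U: "openin X U" and im: "openin (Euclidean_space n) (\<phi> ` U)"
    and h: "homeomorphic_map (subtopology X U) (subtopology (Euclidean_space n) (\<phi> ` U)) \<phi>"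
    by (auto simp: is_chart_def)
  have tU: "topspace (subtopology X U) = U" using openin_subset[OF U] by auto
  have "openin (Euclidean_space n) (\<phi> ` W)" if "openin X W" "W \<subseteq> U" for W
  proof -
    have "openin (subtopology X U) W" using that by (intro subset_openin_subtopology)
    then have "openin (subtopology (Euclidean_space n) (\<phi> ` U)) (\<phi> ` W)"
      using homeomorphic_imp_open_map[OF h] by (simp add: open_map_def)
    then show ?thesis using im by (metis openin_trans_full)
  qed
  moreover have "openin X (U \<inter> \<phi> -` V)" if "openin (Euclidean_space n) V" for V
  proof -
    have "openin (subtopology (Euclidean_space n) (\<phi> ` U)) (\<phi> ` U \<inter> V)"
      using that by (simp add: openin_subtopology_Int2)
    from openin_continuous_map_preimage[OF homeomorphic_imp_continuous_map[OF h] this]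
    have "openin (subtopology X U) {p \<in> U. \<phi> p \<in> \<phi> ` U \<inter> V}" by (simp only: tU)
    moreover have "{p \<in> U. \<phi> p \<in> \<phi> ` U \<inter> V} = U \<inter> \<phi> -` V" by auto
    ultimately show ?thesis using U by (metis openin_trans_full)
  qed
  ultimately show ?R using U homeomorphic_imp_injective_map[OF h] tU by auto
next
  assume R: ?R
  then have U: "openin X U" by blast
  have tU: "topspace (subtopology X U) = U" using openin_subset[OF U] by auto
  have im: "openin (Euclidean_space n) (\<phi> ` U)" using R by blast
  have t: "topspace (subtopology (Euclidean_space n) (\<phi> ` U)) = \<phi> ` U"
    using openin_subset[OF im] by auto
  have "homeomorphic_map (subtopology X U) (subtopology (Euclidean_space n) (\<phi> ` U)) \<phi>"
  proof (rule bijective_open_imp_homeomorphic_map)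
    show "open_map (subtopology X U) (subtopology (Euclidean_space n) (\<phi> ` U)) \<phi>"
      unfolding open_map_def
      using R U im by (auto simp: openin_open_subtopology image_mono)
    show "continuous_map (subtopology X U) (subtopology (Euclidean_space n) (\<phi> ` U)) \<phi>"
      unfolding continuous_map_def tU t
    proof (intro conjI allI impI)
      fix V assume "openin (subtopology (Euclidean_space n) (\<phi> ` U)) V"
      then have "openin (Euclidean_space n) V" using im by (metis openin_trans_full)
      then have "openin X (U \<inter> \<phi> -` V)" using R by blast
      moreover have "U \<inter> \<phi> -` V = {x \<in> U. \<phi> x \<in> V}" by auto
      ultimately show "openin (subtopology X U) {x \<in> U. \<phi> x \<in> V}"
        by (auto intro: subset_openin_subtopology)
    qed auto
  qed (use tU t R in auto)
  then show ?L using U im by (auto simp: is_chart_def)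
qed

lemma is_chartD:
  assumes "is_chart X n (U, \<phi>)"
  shows "openin X U" "inj_on \<phi> U" "\<And>W. openin X W \<Longrightarrow> openin (Euclidean_space n) (\<phi> ` (U \<inter> W))"
    "\<And>V. openin (Euclidean_space n) V \<Longrightarrow> openin X (U \<inter> \<phi> -` V)"
    "openin (Euclidean_space n) (\<phi> ` U)" "\<And>p i. p \<in> U \<Longrightarrow> i \<ge> n \<Longrightarrow> \<phi> p i = 0"
proof -
  note R = assms[unfolded is_chart_iff]
  show 1: "openin X U" "inj_on \<phi> U" "\<And>V. openin (Euclidean_space n) V \<Longrightarrow> openin X (U \<inter> \<phi> -` V)"
    using R by auto
  show 2: "openin (Euclidean_space n) (\<phi> ` (U \<inter> W))" if "openin X W" for W
    using R openin_Int[OF 1(1) that] by auto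
  show 3: "openin (Euclidean_space n) (\<phi> ` U)" using R by auto
  show "\<phi> p i = 0" if "p \<in> U" "i \<ge> n" for p i
    using openin_Euclidean_space_zero[OF 3, of "\<phi> p"] that by auto
qed

text \<open>The part of \<open>smooth_manifold\<close> that concerns charts, split off since it
  passes to products, open submanifolds and coordinate spaces by pure chart calculations.\<close>

definition atlas_manifold :: "'a manifold \<Rightarrow> bool" where
  "atlas_manifold M \<longleftrightarrow>
     (\<forall>c\<in>matlas M. is_chart (mtop M) (mdim M) c) \<and>
     \<Union> (fst ` matlas M) = mcarrier M \<and>
     (\<forall>c\<in>matlas M. \<forall>c'\<in>matlas M. charts_compatible (mdim M) c c') \<and>
     (\<forall>c. is_chart (mtop M) (mdim M) c \<and> (\<forall>c'\<in>matlas M. charts_compatible (mdim M) c c')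
        \<longrightarrow> c \<in> matlas M)"

lemma smooth_manifold_iff:
  "smooth_manifold M \<longleftrightarrow> Hausdorff_space (mtop M) \<and> second_countable (mtop M) \<and> atlas_manifold M"
  by (auto simp: smooth_manifold_def atlas_manifold_def)

lemma smooth_manifold_atlas [simp]: "smooth_manifold M \<Longrightarrow> atlas_manifold M"
  by (simp add: smooth_manifold_iff)

lemma atlas_manifold_chart: "atlas_manifold M \<Longrightarrow> c \<in> matlas M \<Longrightarrow> is_chart (mtop M) (mdim M) c"
  by (simp add: atlas_manifold_def)

lemma atlas_manifold_compatible:
  "atlas_manifold M \<Longrightarrow> c \<in> matlas M \<Longrightarrow> c' \<in> matlas M \<Longrightarrow> charts_compatible (mdim M) c c'"
  by (simp add: atlas_manifold_def)

lemma atlas_manifold_cover: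
  assumes "atlas_manifold M" "p \<in> mcarrier M"
  obtains U \<phi> where "(U, \<phi>) \<in> matlas M" "p \<in> U"
  using assms unfolding atlas_manifold_def by (metis UN_E fst_conv image_iff surj_pair)

lemma charts_compatible_sym: "charts_compatible n c c' \<longleftrightarrow> charts_compatible n c' c"
  by (cases c; cases c') (auto simp: charts_compatible_def Int_commute)

lemma Ck_on_change_chart:
  assumes c: "is_chart X n (U, \<phi>)" "is_chart X n (T, \<kappa>)" "charts_compatible n (U, \<phi>) (T, \<kappa>)"
    and W: "openin X W" and g: "Ck_on k n (\<kappa> ` (T \<inter> W)) (g \<circ> inv_into T \<kappa>)"
  shows "Ck_on k n (\<phi> ` (U \<inter> T \<inter> W)) (g \<circ> inv_into U \<phi>)"
proof -
  note U = is_chartD[OF c(1)] and T = is_chartD[OF c(2)]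
  have o: "openin (Euclidean_space n) (\<phi> ` (U \<inter> T \<inter> W))"
    using U(3)[OF openin_Int[OF T(1) W]] by (simp add: Int_assoc)
  have oUT: "openin (Euclidean_space n) (\<phi> ` (U \<inter> T))" using U(3)[OF T(1)] .
  have inv: "inv_into U \<phi> (\<phi> p) = p" if "p \<in> U" for p using U(2) that by simp
  have invT: "inv_into T \<kappa> (\<kappa> p) = p" if "p \<in> T" for p using T(2) that by simp
  have "Ck_on k n (\<phi> ` (U \<inter> T \<inter> W)) (\<lambda>x. (g \<circ> inv_into T \<kappa>) ((\<kappa> \<circ> inv_into U \<phi>) x))"
  proof (rule Ck_on_compose[OF o _ g])
    show "openin (Euclidean_space n) (\<kappa> ` (T \<inter> W))" using T(3)[OF W] .
    show "Ck_on k n (\<phi> ` (U \<inter> T \<inter> W)) (\<lambda>x. (\<kappa> \<circ> inv_into U \<phi>) x j)" if "j < n" for j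
      by (rule Ck_on_subset[OF oUT o])
        (use c(3) that in \<open>auto simp: charts_compatible_def smooth_on_coords_def\<close>)
    show "(\<kappa> \<circ> inv_into U \<phi>) x \<in> \<kappa> ` (T \<inter> W)" if "x \<in> \<phi> ` (U \<inter> T \<inter> W)" for x
      using that inv by auto
  qed
  then show ?thesis by (rule Ck_on_cong[OF o, rotated]) (use inv invT in auto)
qed

section \<open>Smooth real functions on open subsets of a manifold\<close>

definition smf :: "'a manifold \<Rightarrow> 'a set \<Rightarrow> ('a \<Rightarrow> real) \<Rightarrow> bool" where
  "smf M W f \<longleftrightarrow> openin (mtop M) W \<and>
     (\<forall>(U, \<phi>)\<in>matlas M. \<forall>k. Ck_on k (mdim M) (\<phi> ` (U \<inter> W)) (f \<circ> inv_into U \<phi>))"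

lemma smfD: "smf M W f \<Longrightarrow> (U, \<phi>) \<in> matlas M \<Longrightarrow> Ck_on k (mdim M) (\<phi> ` (U \<inter> W)) (f \<circ> inv_into U \<phi>)"
  unfolding smf_def by blast

lemma smf_open: "smf M W f \<Longrightarrow> openin (mtop M) W"
  by (simp add: smf_def)

lemma smf_subset_carrier: "smf M W f \<Longrightarrow> W \<subseteq> mcarrier M"
  by (meson openin_subset smf_open)

text \<open>One chart around each point is enough, since any other chart differs from it by a smooth
  coordinate change and \<open>Ck_on\<close> is local.\<close>

lemma smfI_charts:
  assumes M: "atlas_manifold M" and W: "openin (mtop M) W"
    and loc: "\<And>p. p \<in> W \<Longrightarrow> \<exists>U \<phi> W'. (U, \<phi>) \<in> matlas M \<and> p \<in> U \<and> openin (mtop M) W' \<and> p \<in> W' \<and>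
       (\<forall>k. Ck_on k (mdim M) (\<phi> ` (U \<inter> W')) (f \<circ> inv_into U \<phi>))"
  shows "smf M W f"
  unfolding smf_def
proof (intro conjI W ballI allI, clarify)
  fix V \<psi> k assume V: "(V, \<psi>) \<in> matlas M"
  note cV = atlas_manifold_chart[OF M V]
  show "Ck_on k (mdim M) (\<psi> ` (V \<inter> W)) (f \<circ> inv_into V \<psi>)"
  proof (rule Ck_on_local[OF is_chartD(3)[OF cV W]])
    fix x assume "x \<in> \<psi> ` (V \<inter> W)"
    then obtain p where p: "p \<in> V" "p \<in> W" "x = \<psi> p" by blast
    obtain U \<phi> W' where U: "(U, \<phi>) \<in> matlas M" "p \<in> U" "openin (mtop M) W'" "p \<in> W'"
      "Ck_on k (mdim M) (\<phi> ` (U \<inter> W')) (f \<circ> inv_into U \<phi>)" using loc[OF p(2)] by blast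
    note cU = atlas_manifold_chart[OF M U(1)]
    have oW: "openin (mtop M) (W' \<inter> W)" using U(3) W by blast
    have "Ck_on k (mdim M) (\<phi> ` (U \<inter> (W' \<inter> W))) (f \<circ> inv_into U \<phi>)"
      by (rule Ck_on_subset[OF is_chartD(3)[OF cU U(3)] is_chartD(3)[OF cU oW] _ U(5)]) auto
    from Ck_on_change_chart[OF cV cU atlas_manifold_compatible[OF M V U(1)] oW this]
    have "Ck_on k (mdim M) (\<psi> ` (V \<inter> U \<inter> (W' \<inter> W))) (f \<circ> inv_into V \<psi>)" .
    moreover have "openin (Euclidean_space (mdim M)) (\<psi> ` (V \<inter> U \<inter> (W' \<inter> W)))"
      using is_chartD(3)[OF cV openin_Int[OF is_chartD(1)[OF cU] oW]] by (simp add: Int_assoc)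
    ultimately show "\<exists>S. openin (Euclidean_space (mdim M)) S \<and> x \<in> S \<and> S \<subseteq> \<psi> ` (V \<inter> W) \<and>
        Ck_on k (mdim M) S (f \<circ> inv_into V \<psi>)"
      using p U(2,4) by (intro exI[of _ "\<psi> ` (V \<inter> U \<inter> (W' \<inter> W))"]) auto
  qed
qed

lemma smf_local:
  assumes M: "atlas_manifold M"
    and loc: "\<And>p. p \<in> W \<Longrightarrow> \<exists>W'. p \<in> W' \<and> W' \<subseteq> W \<and> smf M W' f"
  shows "smf M W f"
proof (rule smfI_charts[OF M])
  show "openin (mtop M) W" 
  proof (subst openin_subopen, intro ballI)
    fix p assume "p \<in> W"
    then obtain W' where "p \<in> W'" "W' \<subseteq> W" "smf M W' f" using loc by blast
    then show "\<exists>T. openin (mtop M) T \<and> p \<in> T \<and> T \<subseteq> W" using smf_open[of M W' f] by blast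
  qed
  fix p assume "p \<in> W"
  then obtain W' where W': "p \<in> W'" "smf M W' f" using loc by blast
  obtain U \<phi> where U: "(U, \<phi>) \<in> matlas M" "p \<in> U"
    using atlas_manifold_cover[OF M] smf_subset_carrier[OF W'(2)] W'(1) by blast
  show "\<exists>U \<phi> W'. (U, \<phi>) \<in> matlas M \<and> p \<in> U \<and> openin (mtop M) W' \<and> p \<in> W' \<and>
       (\<forall>k. Ck_on k (mdim M) (\<phi> ` (U \<inter> W')) (f \<circ> inv_into U \<phi>))"
    using U W' smf_open[OF W'(2)] smfD[OF W'(2) U(1)] by blast
qed

lemma smfI:
  assumes "openin (mtop M) W"
    "\<And>U \<phi> k. (U, \<phi>) \<in> matlas M \<Longrightarrow> openin (Euclidean_space (mdim M)) (\<phi> ` (U \<inter> W)) \<Longrightarrow>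
       Ck_on k (mdim M) (\<phi> ` (U \<inter> W)) (\<lambda>x. f (inv_into U \<phi> x))" and "atlas_manifold M"
  shows "smf M W f"
  unfolding smf_def
proof (intro conjI assms(1) ballI allI, clarify)
  fix U \<phi> k assume U: "(U, \<phi>) \<in> matlas M"
  have "openin (Euclidean_space (mdim M)) (\<phi> ` (U \<inter> W))"
    using is_chartD(3)[OF atlas_manifold_chart[OF assms(3) U] assms(1)] .
  then show "Ck_on k (mdim M) (\<phi> ` (U \<inter> W)) (f \<circ> inv_into U \<phi>)"
    using assms(2)[OF U] by (simp add: o_def)
qed

lemma smf_cong:
  assumes "atlas_manifold M" "smf M W f" "\<And>p. p \<in> W \<Longrightarrow> f p = g p"
  shows "smf M W g"
proof (rule smfI[OF smf_open[OF assms(2)] _ assms(1)])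
  fix U \<phi> k assume U: "(U, \<phi>) \<in> matlas M" and o: "openin (Euclidean_space (mdim M)) (\<phi> ` (U \<inter> W))"
  note i = is_chartD(2)[OF atlas_manifold_chart[OF assms(1) U]]
  show "Ck_on k (mdim M) (\<phi> ` (U \<inter> W)) (\<lambda>x. g (inv_into U \<phi> x))"
    by (rule Ck_on_cong[OF o _ smfD[OF assms(2) U]]) (use i assms(3) in auto)
qed

lemma smf_subset:
  assumes "atlas_manifold M" "smf M W f" "openin (mtop M) V" "V \<subseteq> W"
  shows "smf M V f"
proof (rule smfI[OF assms(3) _ assms(1)])
  fix U \<phi> k assume U: "(U, \<phi>) \<in> matlas M" and o: "openin (Euclidean_space (mdim M)) (\<phi> ` (U \<inter> V))"
  have o2: "openin (Euclidean_space (mdim M)) (\<phi> ` (U \<inter> W))"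
    using is_chartD(3)[OF atlas_manifold_chart[OF assms(1) U] smf_open[OF assms(2)]] .
  show "Ck_on k (mdim M) (\<phi> ` (U \<inter> V)) (\<lambda>x. f (inv_into U \<phi> x))"
    using Ck_on_subset[OF o2 o _ smfD[OF assms(2) U, of k]] assms(4) by (auto simp: o_def)
qed

lemma smf_const: "atlas_manifold M \<Longrightarrow> openin (mtop M) W \<Longrightarrow> smf M W (\<lambda>_. c)"
  by (rule smfI) (auto intro: Ck_on_const)

lemma smf_add: "atlas_manifold M \<Longrightarrow> smf M W f \<Longrightarrow> smf M W g \<Longrightarrow> smf M W (\<lambda>p. f p + g p)"
  by (rule smfI[OF smf_open]) (auto intro!: Ck_on_add dest: smfD simp: o_def)

lemma smf_mult: "atlas_manifold M \<Longrightarrow> smf M W f \<Longrightarrow> smf M W g \<Longrightarrow> smf M W (\<lambda>p. f p * g p)"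
  by (rule smfI[OF smf_open]) (auto intro!: Ck_on_mult dest: smfD simp: o_def)

lemma smf_sum:
  assumes "atlas_manifold M" "openin (mtop M) W"
  shows "(\<And>i. i \<in> A \<Longrightarrow> smf M W (f i)) \<Longrightarrow> smf M W (\<lambda>p. \<Sum>i\<in>A. f i p)"
  by (induction A rule: infinite_finite_induct) (auto intro!: smf_const smf_add assms)

lemma smf_minus: "atlas_manifold M \<Longrightarrow> smf M W f \<Longrightarrow> smf M W (\<lambda>p. - f p)"
  using smf_mult[of M W "\<lambda>_. -1" f] smf_const[of M W "-1"] smf_open[of M W f] by simp

lemma smf_diff: "atlas_manifold M \<Longrightarrow> smf M W f \<Longrightarrow> smf M W g \<Longrightarrow> smf M W (\<lambda>p. f p - g p)"
  using smf_add[of M W f "\<lambda>p. - g p"] smf_minus[of M W g] by simp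

lemma smf_inverse:
  assumes M: "atlas_manifold M" and f: "smf M W f" and nz: "\<And>p. p \<in> W \<Longrightarrow> f p \<noteq> 0"
  shows "smf M W (\<lambda>p. inverse (f p))"
proof (rule smfI[OF smf_open[OF f] _ M])
  fix U \<phi> k assume U: "(U, \<phi>) \<in> matlas M" and o: "openin (Euclidean_space (mdim M)) (\<phi> ` (U \<inter> W))"
  note i = is_chartD(2)[OF atlas_manifold_chart[OF M U]]
  show "Ck_on k (mdim M) (\<phi> ` (U \<inter> W)) (\<lambda>x. inverse (f (inv_into U \<phi> x)))"
    by (rule Ck_on_inverse[OF o]) (use i nz smfD[OF f U] in \<open>auto simp: o_def\<close>)
qed

lemma smf_divide:
  assumes "atlas_manifold M" "smf M W f" "smf M W g" "\<And>p. p \<in> W \<Longrightarrow> g p \<noteq> 0"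
  shows "smf M W (\<lambda>p. f p / g p)"
  using smf_mult[OF assms(1,2) smf_inverse[OF assms(1,3,4)]] by (simp add: divide_inverse)

lemma smf_compose_Euclidean:
  assumes M: "atlas_manifold M" and g: "\<And>j. j < m \<Longrightarrow> smf M W (\<lambda>p. G p j)" and W: "openin (mtop M) W"
    and V: "openin (Euclidean_space m) V" and GV: "\<And>p. p \<in> W \<Longrightarrow> G p \<in> V"
    and F: "\<And>k. Ck_on k m V F"
  shows "smf M W (\<lambda>p. F (G p))"
proof (rule smfI[OF W _ M])
  fix U \<phi> k assume U: "(U, \<phi>) \<in> matlas M" and o: "openin (Euclidean_space (mdim M)) (\<phi> ` (U \<inter> W))"
  note i = is_chartD(2)[OF atlas_manifold_chart[OF M U]]
  show "Ck_on k (mdim M) (\<phi> ` (U \<inter> W)) (\<lambda>x. F (G (inv_into U \<phi> x)))"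
    by (rule Ck_on_compose[OF o V F]) (use i GV smfD[OF g U] in \<open>auto simp: o_def\<close>)
qed

lemma smf_continuous:
  assumes M: "atlas_manifold M" and f: "smf M W f"
  shows "continuous_map (subtopology (mtop M) W) euclideanreal f"
proof (rule continuous_map_local)
  fix p assume p: "p \<in> W"
  obtain U \<phi> where U: "(U, \<phi>) \<in> matlas M" "p \<in> U"
    using atlas_manifold_cover[OF M] smf_subset_carrier[OF f] p by blast
  note c = atlas_manifold_chart[OF M U(1)]
  have UW: "openin (mtop M) (U \<inter> W)" using is_chartD(1)[OF c] smf_open[OF f] by blast
  have UWs: "U \<inter> W \<subseteq> mcarrier M" using openin_subset[OF UW] .
  have o: "openin (Euclidean_space (mdim M)) (\<phi> ` (U \<inter> W))" using is_chartD(3)[OF c smf_open[OF f]] .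
  have 1: "continuous_map (subtopology (Euclidean_space (mdim M)) (\<phi> ` (U \<inter> W))) euclideanreal (f \<circ> inv_into U \<phi>)"
    using Ck_on_continuous[OF smfD[OF f U(1), of 0]] .
  have 2: "continuous_map (subtopology (mtop M) (U \<inter> W)) (subtopology (Euclidean_space (mdim M)) (\<phi> ` (U \<inter> W))) \<phi>"
    unfolding continuous_map_def
  proof (intro conjI allI impI)
    show "\<phi> \<in> topspace (subtopology (mtop M) (U \<inter> W)) \<rightarrow> topspace (subtopology (Euclidean_space (mdim M)) (\<phi> ` (U \<inter> W)))"
      using openin_subset[OF o] by auto
    fix V assume "openin (subtopology (Euclidean_space (mdim M)) (\<phi> ` (U \<inter> W))) V"
    then have "openin (Euclidean_space (mdim M)) V" using o by (metis openin_trans_full)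
    from is_chartD(4)[OF c this] have "openin (mtop M) ((U \<inter> \<phi> -` V) \<inter> (U \<inter> W))" using UW by blast
    moreover have "{x \<in> topspace (subtopology (mtop M) (U \<inter> W)). \<phi> x \<in> V} = (U \<inter> \<phi> -` V) \<inter> (U \<inter> W)"
      using UWs by auto
    ultimately show "openin (subtopology (mtop M) (U \<inter> W)) {x \<in> topspace (subtopology (mtop M) (U \<inter> W)). \<phi> x \<in> V}"
      by (auto intro: subset_openin_subtopology)
  qed
  have "continuous_map (subtopology (mtop M) (U \<inter> W)) euclideanreal f"
    by (rule continuous_map_eq[OF continuous_map_compose[OF 2 1]]) (use is_chartD(2)[OF c] in auto)
  then show "\<exists>V. openin (mtop M) V \<and> p \<in> V \<and> V \<subseteq> W \<and> continuous_map (subtopology (mtop M) V) euclideanreal f"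
    using UW U(2) p by blast
qed

lemma smf_open_preimage:
  assumes M: "atlas_manifold M" and f: "smf M W f" and S: "open S"
  shows "openin (mtop M) {p \<in> W. f p \<in> S}"
proof -
  have "openin (subtopology (mtop M) W) {p \<in> topspace (subtopology (mtop M) W). f p \<in> S}"
    using smf_continuous[OF M f] by (rule openin_continuous_map_preimage) (use S in simp)
  moreover have "{p \<in> topspace (subtopology (mtop M) W). f p \<in> S} = {p \<in> W. f p \<in> S}"
    using smf_subset_carrier[OF f] by auto
  ultimately show ?thesis using smf_open[OF f] by (metis openin_trans_full)
qed

lemma smf_open_preimage_Euclidean:
  assumes M: "atlas_manifold M" and g: "\<And>j. j < m \<Longrightarrow> smf M W (\<lambda>p. G p j)" and W: "openin (mtop M) W"
    and V: "openin (Euclidean_space m) V" and G0: "\<And>p j. p \<in> W \<Longrightarrow> j \<ge> m \<Longrightarrow> G p j = 0"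
  shows "openin (mtop M) {p \<in> W. G p \<in> V}"
proof (subst openin_subopen, clarify)
  fix p assume p: "p \<in> W" "G p \<in> V"
  obtain e where e: "e > 0" "\<And>y. (\<forall>i<m. \<bar>y i - G p i\<bar> < e) \<Longrightarrow> (\<forall>i\<ge>m. y i = 0) \<Longrightarrow> y \<in> V"
    using Euclidean_space_box[OF V p(2)] by auto
  \<comment> \<open>Finitely many coordinate conditions cut out a neighbourhood. The factor
    \<open>W\<close> keeps it inside \<open>W\<close> also for \<open>m = 0\<close>, where the
    intersection runs over no coordinate.\<close>
  define T where "T = W \<inter> (\<Inter>i\<in>{..<m}. {q \<in> W. G q i \<in> ball (G p i) e})"
  have "openin (mtop M) T"
  proof (cases "m = 0")
    case False
    have "openin (mtop M) {q \<in> W. G q i \<in> ball (G p i) e}" if "i < m" for i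
      by (rule smf_open_preimage[OF M g[OF that] open_ball])
    then show ?thesis unfolding T_def using False
      by (intro openin_Int W openin_INT2) (auto simp del: mem_ball)
  qed (use W in \<open>simp add: T_def\<close>)
  moreover have "T \<subseteq> {p \<in> W. G p \<in> V}"
    using e(2) G0 by (fastforce simp: T_def dist_real_def abs_minus_commute)
  moreover have "p \<in> T" using p e(1) by (auto simp: T_def)
  ultimately show "\<exists>T. openin (mtop M) T \<and> p \<in> T \<and> T \<subseteq> {p \<in> W. G p \<in> V}" by blast
qed

section \<open>Smooth maps, described by pull-back of smooth functions\<close>

definition smap :: "'a manifold \<Rightarrow> 'a set \<Rightarrow> 'b manifold \<Rightarrow> ('a \<Rightarrow> 'b) \<Rightarrow> bool" where
  "smap M W N f \<longleftrightarrow> openin (mtop M) W \<and> f ` W \<subseteq> mcarrier N \<and>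
     (\<forall>V g. smf N V g \<longrightarrow> smf M (W \<inter> f -` V) (\<lambda>p. g (f p)))"

lemma smap_open: "smap M W N f \<Longrightarrow> openin (mtop M) W"
  by (simp add: smap_def)

lemma smap_image: "smap M W N f \<Longrightarrow> p \<in> W \<Longrightarrow> f p \<in> mcarrier N"
  by (auto simp: smap_def)

lemma smap_pull: "smap M W N f \<Longrightarrow> smf N V g \<Longrightarrow> smf M (W \<inter> f -` V) (\<lambda>p. g (f p))"
  by (auto simp: smap_def)

lemma smap_pull_subset:
  assumes "smap M W N f" "smf N V g" "f ` W \<subseteq> V"
  shows "smf M W (\<lambda>p. g (f p))"
proof -
  have "W \<inter> f -` V = W" using assms(3) by auto
  then show ?thesis using smap_pull[OF assms(1,2)] by simp
qed

text \<open>Continuity is hidden in \<open>smap\<close>: constant functions on \<open>V\<close> are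
  smooth because \<open>V\<close> is open, and their pull-backs have open domains by the definition
  of \<open>smf\<close>.\<close>

lemma smap_open_preimage:
  assumes "smap M W N f" "atlas_manifold N" "openin (mtop N) V"
  shows "openin (mtop M) (W \<inter> f -` V)"
  using smap_pull[OF assms(1) smf_const[OF assms(2,3)]] by (rule smf_open)

lemma smap_compose:
  assumes f: "smap M W N f" and g: "smap N V P g" and "f ` W \<subseteq> V"
  shows "smap M W P (\<lambda>p. g (f p))"
  unfolding smap_def
proof (intro conjI allI impI)
  show "openin (mtop M) W" using f by (rule smap_open)
  show "(\<lambda>p. g (f p)) ` W \<subseteq> mcarrier P" using assms(3) smap_image[OF g] by auto
  fix Z h assume "smf P Z h"
  from smap_pull[OF f smap_pull[OF g this]]
  have "smf M (W \<inter> f -` (V \<inter> g -` Z)) (\<lambda>p. h (g (f p)))" .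
  moreover have "W \<inter> f -` (V \<inter> g -` Z) = W \<inter> (\<lambda>p. g (f p)) -` Z" using assms(3) by auto
  ultimately show "smf M (W \<inter> (\<lambda>p. g (f p)) -` Z) (\<lambda>p. h (g (f p)))" by simp
qed

lemma smap_cong:
  assumes M: "atlas_manifold M" and f: "smap M W N f" and eq: "\<And>p. p \<in> W \<Longrightarrow> f p = g p"
  shows "smap M W N g"
  unfolding smap_def
proof (intro conjI allI impI)
  show "openin (mtop M) W" using f by (rule smap_open)
  show "g ` W \<subseteq> mcarrier N" using smap_image[OF f] eq by auto
  fix Z h assume h: "smf N Z h"
  have "W \<inter> f -` Z = W \<inter> g -` Z" using eq by auto
  then have "smf M (W \<inter> g -` Z) (\<lambda>p. h (f p))" using smap_pull[OF f h] by simp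
  then show "smf M (W \<inter> g -` Z) (\<lambda>p. h (g p))" by (rule smf_cong[OF M]) (use eq in auto)
qed

lemma smap_subset:
  assumes M: "atlas_manifold M" and f: "smap M W N f" and V: "openin (mtop M) V" "V \<subseteq> W"
  shows "smap M V N f"
  unfolding smap_def
proof (intro conjI allI impI V)
  show "f ` V \<subseteq> mcarrier N" using smap_image[OF f] V by auto
  fix Z h assume h: "smf N Z h"
  note s = smap_pull[OF f h]
  have "openin (mtop M) ((W \<inter> f -` Z) \<inter> V)" using smf_open[OF s] V(1) by blast
  moreover have "(W \<inter> f -` Z) \<inter> V = V \<inter> f -` Z" using V(2) by auto
  ultimately have o: "openin (mtop M) (V \<inter> f -` Z)" by simp
  show "smf M (V \<inter> f -` Z) (\<lambda>p. h (f p))" by (rule smf_subset[OF M s o]) (use V(2) in auto)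
qed

lemma smap_id: "atlas_manifold M \<Longrightarrow> openin (mtop M) W \<Longrightarrow> smap M W M (\<lambda>p. p)"
proof (unfold smap_def, intro conjI allI impI)
  assume M: "atlas_manifold M" and W: "openin (mtop M) W"
  show "openin (mtop M) W" by (rule W)
  show "(\<lambda>p. p) ` W \<subseteq> mcarrier M" using openin_subset[OF W] by simp
  fix V g assume g: "smf M V g"
  have "openin (mtop M) (W \<inter> V)" using W smf_open[OF g] by blast
  then show "smf M (W \<inter> (\<lambda>p. p) -` V) (\<lambda>p. g p)"
    using smf_subset[OF M g, of "W \<inter> V"] by simp
qed

lemma smap_local:
  assumes M: "atlas_manifold M"
    and loc: "\<And>p. p \<in> W \<Longrightarrow> \<exists>W'. p \<in> W' \<and> W' \<subseteq> W \<and> smap M W' N f"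
  shows "smap M W N f"
  unfolding smap_def
proof (intro conjI allI impI)
  show "openin (mtop M) W" 
  proof (subst openin_subopen, intro ballI)
    fix p assume "p \<in> W"
    then obtain W' where "p \<in> W'" "W' \<subseteq> W" "smap M W' N f" using loc by blast
    then show "\<exists>T. openin (mtop M) T \<and> p \<in> T \<and> T \<subseteq> W" using smap_open[of M W' N f] by blast
  qed
  show "f ` W \<subseteq> mcarrier N"
  proof clarify
    fix p assume "p \<in> W"
    then obtain W' where "p \<in> W'" "smap M W' N f" using loc by blast
    then show "f p \<in> mcarrier N" using smap_image by metis
  qed
  fix Z h assume h: "smf N Z h"
  show "smf M (W \<inter> f -` Z) (\<lambda>p. h (f p))"
  proof (rule smf_local[OF M])
    fix p assume p: "p \<in> W \<inter> f -` Z"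
    then obtain W' where W': "p \<in> W'" "W' \<subseteq> W" "smap M W' N f" using loc by blast
    have "smf M (W' \<inter> f -` Z) (\<lambda>p. h (f p))" using smap_pull[OF W'(3) h] .
    then show "\<exists>W'. p \<in> W' \<and> W' \<subseteq> W \<inter> f -` Z \<and> smf M W' (\<lambda>p. h (f p))"
      using W' p by (intro exI[of _ "W' \<inter> f -` Z"]) auto
  qed
qed

text \<open>Locally a smooth function on \<open>N\<close> is a smooth function of chart coordinates,
  so only these have to be pulled back.\<close>

lemma smapI_charts:
  assumes M: "atlas_manifold M" and N: "atlas_manifold N"
    and loc: "\<And>p. p \<in> W \<Longrightarrow> \<exists>W' V \<psi>. p \<in> W' \<and> W' \<subseteq> W \<and> openin (mtop M) W' \<and> (V, \<psi>) \<in> matlas N \<and> f ` W' \<subseteq> V \<and>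
       (\<forall>j<mdim N. smf M W' (\<lambda>p. \<psi> (f p) j))"
  shows "smap M W N f"
proof (rule smap_local[OF M])
  fix p assume "p \<in> W"
  then obtain W' V \<psi> where W': "p \<in> W'" "W' \<subseteq> W" "openin (mtop M) W'" "(V, \<psi>) \<in> matlas N" "f ` W' \<subseteq> V"
    "\<And>j. j < mdim N \<Longrightarrow> smf M W' (\<lambda>p. \<psi> (f p) j)" using loc by meson
  note c = atlas_manifold_chart[OF N W'(4)]
  have "smap M W' N f"
    unfolding smap_def
  proof (intro conjI allI impI W'(3))
    show "f ` W' \<subseteq> mcarrier N" using W'(5) openin_subset[OF is_chartD(1)[OF c]] by auto
    fix Z h assume h: "smf N Z h"
    note Z = is_chartD(3)[OF c smf_open[OF h]]
    have z0: "\<psi> (f q) j = 0" if "q \<in> W'" "j \<ge> mdim N" for q j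
      using is_chartD(6)[OF c] that W'(5) by auto
    have eq: "{q \<in> W'. \<psi> (f q) \<in> \<psi> ` (V \<inter> Z)} = W' \<inter> f -` Z"
      using W'(5) inj_on_image_mem_iff[OF is_chartD(2)[OF c], of _ "V \<inter> Z"] by auto
    have o: "openin (mtop M) (W' \<inter> f -` Z)"
      using smf_open_preimage_Euclidean[OF M, of "mdim N" W' "\<lambda>p. \<psi> (f p)", OF W'(6,3) Z z0] eq by simp
    have "smf M (W' \<inter> f -` Z) (\<lambda>p. (h \<circ> inv_into V \<psi>) (\<psi> (f p)))"
    proof (rule smf_compose_Euclidean[where G = "\<lambda>p. \<psi> (f p)", OF M _ o Z])
      show "smf M (W' \<inter> f -` Z) (\<lambda>p. \<psi> (f p) j)" if "j < mdim N" for j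
        by (rule smf_subset[OF M W'(6)[OF that] o]) auto
      show "Ck_on k (mdim N) (\<psi> ` (V \<inter> Z)) (h \<circ> inv_into V \<psi>)" for k using smfD[OF h W'(4)] .
    qed (use eq in auto)
    then show "smf M (W' \<inter> f -` Z) (\<lambda>p. h (f p))"
      by (rule smf_cong[OF M]) (use W'(5) is_chartD(2)[OF c] in auto)
  qed
  then show "\<exists>W'. p \<in> W' \<and> W' \<subseteq> W \<and> smap M W' N f" using W' by blast
qed

lemma smf_chart_coord:
  assumes M: "atlas_manifold M" and U: "(U, \<phi>) \<in> matlas M"
  shows "smf M U (\<lambda>p. \<phi> p j)"
proof -
  note c = atlas_manifold_chart[OF M U]
  show ?thesis
  proof (rule smfI_charts[OF M is_chartD(1)[OF c]])
    fix p assume p: "p \<in> U"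
    have "Ck_on k (mdim M) (\<phi> ` (U \<inter> U)) ((\<lambda>p. \<phi> p j) \<circ> inv_into U \<phi>)" for k
      by (rule Ck_on_cong[OF is_chartD(3)[OF c is_chartD(1)[OF c]] _ Ck_on_coord[of _ _ _ j]])
        (use is_chartD(3)[OF c is_chartD(1)[OF c]] is_chartD(2)[OF c] in auto)
    then show "\<exists>U' \<phi>' W'. (U', \<phi>') \<in> matlas M \<and> p \<in> U' \<and> openin (mtop M) W' \<and> p \<in> W' \<and>
       (\<forall>k. Ck_on k (mdim M) (\<phi>' ` (U' \<inter> W')) ((\<lambda>p. \<phi> p j) \<circ> inv_into U' \<phi>'))"
      using U p is_chartD(1)[OF c] by blast
  qed
qed

text \<open>Chart coordinates are themselves smooth functions, hence pulling them back returns the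
  coordinate expressions of \<open>f\<close>. After this translation maps are composed without any
  chart.\<close>

lemma smooth_map_iff_smap:
  assumes M: "atlas_manifold M" and N: "atlas_manifold N"
  shows "smooth_map M N f \<longleftrightarrow> smap M (mcarrier M) N f"
proof
  assume L: "smooth_map M N f"
  then have cont: "continuous_map (mtop M) (mtop N) f" by (simp add: smooth_map_def)
  show "smap M (mcarrier M) N f"
  proof (rule smapI_charts[OF M N])
    fix p assume p: "p \<in> mcarrier M"
    have "f p \<in> mcarrier N" using continuous_map_image_subset_topspace[OF cont] p by auto
    then obtain V \<psi> where V: "(V, \<psi>) \<in> matlas N" "f p \<in> V" using atlas_manifold_cover[OF N] by metis
    define W' where "W' = {q \<in> mcarrier M. f q \<in> V}"
    have W': "openin (mtop M) W'" unfolding W'_def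
      using cont is_chartD(1)[OF atlas_manifold_chart[OF N V(1)]] by (rule openin_continuous_map_preimage)
    have "smf M W' (\<lambda>p. \<psi> (f p) j)" if j: "j < mdim N" for j
    proof (rule smfI[OF W' _ M])
      fix U \<phi> k assume U: "(U, \<phi>) \<in> matlas M"
      have "U \<inter> W' = U \<inter> f -` V"
        using openin_subset[OF is_chartD(1)[OF atlas_manifold_chart[OF M U]]] by (auto simp: W'_def)
      moreover have "smooth_on_coords (mdim M) (mdim N) (\<phi> ` (U \<inter> f -` V)) (\<psi> \<circ> f \<circ> inv_into U \<phi>)"
        using L U V(1) by (auto simp: smooth_map_def)
      ultimately show "Ck_on k (mdim M) (\<phi> ` (U \<inter> W')) (\<lambda>x. \<psi> (f (inv_into U \<phi> x)) j)"
        using j by (simp add: smooth_on_coords_def)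
    qed
    then show "\<exists>W' V \<psi>. p \<in> W' \<and> W' \<subseteq> mcarrier M \<and> openin (mtop M) W' \<and> (V, \<psi>) \<in> matlas N \<and> f ` W' \<subseteq> V \<and>
       (\<forall>j<mdim N. smf M W' (\<lambda>p. \<psi> (f p) j))"
      using p V W' by (intro exI[of _ W'] exI[of _ V] exI[of _ \<psi>]) (auto simp: W'_def)
  qed
next
  assume R: "smap M (mcarrier M) N f"
  have pre: "mcarrier M \<inter> f -` V = {x \<in> mcarrier M. f x \<in> V}" for V by auto
  have "continuous_map (mtop M) (mtop N) f"
    unfolding continuous_map_def
    using smap_image[OF R] smap_open_preimage[OF R N] by (auto simp: pre)
  moreover have "smooth_on_coords (mdim M) (mdim N) (\<phi> ` (U \<inter> f -` V)) (\<psi> \<circ> f \<circ> inv_into U \<phi>)"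
    if U: "(U, \<phi>) \<in> matlas M" and V: "(V, \<psi>) \<in> matlas N" for U \<phi> V \<psi>
  proof -
    note c = atlas_manifold_chart[OF M U]
    have eq: "U \<inter> (mcarrier M \<inter> f -` V) = U \<inter> f -` V" using openin_subset[OF is_chartD(1)[OF c]] by auto
    note s = smap_pull[OF R smf_chart_coord[OF N V]]
    show ?thesis
      using smfD[OF s U] is_chartD(3)[OF c smf_open[OF s]] unfolding eq
      by (auto simp: smooth_on_coords_def o_def)
  qed
  ultimately show "smooth_map M N f" by (auto simp: smooth_map_def)
qed

lemma chart_in_atlasI:
  assumes M: "atlas_manifold M" and c: "is_chart (mtop M) (mdim M) (U, \<phi>)"
    and 1: "\<And>j. j < mdim M \<Longrightarrow> smf M U (\<lambda>p. \<phi> p j)"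
    and 2: "\<And>V \<psi> j k. (V, \<psi>) \<in> matlas M \<Longrightarrow> j < mdim M \<Longrightarrow>
      Ck_on k (mdim M) (\<phi> ` (U \<inter> V)) (\<lambda>x. \<psi> (inv_into U \<phi> x) j)"
  shows "(U, \<phi>) \<in> matlas M"
proof -
  have "charts_compatible (mdim M) (U, \<phi>) (V, \<psi>)" if V: "(V, \<psi>) \<in> matlas M" for V \<psi>
  proof -
    note cV = atlas_manifold_chart[OF M V]
    show ?thesis
      using is_chartD(3)[OF c is_chartD(1)[OF cV]] is_chartD(3)[OF cV is_chartD(1)[OF c]]
        2[OF V] smfD[OF 1 V]
      by (auto simp: charts_compatible_def smooth_on_coords_def o_def Int_commute)
  qed
  then show ?thesis using M c unfolding atlas_manifold_def by (metis surj_pair)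
qed

text \<open>By maximality the restriction of a chart to an open set is again a chart. These
  restrictions make \<open>open_submanifold\<close>, which keeps only the charts inside
  \<open>U\<close>, cover all of \<open>U\<close>.\<close>

lemma chart_restrict:
  assumes M: "atlas_manifold M" and V: "(V, \<psi>) \<in> matlas M" and W: "openin (mtop M) W"
  shows "(V \<inter> W, \<psi>) \<in> matlas M"
proof -
  note c = atlas_manifold_chart[OF M V]
  have o: "openin (mtop M) (V \<inter> W)" using is_chartD(1)[OF c] W by blast
  have "openin (mtop M) (V \<inter> W \<inter> \<psi> -` S)" if "openin (Euclidean_space (mdim M)) S" for S
  proof -
    have "openin (mtop M) (V \<inter> \<psi> -` S \<inter> W)" using is_chartD(4)[OF c that] W by blast
    moreover have "V \<inter> \<psi> -` S \<inter> W = V \<inter> W \<inter> \<psi> -` S" by auto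
    ultimately show ?thesis by simp
  qed
  then have c': "is_chart (mtop M) (mdim M) (V \<inter> W, \<psi>)"
    using c o unfolding is_chart_iff by (auto intro: inj_on_subset)
  show ?thesis
  proof (rule chart_in_atlasI[OF M c'])
    show "smf M (V \<inter> W) (\<lambda>p. \<psi> p j)" for j
      by (rule smf_subset[OF M smf_chart_coord[OF M V] o]) auto
    fix T \<kappa> j k assume T: "(T, \<kappa>) \<in> matlas M"
    note cT = atlas_manifold_chart[OF M T]
    have o1: "openin (Euclidean_space (mdim M)) (\<psi> ` (V \<inter> T))" using is_chartD(3)[OF c is_chartD(1)[OF cT]] .
    have o2: "openin (Euclidean_space (mdim M)) (\<psi> ` (V \<inter> W \<inter> T))" using is_chartD(3)[OF c' is_chartD(1)[OF cT]] .
    have "Ck_on k (mdim M) (\<psi> ` (V \<inter> W \<inter> T)) ((\<lambda>p. \<kappa> p j) \<circ> inv_into V \<psi>)"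
      by (rule Ck_on_subset[OF o1 o2 _ smfD[OF smf_chart_coord[OF M T] V]]) auto
    then show "Ck_on k (mdim M) (\<psi> ` (V \<inter> W \<inter> T)) (\<lambda>x. \<kappa> (inv_into (V \<inter> W) \<psi> x) j)"
      by (rule Ck_on_cong[OF o2, rotated]) (use is_chartD(2)[OF c] is_chartD(2)[OF c'] in auto)
  qed
qed

section \<open>Open submanifolds and generated atlases\<close>

lemma open_submanifold_simps [simp]:
  "mtop (open_submanifold M U) = subtopology (mtop M) U"
  "mdim (open_submanifold M U) = mdim M"
  "matlas (open_submanifold M U) = {c \<in> matlas M. fst c \<subseteq> U}"
  by (auto simp: open_submanifold_def)

lemma is_chart_open_subtopology:
  assumes "openin X U"
  shows "is_chart (subtopology X U) n (V, \<psi>) \<longleftrightarrow> is_chart X n (V, \<psi>) \<and> V \<subseteq> U"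
  unfolding is_chart_iff openin_open_subtopology[OF assms] by auto

lemma atlas_open_submanifold:
  assumes M: "atlas_manifold M" and U: "openin (mtop M) U"
  shows "atlas_manifold (open_submanifold M U)"
  unfolding atlas_manifold_def
proof (intro conjI ballI allI impI)
  show "is_chart (mtop (open_submanifold M U)) (mdim (open_submanifold M U)) c"
    if "c \<in> matlas (open_submanifold M U)" for c
    using that is_chart_open_subtopology[OF U] atlas_manifold_chart[OF M] by (cases c) auto
  show "charts_compatible (mdim (open_submanifold M U)) c c'"
    if "c \<in> matlas (open_submanifold M U)" "c' \<in> matlas (open_submanifold M U)" for c c'
    using that atlas_manifold_compatible[OF M] by auto
  show "\<Union> (fst ` matlas (open_submanifold M U)) = mcarrier (open_submanifold M U)"
  proof
    show "\<Union> (fst ` matlas (open_submanifold M U)) \<subseteq> mcarrier (open_submanifold M U)"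
      using M by (auto simp: atlas_manifold_def)
    show "mcarrier (open_submanifold M U) \<subseteq> \<Union> (fst ` matlas (open_submanifold M U))"
    proof
      fix p assume "p \<in> mcarrier (open_submanifold M U)"
      then have p: "p \<in> mcarrier M" "p \<in> U" by auto
      then obtain V \<psi> where "(V, \<psi>) \<in> matlas M" "p \<in> V" using atlas_manifold_cover[OF M] by metis
      then show "p \<in> \<Union> (fst ` matlas (open_submanifold M U))"
        using chart_restrict[OF M _ U] p by force
    qed
  qed
  fix c assume c: "is_chart (mtop (open_submanifold M U)) (mdim (open_submanifold M U)) c \<and>
      (\<forall>c'\<in>matlas (open_submanifold M U). charts_compatible (mdim (open_submanifold M U)) c c')"
  obtain V \<psi> where V: "c = (V, \<psi>)" by (cases c)
  have cV: "is_chart (mtop M) (mdim M) (V, \<psi>)" and VU: "V \<subseteq> U"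
    using c V is_chart_open_subtopology[OF U] by auto
  \<comment> \<open>Since \<open>V\<close> lies in \<open>U\<close>, compatibility with a chart on
    \<open>T\<close> only concerns its restriction to \<open>T \<inter> U\<close>, which is a chart
    of the submanifold.\<close>
  have "charts_compatible (mdim M) (V, \<psi>) (T, \<kappa>)" if T: "(T, \<kappa>) \<in> matlas M" for T \<kappa>
  proof -
    note cT = atlas_manifold_chart[OF M T]
    have T': "(T \<inter> U, \<kappa>) \<in> matlas M" using chart_restrict[OF M T U] .
    note i = is_chartD(2)[OF cT] is_chartD(2)[OF atlas_manifold_chart[OF M T']]
    have cp: "charts_compatible (mdim M) (V, \<psi>) (T \<inter> U, \<kappa>)" using c V T' by auto
    have e: "V \<inter> (T \<inter> U) = V \<inter> T" using VU by auto
    have o: "openin (Euclidean_space (mdim M)) (\<kappa> ` (V \<inter> T))"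
      using is_chartD(3)[OF cT is_chartD(1)[OF cV]] by (simp add: Int_commute)
    have "Ck_on k (mdim M) (\<kappa> ` (V \<inter> T)) (\<lambda>x. (\<psi> \<circ> inv_into T \<kappa>) x j)" if "j < mdim M" for j k
    proof (rule Ck_on_cong[OF o])
      show "Ck_on k (mdim M) (\<kappa> ` (V \<inter> T)) (\<lambda>x. (\<psi> \<circ> inv_into (T \<inter> U) \<kappa>) x j)"
        using cp that by (simp add: charts_compatible_def smooth_on_coords_def e)
    qed (use i VU in auto)
    then show ?thesis using cp o by (simp add: charts_compatible_def smooth_on_coords_def e)
  qed
  then have "(V, \<psi>) \<in> matlas M" using M cV unfolding atlas_manifold_def by (metis surj_pair)
  then show "c \<in> matlas (open_submanifold M U)" using V VU by simp
qed

lemma smf_open_submanifold: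
  assumes M: "atlas_manifold M" and U: "openin (mtop M) U"
  shows "smf (open_submanifold M U) W f \<longleftrightarrow> smf M W f \<and> W \<subseteq> U"
proof
  assume L: "smf (open_submanifold M U) W f"
  then have W: "openin (mtop M) W" "W \<subseteq> U" using U by (auto simp: smf_def openin_open_subtopology)
  have "smf M W f"
  proof (rule smfI_charts[OF M W(1)])
    fix p assume p: "p \<in> W"
    then obtain V \<psi> where V: "(V, \<psi>) \<in> matlas M" "p \<in> V"
      using atlas_manifold_cover[OF M] openin_subset[OF W(1)] by blast
    have V': "(V \<inter> U, \<psi>) \<in> matlas M" using chart_restrict[OF M V(1) U] .
    then have "Ck_on k (mdim M) (\<psi> ` ((V \<inter> U) \<inter> W)) (f \<circ> inv_into (V \<inter> U) \<psi>)" for k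
      using smfD[OF L, of "V \<inter> U" \<psi> k] by simp
    then show "\<exists>U' \<phi> W'. (U', \<phi>) \<in> matlas M \<and> p \<in> U' \<and> openin (mtop M) W' \<and> p \<in> W' \<and>
       (\<forall>k. Ck_on k (mdim M) (\<phi> ` (U' \<inter> W')) (f \<circ> inv_into U' \<phi>))"
      using V' V(2) p W by blast
  qed
  then show "smf M W f \<and> W \<subseteq> U" using W by simp
qed (use U in \<open>auto simp: smf_def openin_open_subtopology\<close>)

lemma smap_into_open_submanifold:
  assumes M: "atlas_manifold M" and U: "openin (mtop M) U"
  shows "smap P W (open_submanifold M U) f \<longleftrightarrow> smap P W M f \<and> f ` W \<subseteq> U"
proof
  assume L: "smap P W (open_submanifold M U) f"
  then have im: "f ` W \<subseteq> mcarrier M \<inter> U" by (auto simp: smap_def)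
  have "smf P (W \<inter> f -` V) (\<lambda>p. g (f p))" if g: "smf M V g" for V g
  proof -
    have o: "openin (mtop M) (V \<inter> U)" using smf_open[OF g] U by blast
    have "smf (open_submanifold M U) (V \<inter> U) g"
      using smf_subset[OF M g o] smf_open_submanifold[OF M U] by auto
    from smap_pull[OF L this] have "smf P (W \<inter> f -` (V \<inter> U)) (\<lambda>p. g (f p))" .
    moreover have "W \<inter> f -` (V \<inter> U) = W \<inter> f -` V" using im by auto
    ultimately show ?thesis by simp
  qed
  then show "smap P W M f \<and> f ` W \<subseteq> U" using L im by (auto simp: smap_def)
qed (auto simp: smap_def smf_open_submanifold[OF M U])

lemma smap_from_open_submanifold:
  assumes M: "atlas_manifold M" and U: "openin (mtop M) U"
  shows "smap (open_submanifold M U) W N f \<longleftrightarrow> smap M W N f \<and> W \<subseteq> U"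
  unfolding smap_def smf_open_submanifold[OF M U] open_submanifold_simps openin_open_subtopology[OF U]
  by auto

lemma generated_manifold_simps [simp]:
  "mtop (generated_manifold X n A) = X" "mdim (generated_manifold X n A) = n"
  by (auto simp: generated_manifold_def)

text \<open>Charts compatible with a generating family are compatible with each other: near each
  common point the change of coordinates factors through a generating chart.\<close>

lemma
  assumes A: "\<And>c. c \<in> A \<Longrightarrow> is_chart X n c" and cov: "topspace X \<subseteq> \<Union> (fst ` A)"
    and comp: "\<And>c c'. c \<in> A \<Longrightarrow> c' \<in> A \<Longrightarrow> charts_compatible n c c'"
  shows atlas_generated_manifold: "atlas_manifold (generated_manifold X n A)"
    and generated_manifold_charts: "A \<subseteq> matlas (generated_manifold X n A)"
proof -
  let ?M = "generated_manifold X n A"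
  have mem: "c \<in> matlas ?M \<longleftrightarrow> is_chart X n c \<and> (\<forall>c'\<in>A. charts_compatible n c c')" for c
    by (simp add: generated_manifold_def)
  show sub: "A \<subseteq> matlas ?M" using A comp mem by auto
  have half: "Ck_on k n (\<phi> ` (U \<inter> V)) (\<lambda>x. \<psi> (inv_into U \<phi> x) j)"
    if c: "(U, \<phi>) \<in> matlas ?M" "(V, \<psi>) \<in> matlas ?M" and j: "j < n" for U \<phi> V \<psi> j k
  proof -
    have cU: "is_chart X n (U, \<phi>)" and cV: "is_chart X n (V, \<psi>)" using c mem by auto
    show ?thesis
    proof (rule Ck_on_local[OF is_chartD(3)[OF cU is_chartD(1)[OF cV]]])
      fix x assume "x \<in> \<phi> ` (U \<inter> V)"
      then obtain p where p: "p \<in> U" "p \<in> V" "x = \<phi> p" by blast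
      then obtain T \<kappa> where T: "(T, \<kappa>) \<in> A" "p \<in> T"
        using cov openin_subset[OF is_chartD(1)[OF cU]] by fastforce
      note cT = A[OF T(1)]
      have "charts_compatible n (V, \<psi>) (T, \<kappa>)" using c(2) T(1) mem by auto
      then have "Ck_on k n (\<kappa> ` (T \<inter> V)) ((\<lambda>p. \<psi> p j) \<circ> inv_into T \<kappa>)"
        using j by (auto simp: charts_compatible_def smooth_on_coords_def o_def Int_commute)
      moreover have "charts_compatible n (U, \<phi>) (T, \<kappa>)" using c(1) T(1) mem by auto
      ultimately have "Ck_on k n (\<phi> ` (U \<inter> T \<inter> V)) ((\<lambda>p. \<psi> p j) \<circ> inv_into U \<phi>)"
        using Ck_on_change_chart[OF cU cT _ is_chartD(1)[OF cV]] by blast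
      moreover have "openin (Euclidean_space n) (\<phi> ` (U \<inter> T \<inter> V))"
        using is_chartD(3)[OF cU openin_Int[OF is_chartD(1)[OF cT] is_chartD(1)[OF cV]]] by (simp add: Int_assoc)
      ultimately show "\<exists>S. openin (Euclidean_space n) S \<and> x \<in> S \<and> S \<subseteq> \<phi> ` (U \<inter> V) \<and>
          Ck_on k n S (\<lambda>x. \<psi> (inv_into U \<phi> x) j)"
        using p T(2) by (intro exI[of _ "\<phi> ` (U \<inter> T \<inter> V)"]) (auto simp: o_def)
    qed
  qed
  show "atlas_manifold ?M"
    unfolding atlas_manifold_def
  proof (intro conjI ballI allI impI)
    show "is_chart (mtop ?M) (mdim ?M) c" if "c \<in> matlas ?M" for c using that mem by simp
    show "\<Union> (fst ` matlas ?M) = mcarrier ?M"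
    proof
      show "\<Union> (fst ` matlas ?M) \<subseteq> mcarrier ?M"
      proof
        fix p assume "p \<in> \<Union> (fst ` matlas ?M)"
        then obtain U \<phi> where U: "(U, \<phi>) \<in> matlas ?M" "p \<in> U" by auto
        then have "is_chart X n (U, \<phi>)" using mem by auto
        then have "openin X U" by (rule is_chartD(1))
        then show "p \<in> mcarrier ?M" using U(2) openin_subset[of X U] by auto
      qed
    qed (use cov sub in auto)
    show "charts_compatible (mdim ?M) c c'" if c: "c \<in> matlas ?M" "c' \<in> matlas ?M" for c c'
    proof -
      obtain U \<phi> V \<psi> where e: "c = (U, \<phi>)" "c' = (V, \<psi>)" by (cases c; cases c')
      have cU: "is_chart X n (U, \<phi>)" and cV: "is_chart X n (V, \<psi>)" using c mem e by auto
      show ?thesis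
        using half[OF c[unfolded e]] half[OF c(2)[unfolded e] c(1)[unfolded e]]
          is_chartD(3)[OF cU is_chartD(1)[OF cV]] is_chartD(3)[OF cV is_chartD(1)[OF cU]]
        by (auto simp: e charts_compatible_def smooth_on_coords_def o_def Int_commute)
    qed
    show "c \<in> matlas ?M" if "is_chart (mtop ?M) (mdim ?M) c \<and> (\<forall>c'\<in>matlas ?M. charts_compatible (mdim ?M) c c')" for c
      using that sub mem by auto
  qed
qed

lemma chart_coord_continuous:
  assumes c: "is_chart X n (U, \<phi>)"
  shows "continuous_map (subtopology X U) (Euclidean_space n) \<phi>"
proof -
  have t: "topspace (subtopology X U) = U" using openin_subset[OF is_chartD(1)[OF c]] by auto
  have "openin (subtopology X U) {p \<in> U. \<phi> p \<in> V}" if "openin (Euclidean_space n) V" for V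
  proof -
    have "{p \<in> U. \<phi> p \<in> V} = U \<inter> \<phi> -` V" by auto
    then show ?thesis using is_chartD(4)[OF c that] by (auto intro: subset_openin_subtopology)
  qed
  then show ?thesis
    using openin_subset[OF is_chartD(5)[OF c]] unfolding continuous_map_def t by auto
qed

lemma chart_inverse_continuous:
  assumes c: "is_chart X n (U, \<phi>)"
  shows "continuous_map (subtopology (Euclidean_space n) (\<phi> ` U)) X (inv_into U \<phi>)"
proof -
  note o = is_chartD(5)[OF c]
  have t: "topspace (subtopology (Euclidean_space n) (\<phi> ` U)) = \<phi> ` U" using openin_subset[OF o] by auto
  have "openin (subtopology (Euclidean_space n) (\<phi> ` U)) {x \<in> \<phi> ` U. inv_into U \<phi> x \<in> W}" if "openin X W" for W
  proof -
    have "{x \<in> \<phi> ` U. inv_into U \<phi> x \<in> W} = \<phi> ` (U \<inter> W)" using is_chartD(2)[OF c] by auto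
    then show ?thesis using is_chartD(3)[OF c that] by (auto intro: subset_openin_subtopology)
  qed
  then show ?thesis
    using openin_subset[OF is_chartD(1)[OF c]] is_chartD(2)[OF c] unfolding continuous_map_def t by auto
qed

lemma continuous_map_into_Euclidean_space:
  assumes "\<And>j. j < n \<Longrightarrow> continuous_map X euclideanreal (\<lambda>p. \<phi> p j)"
    "\<And>p j. p \<in> topspace X \<Longrightarrow> j \<ge> n \<Longrightarrow> \<phi> p j = 0"
  shows "continuous_map X (Euclidean_space n) \<phi>"
proof -
  have "continuous_map X (Euclidean_space n) (\<lambda>p j. if j < n then \<phi> p j else 0)"
    using assms(1) by (simp add: continuous_map_componentwise_Euclidean_space)
  then show ?thesis by (rule continuous_map_eq) (use assms(2) in \<open>auto simp: fun_eq_iff\<close>)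
qed

lemma is_chartI:
  assumes U: "openin X U" and im: "openin (Euclidean_space n) (\<phi> ` U)"
    and \<phi>: "continuous_map (subtopology X U) (Euclidean_space n) \<phi>"
    and g: "continuous_map (subtopology (Euclidean_space n) (\<phi> ` U)) X g" "\<And>p. p \<in> U \<Longrightarrow> g (\<phi> p) = p"
  shows "is_chart X n (U, \<phi>)"
  unfolding is_chart_iff
proof (intro conjI allI impI U)
  show "inj_on \<phi> U" using g(2) by (metis inj_onI)
  have t: "topspace (subtopology X U) = U" using openin_subset[OF U] by auto
  have t2: "topspace (subtopology (Euclidean_space n) (\<phi> ` U)) = \<phi> ` U" using openin_subset[OF im] by auto
  fix W assume W: "openin X W \<and> W \<subseteq> U"
  have "openin (subtopology (Euclidean_space n) (\<phi> ` U)) {x \<in> \<phi> ` U. g x \<in> W}"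
    using openin_continuous_map_preimage[OF g(1)] W unfolding t2 by blast
  moreover have "{x \<in> \<phi> ` U. g x \<in> W} = \<phi> ` W" using W g(2) by auto
  ultimately show "openin (Euclidean_space n) (\<phi> ` W)" using im by (metis openin_trans_full)
next
  have t: "topspace (subtopology X U) = U" using openin_subset[OF U] by auto
  fix V assume V: "openin (Euclidean_space n) V"
  have "openin (subtopology X U) {x \<in> U. \<phi> x \<in> V}"
    using openin_continuous_map_preimage[OF \<phi> V] unfolding t .
  moreover have "{x \<in> U. \<phi> x \<in> V} = U \<inter> \<phi> -` V" by auto
  ultimately show "openin X (U \<inter> \<phi> -` V)" using U by (metis openin_trans_full)
qed

section \<open>Products of manifolds\<close>

definition prod_coords :: "nat \<Rightarrow> ('a \<Rightarrow> nat \<Rightarrow> real) \<Rightarrow> ('b \<Rightarrow> nat \<Rightarrow> real) \<Rightarrow> 'a \<times> 'b \<Rightarrow> nat \<Rightarrow> real" where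
  "prod_coords m \<phi> \<psi> = (\<lambda>(p, q). append_coords m (\<phi> p) (\<psi> q))"

definition head_coords :: "nat \<Rightarrow> (nat \<Rightarrow> real) \<Rightarrow> nat \<Rightarrow> real" where
  "head_coords m x = (\<lambda>i. if i < m then x i else 0)"

definition tail_coords :: "nat \<Rightarrow> nat \<Rightarrow> (nat \<Rightarrow> real) \<Rightarrow> nat \<Rightarrow> real" where
  "tail_coords m n x = (\<lambda>i. if i < n then x (m + i) else 0)"

lemma head_coords_prod:
  assumes "is_chart X m (U, \<phi>)" "p \<in> U"
  shows "head_coords m (prod_coords m \<phi> \<psi> (p, q)) = \<phi> p"
  using is_chartD(6)[OF assms] by (auto simp: head_coords_def prod_coords_def append_coords_def)

lemma tail_coords_prod:
  assumes "is_chart Y n (V, \<psi>)" "q \<in> V"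
  shows "tail_coords m n (prod_coords m \<phi> \<psi> (p, q)) = \<psi> q"
  using is_chartD(6)[OF assms] by (auto simp: tail_coords_def prod_coords_def append_coords_def)

lemma continuous_map_head_coords: "continuous_map (Euclidean_space (m + n)) (Euclidean_space m) (head_coords m)"
  by (rule continuous_map_into_Euclidean_space)
    (use continuous_map_Eu_coord[of "m + n" UNIV] in \<open>auto simp: head_coords_def\<close>)

lemma continuous_map_tail_coords: "continuous_map (Euclidean_space (m + n)) (Euclidean_space n) (tail_coords m n)"
  by (rule continuous_map_into_Euclidean_space)
    (use continuous_map_Eu_coord[of "m + n" UNIV] in \<open>auto simp: tail_coords_def\<close>)

text \<open>The image of a box is cut out by conditions on \<open>head_coords\<close> and
  \<open>tail_coords\<close>, which are continuous.\<close>

lemma prod_chart_image: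
  assumes c1: "is_chart X m (U, \<phi>)" and c2: "is_chart Y n (V, \<psi>)" and W: "openin X W1" "openin Y W2"
  shows "openin (Euclidean_space (m + n)) (prod_coords m \<phi> \<psi> ` ((U \<times> V) \<inter> (W1 \<times> W2)))"
proof -
  let ?E = "Euclidean_space (m + n)"
  have "openin ?E ({x \<in> topspace ?E. head_coords m x \<in> \<phi> ` (U \<inter> W1)} \<inter>
      {x \<in> topspace ?E. tail_coords m n x \<in> \<psi> ` (V \<inter> W2)})"
    by (intro openin_Int openin_continuous_map_preimage[OF continuous_map_head_coords]
        openin_continuous_map_preimage[OF continuous_map_tail_coords] is_chartD(3)[OF c1 W(1)] is_chartD(3)[OF c2 W(2)])
  also have "{x \<in> topspace ?E. head_coords m x \<in> \<phi> ` (U \<inter> W1)} \<inter>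
      {x \<in> topspace ?E. tail_coords m n x \<in> \<psi> ` (V \<inter> W2)} = prod_coords m \<phi> \<psi> ` ((U \<times> V) \<inter> (W1 \<times> W2))"
    (is "?A = ?B")
  proof
    show "?B \<subseteq> ?A"
    proof clarify
      fix p q assume "p \<in> U" "q \<in> V" "p \<in> W1" "q \<in> W2"
      then show "prod_coords m \<phi> \<psi> (p, q) \<in> ?A"
        using head_coords_prod[OF c1, of _ \<psi>] tail_coords_prod[OF c2, of _ m \<phi>] is_chartD(6)[OF c2]
        by (auto simp: topspace_Euclidean_space) (auto simp: prod_coords_def append_coords_def)
    qed
    show "?A \<subseteq> ?B"
    proof clarify
      fix x p q assume x: "x \<in> topspace ?E" "head_coords m x = \<phi> p" "tail_coords m n x = \<psi> q"
        and p: "p \<in> U" "p \<in> W1" "q \<in> V" "q \<in> W2"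
      have "x i = prod_coords m \<phi> \<psi> (p, q) i" for i
      proof (cases "i < m")
        case True
        then show ?thesis using fun_cong[OF x(2), of i] by (simp add: head_coords_def prod_coords_def append_coords_def)
      next
        case False
        then have "\<psi> q (i - m) = (if i < m + n then x i else 0)"
          using fun_cong[OF x(3), of "i - m"] by (auto simp: tail_coords_def split: if_splits)
        then show ?thesis using False x(1) by (auto simp: prod_coords_def append_coords_def topspace_Euclidean_space)
      qed
      then have "x = prod_coords m \<phi> \<psi> (p, q)" by (rule ext)
      then show "x \<in> ?B" using p by blast
    qed
  qed
  finally show ?thesis .
qed

lemma is_chart_prod:
  assumes c1: "is_chart X m (U, \<phi>)" and c2: "is_chart Y n (V, \<psi>)"
  shows "is_chart (prod_topology X Y) (m + n) (U \<times> V, prod_coords m \<phi> \<psi>)"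
proof (rule is_chartI)
  note U = is_chartD[OF c1] and V = is_chartD[OF c2]
  show "openin (prod_topology X Y) (U \<times> V)" using U(1) V(1) by (simp add: openin_prod_Times_iff)
  show im: "openin (Euclidean_space (m + n)) (prod_coords m \<phi> \<psi> ` (U \<times> V))"
    using prod_chart_image[OF c1 c2 U(1) V(1)] by simp
  have f: "continuous_map (subtopology (prod_topology X Y) (U \<times> V)) (subtopology X U) fst"
    by (rule continuous_map_into_subtopology, rule continuous_map_from_subtopology, rule continuous_map_fst) auto
  have s: "continuous_map (subtopology (prod_topology X Y) (U \<times> V)) (subtopology Y V) snd"
    by (rule continuous_map_into_subtopology, rule continuous_map_from_subtopology, rule continuous_map_snd) auto
  show "continuous_map (subtopology (prod_topology X Y) (U \<times> V)) (Euclidean_space (m + n)) (prod_coords m \<phi> \<psi>)"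
  proof (rule continuous_map_into_Euclidean_space)
    have 1: "continuous_map (subtopology (prod_topology X Y) (U \<times> V)) euclideanreal (\<lambda>x. \<phi> (fst x) j)" for j
      using continuous_map_compose[OF continuous_map_compose[OF f chart_coord_continuous[OF c1]]
        continuous_map_Eu_coord[of m UNIV j, simplified]] by (simp add: o_def)
    have 2: "continuous_map (subtopology (prod_topology X Y) (U \<times> V)) euclideanreal (\<lambda>x. \<psi> (snd x) j)" for j
      using continuous_map_compose[OF continuous_map_compose[OF s chart_coord_continuous[OF c2]]
        continuous_map_Eu_coord[of n UNIV j, simplified]] by (simp add: o_def)
    show "continuous_map (subtopology (prod_topology X Y) (U \<times> V)) euclideanreal (\<lambda>p. prod_coords m \<phi> \<psi> p j)" for j
      using 1[of j] 2[of "j - m"] by (cases "j < m") (simp_all add: prod_coords_def append_coords_def case_prod_beta)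
    show "prod_coords m \<phi> \<psi> p j = 0"
      if "p \<in> topspace (subtopology (prod_topology X Y) (U \<times> V))" "m + n \<le> j" for p j
      using that V(6)[of "snd p" "j - m"] by (auto simp: prod_coords_def append_coords_def)
  qed
  let ?S = "subtopology (Euclidean_space (m + n)) (prod_coords m \<phi> \<psi> ` (U \<times> V))"
  have h: "continuous_map ?S (subtopology (Euclidean_space m) (\<phi> ` U)) (head_coords m)"
    by (intro continuous_map_into_subtopology continuous_map_from_subtopology continuous_map_head_coords)
      (use head_coords_prod[OF c1, of _ \<psi>] in auto)
  have t: "continuous_map ?S (subtopology (Euclidean_space n) (\<psi> ` V)) (tail_coords m n)"
    by (intro continuous_map_into_subtopology continuous_map_from_subtopology continuous_map_tail_coords)
      (use tail_coords_prod[OF c2, of _ m \<phi>] in auto)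
  show "continuous_map ?S (prod_topology X Y)
      (\<lambda>x. (inv_into U \<phi> (head_coords m x), inv_into V \<psi> (tail_coords m n x)))"
    using continuous_map_compose[OF h chart_inverse_continuous[OF c1]]
      continuous_map_compose[OF t chart_inverse_continuous[OF c2]]
    by (intro continuous_map_pairedI) (simp_all add: o_def)
  show "(inv_into U \<phi> (head_coords m (prod_coords m \<phi> \<psi> p)), inv_into V \<psi> (tail_coords m n (prod_coords m \<phi> \<psi> p))) = p"
    if "p \<in> U \<times> V" for p
    using that head_coords_prod[OF c1, of _ \<psi>] tail_coords_prod[OF c2, of _ m \<phi>] U(2) V(2) by (cases p) auto
qed

lemma Ck_on_head_coords:
  "openin (Euclidean_space n) S \<Longrightarrow> Ck_on k n S (\<lambda>x. head_coords m x j)"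
  using Ck_on_coord[of n S k j] Ck_on_const[of n S k 0] by (cases "j < m") (simp_all add: head_coords_def)

lemma Ck_on_tail_coords:
  "openin (Euclidean_space n) S \<Longrightarrow> Ck_on k n S (\<lambda>x. tail_coords m l x j)"
  using Ck_on_coord[of n S k "m + j"] Ck_on_const[of n S k 0] by (cases "j < l") (simp_all add: tail_coords_def)

text \<open>In a product chart, a function of the first factor is its own coordinate expression
  after \<open>head_coords\<close>.\<close>

lemma Ck_on_prod_fst:
  assumes c1: "is_chart X m (U, \<phi>)" and c2: "is_chart Y n (V, \<psi>)" and W: "openin X W1" "openin Y W2"
    and f: "Ck_on k m (\<phi> ` (U \<inter> W1)) (f \<circ> inv_into U \<phi>)"
  shows "Ck_on k (m + n) (prod_coords m \<phi> \<psi> ` ((U \<times> V) \<inter> (W1 \<times> W2)))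
     (\<lambda>x. f (fst (inv_into (U \<times> V) (prod_coords m \<phi> \<psi>) x)))"
proof -
  note o = prod_chart_image[OF c1 c2 W] and i = is_chartD(2)[OF is_chart_prod[OF c1 c2]]
  have "Ck_on k (m + n) (prod_coords m \<phi> \<psi> ` ((U \<times> V) \<inter> (W1 \<times> W2))) (\<lambda>x. (f \<circ> inv_into U \<phi>) (head_coords m x))"
    by (rule Ck_on_compose[OF o is_chartD(3)[OF c1 W(1)] f Ck_on_head_coords[OF o]])
      (use head_coords_prod[OF c1, of _ \<psi>] in auto)
  then show ?thesis
    by (rule Ck_on_cong[OF o, rotated]) (use head_coords_prod[OF c1, of _ \<psi>] i is_chartD(2)[OF c1] in \<open>auto simp: inv_into_f_f\<close>)
qed

lemma Ck_on_prod_snd: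
  assumes c1: "is_chart X m (U, \<phi>)" and c2: "is_chart Y n (V, \<psi>)" and W: "openin X W1" "openin Y W2"
    and f: "Ck_on k n (\<psi> ` (V \<inter> W2)) (f \<circ> inv_into V \<psi>)"
  shows "Ck_on k (m + n) (prod_coords m \<phi> \<psi> ` ((U \<times> V) \<inter> (W1 \<times> W2)))
     (\<lambda>x. f (snd (inv_into (U \<times> V) (prod_coords m \<phi> \<psi>) x)))"
proof -
  note o = prod_chart_image[OF c1 c2 W] and i = is_chartD(2)[OF is_chart_prod[OF c1 c2]]
  have "Ck_on k (m + n) (prod_coords m \<phi> \<psi> ` ((U \<times> V) \<inter> (W1 \<times> W2))) (\<lambda>x. (f \<circ> inv_into V \<psi>) (tail_coords m n x))"
    by (rule Ck_on_compose[OF o is_chartD(3)[OF c2 W(2)] f Ck_on_tail_coords[OF o]])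
      (use tail_coords_prod[OF c2, of _ m \<phi>] in auto)
  then show ?thesis
    by (rule Ck_on_cong[OF o, rotated]) (use tail_coords_prod[OF c2, of _ m \<phi>] i is_chartD(2)[OF c2] in \<open>auto simp: inv_into_f_f\<close>)
qed

definition product_charts :: "'a manifold \<Rightarrow> 'b manifold \<Rightarrow> ('a \<times> 'b) chart set" where
  "product_charts M N = {(U \<times> V, prod_coords (mdim M) \<phi> \<psi>) | U \<phi> V \<psi>. (U, \<phi>) \<in> matlas M \<and> (V, \<psi>) \<in> matlas N}"

lemma product_manifold_eq:
  "product_manifold M N = generated_manifold (prod_topology (mtop M) (mtop N)) (mdim M + mdim N) (product_charts M N)"
  unfolding product_manifold_def product_charts_def prod_coords_def ..

lemma product_manifold_simps [simp]:
  "mtop (product_manifold M N) = prod_topology (mtop M) (mtop N)"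
  "mdim (product_manifold M N) = mdim M + mdim N"
  by (auto simp: product_manifold_eq)

lemma
  assumes M: "atlas_manifold M" and N: "atlas_manifold N"
  shows atlas_product_manifold: "atlas_manifold (product_manifold M N)"
    and product_charts_atlas: "product_charts M N \<subseteq> matlas (product_manifold M N)"
proof -
  let ?A = "product_charts M N" and ?X = "prod_topology (mtop M) (mtop N)"
  have A: "is_chart ?X (mdim M + mdim N) c" if "c \<in> ?A" for c
    using that is_chart_prod atlas_manifold_chart[OF M] atlas_manifold_chart[OF N] by (fastforce simp: product_charts_def)
  have half: "Ck_on k (mdim M + mdim N) (prod_coords (mdim M) \<phi> \<psi> ` ((U \<times> V) \<inter> (U' \<times> V')))
      (\<lambda>x. prod_coords (mdim M) \<phi>' \<psi>' (inv_into (U \<times> V) (prod_coords (mdim M) \<phi> \<psi>) x) j)"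
    if c: "(U, \<phi>) \<in> matlas M" "(V, \<psi>) \<in> matlas N" "(U', \<phi>') \<in> matlas M" "(V', \<psi>') \<in> matlas N"
    for U \<phi> V \<psi> U' \<phi>' V' \<psi>' j k
  proof -
    note c1 = atlas_manifold_chart[OF M c(1)] and c2 = atlas_manifold_chart[OF N c(2)]
    note o = is_chartD(1)[OF atlas_manifold_chart[OF M c(3)]] is_chartD(1)[OF atlas_manifold_chart[OF N c(4)]]
    show ?thesis
    proof (cases "j < mdim M")
      case True
      then show ?thesis
        using Ck_on_prod_fst[OF c1 c2 o smfD[OF smf_chart_coord[OF M c(3)] c(1)], of k j]
        by (simp add: prod_coords_def append_coords_def case_prod_beta)
    next
      case False
      then show ?thesis
        using Ck_on_prod_snd[OF c1 c2 o smfD[OF smf_chart_coord[OF N c(4)] c(2)], of k "j - mdim M"]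
        by (simp add: prod_coords_def append_coords_def case_prod_beta)
    qed
  qed
  have comp: "charts_compatible (mdim M + mdim N) c c'" if "c \<in> ?A" "c' \<in> ?A" for c c'
  proof -
    obtain U \<phi> V \<psi> U' \<phi>' V' \<psi>' where c: "(U, \<phi>) \<in> matlas M" "(V, \<psi>) \<in> matlas N" "(U', \<phi>') \<in> matlas M" "(V', \<psi>') \<in> matlas N"
      and e: "c = (U \<times> V, prod_coords (mdim M) \<phi> \<psi>)" "c' = (U' \<times> V', prod_coords (mdim M) \<phi>' \<psi>')"
      using \<open>c \<in> ?A\<close> \<open>c' \<in> ?A\<close> unfolding product_charts_def by blast
    note c1 = atlas_manifold_chart[OF M c(1)] and c2 = atlas_manifold_chart[OF N c(2)]
    note c1' = atlas_manifold_chart[OF M c(3)] and c2' = atlas_manifold_chart[OF N c(4)]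
    have e2: "(U \<times> V) \<inter> (U' \<times> V') = (U' \<times> V') \<inter> (U \<times> V)" by (rule Int_commute)
    show ?thesis
      unfolding e charts_compatible_def smooth_on_coords_def split
    proof (intro conjI allI impI)
      show "openin (Euclidean_space (mdim M + mdim N)) (prod_coords (mdim M) \<phi> \<psi> ` (U \<times> V \<inter> U' \<times> V'))"
        by (rule prod_chart_image[OF c1 c2 is_chartD(1)[OF c1'] is_chartD(1)[OF c2']])
      show "openin (Euclidean_space (mdim M + mdim N)) (prod_coords (mdim M) \<phi>' \<psi>' ` (U \<times> V \<inter> U' \<times> V'))"
        unfolding e2 by (rule prod_chart_image[OF c1' c2' is_chartD(1)[OF c1] is_chartD(1)[OF c2]])
    qed (use half[OF c] half[OF c(3,4,1,2)] in \<open>simp_all add: o_def Int_commute e2\<close>)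
  qed
  have cov: "topspace ?X \<subseteq> \<Union> (fst ` ?A)"
  proof
    fix x assume "x \<in> topspace ?X"
    then obtain p q where x: "x = (p, q)" "p \<in> mcarrier M" "q \<in> mcarrier N" by auto
    obtain U \<phi> where "(U, \<phi>) \<in> matlas M" "p \<in> U" using atlas_manifold_cover[OF M x(2)] .
    moreover obtain V \<psi> where "(V, \<psi>) \<in> matlas N" "q \<in> V" using atlas_manifold_cover[OF N x(3)] .
    ultimately have "(U \<times> V, prod_coords (mdim M) \<phi> \<psi>) \<in> ?A" "x \<in> fst (U \<times> V, prod_coords (mdim M) \<phi> \<psi>)"
      using x(1) by (auto simp: product_charts_def)
    then show "x \<in> \<Union> (fst ` ?A)" by blast
  qed
  show "atlas_manifold (product_manifold M N)" "?A \<subseteq> matlas (product_manifold M N)"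
    unfolding product_manifold_eq
    by (rule atlas_generated_manifold[OF A cov comp], assumption+) (rule generated_manifold_charts[OF A cov comp], assumption+)
qed

lemma product_chart_in_atlas:
  assumes "atlas_manifold M" "atlas_manifold N" "(U, \<phi>) \<in> matlas M" "(V, \<psi>) \<in> matlas N"
  shows "(U \<times> V, prod_coords (mdim M) \<phi> \<psi>) \<in> matlas (product_manifold M N)"
  using product_charts_atlas[OF assms(1,2)] assms(3,4) unfolding product_charts_def by blast

lemma smap_fst:
  assumes M: "atlas_manifold M" and N: "atlas_manifold N" and W: "openin (mtop (product_manifold M N)) W"
  shows "smap (product_manifold M N) W M fst"
proof -
  note P = atlas_product_manifold[OF M N]
  have "smf (product_manifold M N) (fst -` V \<inter> mcarrier (product_manifold M N)) (\<lambda>x. g (fst x))" if g: "smf M V g" for V g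
  proof -
    have V: "V \<subseteq> mcarrier M" using smf_subset_carrier[OF g] .
    have eq: "fst -` V \<inter> mcarrier (product_manifold M N) = V \<times> mcarrier N" using V by auto
    show ?thesis unfolding eq
    proof (rule smfI_charts[OF P])
      show o: "openin (mtop (product_manifold M N)) (V \<times> mcarrier N)"
        using smf_open[OF g] by (simp add: openin_prod_Times_iff)
      fix x assume x: "x \<in> V \<times> mcarrier N"
      have "fst x \<in> mcarrier M" using x V by auto
      then obtain U \<phi> where U: "(U, \<phi>) \<in> matlas M" "fst x \<in> U" using atlas_manifold_cover[OF M] by metis
      have "snd x \<in> mcarrier N" using x by auto
      then obtain T \<psi> where T: "(T, \<psi>) \<in> matlas N" "snd x \<in> T" using atlas_manifold_cover[OF N] by metis
      have "(U \<times> T, prod_coords (mdim M) \<phi> \<psi>) \<in> matlas (product_manifold M N)"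
        using product_chart_in_atlas[OF M N U(1) T(1)] .
      moreover have "Ck_on k (mdim M + mdim N) (prod_coords (mdim M) \<phi> \<psi> ` ((U \<times> T) \<inter> (V \<times> mcarrier N)))
         (\<lambda>y. g (fst (inv_into (U \<times> T) (prod_coords (mdim M) \<phi> \<psi>) y)))" for k
        by (rule Ck_on_prod_fst[OF atlas_manifold_chart[OF M U(1)] atlas_manifold_chart[OF N T(1)] smf_open[OF g] openin_topspace
              smfD[OF g U(1)]])
      moreover have "x \<in> U \<times> T" using U T by (cases x) auto
      ultimately show "\<exists>U' \<phi>' W'. (U', \<phi>') \<in> matlas (product_manifold M N) \<and> x \<in> U' \<and> openin (mtop (product_manifold M N)) W' \<and>
          x \<in> W' \<and> (\<forall>k. Ck_on k (mdim (product_manifold M N)) (\<phi>' ` (U' \<inter> W')) ((\<lambda>x. g (fst x)) \<circ> inv_into U' \<phi>'))"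
        using x o by (intro exI[of _ "U \<times> T"] exI[of _ "prod_coords (mdim M) \<phi> \<psi>"] exI[of _ "V \<times> mcarrier N"]) (simp add: o_def)
    qed
  qed
  note pull = this
  have "smap (product_manifold M N) (mcarrier (product_manifold M N)) M fst"
    unfolding smap_def
  proof (intro conjI allI impI openin_topspace)
    show "fst ` mcarrier (product_manifold M N) \<subseteq> mcarrier M" by auto
  qed (use pull in \<open>simp add: Int_commute\<close>)
  then show ?thesis using openin_subset[OF W] by (rule smap_subset[OF P _ W])
qed

lemma smap_snd:
  assumes M: "atlas_manifold M" and N: "atlas_manifold N" and W: "openin (mtop (product_manifold M N)) W"
  shows "smap (product_manifold M N) W N snd"
proof -
  note P = atlas_product_manifold[OF M N]
  have "smf (product_manifold M N) (snd -` V \<inter> mcarrier (product_manifold M N)) (\<lambda>x. g (snd x))" if g: "smf N V g" for V g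
  proof -
    have V: "V \<subseteq> mcarrier N" using smf_subset_carrier[OF g] .
    have eq: "snd -` V \<inter> mcarrier (product_manifold M N) = mcarrier M \<times> V" using V by auto
    show ?thesis unfolding eq
    proof (rule smfI_charts[OF P])
      show o: "openin (mtop (product_manifold M N)) (mcarrier M \<times> V)"
        using smf_open[OF g] by (simp add: openin_prod_Times_iff)
      fix x assume x: "x \<in> mcarrier M \<times> V"
      have "fst x \<in> mcarrier M" using x by auto
      then obtain U \<phi> where U: "(U, \<phi>) \<in> matlas M" "fst x \<in> U" using atlas_manifold_cover[OF M] by metis
      have "snd x \<in> mcarrier N" using x V by auto
      then obtain T \<psi> where T: "(T, \<psi>) \<in> matlas N" "snd x \<in> T" using atlas_manifold_cover[OF N] by metis
      have "(U \<times> T, prod_coords (mdim M) \<phi> \<psi>) \<in> matlas (product_manifold M N)"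
        using product_chart_in_atlas[OF M N U(1) T(1)] .
      moreover have "Ck_on k (mdim M + mdim N) (prod_coords (mdim M) \<phi> \<psi> ` ((U \<times> T) \<inter> (mcarrier M \<times> V)))
         (\<lambda>y. g (snd (inv_into (U \<times> T) (prod_coords (mdim M) \<phi> \<psi>) y)))" for k
        by (rule Ck_on_prod_snd[OF atlas_manifold_chart[OF M U(1)] atlas_manifold_chart[OF N T(1)] openin_topspace smf_open[OF g]
              smfD[OF g T(1)]])
      moreover have "x \<in> U \<times> T" using U T by (cases x) auto
      ultimately show "\<exists>U' \<phi>' W'. (U', \<phi>') \<in> matlas (product_manifold M N) \<and> x \<in> U' \<and> openin (mtop (product_manifold M N)) W' \<and>
          x \<in> W' \<and> (\<forall>k. Ck_on k (mdim (product_manifold M N)) (\<phi>' ` (U' \<inter> W')) ((\<lambda>x. g (snd x)) \<circ> inv_into U' \<phi>'))"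
        using x o by (intro exI[of _ "U \<times> T"] exI[of _ "prod_coords (mdim M) \<phi> \<psi>"] exI[of _ "mcarrier M \<times> V"]) (simp add: o_def)
    qed
  qed
  note pull = this
  have "smap (product_manifold M N) (mcarrier (product_manifold M N)) N snd"
    unfolding smap_def
  proof (intro conjI allI impI openin_topspace)
    show "snd ` mcarrier (product_manifold M N) \<subseteq> mcarrier N" by auto
  qed (use pull in \<open>simp add: Int_commute\<close>)
  then show ?thesis using openin_subset[OF W] by (rule smap_subset[OF P _ W])
qed

lemma smap_pair:
  assumes M: "atlas_manifold M" and N: "atlas_manifold N" and P: "atlas_manifold P"
    and f: "smap P W M f" and g: "smap P W N g"
  shows "smap P W (product_manifold M N) (\<lambda>p. (f p, g p))"
proof (rule smapI_charts[OF P atlas_product_manifold[OF M N]])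
  fix p assume p: "p \<in> W"
  obtain U \<phi> where U: "(U, \<phi>) \<in> matlas M" "f p \<in> U" using atlas_manifold_cover[OF M smap_image[OF f p]] .
  obtain T \<psi> where T: "(T, \<psi>) \<in> matlas N" "g p \<in> T" using atlas_manifold_cover[OF N smap_image[OF g p]] .
  note c1 = atlas_manifold_chart[OF M U(1)] and c2 = atlas_manifold_chart[OF N T(1)]
  define W' where "W' = (W \<inter> f -` U) \<inter> (W \<inter> g -` T)"
  have o: "openin (mtop P) W'" unfolding W'_def
    by (intro openin_Int smap_open_preimage[OF f M is_chartD(1)[OF c1]] smap_open_preimage[OF g N is_chartD(1)[OF c2]])
  have c: "(U \<times> T, prod_coords (mdim M) \<phi> \<psi>) \<in> matlas (product_manifold M N)"
    using product_chart_in_atlas[OF M N U(1) T(1)] .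
  have "smf P W' (\<lambda>p. \<phi> (f p) j)" for j
    by (rule smf_subset[OF P smap_pull[OF f smf_chart_coord[OF M U(1)]] o]) (auto simp: W'_def)
  moreover have "smf P W' (\<lambda>p. \<psi> (g p) j)" for j
    by (rule smf_subset[OF P smap_pull[OF g smf_chart_coord[OF N T(1)]] o]) (auto simp: W'_def)
  ultimately have "smf P W' (\<lambda>p. prod_coords (mdim M) \<phi> \<psi> (f p, g p) j)" for j
    by (cases "j < mdim M") (simp_all add: prod_coords_def append_coords_def)
  then show "\<exists>W' V \<psi>. p \<in> W' \<and> W' \<subseteq> W \<and> openin (mtop P) W' \<and> (V, \<psi>) \<in> matlas (product_manifold M N) \<and>
      (\<lambda>p. (f p, g p)) ` W' \<subseteq> V \<and> (\<forall>j<mdim (product_manifold M N). smf P W' (\<lambda>p. \<psi> (f p, g p) j))"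
    using o c p U(2) T(2)
    by (intro exI[of _ W'] exI[of _ "U \<times> T"] exI[of _ "prod_coords (mdim M) \<phi> \<psi>"]) (auto simp: W'_def)
qed

lemma smap_const:
  assumes "atlas_manifold M" "atlas_manifold N" "openin (mtop M) W" "c \<in> mcarrier N"
  shows "smap M W N (\<lambda>_. c)"
  unfolding smap_def
proof (intro conjI allI impI)
  fix V g assume "smf N V g"
  show "smf M (W \<inter> (\<lambda>_. c) -` V) (\<lambda>p. g c)"
    by (rule smf_const[OF assms(1)]) (use assms(3) in \<open>cases "c \<in> V"; simp\<close>)
qed (use assms in auto)

section \<open>Coordinate spaces and dimension\<close>

lemma basis_enum_bij: "bij_betw (basis_enum :: nat \<Rightarrow> 'k::euclidean_space) {..<DIM('k)} Basis"
proof -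
  have "\<exists>b. bij_betw b {..<DIM('k)} (Basis :: 'k set)"
    using ex_bij_betw_nat_finite[OF finite_Basis] by (simp add: lessThan_atLeast0)
  then show ?thesis unfolding basis_enum_def by (rule someI_ex)
qed

lemma basis_enum_Basis: "e < DIM('k) \<Longrightarrow> (basis_enum e :: 'k::euclidean_space) \<in> Basis"
  using bij_betwE[OF basis_enum_bij] by auto

lemma basis_enum_sum: "(\<Sum>e<DIM('k). (z \<bullet> basis_enum e) *\<^sub>R basis_enum e) = (z :: 'k::euclidean_space)"
proof -
  have "(\<Sum>e<DIM('k). (z \<bullet> basis_enum e) *\<^sub>R basis_enum e) = (\<Sum>b\<in>Basis. (z \<bullet> b) *\<^sub>R b)"
    by (rule sum.reindex_bij_betw[OF basis_enum_bij])
  then show ?thesis by (simp add: euclidean_representation)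
qed

lemma basis_enum_inner:
  assumes "e < DIM('k)" "e' < DIM('k)"
  shows "(basis_enum e :: 'k::euclidean_space) \<bullet> basis_enum e' = (if e = e' then 1 else 0)"
  using inner_Basis[OF basis_enum_Basis[OF assms(1)] basis_enum_Basis[OF assms(2)]]
    bij_betw_imp_inj_on[OF basis_enum_bij] assms by (auto simp: inj_on_def)

lemma Basis_enum_cases:
  assumes "(b :: 'k::euclidean_space) \<in> Basis"
  obtains e where "e < DIM('k)" "b = basis_enum e"
  proof -
  have "b \<in> basis_enum ` {..<DIM('k)}" using assms bij_betw_imp_surj_on[OF basis_enum_bij] by blast
  then show ?thesis using that by auto
qed

lemma Euclidean_space_top_of_set: "Euclidean_space n = top_of_set {x. \<forall>i\<ge>n. x i = 0}"
  unfolding Euclidean_space_def euclidean_product_topology ..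

lemma single_chart_manifold:
  assumes c: "is_chart X n (topspace X, \<phi>)"
  shows "atlas_manifold (generated_manifold X n {(topspace X, \<phi>)})"
    "(topspace X, \<phi>) \<in> matlas (generated_manifold X n {(topspace X, \<phi>)})"
proof -
  have "Ck_on k n (\<phi> ` topspace X) (\<lambda>x. \<phi> (inv_into (topspace X) \<phi> x) j)" for k j
    by (rule Ck_on_cong[OF is_chartD(5)[OF c] _ Ck_on_coord[OF is_chartD(5)[OF c], of k j]])
      (auto simp: f_inv_into_f)
  then have "charts_compatible n (topspace X, \<phi>) (topspace X, \<phi>)"
    using is_chartD(5)[OF c] by (auto simp: charts_compatible_def smooth_on_coords_def)
  then show "atlas_manifold (generated_manifold X n {(topspace X, \<phi>)})"
    "(topspace X, \<phi>) \<in> matlas (generated_manifold X n {(topspace X, \<phi>)})"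
    using c atlas_generated_manifold[of "{(topspace X, \<phi>)}" X n]
      generated_manifold_charts[of "{(topspace X, \<phi>)}" X n] by auto
qed

lemma smap_single_chart:
  assumes c: "is_chart X n (topspace X, \<phi>)" and P: "atlas_manifold P" and W: "openin (mtop P) W"
  shows "smap P W (generated_manifold X n {(topspace X, \<phi>)}) f \<longleftrightarrow>
    f ` W \<subseteq> topspace X \<and> (\<forall>j<n. smf P W (\<lambda>p. \<phi> (f p) j))"
proof (intro iffI conjI allI impI)
  note M = single_chart_manifold[OF c]
  show "smf P W (\<lambda>p. \<phi> (f p) j)"
    if L: "smap P W (generated_manifold X n {(topspace X, \<phi>)}) f" for j
    by (rule smap_pull_subset[OF L smf_chart_coord[OF M]]) (use smap_image[OF L] in auto)
  show "f ` W \<subseteq> topspace X" if L: "smap P W (generated_manifold X n {(topspace X, \<phi>)}) f"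
    using smap_image[OF L] by auto
  show "smap P W (generated_manifold X n {(topspace X, \<phi>)}) f"
    if "f ` W \<subseteq> topspace X \<and> (\<forall>j<n. smf P W (\<lambda>p. \<phi> (f p) j))"
  proof (rule smapI_charts[OF P M(1)])
    fix p assume "p \<in> W"
    then show "\<exists>W' V \<psi>. p \<in> W' \<and> W' \<subseteq> W \<and> openin (mtop P) W' \<and>
        (V, \<psi>) \<in> matlas (generated_manifold X n {(topspace X, \<phi>)}) \<and> f ` W' \<subseteq> V \<and>
        (\<forall>j<mdim (generated_manifold X n {(topspace X, \<phi>)}). smf P W' (\<lambda>p. \<psi> (f p) j))"
      using that M(2) W by (intro exI[of _ W] exI[of _ "topspace X"] exI[of _ \<phi>]) simp
  qed
qed

section \<open>The manifolds \<open>Kspace_manifold N\<close> and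
  \<open>field_manifold\<close>\<close>

definition Kcoords :: "nat \<Rightarrow> (nat \<Rightarrow> 'k::euclidean_space) \<Rightarrow> nat \<Rightarrow> real" where
  "Kcoords N z i = (if i < N * DIM('k) then z (i div DIM('k)) \<bullet> basis_enum (i mod DIM('k)) else 0)"

text \<open>Inverse of \<open>Kcoords\<close>: the real index \<open>a * DIM('k) + e\<close> stands
  for the component of coordinate \<open>a\<close> along basis vector \<open>e\<close>, so division
  with remainder by \<open>DIM('k)\<close> recovers both.\<close>

definition Kpoint :: "nat \<Rightarrow> (nat \<Rightarrow> real) \<Rightarrow> nat \<Rightarrow> 'k::euclidean_space" where
  "Kpoint N x a = (if a < N then \<Sum>e<DIM('k). x (a * DIM('k) + e) *\<^sub>R basis_enum e else 0)"

lemma div_mod_DIM: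
  assumes "i < N * DIM('k::euclidean_space)"
  shows "i div DIM('k) < N" "i mod DIM('k) < DIM('k)"
  using assms by (auto simp: less_mult_imp_div_less)

lemma mult_add_DIM:
  assumes "a < N" "e < DIM('k::euclidean_space)"
  shows "a * DIM('k) + e < N * DIM('k)"
proof -
  have "a * DIM('k) + e < (a + 1) * DIM('k)" using assms(2) by simp
  also have "\<dots> \<le> N * DIM('k)" using assms(1) by (intro mult_le_mono1) simp
  finally show ?thesis .
qed

lemma Kcoords_mult_add:
  fixes z :: "nat \<Rightarrow> 'k::euclidean_space"
  assumes "a < N" "e < DIM('k)"
  shows "Kcoords N z (a * DIM('k) + e) = z a \<bullet> basis_enum e"
  using mult_add_DIM[OF assms] assms by (simp add: Kcoords_def)

lemma Kpoint_Kspace: "Kpoint N x \<in> Kspace N"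
  by (simp add: Kspace_def Kpoint_def)

lemma Kpoint_Kcoords: "z \<in> Kspace N \<Longrightarrow> Kpoint N (Kcoords N z) = z"
  by (rule ext) (auto simp: Kpoint_def Kcoords_mult_add basis_enum_sum Kspace_def)

lemma Kcoords_Kpoint:
  assumes "x \<in> topspace (Euclidean_space (N * DIM('k::euclidean_space)))"
  shows "Kcoords N (Kpoint N x :: nat \<Rightarrow> 'k) = x"
proof
  fix i
  show "Kcoords N (Kpoint N x :: nat \<Rightarrow> 'k) i = x i"
  proof (cases "i < N * DIM('k)")
    case True
    have "Kpoint N x (i div DIM('k)) \<bullet> (basis_enum (i mod DIM('k)) :: 'k)
        = (\<Sum>e<DIM('k). x (i div DIM('k) * DIM('k) + e) * (if e = i mod DIM('k) then 1 else 0))"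
      using div_mod_DIM[OF True] by (auto simp: Kpoint_def inner_sum_left basis_enum_inner intro!: sum.cong)
    also have "\<dots> = x i"
      using div_mod_DIM[OF True] by (subst sum.mono_neutral_right[of _ "{i mod DIM('k)}"]) auto
    finally show ?thesis using True by (simp add: Kcoords_def)
  next
    case False
    then show ?thesis using assms by (auto simp: Kcoords_def topspace_Euclidean_space)
  qed
qed

lemma Kcoords_Euclidean: "Kcoords N (z :: nat \<Rightarrow> 'k::euclidean_space) \<in> topspace (Euclidean_space (N * DIM('k)))"
  by (auto simp: Kcoords_def topspace_Euclidean_space)

lemma Kcoords_image:
  "Kcoords N ` (Kspace N :: (nat \<Rightarrow> 'k::euclidean_space) set) = topspace (Euclidean_space (N * DIM('k)))"
proof
  show "topspace (Euclidean_space (N * DIM('k))) \<subseteq> Kcoords N ` (Kspace N :: (nat \<Rightarrow> 'k) set)"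
  proof
    fix x assume "x \<in> topspace (Euclidean_space (N * DIM('k)))"
    then show "x \<in> Kcoords N ` (Kspace N :: (nat \<Rightarrow> 'k) set)"
      by (intro image_eqI[of _ _ "Kpoint N x"]) (simp_all add: Kcoords_Kpoint Kpoint_Kspace)
  qed
qed (use Kcoords_Euclidean in auto)

definition Ktop :: "nat \<Rightarrow> (nat \<Rightarrow> 'k::euclidean_space) topology" where
  "Ktop N = subtopology (product_topology (\<lambda>_. euclidean) UNIV) (Kspace N)"

lemma topspace_Ktop [simp]: "topspace (Ktop N) = Kspace N"
  by (simp add: Ktop_def)

lemma Ktop_top_of_set: "Ktop N = top_of_set (Kspace N)"
  by (simp add: Ktop_def euclidean_product_topology)

lemma is_chart_Kcoords: "is_chart (Ktop N) (N * DIM('k)) (Kspace N, Kcoords N :: (nat \<Rightarrow> 'k::euclidean_space) \<Rightarrow> _)"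
proof (rule is_chartI)
  show "openin (Ktop N) (Kspace N :: (nat \<Rightarrow> 'k) set)" using openin_topspace[of "Ktop N"] by simp
  show "openin (Euclidean_space (N * DIM('k))) (Kcoords N ` (Kspace N :: (nat \<Rightarrow> 'k) set))"
    unfolding Kcoords_image by (rule openin_topspace)
  show "continuous_map (subtopology (Ktop N) (Kspace N)) (Euclidean_space (N * DIM('k)))
      (Kcoords N :: (nat \<Rightarrow> 'k) \<Rightarrow> _)"
  proof (rule continuous_map_into_Euclidean_space)
    have "continuous_on (Kspace N) (\<lambda>z :: nat \<Rightarrow> 'k. z a)" for a
      using continuous_on_product_coordinates by (rule continuous_on_subset) simp
    then show "continuous_map (subtopology (Ktop N) (Kspace N)) euclideanreal (\<lambda>z :: nat \<Rightarrow> 'k. Kcoords N z j)" for j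
      by (cases "j < N * DIM('k)") (auto simp: Kcoords_def Ktop_top_of_set subtopology_subtopology intro!: continuous_intros)
  qed (simp add: Kcoords_def)
  show "continuous_map (subtopology (Euclidean_space (N * DIM('k))) (Kcoords N ` (Kspace N :: (nat \<Rightarrow> 'k) set))) (Ktop N)
     (Kpoint N :: _ \<Rightarrow> nat \<Rightarrow> 'k)"
  proof -
    have 1: "continuous_on S (\<lambda>x. x a)" for S and a :: nat
      using continuous_on_product_coordinates by (rule continuous_on_subset) simp
    have "continuous_on S (\<lambda>x. Kpoint N x a :: 'k)" for S a
      by (cases "a < N") (auto simp: Kpoint_def intro!: continuous_intros 1)
    then have "continuous_on S (Kpoint N :: _ \<Rightarrow> nat \<Rightarrow> 'k)" for S
      by (rule continuous_on_coordinatewise_then_product)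
    then show ?thesis
      unfolding Euclidean_space_top_of_set Ktop_top_of_set subtopology_subtopology
      by (auto simp: continuous_map_in_subtopology Kpoint_Kspace)
  qed
qed (rule Kpoint_Kcoords)

lemma Kspace_manifold_eq:
  "Kspace_manifold N = generated_manifold (Ktop N) (N * DIM('k))
     {(topspace (Ktop N), Kcoords N :: (nat \<Rightarrow> 'k::euclidean_space) \<Rightarrow> _)}"
  by (simp add: Kspace_manifold_def Ktop_def Kcoords_def[abs_def])

lemma Kspace_manifold_simps [simp]:
  "mtop (Kspace_manifold N) = Ktop N" "mdim (Kspace_manifold N :: (nat \<Rightarrow> 'k::euclidean_space) manifold) = N * DIM('k)"
  by (simp_all add: Kspace_manifold_eq)

lemma atlas_Kspace [simp]: "atlas_manifold (Kspace_manifold N)"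
  unfolding Kspace_manifold_eq by (rule single_chart_manifold) (simp add: is_chart_Kcoords)

text \<open>Trading the flattened real index for a pair of a coordinate and a basis vector removes
  the enumeration of the basis from the later arguments.\<close>

lemma smap_Kspace_iff:
  fixes f :: "'a \<Rightarrow> nat \<Rightarrow> 'k::euclidean_space"
  assumes P: "atlas_manifold P" and W: "openin (mtop P) W"
  shows "smap P W (Kspace_manifold N) f \<longleftrightarrow>
    (\<forall>p\<in>W. f p \<in> Kspace N) \<and> (\<forall>a<N. \<forall>b\<in>Basis. smf P W (\<lambda>p. f p a \<bullet> b))"
proof -
  have "smap P W (Kspace_manifold N) f \<longleftrightarrow>
      f ` W \<subseteq> Kspace N \<and> (\<forall>j<N * DIM('k). smf P W (\<lambda>p. Kcoords N (f p) j))"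
    unfolding Kspace_manifold_eq by (subst smap_single_chart[OF _ P W]) (simp_all add: is_chart_Kcoords)
  also have "(\<forall>j<N * DIM('k). smf P W (\<lambda>p. Kcoords N (f p) j)) \<longleftrightarrow> (\<forall>a<N. \<forall>b\<in>Basis. smf P W (\<lambda>p. f p a \<bullet> b))"
  proof (intro iffI allI impI ballI)
    fix a and b :: 'k assume L: "\<forall>j<N * DIM('k). smf P W (\<lambda>p. Kcoords N (f p) j)" and a: "a < N" and b: "b \<in> Basis"
    obtain e where e: "e < DIM('k)" "b = basis_enum e" using Basis_enum_cases[OF b] .
    have "smf P W (\<lambda>p. Kcoords N (f p) (a * DIM('k) + e))" using L mult_add_DIM[OF a e(1)] by blast
    then show "smf P W (\<lambda>p. f p a \<bullet> b)" by (simp add: Kcoords_mult_add[OF a e(1)] e(2))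
  next
    fix j assume R: "\<forall>a<N. \<forall>b\<in>Basis. smf P W (\<lambda>p. f p a \<bullet> b)" and j: "j < N * DIM('k)"
    then show "smf P W (\<lambda>p. Kcoords N (f p) j)"
      using div_mod_DIM[OF j] basis_enum_Basis[of "j mod DIM('k)", where 'k = 'k] by (simp add: Kcoords_def)
  qed
  finally show ?thesis by auto
qed

lemma smf_Kspace_coord:
  assumes "b \<in> Basis"
  shows "smf (Kspace_manifold N) (Kspace N) (\<lambda>z :: nat \<Rightarrow> 'k::euclidean_space. z a \<bullet> b)"
proof (cases "a < N")
  case True
  have o: "openin (mtop (Kspace_manifold N :: (nat \<Rightarrow> 'k) manifold)) (Kspace N)"
    using openin_topspace[of "Ktop N"] by simp
  show ?thesis
    using smap_id[OF atlas_Kspace o] True assms unfolding smap_Kspace_iff[OF atlas_Kspace o] by blast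
next
  case False
  have "smf (Kspace_manifold N) (Kspace N) (\<lambda>_ :: nat \<Rightarrow> 'k. 0)"
    using openin_topspace[of "Ktop N"] by (intro smf_const) auto
  then show ?thesis by (rule smf_cong[OF atlas_Kspace]) (use False in \<open>auto simp: Kspace_def\<close>)
qed

text \<open>Passes from \<open>Kspace N\<close> to the real coordinates in which smooth homogeneous
  functions were shown to be polynomials.\<close>

lemma smf_Kspace_Ck_on:
  fixes f :: "(nat \<Rightarrow> 'k::euclidean_space) \<Rightarrow> real"
  assumes "smf (Kspace_manifold N) (Kspace N) f"
  shows "Ck_on k (N * DIM('k)) (topspace (Euclidean_space (N * DIM('k)))) (\<lambda>x. f (Kpoint N x))"
proof -
  have "(Kspace N, Kcoords N) \<in> matlas (Kspace_manifold N :: (nat \<Rightarrow> 'k) manifold)"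
    unfolding Kspace_manifold_eq using single_chart_manifold(2)[of "Ktop N"] is_chart_Kcoords by (metis topspace_Ktop)
  from smfD[OF assms this, of k]
  have "Ck_on k (N * DIM('k)) (topspace (Euclidean_space (N * DIM('k)))) (f \<circ> inv_into (Kspace N) (Kcoords N))"
    by (simp add: Kcoords_image)
  moreover have "inv_into (Kspace N) (Kcoords N) x = (Kpoint N x :: nat \<Rightarrow> 'k)"
    if "x \<in> topspace (Euclidean_space (N * DIM('k)))" for x
  proof -
    have "Kpoint N x \<in> (Kspace N :: (nat \<Rightarrow> 'k) set)" by (rule Kpoint_Kspace)
    from inv_into_f_f[OF is_chartD(2)[OF is_chart_Kcoords] this] show ?thesis
      unfolding Kcoords_Kpoint[OF that] .
  qed
  ultimately show ?thesis by (rule_tac Ck_on_cong[OF openin_topspace]) auto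
qed

lemma field_manifold_eq:
  "field_manifold = generated_manifold euclidean DIM('k)
     {(topspace euclidean, \<lambda>(z :: 'k::euclidean_space) i. if i < DIM('k) then z \<bullet> basis_enum i else 0)}"
  by (simp add: field_manifold_def)

lemma is_chart_field:
  "is_chart euclidean DIM('k) (topspace euclidean, \<lambda>(z :: 'k::euclidean_space) i. if i < DIM('k) then z \<bullet> basis_enum i else 0)"
  (is "is_chart _ _ (_, ?\<phi>)")
proof (rule is_chartI)
  let ?g = "\<lambda>x. \<Sum>e<DIM('k). x e *\<^sub>R (basis_enum e :: 'k)"
  have im: "?\<phi> ` topspace euclidean = topspace (Euclidean_space DIM('k))"
  proof
    show "topspace (Euclidean_space DIM('k)) \<subseteq> ?\<phi> ` topspace euclidean"
    proof
      fix x assume x: "x \<in> topspace (Euclidean_space DIM('k))"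
      have "?\<phi> (?g x) i = x i" for i
      proof (cases "i < DIM('k)")
        case True
        have "?g x \<bullet> basis_enum i = (\<Sum>e<DIM('k). x e * (if e = i then 1 else 0))"
          using True by (auto simp: inner_sum_left basis_enum_inner intro!: sum.cong)
        also have "\<dots> = x i" using True by (subst sum.mono_neutral_right[of _ "{i}"]) auto
        finally show ?thesis using True by simp
      qed (use x in \<open>auto simp: topspace_Euclidean_space\<close>)
      then have "x = ?\<phi> (?g x)" by auto
      then show "x \<in> ?\<phi> ` topspace euclidean" by auto
    qed
  qed (auto simp: topspace_Euclidean_space)
  show "openin (Euclidean_space DIM('k)) (?\<phi> ` topspace euclidean)" unfolding im by (rule openin_topspace)
  show "continuous_map (subtopology euclidean (topspace euclidean)) (Euclidean_space DIM('k)) ?\<phi>"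
  proof (rule continuous_map_into_Euclidean_space)
    show "continuous_map (subtopology euclidean (topspace euclidean)) euclideanreal (\<lambda>p. ?\<phi> p j)" for j
      by (cases "j < DIM('k)") (auto intro!: continuous_intros)
  qed simp
  show "continuous_map (subtopology (Euclidean_space DIM('k)) (?\<phi> ` topspace euclidean)) euclidean ?g"
  proof -
    have 1: "continuous_on S (\<lambda>x. x a)" for S and a :: nat
      using continuous_on_product_coordinates by (rule continuous_on_subset) simp
    have "continuous_on S ?g" for S by (intro continuous_intros 1)
    then show ?thesis
      unfolding Euclidean_space_top_of_set subtopology_subtopology by simp
  qed
  show "?g (?\<phi> z) = z" for z :: 'k
  proof -
    have "?g (?\<phi> z) = (\<Sum>e<DIM('k). (z \<bullet> basis_enum e) *\<^sub>R basis_enum e)" by (rule sum.cong) auto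
    then show ?thesis by (simp add: basis_enum_sum)
  qed
qed simp

lemma field_manifold_simps [simp]: "mtop field_manifold = euclidean"
  by (simp add: field_manifold_def)

lemma atlas_field [simp]: "atlas_manifold field_manifold"
  unfolding field_manifold_eq by (rule single_chart_manifold[OF is_chart_field])

lemma smap_field_iff:
  fixes f :: "'a \<Rightarrow> 'k::euclidean_space"
  assumes P: "atlas_manifold P" and W: "openin (mtop P) W"
  shows "smap P W field_manifold f \<longleftrightarrow> (\<forall>b\<in>Basis. smf P W (\<lambda>p. f p \<bullet> b))"
proof -
  have "smap P W field_manifold f \<longleftrightarrow>
      f ` W \<subseteq> UNIV \<and> (\<forall>j<DIM('k). smf P W (\<lambda>p. if j < DIM('k) then f p \<bullet> basis_enum j else 0))"
    unfolding field_manifold_eq by (subst smap_single_chart[OF is_chart_field P W]) simp_all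
  also have "\<dots> \<longleftrightarrow> (\<forall>b\<in>Basis. smf P W (\<lambda>p. f p \<bullet> b))"
  proof (intro iffI conjI ballI allI impI)
    fix b :: 'k assume L: "f ` W \<subseteq> UNIV \<and>
      (\<forall>j<DIM('k). smf P W (\<lambda>p. if j < DIM('k) then f p \<bullet> basis_enum j else 0))" and b: "b \<in> Basis"
    obtain e where e: "e < DIM('k)" "b = basis_enum e" using Basis_enum_cases[OF b] .
    then show "smf P W (\<lambda>p. f p \<bullet> b)" using L by auto
  qed (use basis_enum_Basis[where 'k = 'k] in auto)
  finally show ?thesis .
qed

text \<open>Dimensions are compared by the traces of the two products of the Jacobians of a map and its inverse.\<close>

lemma Jacobian_inverse:
  assumes U: "openin (Euclidean_space m) U" and V: "openin (Euclidean_space n) V"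
    and T: "\<And>x. x \<in> U \<Longrightarrow> T x \<in> V" and ST: "\<And>x. x \<in> U \<Longrightarrow> S (T x) = x"
    and TC: "\<And>j. j < n \<Longrightarrow> Ck_on 1 m U (\<lambda>x. T x j)" and SC: "\<And>j. j < m \<Longrightarrow> Ck_on 1 n V (\<lambda>y. S y j)"
    and x: "x \<in> U" and i: "i < m" and l: "l < m"
  shows "(\<Sum>j<n. pd j (\<lambda>y. S y l) (T x) * pd i (\<lambda>x. T x j) x) = (if l = i then 1 else 0)"
proof -
  note TD = TC[unfolded One_nat_def Ck_on_Suc_iff[OF U]] and SD = SC[unfolded One_nat_def Ck_on_Suc_iff[OF V]]
  \<comment> \<open>The image under \<open>T\<close> of the \<open>i\<close>-th coordinate line
    through \<open>x\<close>, set to zero where the line leaves \<open>U\<close>, so that its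
    coordinates from \<open>n\<close> on vanish throughout.\<close>
  define c where "c = (\<lambda>t. if x(i := t) \<in> U then T (x(i := t)) else (\<lambda>_. 0))"
  have ev: "eventually (\<lambda>t. x(i := t) \<in> U) (nhds (x i))" by (rule Euclidean_space_line_open[OF U x i])
  have cx: "c (x i) = T x" using x by (simp add: c_def)
  have "((\<lambda>t. S (c t) l) has_real_derivative (\<Sum>j<n. pd j (\<lambda>y. S y l) (c (x i)) * pd i (\<lambda>x. T x j) x)) (at (x i))"
  proof (rule curve_chain_rule[OF V])
    show "((\<lambda>t. S (y(j := t)) l) has_real_derivative pd j (\<lambda>y. S y l) y) (at (y j))" if "j < n" "y \<in> V" for j y
      using SD[OF l] that by (simp del: fun_upd_apply)
    show "continuous_map (subtopology (Euclidean_space n) V) euclideanreal (pd j (\<lambda>y. S y l))" if "j < n" for j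
      using SD[OF l] that by simp
    show "c t j = 0" if "j \<ge> n" for t j
      using openin_Euclidean_space_zero[OF V T that] by (simp add: c_def)
    show "c (x i) \<in> V" using T[OF x] cx by simp
    show "((\<lambda>t. c t j) has_real_derivative pd i (\<lambda>x. T x j) x) (at (x i))" if j: "j < n" for j
    proof -
      have "eventually (\<lambda>t. T (x(i := t)) j = c t j) (nhds (x i))"
        using ev by eventually_elim (simp add: c_def)
      moreover have "((\<lambda>t. T (x(i := t)) j) has_real_derivative pd i (\<lambda>x. T x j) x) (at (x i))"
        using TD[OF j] i x by (simp del: fun_upd_apply)
      ultimately show ?thesis by (metis DERIV_cong_ev)
    qed
  qed
  moreover have "((\<lambda>t. S (c t) l) has_real_derivative (if l = i then 1 else 0)) (at (x i))"
  proof -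
    have e: "eventually (\<lambda>t. (x(i := t)) l = S (c t) l) (nhds (x i))"
      using ev by eventually_elim (simp add: c_def ST)
    have "((\<lambda>t. (x(i := t)) l) has_real_derivative (if l = i then 1 else 0)) (at (x i))"
      by auto
    then show ?thesis using DERIV_cong_ev[OF refl e refl] by blast
  qed
  ultimately show ?thesis unfolding cx by (rule DERIV_unique)
qed

lemma dimension_unique:
  assumes U: "openin (Euclidean_space m) U" and V: "openin (Euclidean_space n) V"
    and T: "\<And>x. x \<in> U \<Longrightarrow> T x \<in> V" "\<And>x. x \<in> U \<Longrightarrow> S (T x) = x"
    and S: "\<And>y. y \<in> V \<Longrightarrow> S y \<in> U" "\<And>y. y \<in> V \<Longrightarrow> T (S y) = y"
    and TC: "\<And>j. j < n \<Longrightarrow> Ck_on 1 m U (\<lambda>x. T x j)" and SC: "\<And>j. j < m \<Longrightarrow> Ck_on 1 n V (\<lambda>y. S y j)"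
    and x: "x \<in> U"
  shows "m = n"
proof -
  have "real m = (\<Sum>i<m. \<Sum>j<n. pd j (\<lambda>y. S y i) (T x) * pd i (\<lambda>x. T x j) x)"
    using Jacobian_inverse[OF U V T TC SC x] by simp
  also have "\<dots> = (\<Sum>j<n. \<Sum>i<m. pd i (\<lambda>x. T x j) (S (T x)) * pd j (\<lambda>y. S y i) (T x))"
    using T(2)[OF x] by (subst sum.swap) (simp add: mult.commute)
  also have "\<dots> = real n"
    using Jacobian_inverse[OF V U S SC TC T(1)[OF x]] by simp
  finally show ?thesis by simp
qed

text \<open>Atlases are maximal, so two manifolds on one set for which the identity is smooth both
  ways are equal as records. The dimensions are compared at a point, hence the nonempty
  carrier.\<close>

lemma manifold_eqI:
  assumes M: "atlas_manifold M" and N: "atlas_manifold N" and c: "mcarrier M = mcarrier N" "mcarrier M \<noteq> {}"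
    and MN: "smap M (mcarrier M) N (\<lambda>p. p)" and NM: "smap N (mcarrier N) M (\<lambda>p. p)"
  shows "M = N"
proof -
  have smf: "smf M V g \<longleftrightarrow> smf N V g" for V g
  proof -
    have "smf M V g" if g: "smf N V g" for V g
      using smap_pull[OF MN g] smf_subset_carrier[OF g] c(1) by (simp add: Int_absorb1)
    moreover have "smf N V g" if g: "smf M V g" for V g
      using smap_pull[OF NM g] smf_subset_carrier[OF g] c(1) by (simp add: Int_absorb1)
    ultimately show ?thesis by blast
  qed
  \<comment> \<open>A set is open exactly if constant functions are smooth on it.\<close>
  have top: "mtop M = mtop N"
  proof (rule topology_eq[THEN iffD2], intro allI iffI)
    show "openin (mtop N) S" if "openin (mtop M) S" for S
      using smf_const[OF M that, of 0] unfolding smf by (rule smf_open)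
    show "openin (mtop M) S" if "openin (mtop N) S" for S
      using smf_const[OF N that, of 0] unfolding smf[symmetric] by (rule smf_open)
  qed
  have half: "Ck_on k (mdim M) (\<phi> ` (U \<inter> V)) (\<lambda>x. (\<psi> \<circ> inv_into U \<phi>) x j)"
    "Ck_on k (mdim N) (\<psi> ` (U \<inter> V)) (\<lambda>x. (\<phi> \<circ> inv_into V \<psi>) x j)"
    if U: "(U, \<phi>) \<in> matlas M" and V: "(V, \<psi>) \<in> matlas N" for U \<phi> V \<psi> j k
  proof -
    show "Ck_on k (mdim M) (\<phi> ` (U \<inter> V)) (\<lambda>x. (\<psi> \<circ> inv_into U \<phi>) x j)"
      using smfD[OF smf_chart_coord[OF N V, unfolded smf[symmetric]] U] by (simp add: o_def)
    show "Ck_on k (mdim N) (\<psi> ` (U \<inter> V)) (\<lambda>x. (\<phi> \<circ> inv_into V \<psi>) x j)"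
      using smfD[OF smf_chart_coord[OF M U, unfolded smf] V] by (simp add: o_def Int_commute)
  qed
  have open2: "openin (Euclidean_space (mdim M)) (\<phi> ` (U \<inter> V))" "openin (Euclidean_space (mdim N)) (\<psi> ` (U \<inter> V))"
    if U: "(U, \<phi>) \<in> matlas M" and V: "(V, \<psi>) \<in> matlas N" for U \<phi> V \<psi>
  proof -
    note cU = atlas_manifold_chart[OF M U] and cV = atlas_manifold_chart[OF N V]
    show "openin (Euclidean_space (mdim M)) (\<phi> ` (U \<inter> V))"
      using is_chartD(3)[OF cU is_chartD(1)[OF cV, folded top]] .
    show "openin (Euclidean_space (mdim N)) (\<psi> ` (U \<inter> V))"
      using is_chartD(3)[OF cV is_chartD(1)[OF cU, unfolded top]] by (simp add: Int_commute)
  qed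
  have dim: "mdim M = mdim N"
  proof -
    obtain p where p: "p \<in> mcarrier M" using c(2) by blast
    obtain U \<phi> where U: "(U, \<phi>) \<in> matlas M" "p \<in> U" using atlas_manifold_cover[OF M p] .
    obtain V \<psi> where V: "(V, \<psi>) \<in> matlas N" "p \<in> V" using atlas_manifold_cover[OF N] p c(1) by metis
    note i = is_chartD(2)[OF atlas_manifold_chart[OF M U(1)]] is_chartD(2)[OF atlas_manifold_chart[OF N V(1)]]
    show ?thesis
    proof (rule dimension_unique[OF open2[OF U(1) V(1)], of "\<psi> \<circ> inv_into U \<phi>" "\<phi> \<circ> inv_into V \<psi>" "\<phi> p"])
      show "Ck_on 1 (mdim M) (\<phi> ` (U \<inter> V)) (\<lambda>x. (\<psi> \<circ> inv_into U \<phi>) x j)" for j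
        by (rule half[OF U(1) V(1)])
      show "Ck_on 1 (mdim N) (\<psi> ` (U \<inter> V)) (\<lambda>x. (\<phi> \<circ> inv_into V \<psi>) x j)" for j
        by (rule half[OF U(1) V(1)])
    qed (use i U(2) V(2) in auto)
  qed
  have comp: "charts_compatible (mdim M) c c'" if "c \<in> matlas M" "c' \<in> matlas N" for c c'
    using that half open2 dim by (cases c; cases c') (auto simp: charts_compatible_def smooth_on_coords_def)
  have "matlas M = matlas N"
  proof (intro equalityI subsetI)
    show "c \<in> matlas N" if "c \<in> matlas M" for c
      using N atlas_manifold_chart[OF M that] comp[OF that] unfolding atlas_manifold_def dim top by blast
    show "c \<in> matlas M" if "c \<in> matlas N" for c
      using M atlas_manifold_chart[OF N that] comp[OF _ that] unfolding atlas_manifold_def dim[symmetric] top[symmetric]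
      by (metis charts_compatible_sym)
  qed
  then show ?thesis using top dim by (cases M; cases N) simp
qed

section \<open>Smooth homogeneous functions\<close>

definition ksmf :: "'a manifold \<Rightarrow> 'a set \<Rightarrow> ('a \<Rightarrow> 'k::euclidean_space) \<Rightarrow> bool" where
  "ksmf M W f \<longleftrightarrow> openin (mtop M) W \<and> (\<forall>b\<in>Basis. smf M W (\<lambda>p. f p \<bullet> b))"

lemma ksmf_open: "ksmf M W f \<Longrightarrow> openin (mtop M) W"
  by (simp add: ksmf_def)

lemma ksmf_cong:
  assumes "atlas_manifold M" "ksmf M W f" "\<And>p. p \<in> W \<Longrightarrow> f p = g p"
  shows "ksmf M W g"
  using assms unfolding ksmf_def by (auto intro: smf_cong[OF assms(1)])

lemma ksmf_const: "atlas_manifold M \<Longrightarrow> openin (mtop M) W \<Longrightarrow> ksmf M W (\<lambda>_. c)"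
  by (simp add: ksmf_def smf_const)

lemma ksmf_add: "atlas_manifold M \<Longrightarrow> ksmf M W f \<Longrightarrow> ksmf M W g \<Longrightarrow> ksmf M W (\<lambda>p. f p + g p)"
  by (simp add: ksmf_def inner_add_left smf_add)

text \<open>Multiplication of the field is bilinear over the reals, hence in components a finite sum
  of products with constant structure coefficients.\<close>

lemma ksmf_mult:
  fixes f g :: "'a \<Rightarrow> 'k::{real_normed_field, euclidean_space}"
  assumes M: "atlas_manifold M" and f: "ksmf M W f" and g: "ksmf M W g"
  shows "ksmf M W (\<lambda>p. f p * g p)"
proof -
  have eq: "(x * y) \<bullet> c = (\<Sum>b\<in>Basis. \<Sum>b'\<in>Basis. (x \<bullet> b) * (y \<bullet> b') * ((b * b') \<bullet> c))" for x y c :: 'k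
  proof -
    have "x * y = (\<Sum>b\<in>Basis. (x \<bullet> b) *\<^sub>R b) * (\<Sum>b\<in>Basis. (y \<bullet> b) *\<^sub>R b)"
      by (simp add: euclidean_representation)
    also have "\<dots> = (\<Sum>b\<in>Basis. \<Sum>b'\<in>Basis. ((x \<bullet> b) * (y \<bullet> b')) *\<^sub>R (b * b'))"
      by (simp add: sum_product mult_ac)
    finally show ?thesis by (simp add: inner_sum_left)
  qed
  have "smf M W (\<lambda>p. (f p * g p) \<bullet> c)" for c
  proof (rule smf_cong[OF M])
    show "smf M W (\<lambda>p. \<Sum>b\<in>Basis. \<Sum>b'\<in>Basis. (f p \<bullet> b) * (g p \<bullet> b') * ((b * b') \<bullet> c))"
      using f g unfolding ksmf_def by (intro smf_sum[OF M] smf_mult[OF M] smf_const[OF M]) auto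
  qed (rule eq[symmetric])
  then show ?thesis using ksmf_open[OF f] by (simp add: ksmf_def)
qed

lemma ksmf_power:
  fixes f :: "'a \<Rightarrow> 'k::{real_normed_field, euclidean_space}"
  assumes M: "atlas_manifold M" and f: "ksmf M W f"
  shows "ksmf M W (\<lambda>p. f p ^ n)"
  by (induction n) (auto intro: ksmf_const[OF M ksmf_open[OF f]] ksmf_mult[OF M f])

lemma ksmf_sum:
  assumes M: "atlas_manifold M" and W: "openin (mtop M) W" and f: "\<And>i. i \<in> A \<Longrightarrow> ksmf M W (f i)"
  shows "ksmf M W (\<lambda>p. \<Sum>i\<in>A. f i p)"
  using f by (induction A rule: infinite_finite_induct) (auto intro!: ksmf_const[OF M W] ksmf_add[OF M])

lemma smap_field_ksmf:
  assumes "atlas_manifold P"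
  shows "smap P W field_manifold f \<longleftrightarrow> ksmf P W f"
  using smap_field_iff[OF assms, of W f] smap_open[of P W field_manifold f] by (auto simp: ksmf_def)

lemma smap_Kspace_ksmf:
  assumes "atlas_manifold P"
  shows "smap P W (Kspace_manifold N) f \<longleftrightarrow>
    openin (mtop P) W \<and> (\<forall>p\<in>W. f p \<in> Kspace N) \<and> (\<forall>a<N. ksmf P W (\<lambda>p. f p a))"
  using smap_Kspace_iff[OF assms, of W N f] smap_open[of P W "Kspace_manifold N" f] by (auto simp: ksmf_def)

lemma ksmf_pull:
  assumes "smap M W N f" "ksmf N V g" "f ` W \<subseteq> V"
  shows "ksmf M W (\<lambda>p. g (f p))"
  using assms smap_pull_subset[OF assms(1) _ assms(3)] by (auto simp: ksmf_def smap_open)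

lemma openin_Ktop_Kspace [simp]: "openin (Ktop N) (Kspace N)"
  using openin_topspace[of "Ktop N"] by simp

lemma ksmf_Kspace_coord: "ksmf (Kspace_manifold N) (Kspace N) (\<lambda>z. z a)"
  by (simp add: ksmf_def smf_Kspace_coord)

lemma ksmf_real [simp]: "ksmf M W (f :: _ \<Rightarrow> real) \<longleftrightarrow> smf M W f"
  by (auto simp: ksmf_def smf_open)

lemma ksmf_complex: "ksmf M W f \<longleftrightarrow> smf M W (\<lambda>p. Re (f p)) \<and> smf M W (\<lambda>p. Im (f p))"
  by (auto simp: ksmf_def smf_open Basis_complex_def inner_complex_def)

lemma ksmf_of_real:
  assumes "atlas_manifold M" "smf M W f"
  shows "ksmf M W (\<lambda>p. complex_of_real (f p))"
  using assms smf_const[OF assms(1) smf_open[OF assms(2)]] by (simp add: ksmf_complex)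

section \<open>Graded scaling and polynomiality of smooth homogeneous functions\<close>

lemma graded_scale_Kspace [simp]: "graded_scale ws \<xi> z \<in> Kspace (length ws)"
  by (simp add: graded_scale_def Kspace_def)

lemma graded_scale_one: "z \<in> Kspace (length ws) \<Longrightarrow> graded_scale ws 1 z = z"
  by (auto simp: graded_scale_def Kspace_def fun_eq_iff)

lemma graded_scale_mult: "graded_scale ws \<xi> (graded_scale ws \<eta> z) = graded_scale ws (\<xi> * \<eta>) z"
  by (auto simp: graded_scale_def fun_eq_iff power_mult_distrib)

text \<open>The property of the field on which the theory of graded bundles below rests. It is
  verified for the reals by Euler's formula and for the complex numbers with the help of the circle
  action; what is proved in this locale then holds for both kinds of bundles.\<close>

locale graded_field =
  fixes K :: "'k::{real_normed_field, euclidean_space} itself"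
  assumes smooth_homogeneous:
    "(\<And>v. v \<in> set ws \<Longrightarrow> 1 \<le> v) \<Longrightarrow> 1 \<le> w \<Longrightarrow>
     ksmf (Kspace_manifold (length ws)) (Kspace (length ws)) f \<Longrightarrow>
     (\<And>\<xi> z. z \<in> Kspace (length ws) \<Longrightarrow> f (graded_scale ws \<xi> z) = \<xi> ^ w * f z) \<Longrightarrow>
     homogeneous_polynomial ws w (f :: (nat \<Rightarrow> 'k) \<Rightarrow> 'k)"

lemma index_lists_nonempty:
  assumes "1 \<le> w"
  shows "{as. as \<noteq> [] \<and> set as \<subseteq> {..<n} \<and> (\<Sum>a\<leftarrow>as. v a) = w} = index_lists n v w"
  using assms by (auto simp: index_lists_def)

text \<open>A coordinate of weight \<open>v\<close> over the field amounts to \<open>DIM('k)\<close>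
  real coordinates of the same weight, and homogeneity under positive real scalars already makes
  each component of \<open>f\<close> a real polynomial in them.\<close>

lemma real_homogeneous_coordinates:
  fixes f :: "(nat \<Rightarrow> 'k::{real_normed_field, euclidean_space}) \<Rightarrow> 'k"
  assumes ws: "\<And>v. v \<in> set ws \<Longrightarrow> 1 \<le> v"
    and f: "ksmf (Kspace_manifold (length ws)) (Kspace (length ws)) f"
    and hom: "\<And>t z. t > 0 \<Longrightarrow> z \<in> Kspace (length ws) \<Longrightarrow> f (graded_scale ws (of_real t) z) = of_real t ^ w * f z"
    and b: "b \<in> Basis"
  shows "\<exists>c. \<forall>z\<in>Kspace (length ws). f z \<bullet> b =
    (\<Sum>ls\<in>index_lists (length ws * DIM('k)) (\<lambda>i. ws ! (i div DIM('k))) w. c ls * (\<Prod>l\<leftarrow>ls. Kcoords (length ws) z l))"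
proof -
  let ?N = "length ws" and ?D = "DIM('k)"
  have "\<exists>c. \<forall>x\<in>topspace (Euclidean_space (?N * ?D)). f (Kpoint ?N x) \<bullet> b =
     (\<Sum>ls\<in>index_lists (?N * ?D) (\<lambda>i. ws ! (i div ?D)) w. c ls * (\<Prod>l\<leftarrow>ls. x l))"
  proof (rule smooth_homogeneous_polynomial)
    show "1 \<le> ws ! (i div ?D)" if "i < ?N * ?D" for i
      using ws[OF nth_mem[OF div_mod_DIM(1)[OF that]]] .
    show "Ck_on k (?N * ?D) (topspace (Euclidean_space (?N * ?D))) (\<lambda>x. f (Kpoint ?N x) \<bullet> b)" for k
      by (rule smf_Kspace_Ck_on) (use f b in \<open>auto simp: ksmf_def\<close>)
    fix t :: real and x assume t: "t > 0" and x: "x \<in> topspace (Euclidean_space (?N * ?D))"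
    have "Kpoint ?N (\<lambda>i. t ^ (ws ! (i div ?D)) * x i) = (graded_scale ws (of_real t) (Kpoint ?N x) :: nat \<Rightarrow> 'k)"
      by (rule ext) (auto simp: Kpoint_def graded_scale_def sum_distrib_left scaleR_conv_of_real mult_ac intro!: sum.cong)
    then show "f (Kpoint ?N (\<lambda>i. t ^ (ws ! (i div ?D)) * x i)) \<bullet> b = t ^ w * (f (Kpoint ?N x) \<bullet> b)"
      using hom[OF t Kpoint_Kspace[of ?N x]] by (simp flip: of_real_power scaleR_conv_of_real)
  qed
  then obtain c where c: "\<And>x. x \<in> topspace (Euclidean_space (?N * ?D)) \<Longrightarrow> f (Kpoint ?N x) \<bullet> b =
     (\<Sum>ls\<in>index_lists (?N * ?D) (\<lambda>i. ws ! (i div ?D)) w. c ls * (\<Prod>l\<leftarrow>ls. x l))" by blast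
  show ?thesis
  proof (intro exI[of _ c] ballI)
    fix z :: "nat \<Rightarrow> 'k" assume "z \<in> Kspace ?N"
    then show "f z \<bullet> b = (\<Sum>ls\<in>index_lists (?N * ?D) (\<lambda>i. ws ! (i div ?D)) w. c ls * (\<Prod>l\<leftarrow>ls. Kcoords ?N z l))"
      using c[OF Kcoords_Euclidean[of ?N z]] by (simp add: Kpoint_Kcoords)
  qed
qed

interpretation real_field: graded_field "TYPE(real)"
proof
  fix ws w and f :: "(nat \<Rightarrow> real) \<Rightarrow> real"
  assume ws: "\<And>v. v \<in> set ws \<Longrightarrow> 1 \<le> v" and w: "1 \<le> w"
    and f: "ksmf (Kspace_manifold (length ws)) (Kspace (length ws)) f"
    and hom: "\<And>\<xi> z. z \<in> Kspace (length ws) \<Longrightarrow> f (graded_scale ws \<xi> z) = \<xi> ^ w * f z"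
  have "\<exists>c. \<forall>z\<in>Kspace (length ws). f z \<bullet> 1 =
    (\<Sum>ls\<in>index_lists (length ws * DIM(real)) (\<lambda>i. ws ! (i div DIM(real))) w. c ls * (\<Prod>l\<leftarrow>ls. Kcoords (length ws) z l))"
    by (rule real_homogeneous_coordinates[OF ws f]) (use hom in auto)
  then obtain c where c: "\<And>z. z \<in> Kspace (length ws) \<Longrightarrow>
    f z = (\<Sum>ls\<in>index_lists (length ws) (\<lambda>i. ws ! i) w. c ls * (\<Prod>l\<leftarrow>ls. Kcoords (length ws) z l))" by auto
  have b: "basis_enum 0 = (1 :: real)" using basis_enum_Basis[of 0, where 'k = real] by simp
  have "f z = (\<Sum>ls\<in>index_lists (length ws) (\<lambda>i. ws ! i) w. c ls * (\<Prod>l\<leftarrow>ls. z l))" if z: "z \<in> Kspace (length ws)" for z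
    unfolding c[OF z]
  proof (intro sum.cong refl arg_cong2[of _ _ _ _ "(*)"] arg_cong[of _ _ prod_list] map_cong)
    fix ls l assume "ls \<in> index_lists (length ws) ((!) ws) w" "l \<in> set ls"
    then show "Kcoords (length ws) z l = z l" using b by (auto simp: Kcoords_def index_lists_def)
  qed
  then show "homogeneous_polynomial ws w f"
    unfolding homogeneous_polynomial_def index_lists_nonempty[OF w] by blast
qed

lemma coeff_mult_degree_bounds:
  fixes p q :: "'a::comm_semiring_1 poly"
  assumes "degree p \<le> m" "degree q \<le> n"
  shows "coeff (p * q) (m + n) = coeff p m * coeff q n"
proof -
  have "coeff p i * coeff q (m + n - i) = 0" if "i \<noteq> m" for i
    using that assms by (cases "i < m") (auto simp: coeff_eq_0)
  then show ?thesis
    unfolding coeff_mult by (subst sum.mono_neutral_right[of _ "{m}"]) auto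
qed

text \<open>On the unit circle \<open>cnj u = 1 / u\<close>, so \<open>u ^ m * f (u \<cdot> z)\<close> is a polynomial in \<open>u\<close>; its coefficient of
  degree \<open>2 * m\<close> comes from the monomials of \<open>f\<close> without conjugates.\<close>

lemma real_homogeneous_circle_polynomial:
  fixes f :: "(nat \<Rightarrow> complex) \<Rightarrow> complex"
  assumes ws: "\<And>v. v \<in> set ws \<Longrightarrow> 1 \<le> v"
    and f: "ksmf (Kspace_manifold (length ws)) (Kspace (length ws)) f"
    and hom: "\<And>t z. t > 0 \<Longrightarrow> z \<in> Kspace (length ws) \<Longrightarrow> f (graded_scale ws (of_real t) z) = of_real t ^ m * f z"
  shows "\<exists>c. \<forall>z\<in>Kspace (length ws). \<exists>P. degree P \<le> 2 * m \<and>
     coeff P (2 * m) = (\<Sum>as\<in>index_lists (length ws) (\<lambda>a. ws ! a) m. c as * (\<Prod>a\<leftarrow>as. z a)) \<and>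
     (\<forall>u. cmod u = 1 \<longrightarrow> u ^ m * f (graded_scale ws u z) = poly P u)"
proof -
  let ?N = "length ws"
  define L where "L = index_lists (?N * 2) (\<lambda>i. ws ! (i div 2)) m"
  have finL: "finite L" unfolding L_def
  proof (rule finite_index_lists)
    show "1 \<le> ws ! (i div 2)" if "i < ?N * 2" for i
      using that ws[OF nth_mem[of "i div 2" ws]] by simp
  qed
  define \<beta> where "\<beta> = (\<lambda>l. basis_enum (l mod 2) :: complex)"
  have Lmem: "l div 2 < ?N" "l < ?N * 2" if "ls \<in> L" "l \<in> set ls" for ls l
    using that by (auto simp: L_def index_lists_def)
  have "\<exists>c. \<forall>z\<in>Kspace ?N. f z \<bullet> b = (\<Sum>ls\<in>L. c ls * (\<Prod>l\<leftarrow>ls. Kcoords ?N z l))" if "b \<in> Basis" for b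
    using real_homogeneous_coordinates[OF ws f hom that] by (simp add: L_def)
  then obtain c where c: "\<And>b z. b \<in> Basis \<Longrightarrow> z \<in> Kspace ?N \<Longrightarrow>
      f z \<bullet> b = (\<Sum>ls\<in>L. c b ls * (\<Prod>l\<leftarrow>ls. Kcoords ?N z l))" by metis
  define C where "C = (\<lambda>ls. \<Sum>b\<in>Basis. c b ls *\<^sub>R b)"
  have fz: "f z = (\<Sum>ls\<in>L. C ls * of_real (\<Prod>l\<leftarrow>ls. Kcoords ?N z l))" if "z \<in> Kspace ?N" for z
  proof -
    have "f z = (\<Sum>b\<in>Basis. (f z \<bullet> b) *\<^sub>R b)" by (simp add: euclidean_representation)
    also have "\<dots> = (\<Sum>b\<in>Basis. \<Sum>ls\<in>L. (c b ls *\<^sub>R b) * of_real (\<Prod>l\<leftarrow>ls. Kcoords ?N z l))"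
      using c that by (simp add: scaleR_sum_left scaleR_conv_of_real mult_ac sum_distrib_left)
    also have "\<dots> = (\<Sum>ls\<in>L. C ls * of_real (\<Prod>l\<leftarrow>ls. Kcoords ?N z l))"
      by (subst sum.swap) (simp add: C_def sum_distrib_right)
    finally show ?thesis .
  qed
  \<comment> \<open>A real coordinate of \<open>x\<close> is
    \<open>(x * cnj y + cnj x * y) / 2\<close> with a basis vector \<open>y\<close>. After
    \<open>x\<close> is scaled by \<open>u ^ w\<close> and the result multiplied by
    \<open>u ^ w\<close>, the first term carries \<open>u ^ (2 * w)\<close>, and the conjugated one
    becomes constant as \<open>u * cnj u = 1\<close>. So each letter contributes a polynomial in
    \<open>u\<close> of degree at most \<open>2 * w\<close>.\<close>
  define p where "p = (\<lambda>(z :: nat \<Rightarrow> complex) ls. \<Prod>l\<leftarrow>ls. monom (z (l div 2) * cnj (\<beta> l) / 2) (2 * ws ! (l div 2)) + [:cnj (z (l div 2)) * \<beta> l / 2:])"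
  have p: "degree (p z ls) \<le> 2 * (\<Sum>l\<leftarrow>ls. ws ! (l div 2)) \<and>
      coeff (p z ls) (2 * (\<Sum>l\<leftarrow>ls. ws ! (l div 2))) = (\<Prod>l\<leftarrow>ls. z (l div 2) * cnj (\<beta> l) / 2)"
    if "\<And>l. l \<in> set ls \<Longrightarrow> 1 \<le> ws ! (l div 2)" for z ls
    using that
  proof (induction ls)
    case (Cons l ls)
    define q where "q = monom (z (l div 2) * cnj (\<beta> l) / 2) (2 * ws ! (l div 2)) + [:cnj (z (l div 2)) * \<beta> l / 2:]"
    have w: "1 \<le> ws ! (l div 2)" using Cons.prems by simp
    have d: "degree q \<le> 2 * ws ! (l div 2)"
      unfolding q_def by (rule degree_add_le) (auto simp: degree_monom_le)
    have q: "coeff q (2 * ws ! (l div 2)) = z (l div 2) * cnj (\<beta> l) / 2"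
      using w by (simp add: q_def coeff_pCons split: nat.split)
    have IH: "degree (p z ls) \<le> 2 * (\<Sum>l\<leftarrow>ls. ws ! (l div 2))"
      "coeff (p z ls) (2 * (\<Sum>l\<leftarrow>ls. ws ! (l div 2))) = (\<Prod>l\<leftarrow>ls. z (l div 2) * cnj (\<beta> l) / 2)"
      using Cons by auto
    have e: "p z (l # ls) = q * p z ls" by (simp add: p_def q_def)
    show ?case
      unfolding e using degree_mult_le[of q "p z ls"] d IH(1) coeff_mult_degree_bounds[OF d IH(1)]
      by (simp add: distrib_left q IH(2))
  qed (simp add: p_def)
  have pu: "poly (p z ls) u = (\<Prod>l\<leftarrow>ls. u ^ ws ! (l div 2) * of_real (Kcoords ?N (graded_scale ws u z) l))"
    if u: "cmod u = 1" and ls: "ls \<in> L" for z u ls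
  proof -
    have uu: "u ^ k * cnj u ^ k = 1" for k
      using u by (metis complex_norm_square mult_1_right of_real_1 one_power2 power_mult_distrib power_one)
    have "u ^ ws ! (l div 2) * of_real (Kcoords ?N (graded_scale ws u z) l) =
       z (l div 2) * cnj (\<beta> l) / 2 * u ^ (2 * ws ! (l div 2)) + cnj (z (l div 2)) * \<beta> l / 2" if l: "l \<in> set ls" for l
    proof -
      have K: "Kcoords ?N (graded_scale ws u z) l = (u ^ ws ! (l div 2) * z (l div 2)) \<bullet> \<beta> l"
        using Lmem[OF ls l] by (simp add: Kcoords_def graded_scale_def \<beta>_def)
      have in2: "complex_of_real (x \<bullet> y) = (x * cnj y + cnj x * y) / 2" for x y
        by (simp add: complex_eq_iff inner_complex_def)
      have "u ^ ws ! (l div 2) * of_real (Kcoords ?N (graded_scale ws u z) l) =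
          z (l div 2) * cnj (\<beta> l) / 2 * (u ^ ws ! (l div 2) * u ^ ws ! (l div 2))
          + (u ^ ws ! (l div 2) * cnj u ^ ws ! (l div 2)) * (cnj (z (l div 2)) * \<beta> l / 2)"
        unfolding K in2 by (simp add: field_simps)
      then show ?thesis unfolding uu by (simp add: mult_2 power_add)
    qed
    moreover have "poly (\<Prod>l\<leftarrow>ks. q l) u = (\<Prod>l\<leftarrow>ks. poly (q l) u)" for ks and q :: "nat \<Rightarrow> complex poly"
      by (induction ks) auto
    ultimately show ?thesis
      by (simp add: p_def poly_monom cong: map_cong)
  qed
  \<comment> \<open>Several real words lie over the same complex word; their contributions to the
    top coefficient add up to the coefficient of that word.\<close>
  define c' where "c' = (\<lambda>as. \<Sum>ls | ls \<in> L \<and> map (\<lambda>l. l div 2) ls = as. C ls * (\<Prod>l\<leftarrow>ls. cnj (\<beta> l) / 2))"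
  have "\<exists>P. degree P \<le> 2 * m \<and>
     coeff P (2 * m) = (\<Sum>as\<in>index_lists ?N (\<lambda>a. ws ! a) m. c' as * (\<Prod>a\<leftarrow>as. z a)) \<and>
     (\<forall>u. cmod u = 1 \<longrightarrow> u ^ m * f (graded_scale ws u z) = poly P u)" if z: "z \<in> Kspace ?N" for z
  proof (intro exI conjI allI impI)
    let ?P = "\<Sum>ls\<in>L. smult (C ls) (p z ls)"
    have sumL: "(\<Sum>l\<leftarrow>ls. ws ! (l div 2)) = m" if "ls \<in> L" for ls using that by (simp add: L_def index_lists_def)
    have pos: "1 \<le> ws ! (l div 2)" if "ls \<in> L" "l \<in> set ls" for ls l using ws Lmem[OF that] by simp
    have pls: "degree (p z ls) \<le> 2 * m"
      "coeff (p z ls) (2 * m) = (\<Prod>l\<leftarrow>ls. z (l div 2) * cnj (\<beta> l) / 2)" if "ls \<in> L" for ls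
      using p[of ls z] pos[OF that] sumL[OF that] by auto
    show "degree ?P \<le> 2 * m"
    proof (rule degree_sum_le[OF finL])
      fix ls assume "ls \<in> L"
      then show "degree (smult (C ls) (p z ls)) \<le> 2 * m"
        using pls[of ls] degree_smult_le[of "C ls" "p z ls"] by linarith
    qed
    show "coeff ?P (2 * m) = (\<Sum>as\<in>index_lists ?N (\<lambda>a. ws ! a) m. c' as * (\<Prod>a\<leftarrow>as. z a))"
    proof -
      have split: "(\<Prod>l\<leftarrow>ls. z (l div 2) * cnj (\<beta> l) / 2) = (\<Prod>l\<leftarrow>ls. cnj (\<beta> l) / 2) * (\<Prod>a\<leftarrow>map (\<lambda>l. l div 2) ls. z a)" for ls
        by (induction ls) (auto simp: mult_ac)
      have "coeff ?P (2 * m) = (\<Sum>ls\<in>L. C ls * (\<Prod>l\<leftarrow>ls. cnj (\<beta> l) / 2) * (\<Prod>a\<leftarrow>map (\<lambda>l. l div 2) ls. z a))"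
        unfolding coeff_sum coeff_smult
      proof (rule sum.cong)
        fix ls assume "ls \<in> L"
        then show "C ls * coeff (p z ls) (2 * m) = C ls * (\<Prod>l\<leftarrow>ls. cnj (\<beta> l) / 2) * (\<Prod>a\<leftarrow>map (\<lambda>l. l div 2) ls. z a)"
          unfolding pls(2)[OF \<open>ls \<in> L\<close>] split by (simp only: mult.assoc)
      qed simp
      also have "\<dots> = (\<Sum>as\<in>index_lists ?N (\<lambda>a. ws ! a) m. \<Sum>ls | ls \<in> L \<and> map (\<lambda>l. l div 2) ls = as.
          C ls * (\<Prod>l\<leftarrow>ls. cnj (\<beta> l) / 2) * (\<Prod>a\<leftarrow>map (\<lambda>l. l div 2) ls. z a))"
      proof (rule sum.group[symmetric, OF finL])
        show "finite (index_lists ?N (\<lambda>a. ws ! a) m)" 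
          by (rule finite_index_lists) (rule ws[OF nth_mem])
        show "map (\<lambda>l. l div 2) ` L \<subseteq> index_lists ?N (\<lambda>a. ws ! a) m"
        proof clarify
          fix ls assume "ls \<in> L"
          then show "map (\<lambda>l. l div 2) ls \<in> index_lists ?N (\<lambda>a. ws ! a) m"
            using Lmem(1)[of ls] sumL[of ls] by (auto simp: index_lists_def o_def)
        qed
      qed
      also have "\<dots> = (\<Sum>as\<in>index_lists ?N (\<lambda>a. ws ! a) m. c' as * (\<Prod>a\<leftarrow>as. z a))"
        by (rule sum.cong) (auto simp: c'_def sum_distrib_right intro!: sum.cong)
      finally show ?thesis .
    qed
    fix u :: complex assume u: "cmod u = 1"
    have split: "(\<Prod>l\<leftarrow>ls. u ^ ws ! (l div 2) * x l) = u ^ (\<Sum>l\<leftarrow>ls. ws ! (l div 2)) * (\<Prod>l\<leftarrow>ls. x l)" for ls x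
      by (induction ls) (auto simp: mult_ac power_add)
    have opl: "complex_of_real (prod_list xs) = prod_list (map complex_of_real xs)" for xs by (induction xs) auto
    have "u ^ m * f (graded_scale ws u z) =
       (\<Sum>ls\<in>L. C ls * (u ^ m * of_real (\<Prod>l\<leftarrow>ls. Kcoords ?N (graded_scale ws u z) l)))"
      by (simp add: fz sum_distrib_left mult_ac)
    also have "\<dots> = (\<Sum>ls\<in>L. C ls * poly (p z ls) u)"
      by (intro sum.cong refl) (simp add: pu[OF u] split sumL opl o_def)
    finally show "u ^ m * f (graded_scale ws u z) = poly ?P u" by (simp add: poly_sum)
  qed
  then show ?thesis by blast
qed

text \<open>A finite connected set has at most one point, but the circle contains 1 and -1.\<close>

lemma infinite_unit_circle: "infinite {u. cmod u = 1}"
proof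
  assume fin: "finite {u. cmod u = 1}"
  have "connected (sphere (0::complex) 1)" by (rule connected_sphere) simp
  moreover have "sphere (0::complex) 1 = {u. cmod u = 1}" by (auto simp: dist_norm)
  ultimately have "connected {u. cmod u = 1}" by simp
  then have "{u. cmod u = 1} = {} \<or> (\<exists>x. {u. cmod u = 1} = {x})" using fin connected_finite_iff_sing by blast
  moreover have "1 \<in> {u. cmod u = 1}" "-1 \<in> {u. cmod u = 1}" by auto
  moreover have "(1::complex) \<noteq> -1" by simp
  ultimately show False by (metis empty_iff singletonD)
qed

lemma poly_eq_on_unit_circle:
  assumes "\<And>u. cmod u = 1 \<Longrightarrow> poly P u = poly Q u"
  shows "P = Q"
proof (rule ccontr)
  assume "P \<noteq> Q"
  then have "finite {x. poly (P - Q) x = 0}" by (intro poly_roots_finite) simp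
  moreover have "{u. cmod u = 1} \<subseteq> {x. poly (P - Q) x = 0}" using assms by auto
  ultimately show False using infinite_unit_circle finite_subset by blast
qed

interpretation complex_field: graded_field "TYPE(complex)"
proof
  fix ws w and f :: "(nat \<Rightarrow> complex) \<Rightarrow> complex"
  assume ws: "\<And>v. v \<in> set ws \<Longrightarrow> 1 \<le> v" and w: "1 \<le> w"
    and f: "ksmf (Kspace_manifold (length ws)) (Kspace (length ws)) f"
    and hom: "\<And>\<xi> z. z \<in> Kspace (length ws) \<Longrightarrow> f (graded_scale ws \<xi> z) = \<xi> ^ w * f z"
  obtain c where c: "\<forall>z\<in>Kspace (length ws). \<exists>P. degree P \<le> 2 * w \<and>
     coeff P (2 * w) = (\<Sum>as\<in>index_lists (length ws) (\<lambda>a. ws ! a) w. c as * (\<Prod>a\<leftarrow>as. z a)) \<and>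
     (\<forall>u. cmod u = 1 \<longrightarrow> u ^ w * f (graded_scale ws u z) = poly P u)"
    using real_homogeneous_circle_polynomial[OF ws f, of w] hom by blast
  have "f z = (\<Sum>as\<in>index_lists (length ws) (\<lambda>a. ws ! a) w. c as * (\<Prod>a\<leftarrow>as. z a))" if z: "z \<in> Kspace (length ws)" for z
  proof -
    obtain P where P: "coeff P (2 * w) = (\<Sum>as\<in>index_lists (length ws) (\<lambda>a. ws ! a) w. c as * (\<Prod>a\<leftarrow>as. z a))"
      "\<And>u. cmod u = 1 \<Longrightarrow> u ^ w * f (graded_scale ws u z) = poly P u" using c z by blast
    \<comment> \<open>For complex homogeneous \<open>f\<close> the function on the circle is
      \<open>u ^ (2 * w) * f z\<close>; so the top coefficient, the part of \<open>f\<close> free of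
      conjugates, is all of \<open>f z\<close>.\<close>
    have "P = monom (f z) (2 * w)"
      by (rule poly_eq_on_unit_circle) (simp add: P(2)[symmetric] hom[OF z] poly_monom mult_2_right power_add mult_ac)
    then show ?thesis using P(1) by simp
  qed
  then show "homogeneous_polynomial ws w f"
    unfolding homogeneous_polynomial_def index_lists_nonempty[OF w] by blast
qed

section \<open>Homogeneous polynomials and isomorphisms of graded spaces\<close>

lemma homogeneous_polynomial_scale:
  assumes "homogeneous_polynomial ws w f" "z \<in> Kspace (length ws)"
  shows "f (graded_scale ws \<xi> z) = \<xi> ^ w * f z"
proof -
  let ?S = "{as. as \<noteq> [] \<and> set as \<subseteq> {..<length ws} \<and> (\<Sum>a\<leftarrow>as. ws ! a) = w}"
  obtain c where c: "\<And>z. z \<in> Kspace (length ws) \<Longrightarrow> f z = (\<Sum>as\<in>?S. c as * (\<Prod>a\<leftarrow>as. z a))"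
    using assms(1) unfolding homogeneous_polynomial_def by blast
  have "set as \<subseteq> {..<length ws} \<Longrightarrow> (\<Prod>a\<leftarrow>as. graded_scale ws \<xi> z a) = \<xi> ^ (\<Sum>a\<leftarrow>as. ws ! a) * (\<Prod>a\<leftarrow>as. z a)" for as
    by (induction as) (auto simp: graded_scale_def power_add mult_ac)
  then show ?thesis
    unfolding c[OF assms(2)] c[OF graded_scale_Kspace] sum_distrib_left by (intro sum.cong refl) (auto simp: mult_ac)
qed

lemma homogeneous_polynomial_zero:
  assumes "homogeneous_polynomial ws w f"
  shows "f (\<lambda>_. 0) = 0"
proof -
  let ?S = "{as. as \<noteq> [] \<and> set as \<subseteq> {..<length ws} \<and> (\<Sum>a\<leftarrow>as. ws ! a) = w}"
  obtain c where c: "\<And>z. z \<in> Kspace (length ws) \<Longrightarrow> f z = (\<Sum>as\<in>?S. c as * (\<Prod>a\<leftarrow>as. z a))"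
    using assms(1) unfolding homogeneous_polynomial_def by blast
  have "(\<Prod>a\<leftarrow>as. 0) = (0 :: 'a)" if "as \<noteq> []" for as :: "nat list" using that by (cases as) auto
  then show ?thesis by (subst c) (auto simp: Kspace_def intro!: sum.neutral)
qed

definition unit_vec :: "nat \<Rightarrow> nat \<Rightarrow> 'k::zero_neq_one" where
  "unit_vec b = (\<lambda>a. if a = b then 1 else 0)"

definition lower_part :: "nat list \<Rightarrow> nat \<Rightarrow> (nat \<Rightarrow> 'k::zero) \<Rightarrow> nat \<Rightarrow> 'k" where
  "lower_part ws w z = (\<lambda>a. if a < length ws \<and> ws ! a < w then z a else 0)"

text \<open>A monomial of weight \<open>w\<close> in which a coordinate of weight at least \<open>w\<close> occurs is this single coordinate.\<close>

lemma homogeneous_polynomial_decomposition: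
  fixes f :: "(nat \<Rightarrow> 'k::comm_ring_1) \<Rightarrow> 'k"
  assumes ws: "\<And>v. v \<in> set ws \<Longrightarrow> 1 \<le> v" and f: "homogeneous_polynomial ws w f" and z: "z \<in> Kspace (length ws)"
  shows "f z = f (lower_part ws w z) + (\<Sum>b | b < length ws \<and> ws ! b = w. f (unit_vec b) * z b)"
proof -
  let ?n = "length ws"
  define S where "S = {as. as \<noteq> [] \<and> set as \<subseteq> {..<length ws} \<and> (\<Sum>a\<leftarrow>as. ws ! a) = w}"
  define S1 where "S1 = {as \<in> S. \<forall>a\<in>set as. ws ! a < w}"
  obtain c where c: "\<And>z. z \<in> Kspace ?n \<Longrightarrow> f z = (\<Sum>as\<in>S. c as * (\<Prod>a\<leftarrow>as. z a))"
    using f unfolding homogeneous_polynomial_def S_def by blast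
  let ?B = "{b. b < ?n \<and> ws ! b = w}"
  have finS: "finite S"
  proof (rule finite_subset[OF _ finite_index_lists[of ?n "\<lambda>a. ws ! a" w]])
    show "1 \<le> ws ! i" if "i < ?n" for i using ws[OF nth_mem[OF that]] .
  qed (auto simp: index_lists_def S_def)
  have "as \<in> (\<lambda>b. [b]) ` ?B" if as: "as \<in> S" and a: "a \<in> set as" "\<not> ws ! a < w" for as a
  proof -
    obtain xs ys where e: "as = xs @ a # ys" using split_list[OF a(1)] by blast
    have s: "(\<Sum>a\<leftarrow>xs. ws ! a) + (\<Sum>a\<leftarrow>ys. ws ! a) + ws ! a = w" using as e by (simp add: S_def)
    have pos: "1 \<le> ws ! x" if "x \<in> set as" for x using that as by (intro ws nth_mem) (auto simp: S_def)
    have "xs = []"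
    proof (cases xs)
      case (Cons x xs') then show ?thesis using s a(2) pos[of x] e by simp
    qed
    moreover have "ys = []"
    proof (cases ys)
      case (Cons x xs') then show ?thesis using s a(2) pos[of x] e by simp
    qed
    ultimately show ?thesis using e s as by (auto simp: S_def)
  qed
  then have S: "S = S1 \<union> (\<lambda>b. [b]) ` ?B" and disj: "S1 \<inter> (\<lambda>b. [b]) ` ?B = {}"
    by (auto simp: S1_def) (use ws in \<open>auto simp: S_def dest!: nth_mem\<close>)
  define A where "A = (\<lambda>z. \<Sum>as\<in>S1. c as * (\<Prod>a\<leftarrow>as. z a))"
  have fAB: "f z = A z + (\<Sum>b\<in>?B. c [b] * z b)" if "z \<in> Kspace ?n" for z
  proof -
    have "f z = A z + (\<Sum>as\<in>(\<lambda>b. [b]) ` ?B. c as * (\<Prod>a\<leftarrow>as. z a))"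
      unfolding c[OF that] A_def S
      by (rule sum.union_disjoint) (use finS disj in \<open>auto simp: S1_def\<close>)
    also have "(\<Sum>as\<in>(\<lambda>b. [b]) ` ?B. c as * (\<Prod>a\<leftarrow>as. z a)) = (\<Sum>b\<in>?B. c [b] * z b)"
      by (subst sum.reindex) (auto simp: inj_on_def)
    finally show ?thesis .
  qed
  have low: "lower_part ws w z \<in> Kspace ?n" by (simp add: lower_part_def Kspace_def)
  have "A (lower_part ws w z) = A z"
    unfolding A_def
    by (intro sum.cong refl arg_cong2[of _ _ _ _ "(*)"] arg_cong[of _ _ prod_list] map_cong) (auto simp: lower_part_def S1_def S_def)
  then have 1: "f (lower_part ws w z) = A z"
    using fAB[OF low] by (simp add: lower_part_def sum.neutral)
  \<comment> \<open>Evaluation at a basis vector isolates the coefficient of the one-letter word: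
    the words in \<open>S1\<close> have only letters of lower weight, which vanish there.\<close>
  have 2: "f (unit_vec b) = c [b]" if b: "b \<in> ?B" for b
  proof -
    have u: "unit_vec b \<in> Kspace ?n" using b by (auto simp: unit_vec_def Kspace_def)
    have "(\<Prod>a\<leftarrow>as. unit_vec b a) = (0 :: 'k)" if "as \<in> S1" for as
      using that b by (cases as) (auto simp: unit_vec_def S1_def S_def)
    then have "A (unit_vec b) = 0" unfolding A_def by (auto intro: sum.neutral)
    moreover have "(\<Sum>b'\<in>?B. c [b'] * unit_vec b b') = c [b]"
      using b by (subst sum.mono_neutral_right[of _ "{b}"]) (auto simp: unit_vec_def)
    ultimately show ?thesis using fAB[OF u] by simp
  qed
  show ?thesis using fAB[OF z] 1 2 by simp
qed

lemma unit_vec_Kspace: "b < N \<Longrightarrow> unit_vec b \<in> Kspace N"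
  by (auto simp: unit_vec_def Kspace_def)

lemma homogeneous_polynomial_unit_vec:
  fixes f :: "(nat \<Rightarrow> 'k::comm_ring_1) \<Rightarrow> 'k"
  assumes ws: "\<And>v. v \<in> set ws \<Longrightarrow> 1 \<le> v" and f: "homogeneous_polynomial ws w f" and b: "b < length ws" "w < ws ! b"
  shows "f (unit_vec b) = 0"
proof -
  have "lower_part ws w (unit_vec b :: nat \<Rightarrow> 'k) = (\<lambda>_. 0)" using b by (auto simp: lower_part_def unit_vec_def)
  moreover have "(\<Sum>b' | b' < length ws \<and> ws ! b' = w. f (unit_vec b') * unit_vec b b') = 0"
    using b by (intro sum.neutral) (auto simp: unit_vec_def)
  ultimately show ?thesis
    using homogeneous_polynomial_decomposition[OF ws f unit_vec_Kspace[OF b(1)]] homogeneous_polynomial_zero[OF f] by simp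
qed

lemma graded_space_morphism_scale:
  assumes g: "graded_space_morphism ws ws' g" and z: "z \<in> Kspace (length ws)"
  shows "g (graded_scale ws \<xi> z) = graded_scale ws' \<xi> (g z)"
proof
  fix b
  have K: "g (graded_scale ws \<xi> z) \<in> Kspace (length ws')" using g unfolding graded_space_morphism_def by auto
  show "g (graded_scale ws \<xi> z) b = graded_scale ws' \<xi> (g z) b"
  proof (cases "b < length ws'")
    case True
    then have "homogeneous_polynomial ws (ws' ! b) (\<lambda>z. g z b)" using g unfolding graded_space_morphism_def by blast
    from homogeneous_polynomial_scale[OF this z] show ?thesis using True by (simp add: graded_scale_def)
  next
    case False then show ?thesis using K by (simp add: graded_scale_def Kspace_def)
  qed
qed

text \<open>In every weight, the linear parts of an isomorphism and of its inverse are inverse matrices,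
  whose sizes are the traces of the two products.\<close>

lemma graded_isomorphic_weights:
  fixes g :: "(nat \<Rightarrow> 'k::{comm_ring_1, ring_char_0}) \<Rightarrow> nat \<Rightarrow> 'k"
  assumes ws: "is_weights ws" and ws': "is_weights ws'" and iso: "graded_space_isomorphism ws ws' g"
  shows "ws = ws'"
proof -
  obtain g' where g: "graded_space_morphism ws ws' g" and g': "graded_space_morphism ws' ws g'"
    and inv: "\<And>z. z \<in> Kspace (length ws) \<Longrightarrow> g' (g z) = z" "\<And>z. z \<in> Kspace (length ws') \<Longrightarrow> g (g' z) = z"
    using iso unfolding graded_space_isomorphism_def by blast
  \<comment> \<open>At a basis vector of weight \<open>j\<close> the components of \<open>h\<close>
    of lower weight vanish, so the component \<open>a\<close> of \<open>h'\<close> is reduced to its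
    linear part. In each weight, the matrices of linear parts are thus one-sided inverses of each
    other.\<close>
  have matrix: "(\<Sum>c | c < length vs' \<and> vs' ! c = j. h' (unit_vec c) a * h (unit_vec b) c) = (if a = b then 1 else 0)"
    if vs: "is_weights vs" and vs': "is_weights vs'"
      and h: "graded_space_morphism vs vs' h" and h': "graded_space_morphism vs' vs h'"
      and inv: "\<And>z. z \<in> Kspace (length vs) \<Longrightarrow> h' (h z) = z"
      and a: "a < length vs" "vs ! a = j" and b: "b < length vs" "vs ! b = j"
    for vs vs' h j a b and h' :: "(nat \<Rightarrow> 'k) \<Rightarrow> nat \<Rightarrow> 'k"
  proof -
    have K: "h (unit_vec b) \<in> Kspace (length vs')"
    proof -
      have "unit_vec b \<in> (Kspace (length vs) :: (nat \<Rightarrow> 'k) set)" by (rule unit_vec_Kspace[OF b(1)])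
      then show ?thesis using h unfolding graded_space_morphism_def by blast
    qed
    have pa: "homogeneous_polynomial vs' j (\<lambda>z. h' z a)" using h' a unfolding graded_space_morphism_def by blast
    have "h (unit_vec b) c = 0" if "c < length vs'" "vs' ! c < j" for c
      by (rule homogeneous_polynomial_unit_vec[of vs "vs' ! c" "\<lambda>z. h z c" b])
        (use that h b vs in \<open>auto simp: graded_space_morphism_def is_weights_def\<close>)
    then have "lower_part vs' j (h (unit_vec b)) = (\<lambda>_. 0)" by (auto simp: lower_part_def)
    then have "h' (h (unit_vec b)) a = (\<Sum>c | c < length vs' \<and> vs' ! c = j. h' (unit_vec c) a * h (unit_vec b) c)"
      using homogeneous_polynomial_decomposition[OF _ pa K] homogeneous_polynomial_zero[OF pa] vs'
      by (simp add: is_weights_def)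
    then show ?thesis using inv[OF unit_vec_Kspace[OF b(1)]] by (simp add: unit_vec_def)
  qed
  have "card {b. b < length ws \<and> ws ! b = j} = card {c. c < length ws' \<and> ws' ! c = j}" for j
  proof -
    let ?B = "{b. b < length ws \<and> ws ! b = j}" and ?C = "{c. c < length ws' \<and> ws' ! c = j}"
    \<comment> \<open>The trace of an identity matrix is its size as an element of the ring;
      characteristic zero recovers the number.\<close>
    have "(of_nat (card ?B) :: 'k) = (\<Sum>b\<in>?B. \<Sum>c\<in>?C. g' (unit_vec c) b * g (unit_vec b) c)"
      using matrix[OF ws ws' g g' inv(1)] by simp
    also have "\<dots> = (\<Sum>c\<in>?C. \<Sum>b\<in>?B. g (unit_vec b) c * g' (unit_vec c) b)"
      by (subst sum.swap) (simp add: mult.commute)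
    also have "\<dots> = of_nat (card ?C)"
      using matrix[OF ws' ws g' g inv(2)] by simp
    finally show ?thesis by (simp only: of_nat_eq_iff)
  qed
  then have "mset ws = mset ws'"
    by (intro multiset_eqI) (simp add: count_mset count_list_eq_length_filter length_filter_conv_card eq_commute)
  then show ?thesis using ws ws' unfolding is_weights_def by (metis properties_for_sort)
qed

section \<open>Homogeneous coordinates and graded bundles\<close>

definition over :: "'e manifold \<Rightarrow> ('e \<Rightarrow> 'b) \<Rightarrow> 'b set \<Rightarrow> 'e set" where
  "over M \<tau> U = {p \<in> mcarrier M. \<tau> p \<in> U}"

lemma over_iff: "p \<in> over M \<tau> U \<longleftrightarrow> p \<in> mcarrier M \<and> \<tau> p \<in> U"
  by (simp add: over_def)

text \<open>\<open>\<sigma>\<close> is the inverse of the trivialization, as a function of base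
  point and coordinates. Its domain is an open subset of the full product of \<open>B\<close> with
  the coordinate space, which avoids the open submanifolds in
  \<open>local_trivialization\<close>.\<close>

definition coord_section :: "'e manifold \<Rightarrow> 'b manifold \<Rightarrow> ('e \<Rightarrow> 'b) \<Rightarrow> nat \<Rightarrow> 'b set \<Rightarrow>
    ('e \<Rightarrow> nat \<Rightarrow> 'k::euclidean_space) \<Rightarrow> ('b \<Rightarrow> (nat \<Rightarrow> 'k) \<Rightarrow> 'e) \<Rightarrow> bool" where
  "coord_section M B \<tau> N U \<psi> \<sigma> \<longleftrightarrow>
     smap (product_manifold B (Kspace_manifold N)) (U \<times> Kspace N) M (\<lambda>x. \<sigma> (fst x) (snd x)) \<and>
     (\<forall>q\<in>U. \<forall>z\<in>Kspace N. \<tau> (\<sigma> q z) = q \<and> \<psi> (\<sigma> q z) = z) \<and>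
     (\<forall>p\<in>over M \<tau> U. \<sigma> (\<tau> p) (\<psi> p) = p)"

definition coord_triv :: "'e manifold \<Rightarrow> 'b manifold \<Rightarrow> ('e \<Rightarrow> 'b) \<Rightarrow> nat \<Rightarrow> 'b set \<Rightarrow>
    ('e \<Rightarrow> nat \<Rightarrow> 'k::euclidean_space) \<Rightarrow> bool" where
  "coord_triv M B \<tau> N U \<psi> \<longleftrightarrow> openin (mtop B) U \<and> smap M (over M \<tau> U) (Kspace_manifold N) \<psi> \<and>
     (\<exists>\<sigma>. coord_section M B \<tau> N U \<psi> \<sigma>)"

definition hom_coords :: "'e manifold \<Rightarrow> ('e \<Rightarrow> 'b) \<Rightarrow> nat list \<Rightarrow> ('k::comm_ring_1 \<Rightarrow> 'e \<Rightarrow> 'e) \<Rightarrow> 'b set \<Rightarrow>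
    ('e \<Rightarrow> nat \<Rightarrow> 'k) \<Rightarrow> bool" where
  "hom_coords M \<tau> ws h U \<psi> \<longleftrightarrow> (\<forall>\<xi>. \<forall>p\<in>over M \<tau> U. \<psi> (h \<xi> p) = graded_scale ws \<xi> (\<psi> p))"

lemma coord_sectionD:
  assumes "coord_section M B \<tau> N U \<psi> \<sigma>"
  shows "smap (product_manifold B (Kspace_manifold N)) (U \<times> Kspace N) M (\<lambda>x. \<sigma> (fst x) (snd x))"
    "\<And>q z. q \<in> U \<Longrightarrow> z \<in> Kspace N \<Longrightarrow> \<tau> (\<sigma> q z) = q" "\<And>q z. q \<in> U \<Longrightarrow> z \<in> Kspace N \<Longrightarrow> \<psi> (\<sigma> q z) = z"
    "\<And>p. p \<in> over M \<tau> U \<Longrightarrow> \<sigma> (\<tau> p) (\<psi> p) = p"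
    "\<And>q z. q \<in> U \<Longrightarrow> z \<in> Kspace N \<Longrightarrow> \<sigma> q z \<in> mcarrier M"
    "\<And>q z. q \<in> U \<Longrightarrow> z \<in> Kspace N \<Longrightarrow> \<sigma> q z \<in> over M \<tau> U"
proof -
  show 1: "smap (product_manifold B (Kspace_manifold N)) (U \<times> Kspace N) M (\<lambda>x. \<sigma> (fst x) (snd x))"
    and 2: "\<And>q z. q \<in> U \<Longrightarrow> z \<in> Kspace N \<Longrightarrow> \<tau> (\<sigma> q z) = q" and "\<And>q z. q \<in> U \<Longrightarrow> z \<in> Kspace N \<Longrightarrow> \<psi> (\<sigma> q z) = z"
    and "\<And>p. p \<in> over M \<tau> U \<Longrightarrow> \<sigma> (\<tau> p) (\<psi> p) = p"
    using assms by (auto simp: coord_section_def)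
  show 3: "\<sigma> q z \<in> mcarrier M" if "q \<in> U" "z \<in> Kspace N" for q z
    using smap_image[OF 1, of "(q, z)"] that by simp
  show "\<sigma> q z \<in> over M \<tau> U" if "q \<in> U" "z \<in> Kspace N" for q z
    using 3[OF that] 2[OF that] that by (simp add: over_iff)
qed

lemma coord_trivD:
  assumes "coord_triv M B \<tau> N U \<psi>"
  shows "openin (mtop B) U" "smap M (over M \<tau> U) (Kspace_manifold N) \<psi>" "openin (mtop M) (over M \<tau> U)"
    "\<And>p. p \<in> over M \<tau> U \<Longrightarrow> \<psi> p \<in> Kspace N"
proof -
  show 1: "openin (mtop B) U" "smap M (over M \<tau> U) (Kspace_manifold N) \<psi>"
    using assms by (auto simp: coord_triv_def)
  show "openin (mtop M) (over M \<tau> U)" using 1(2) by (rule smap_open)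
  show "\<psi> p \<in> Kspace N" if "p \<in> over M \<tau> U" for p
    using smap_image[OF 1(2) that] by simp
qed

lemma coord_trivE:
  assumes "coord_triv M B \<tau> N U \<psi>"
  obtains \<sigma> where "coord_section M B \<tau> N U \<psi> \<sigma>"
  using assms by (auto simp: coord_triv_def)

lemma coord_eqI:
  assumes s: "coord_section M B \<tau> N U \<psi> \<sigma>" and p: "p \<in> over M \<tau> U" "p' \<in> over M \<tau> U" "\<tau> p = \<tau> p'" "\<psi> p = \<psi> p'"
  shows "p = p'"
  using coord_sectionD(4)[OF s p(1)] coord_sectionD(4)[OF s p(2)] p(3,4) by metis

text \<open>Both components of the identity are smooth on either side, so the product with an open
  submanifold may be replaced by an open part of the product.\<close>

lemma smap_prod_open_id:
  assumes B: "atlas_manifold B" and U: "openin (mtop B) U" and K: "atlas_manifold K"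
  shows "smap (product_manifold B K) (U \<times> mcarrier K) (product_manifold (open_submanifold B U) K) (\<lambda>x. x)"
    "smap (product_manifold (open_submanifold B U) K) (U \<times> mcarrier K) (product_manifold B K) (\<lambda>x. x)"
proof -
  note BU = atlas_open_submanifold[OF B U] and P = atlas_product_manifold[OF B K]
  note PU = atlas_product_manifold[OF BU K]
  have o1: "openin (mtop (product_manifold B K)) (U \<times> mcarrier K)"
    using U by (simp add: openin_prod_Times_iff)
  have "openin (subtopology (mtop B) U) U" using U by (simp add: openin_open_subtopology)
  then have o2: "openin (mtop (product_manifold (open_submanifold B U) K)) (U \<times> mcarrier K)"
    by (simp add: openin_prod_Times_iff)
  have "smap (product_manifold B K) (U \<times> mcarrier K) (open_submanifold B U) fst"
    unfolding smap_into_open_submanifold[OF B U] using smap_fst[OF B K o1] by auto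
  from smap_pair[OF BU K P this smap_snd[OF B K o1]]
  show "smap (product_manifold B K) (U \<times> mcarrier K) (product_manifold (open_submanifold B U) K) (\<lambda>x. x)"
    by simp
  have "smap (product_manifold (open_submanifold B U) K) (U \<times> mcarrier K) B fst"
    using smap_fst[OF BU K o2] unfolding smap_into_open_submanifold[OF B U] by blast
  from smap_pair[OF B K PU this smap_snd[OF BU K o2]]
  show "smap (product_manifold (open_submanifold B U) K) (U \<times> mcarrier K) (product_manifold B K) (\<lambda>x. x)"
    by simp
qed

text \<open>The first component of the trivialization is the projection, smooth by assumption; what
  remains of the diffeomorphism is the smoothness of \<open>\<psi>\<close> and of an inverse
  \<open>\<sigma>\<close>. Trivializations are used in this form from here on.\<close>

lemma local_trivialization_iff:
  fixes E :: "('e, 'b, 'k::euclidean_space) graded_bundle"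
  assumes M: "atlas_manifold (tot E)" and B: "atlas_manifold (base E)" and \<tau>: "smooth_map (tot E) (base E) (proj E)"
  shows "local_trivialization E (U, \<psi>) \<longleftrightarrow> coord_triv (tot E) (base E) (proj E) (length (weights E)) U \<psi>"
proof -
  let ?M = "tot E" and ?B = "base E" and ?\<tau> = "proj E" and ?N = "length (weights E)"
  let ?K = "Kspace_manifold ?N :: (nat \<Rightarrow> 'k) manifold" and ?PU = "over ?M ?\<tau> U"
  let ?MU = "open_submanifold ?M ?PU" and ?BU = "open_submanifold ?B U"
  let ?F = "\<lambda>p. (?\<tau> p, \<psi> p)"
  have st: "smap ?M (mcarrier ?M) ?B ?\<tau>" using \<tau> smooth_map_iff_smap[OF M B] by simp
  have def: "local_trivialization E (U, \<psi>) \<longleftrightarrow> openin (mtop ?B) U \<and> diffeomorphism ?MU (product_manifold ?BU ?K) ?F"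
    by (simp add: local_trivialization_def over_def)
  show ?thesis
  proof (cases "openin (mtop ?B) U")
    case False then show ?thesis by (simp add: def coord_triv_def)
  next
    case U: True
    have "over ?M ?\<tau> U = mcarrier ?M \<inter> ?\<tau> -` U" by (auto simp: over_def)
    then have PU: "openin (mtop ?M) ?PU" using smap_open_preimage[OF st B U] by simp
    have K: "atlas_manifold ?K" by simp
    note MU = atlas_open_submanifold[OF M PU] and BU = atlas_open_submanifold[OF B U]
    note QU = atlas_product_manifold[OF BU K]
    have cM: "mcarrier ?MU = ?PU" using openin_subset[OF PU] by auto
    have cQ: "mcarrier (product_manifold ?BU ?K) = U \<times> Kspace ?N" using openin_subset[OF U] by auto
    have stU: "smap ?M ?PU ?B ?\<tau>" by (rule smap_subset[OF M st PU]) (auto simp: over_def)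
    note id = smap_prod_open_id[OF B U K, simplified]
    have F: "smooth_map ?MU (product_manifold ?BU ?K) ?F \<longleftrightarrow> smap ?M ?PU ?K \<psi>"
    proof -
      have "smap ?MU ?PU (product_manifold ?BU ?K) ?F \<longleftrightarrow> smap ?M ?PU ?K \<psi>"
      proof
        assume L: "smap ?MU ?PU (product_manifold ?BU ?K) ?F"
        have o: "openin (mtop (product_manifold ?BU ?K)) (mcarrier (product_manifold ?BU ?K))"
          by (rule openin_topspace)
        have "smap ?MU ?PU ?K (\<lambda>p. snd (?F p))"
          by (rule smap_compose[OF L smap_snd[OF BU K o]]) (use smap_image[OF L] in auto)
        then show "smap ?M ?PU ?K \<psi>" unfolding smap_from_open_submanifold[OF M PU] by simp
      next
        assume R: "smap ?M ?PU ?K \<psi>"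
        have "smap ?MU ?PU ?K \<psi>" unfolding smap_from_open_submanifold[OF M PU] using R by simp
        moreover have "smap ?MU ?PU ?BU ?\<tau>"
          unfolding smap_from_open_submanifold[OF M PU] smap_into_open_submanifold[OF B U]
          using stU by (auto simp: over_def)
        ultimately show "smap ?MU ?PU (product_manifold ?BU ?K) ?F" by (intro smap_pair[OF BU K MU])
      qed
      then show ?thesis using smooth_map_iff_smap[OF MU QU] unfolding cM by simp
    qed
    have G: "smooth_map (product_manifold ?BU ?K) ?MU g \<longleftrightarrow>
        smap (product_manifold ?B ?K) (U \<times> Kspace ?N) ?M g \<and> g ` (U \<times> Kspace ?N) \<subseteq> ?PU" for g
    proof -
      have "smap (product_manifold ?BU ?K) (U \<times> Kspace ?N) ?M g \<longleftrightarrow> smap (product_manifold ?B ?K) (U \<times> Kspace ?N) ?M g"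
        using smap_compose[OF id(1), of "U \<times> Kspace ?N" ?M g] smap_compose[OF id(2), of "U \<times> Kspace ?N" ?M g] by auto
      then show ?thesis
        unfolding smooth_map_iff_smap[OF QU MU] cQ smap_into_open_submanifold[OF M PU] by simp
    qed
    have "diffeomorphism ?MU (product_manifold ?BU ?K) ?F \<longleftrightarrow> smap ?M ?PU ?K \<psi> \<and> (\<exists>\<sigma>. coord_section ?M ?B ?\<tau> ?N U \<psi> \<sigma>)"
    proof
      assume "diffeomorphism ?MU (product_manifold ?BU ?K) ?F"
      then obtain g where g: "smap ?M ?PU ?K \<psi>" "smap (product_manifold ?B ?K) (U \<times> Kspace ?N) ?M g"
        "\<And>p. p \<in> ?PU \<Longrightarrow> g (?F p) = p" "\<And>x. x \<in> U \<times> Kspace ?N \<Longrightarrow> ?F (g x) = x"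
        unfolding diffeomorphism_def F G cM cQ by blast
      have "coord_section ?M ?B ?\<tau> ?N U \<psi> (\<lambda>q z. g (q, z))"
        unfolding coord_section_def
      proof (intro conjI ballI)
        fix q and z :: "nat \<Rightarrow> 'k" assume "q \<in> U" "z \<in> Kspace ?N"
        then show "?\<tau> (g (q, z)) = q" "\<psi> (g (q, z)) = z" using g(4)[of "(q, z)"] by auto
      qed (use g in auto)
      then show "smap ?M ?PU ?K \<psi> \<and> (\<exists>\<sigma>. coord_section ?M ?B ?\<tau> ?N U \<psi> \<sigma>)" using g(1) by blast
    next
      assume "smap ?M ?PU ?K \<psi> \<and> (\<exists>\<sigma>. coord_section ?M ?B ?\<tau> ?N U \<psi> \<sigma>)"
      then obtain \<sigma> where s: "smap ?M ?PU ?K \<psi>" "coord_section ?M ?B ?\<tau> ?N U \<psi> \<sigma>" by blast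
      show "diffeomorphism ?MU (product_manifold ?BU ?K) ?F"
        unfolding diffeomorphism_def F G cM cQ
        by (intro conjI s(1) exI[of _ "\<lambda>x. \<sigma> (fst x) (snd x)"]) (use coord_sectionD[OF s(2)] in auto)
    qed
    then show ?thesis unfolding def coord_triv_def using U by simp
  qed
qed

section \<open>Intertwining maps between fibers\<close>

definition fibered_action :: "'e manifold \<Rightarrow> ('e \<Rightarrow> 'b) \<Rightarrow> ('k \<Rightarrow> 'e \<Rightarrow> 'e) \<Rightarrow> bool" where
  "fibered_action M \<tau> h \<longleftrightarrow> (\<forall>\<xi>. \<forall>p\<in>mcarrier M. h \<xi> p \<in> mcarrier M \<and> \<tau> (h \<xi> p) = \<tau> p)"

lemma fibered_action_over: "fibered_action M \<tau> h \<Longrightarrow> p \<in> over M \<tau> U \<Longrightarrow> h \<xi> p \<in> over M \<tau> U"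
  by (auto simp: fibered_action_def over_def)

lemma coord_section_scale:
  assumes s: "coord_section M B \<tau> (length ws) U \<psi> \<sigma>" and h: "fibered_action M \<tau> h" and hc: "hom_coords M \<tau> ws h U \<psi>"
    and q: "q \<in> U" and z: "z \<in> Kspace (length ws)"
  shows "\<sigma> q (graded_scale ws \<xi> z) = h \<xi> (\<sigma> q z)"
proof -
  note p = coord_sectionD(6)[OF s q z]
  have "\<psi> (h \<xi> (\<sigma> q z)) = graded_scale ws \<xi> z"
    using hc p coord_sectionD(3)[OF s q z] by (simp add: hom_coords_def)
  moreover have "\<tau> (h \<xi> (\<sigma> q z)) = q"
    using h p coord_sectionD(2)[OF s q z] by (simp add: fibered_action_def over_iff)
  ultimately show ?thesis using coord_sectionD(4)[OF s fibered_action_over[OF h p, of \<xi>]] by simp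
qed

lemma smap_section_fiber:
  assumes B: "atlas_manifold B" and s: "coord_section M B \<tau> N U \<psi> \<sigma>" and U: "openin (mtop B) U" and q: "q \<in> U"
  shows "smap (Kspace_manifold N :: (nat \<Rightarrow> 'k::euclidean_space) manifold) (Kspace N) M (\<sigma> q)"
proof -
  let ?K = "Kspace_manifold N :: (nat \<Rightarrow> 'k) manifold"
  have o: "openin (mtop ?K) (Kspace N)" by simp
  have "q \<in> mcarrier B" using q openin_subset[OF U] by auto
  then have "smap ?K (Kspace N) B (\<lambda>_. q)" using smap_const[OF _ B o] by simp
  from smap_pair[OF B atlas_Kspace atlas_Kspace this smap_id[OF atlas_Kspace o]]
  have "smap ?K (Kspace N) (product_manifold B ?K) (\<lambda>z. (q, z))" .
  from smap_compose[OF this coord_sectionD(1)[OF s]] show ?thesis using q by auto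
qed

context graded_field
begin

text \<open>Restricted to the fiber over \<open>q\<close> and read in coordinates, an intertwining
  smooth map is homogeneous in each component, so \<open>smooth_homogeneous\<close> applies. The
  target data are kept general because \<open>\<Phi>\<close> will be a morphism, the identity
  between two trivializations, or a single map \<open>H \<xi>\<close>.\<close>

lemma intertwining_polynomial:
  fixes h :: "'k \<Rightarrow> 'e \<Rightarrow> 'e" and h' :: "'k \<Rightarrow> 'e2 \<Rightarrow> 'e2"
  assumes B: "atlas_manifold B"
    and ws: "\<And>v. v \<in> set ws \<Longrightarrow> 1 \<le> v" and ws': "\<And>v. v \<in> set ws' \<Longrightarrow> 1 \<le> v"
    and U: "coord_triv M B \<tau> (length ws) U \<psi>" "hom_coords M \<tau> ws h U \<psi>" and h: "fibered_action M \<tau> h"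
    and V: "smap M' V (Kspace_manifold (length ws')) \<theta>"
      "\<And>\<xi> p. p \<in> V \<Longrightarrow> \<theta> (h' \<xi> p) = graded_scale ws' \<xi> (\<theta> p)"
    and \<Phi>: "smap M W M' \<Phi>" and W: "\<And>p. p \<in> mcarrier M \<Longrightarrow> \<tau> p = q \<Longrightarrow> p \<in> W \<and> \<Phi> p \<in> V"
    and hh': "\<And>\<xi> p. p \<in> W \<Longrightarrow> \<tau> p = q \<Longrightarrow> \<Phi> (h \<xi> p) = h' \<xi> (\<Phi> p)"
    and q: "q \<in> U"
  shows "\<exists>g. graded_space_morphism ws ws' g \<and> (\<forall>p\<in>mcarrier M. \<tau> p = q \<longrightarrow> \<theta> (\<Phi> p) = g (\<psi> p))"
proof -
  let ?K = "Kspace_manifold (length ws) :: (nat \<Rightarrow> 'k) manifold"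
  obtain \<sigma> where s: "coord_section M B \<tau> (length ws) U \<psi> \<sigma>" using coord_trivE[OF U(1)] .
  define g where "g = (\<lambda>z. \<theta> (\<Phi> (\<sigma> q z)))"
  have p: "\<sigma> q z \<in> mcarrier M" "\<tau> (\<sigma> q z) = q" if "z \<in> Kspace (length ws)" for z
    using coord_sectionD[OF s] q that by auto
  have "smap ?K (Kspace (length ws)) M' (\<lambda>z. \<Phi> (\<sigma> q z))"
    by (rule smap_compose[OF smap_section_fiber[OF B s coord_trivD(1)[OF U(1)] q] \<Phi>]) (use p W in auto)
  then have gs: "smap ?K (Kspace (length ws)) (Kspace_manifold (length ws')) g"
    unfolding g_def by (rule smap_compose[OF _ V(1)]) (use p W in auto)
  have gK: "g z \<in> Kspace (length ws')" if "z \<in> Kspace (length ws)" for z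
    using smap_image[OF gs that] by simp
  \<comment> \<open>Scaling the coordinates is the action of \<open>h\<close> on the section;
    \<open>\<Phi>\<close> exchanges it for \<open>h'\<close>, which \<open>\<theta>\<close> reads as
    scaling with the weights \<open>ws'\<close>.\<close>
  have ghom: "g (graded_scale ws \<xi> z) = graded_scale ws' \<xi> (g z)" if z: "z \<in> Kspace (length ws)" for \<xi> z
    unfolding g_def coord_section_scale[OF s h U(2) q z]
    using hh' V(2) p[OF z] W by simp
  have "homogeneous_polynomial ws (ws' ! b) (\<lambda>z. g z b)" if b: "b < length ws'" for b
  proof (rule smooth_homogeneous[OF ws])
    show "1 \<le> ws' ! b" using ws' b by simp
    show "ksmf ?K (Kspace (length ws)) (\<lambda>z. g z b)"
      using gs b unfolding smap_Kspace_ksmf[OF atlas_Kspace] by blast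
    show "g (graded_scale ws \<xi> z) b = \<xi> ^ ws' ! b * g z b" if "z \<in> Kspace (length ws)" for \<xi> z
      using ghom[OF that] b by (simp add: graded_scale_def)
  qed
  then have "graded_space_morphism ws ws' g" unfolding graded_space_morphism_def using gK by auto
  moreover have "\<theta> (\<Phi> p) = g (\<psi> p)" if "p \<in> mcarrier M" "\<tau> p = q" for p
    using coord_sectionD(4)[OF s, of p] that q by (simp add: g_def over_iff)
  ultimately show ?thesis by blast
qed

text \<open>The polynomials in both directions come from the identity map, and they are inverse to
  each other because sections exist on both sides. The lists \<open>ws\<close> and
  \<open>ws'\<close> may differ, which later serves to compare the weights of two bundles.\<close>

lemma hom_coords_isomorphism:
  fixes \<psi> \<theta> :: "'e \<Rightarrow> nat \<Rightarrow> 'k"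
  assumes M: "atlas_manifold M" and B: "atlas_manifold B"
    and ws: "\<And>v. v \<in> set ws \<Longrightarrow> 1 \<le> v" and ws': "\<And>v. v \<in> set ws' \<Longrightarrow> 1 \<le> v"
    and U: "coord_triv M B \<tau> (length ws) U \<psi>" "hom_coords M \<tau> ws h U \<psi>"
    and V: "coord_triv M B \<tau> (length ws') V \<theta>" "hom_coords M \<tau> ws' h V \<theta>"
    and h: "fibered_action M \<tau> h" and q: "q \<in> U" "q \<in> V"
  shows "\<exists>g. graded_space_isomorphism ws ws' g \<and> (\<forall>p\<in>mcarrier M. \<tau> p = q \<longrightarrow> \<theta> p = g (\<psi> p))"
proof -
  have half: "\<exists>g. graded_space_morphism ws ws' g \<and> (\<forall>p\<in>mcarrier M. \<tau> p = q \<longrightarrow> \<theta> p = g (\<psi> p))"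
    if ws: "\<And>v. v \<in> set ws \<Longrightarrow> 1 \<le> v" and ws': "\<And>v. v \<in> set ws' \<Longrightarrow> 1 \<le> v"
      and U: "coord_triv M B \<tau> (length ws) U \<psi>" "hom_coords M \<tau> ws h U \<psi>"
      and V: "coord_triv M B \<tau> (length ws') V \<theta>" "hom_coords M \<tau> ws' h V \<theta>" and q: "q \<in> U" "q \<in> V"
    for U V ws ws' and \<psi> \<theta> :: "'e \<Rightarrow> nat \<Rightarrow> 'k"
  proof (rule intertwining_polynomial[OF B ws ws' U h coord_trivD(2)[OF V(1)] _ smap_id[OF M openin_topspace] _ _ q(1)])
    show "\<theta> (h \<xi> p) = graded_scale ws' \<xi> (\<theta> p)" if "p \<in> over M \<tau> V" for \<xi> p
      using V(2) that by (simp add: hom_coords_def)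
  qed (use q in \<open>auto simp: over_iff\<close>)
  obtain g where g: "graded_space_morphism ws ws' g" "\<And>p. p \<in> mcarrier M \<Longrightarrow> \<tau> p = q \<Longrightarrow> \<theta> p = g (\<psi> p)"
    using half[OF ws ws' U V q] by blast
  obtain g' where g': "graded_space_morphism ws' ws g'" "\<And>p. p \<in> mcarrier M \<Longrightarrow> \<tau> p = q \<Longrightarrow> \<psi> p = g' (\<theta> p)"
    using half[OF ws' ws V U q(2,1)] by blast
  obtain \<sigma> where s: "coord_section M B \<tau> (length ws) U \<psi> \<sigma>" using coord_trivE[OF U(1)] .
  obtain \<rho> where r: "coord_section M B \<tau> (length ws') V \<theta> \<rho>" using coord_trivE[OF V(1)] .
  have "g' (g z) = z" if z: "z \<in> Kspace (length ws)" for z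
  proof -
    note x = coord_sectionD(2,3,5)[OF s q(1) z]
    show ?thesis using g(2)[OF x(3,1)] g'(2)[OF x(3,1)] x(2) by metis
  qed
  moreover have "g (g' z) = z" if z: "z \<in> Kspace (length ws')" for z
  proof -
    note x = coord_sectionD(2,3,5)[OF r q(2) z]
    show ?thesis using g(2)[OF x(3,1)] g'(2)[OF x(3,1)] x(2) by metis
  qed
  ultimately have "graded_space_isomorphism ws ws' g"
    unfolding graded_space_isomorphism_def using g(1) g'(1) by blast
  then show ?thesis using g(2) by blast
qed

lemma hom_coords_compatible:
  fixes E :: "('e, 'b, 'k) graded_bundle"
  assumes M: "atlas_manifold (tot E)" and B: "atlas_manifold (base E)" and ws: "is_weights (weights E)"
    and U: "coord_triv (tot E) (base E) (proj E) (length (weights E)) U \<psi>" "hom_coords (tot E) (proj E) (weights E) h U \<psi>"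
    and V: "coord_triv (tot E) (base E) (proj E) (length (weights E)) V \<theta>" "hom_coords (tot E) (proj E) (weights E) h V \<theta>"
    and h: "fibered_action (tot E) (proj E) h"
  shows "trivs_compatible E (U, \<psi>) (V, \<theta>)"
  unfolding trivs_compatible_def split
proof
  fix q assume q: "q \<in> U \<inter> V"
  have pos: "\<And>v. v \<in> set (weights E) \<Longrightarrow> 1 \<le> v" using ws by (simp add: is_weights_def)
  show "\<exists>g. graded_space_isomorphism (weights E) (weights E) g \<and> (\<forall>p\<in>fiber E q. \<theta> p = g (\<psi> p))"
    using hom_coords_isomorphism[OF M B pos pos U V h, of q] q by (auto simp: fiber_def)
qed

end

section \<open>The homotheties and the zero section of a graded bundle\<close>

locale gr_bundle =
  fixes E :: "('e, 'b, 'k::{real_normed_field, euclidean_space}) graded_bundle"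
  assumes is_bundle: "is_graded_bundle E"
begin

abbreviation "h \<equiv> homothety E"

lemma tot_smooth: "smooth_manifold (tot E)" and base_smooth: "smooth_manifold (base E)"
  and proj_smooth: "smooth_map (tot E) (base E) (proj E)" and proj_surj: "proj E ` mcarrier (tot E) = mcarrier (base E)"
  and weights: "is_weights (weights E)"
  using is_bundle by (auto simp: is_graded_bundle_def)

lemma tot_atlas [simp]: "atlas_manifold (tot E)" and base_atlas [simp]: "atlas_manifold (base E)"
  using tot_smooth base_smooth by auto

lemma proj_smap: "smap (tot E) (mcarrier (tot E)) (base E) (proj E)"
  using proj_smooth unfolding smooth_map_iff_smap[OF tot_atlas base_atlas] .

lemma weights_pos: "v \<in> set (weights E) \<Longrightarrow> 1 \<le> v"
  using weights by (simp add: is_weights_def)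

lemma proj_base: "p \<in> mcarrier (tot E) \<Longrightarrow> proj E p \<in> mcarrier (base E)"
  using proj_surj by auto

lemma trivs_coord: "(U, \<psi>) \<in> trivs E \<Longrightarrow> coord_triv (tot E) (base E) (proj E) (length (weights E)) U \<psi>"
  using is_bundle local_trivialization_iff[OF tot_atlas base_atlas proj_smooth] by (auto simp: is_graded_bundle_def)

lemma trivs_cover:
  assumes "q \<in> mcarrier (base E)"
  obtains U \<psi> where "(U, \<psi>) \<in> trivs E" "q \<in> U"
proof -
  have "q \<in> \<Union> (fst ` trivs E)" using assms is_bundle by (simp add: is_graded_bundle_def)
  then show ?thesis using that by auto
qed

lemma trivs_transition:
  assumes "(U, \<psi>) \<in> trivs E" "(V, \<theta>) \<in> trivs E" "q \<in> U" "q \<in> V"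
  shows "\<exists>g. graded_space_isomorphism (weights E) (weights E) g \<and> (\<forall>p\<in>fiber E q. \<theta> p = g (\<psi> p))"
proof -
  have "\<forall>t\<in>trivs E. \<forall>t'\<in>trivs E. trivs_compatible E t t'"
    using is_bundle unfolding is_graded_bundle_def by (elim conjE)
  then have "trivs_compatible E (U, \<psi>) (V, \<theta>)" using assms(1,2) by blast
  then have "\<forall>q\<in>U \<inter> V. \<exists>g. graded_space_isomorphism (weights E) (weights E) g \<and> (\<forall>p\<in>fiber E q. \<theta> p = g (\<psi> p))"
    unfolding trivs_compatible_def split .
  then show ?thesis using assms(3,4) by (metis IntI)
qed

text \<open>The \<open>THE\<close> in \<open>homothety\<close> is meaningful because transition
  functions commute with \<open>graded_scale\<close>: what is scaling in one trivialization is
  scaling in all of them.\<close>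

lemma homothety_ex1:
  assumes p: "p \<in> mcarrier (tot E)"
  shows "\<exists>!p'. p' \<in> fiber E (proj E p) \<and>
     (\<forall>(U, \<psi>)\<in>trivs E. proj E p \<in> U \<longrightarrow> \<psi> p' = graded_scale (weights E) \<xi> (\<psi> p))"
proof -
  obtain U \<psi> where U: "(U, \<psi>) \<in> trivs E" "proj E p \<in> U" using trivs_cover[OF proj_base[OF p]] .
  note c = trivs_coord[OF U(1)]
  obtain \<sigma> where s: "coord_section (tot E) (base E) (proj E) (length (weights E)) U \<psi> \<sigma>" using coord_trivE[OF c] .
  define p' where "p' = \<sigma> (proj E p) (graded_scale (weights E) \<xi> (\<psi> p))"
  have pU: "p \<in> over (tot E) (proj E) U" using p U(2) by (simp add: over_iff)
  have p': "p' \<in> fiber E (proj E p)" "\<psi> p' = graded_scale (weights E) \<xi> (\<psi> p)"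
    using coord_sectionD(2,3,5)[OF s U(2) graded_scale_Kspace] by (auto simp: p'_def fiber_def)
  show ?thesis
  proof (rule ex1I[of _ p'])
    show "p' \<in> fiber E (proj E p) \<and>
     (\<forall>(U, \<psi>)\<in>trivs E. proj E p \<in> U \<longrightarrow> \<psi> p' = graded_scale (weights E) \<xi> (\<psi> p))"
    proof (intro conjI p'(1) ballI, clarify)
      fix V \<theta> assume V: "(V, \<theta>) \<in> trivs E" "proj E p \<in> V"
      obtain g where g: "graded_space_isomorphism (weights E) (weights E) g" "\<And>x. x \<in> fiber E (proj E p) \<Longrightarrow> \<theta> x = g (\<psi> x)"
        using trivs_transition[OF U(1) V(1) U(2) V(2)] by blast
      have "p \<in> fiber E (proj E p)" using p by (simp add: fiber_def)
      then show "\<theta> p' = graded_scale (weights E) \<xi> (\<theta> p)"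
        using g p' graded_space_morphism_scale[OF _ coord_trivD(4)[OF c pU]]
        by (simp add: graded_space_isomorphism_def)
    qed
    fix x assume x: "x \<in> fiber E (proj E p) \<and>
     (\<forall>(U, \<psi>)\<in>trivs E. proj E p \<in> U \<longrightarrow> \<psi> x = graded_scale (weights E) \<xi> (\<psi> p))"
    show "x = p'"
      by (rule coord_eqI[OF s]) (use x p' U in \<open>auto simp: fiber_def over_iff\<close>)
  qed
qed

lemma homothety_props:
  assumes p: "p \<in> mcarrier (tot E)"
  shows "h \<xi> p \<in> mcarrier (tot E)" "proj E (h \<xi> p) = proj E p"
    "\<And>U \<psi>. (U, \<psi>) \<in> trivs E \<Longrightarrow> proj E p \<in> U \<Longrightarrow> \<psi> (h \<xi> p) = graded_scale (weights E) \<xi> (\<psi> p)"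
proof -
  have "h \<xi> p = (THE p'. p' \<in> fiber E (proj E p) \<and>
     (\<forall>(U, \<psi>)\<in>trivs E. proj E p \<in> U \<longrightarrow> \<psi> p' = graded_scale (weights E) \<xi> (\<psi> p)))"
    using p by (simp add: homothety_def)
  with theI'[OF homothety_ex1[OF p, of \<xi>]]
  have *: "h \<xi> p \<in> fiber E (proj E p) \<and>
     (\<forall>(U, \<psi>)\<in>trivs E. proj E p \<in> U \<longrightarrow> \<psi> (h \<xi> p) = graded_scale (weights E) \<xi> (\<psi> p))" by simp
  then show "h \<xi> p \<in> mcarrier (tot E)" "proj E (h \<xi> p) = proj E p"
    "\<And>U \<psi>. (U, \<psi>) \<in> trivs E \<Longrightarrow> proj E p \<in> U \<Longrightarrow> \<psi> (h \<xi> p) = graded_scale (weights E) \<xi> (\<psi> p)"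
    by (auto simp: fiber_def)
qed

text \<open>One trivialization determines the value, since a point is determined by its base point
  and its coordinates.\<close>

lemma homothety_eqI:
  assumes p: "p \<in> mcarrier (tot E)" and p': "p' \<in> mcarrier (tot E)" "proj E p' = proj E p"
    and U: "(U, \<psi>) \<in> trivs E" "proj E p \<in> U" "\<psi> p' = graded_scale (weights E) \<xi> (\<psi> p)"
  shows "h \<xi> p = p'"
proof -
  obtain \<sigma> where s: "coord_section (tot E) (base E) (proj E) (length (weights E)) U \<psi> \<sigma>"
    using coord_trivE[OF trivs_coord[OF U(1)]] .
  show ?thesis
    by (rule coord_eqI[OF s]) (use homothety_props[OF p] p' U in \<open>auto simp: over_iff\<close>)
qed

lemma homothety_fibered: "fibered_action (tot E) (proj E) h"
  using homothety_props by (simp add: fibered_action_def)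

lemma homothety_hom_coords: "(U, \<psi>) \<in> trivs E \<Longrightarrow> hom_coords (tot E) (proj E) (weights E) h U \<psi>"
  using homothety_props(3) by (simp add: hom_coords_def over_iff)

lemma homothety_ext: "h \<xi> \<in> extensional (mcarrier (tot E))"
  by (simp add: homothety_def)

lemma homothety_one: "p \<in> mcarrier (tot E) \<Longrightarrow> h 1 p = p"
proof -
  assume p: "p \<in> mcarrier (tot E)"
  obtain U \<psi> where U: "(U, \<psi>) \<in> trivs E" "proj E p \<in> U" using trivs_cover[OF proj_base[OF p]] .
  show "h 1 p = p"
    by (rule homothety_eqI[OF p p refl U])
      (use coord_trivD(4)[OF trivs_coord[OF U(1)], of p] p U(2) in \<open>simp add: graded_scale_one over_iff\<close>)
qed

lemma homothety_mult: "p \<in> mcarrier (tot E) \<Longrightarrow> h \<xi> (h \<eta> p) = h (\<xi> * \<eta>) p"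
proof -
  assume p: "p \<in> mcarrier (tot E)"
  obtain U \<psi> where U: "(U, \<psi>) \<in> trivs E" "proj E p \<in> U" using trivs_cover[OF proj_base[OF p]] .
  note hp = homothety_props[OF p]
  show "h \<xi> (h \<eta> p) = h (\<xi> * \<eta>) p"
    by (rule homothety_eqI[OF hp(1) hp(1) _ U(1)])
      (use hp U in \<open>simp_all add: graded_scale_mult\<close>)
qed

text \<open>In a trivialization the action is the section applied to the scaled coordinates, and
  these are products of powers of the scalar with smooth functions.\<close>

lemma homothety_smap:
  "smap (product_manifold field_manifold (tot E)) (mcarrier (product_manifold field_manifold (tot E))) (tot E)
     (\<lambda>x. h (fst x) (snd x))"
proof -
  let ?F = "field_manifold :: 'k manifold" and ?M = "tot E" and ?B = "base E" and ?ws = "weights E"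
  let ?K = "Kspace_manifold (length ?ws) :: (nat \<Rightarrow> 'k) manifold"
  let ?P = "product_manifold ?F ?M"
  have P: "atlas_manifold ?P" by (rule atlas_product_manifold) simp_all
  show ?thesis
  proof (rule smap_local[OF P])
    fix x assume "x \<in> mcarrier ?P"
    then have p: "snd x \<in> mcarrier ?M" by auto
    obtain U \<psi> where U: "(U, \<psi>) \<in> trivs E" "proj E (snd x) \<in> U" using trivs_cover[OF proj_base[OF p]] .
    note c = trivs_coord[OF U(1)]
    obtain \<sigma> where s: "coord_section ?M ?B (proj E) (length ?ws) U \<psi> \<sigma>" using coord_trivE[OF c] .
    define W where "W = (UNIV :: 'k set) \<times> over ?M (proj E) U"
    have W: "openin (mtop ?P) W" unfolding W_def using coord_trivD(3)[OF c] by (simp add: openin_prod_Times_iff)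
    have sn: "smap ?P W ?M snd" by (rule smap_snd[OF _ _ W]) simp_all
    have fs: "ksmf ?P W fst" using smap_fst[OF atlas_field tot_atlas W] unfolding smap_field_ksmf[OF P] .
    have "ksmf ?P W (\<lambda>y. \<psi> (snd y) a)" if "a < length ?ws" for a
    proof (rule ksmf_pull[OF sn])
      show "ksmf ?M (over ?M (proj E) U) (\<lambda>p. \<psi> p a)"
        using coord_trivD(2)[OF c] that by (simp add: smap_Kspace_ksmf)
    qed (auto simp: W_def)
    then have "ksmf ?P W (\<lambda>y. graded_scale ?ws (fst y) (\<psi> (snd y)) a)" if "a < length ?ws" for a
      using that by (simp add: graded_scale_def ksmf_mult[OF P ksmf_power[OF P fs]])
    then have 1: "smap ?P W ?K (\<lambda>y. graded_scale ?ws (fst y) (\<psi> (snd y)))"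
      using W by (simp add: smap_Kspace_ksmf[OF P])
    have 2: "smap ?P W ?B (\<lambda>y. proj E (snd y))"
      by (rule smap_compose[OF sn proj_smap]) (auto simp: W_def over_iff)
    have 3: "smap ?P W ?M (\<lambda>y. \<sigma> (proj E (snd y)) (graded_scale ?ws (fst y) (\<psi> (snd y))))"
    proof -
      have "(\<lambda>y. (proj E (snd y), graded_scale ?ws (fst y) (\<psi> (snd y)))) ` W \<subseteq> U \<times> Kspace (length ?ws)"
        by (auto simp: W_def over_iff)
      from smap_compose[OF smap_pair[OF base_atlas atlas_Kspace P 2 1] coord_sectionD(1)[OF s] this]
      show ?thesis by simp
    qed
    have "smap ?P W ?M (\<lambda>y. h (fst y) (snd y))"
    proof (rule smap_cong[OF P 3])
      fix y assume "y \<in> W"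
      then have y: "snd y \<in> over ?M (proj E) U" by (auto simp: W_def)
      then have "h (fst y) (snd y) = h (fst y) (\<sigma> (proj E (snd y)) (\<psi> (snd y)))" using coord_sectionD(4)[OF s] by simp
      also have "\<dots> = \<sigma> (proj E (snd y)) (graded_scale ?ws (fst y) (\<psi> (snd y)))"
        by (rule coord_section_scale[OF s homothety_fibered homothety_hom_coords[OF U(1)], symmetric])
          (use y coord_trivD(4)[OF c] in \<open>auto simp: over_iff\<close>)
      finally show "\<sigma> (proj E (snd y)) (graded_scale ?ws (fst y) (\<psi> (snd y))) = h (fst y) (snd y)" by simp
    qed
    moreover have "x \<in> W" using p U(2) by (cases x) (simp add: W_def over_iff)
    moreover have "W \<subseteq> mcarrier ?P" by (auto simp: W_def over_iff)
    ultimately show "\<exists>W'. x \<in> W' \<and> W' \<subseteq> mcarrier ?P \<and> smap ?P W' ?M (\<lambda>y. h (fst y) (snd y))" by blast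
  qed
qed

lemma homothety_structure: "homogeneity_structure (tot E) h"
  unfolding homogeneity_structure_def
proof (intro conjI allI ballI)
  have "smooth_map (product_manifold field_manifold (tot E)) (tot E) (\<lambda>x. h (fst x) (snd x))"
    using homothety_smap by (subst smooth_map_iff_smap) (auto intro: atlas_product_manifold)
  then show "smooth_map (product_manifold field_manifold (tot E)) (tot E) (\<lambda>(\<xi>, p). h \<xi> p)"
    by (simp add: case_prod_beta')
qed (use tot_smooth homothety_ext homothety_one homothety_mult in auto)

text \<open>The value does not depend on the chosen point of the fiber: as all weights are positive,
  \<open>h 0\<close> maps the whole fiber to the point with vanishing coordinates.\<close>

definition zero_section :: "'b \<Rightarrow> 'e" where
  "zero_section q = h 0 (SOME p. p \<in> fiber E q)"

lemma fiber_nonempty: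
  assumes "q \<in> mcarrier (base E)"
  shows "(SOME p. p \<in> fiber E q) \<in> fiber E q"
proof -
  have "q \<in> proj E ` mcarrier (tot E)" using assms proj_surj by simp
  then have "\<exists>p. p \<in> fiber E q" by (auto simp: fiber_def)
  then show ?thesis by (rule someI_ex)
qed

lemma zero_section_section:
  assumes s: "coord_section (tot E) (base E) (proj E) (length (weights E)) U \<psi> \<sigma>" and U: "(U, \<psi>) \<in> trivs E" "q \<in> U"
    and p: "p \<in> mcarrier (tot E)" "proj E p = q"
  shows "h 0 p = \<sigma> q (\<lambda>_. 0)"
proof -
  have "(\<lambda>_. 0 :: 'k) \<in> Kspace (length (weights E))" by (simp add: Kspace_def)
  note z = coord_sectionD(2,3,5)[OF s U(2) this]
  show ?thesis
  proof (rule homothety_eqI[OF p(1) z(3) _ U(1)])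
    have "graded_scale (weights E) 0 (\<psi> p) = (\<lambda>_. 0)"
      using weights_pos[OF nth_mem] by (force simp: graded_scale_def power_0_left)
    then show "\<psi> (\<sigma> q (\<lambda>_. 0)) = graded_scale (weights E) 0 (\<psi> p)" using z by simp
  qed (use z p U in auto)
qed

lemma zero_section_props:
  assumes q: "q \<in> mcarrier (base E)"
  shows "zero_section q \<in> mcarrier (tot E)" "proj E (zero_section q) = q"
  using homothety_props(1,2)[of "SOME p. p \<in> fiber E q" 0] fiber_nonempty[OF q] by (auto simp: zero_section_def fiber_def)

lemma homothety_zero:
  assumes p: "p \<in> mcarrier (tot E)"
  shows "h 0 p = zero_section (proj E p)"
proof -
  obtain U \<psi> where U: "(U, \<psi>) \<in> trivs E" "proj E p \<in> U" using trivs_cover[OF proj_base[OF p]] .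
  obtain \<sigma> where s: "coord_section (tot E) (base E) (proj E) (length (weights E)) U \<psi> \<sigma>"
    using coord_trivE[OF trivs_coord[OF U(1)]] .
  show ?thesis
    unfolding zero_section_def
    using zero_section_section[OF s U p refl] zero_section_section[OF s U, of "SOME p'. p' \<in> fiber E (proj E p)"]
      fiber_nonempty[OF proj_base[OF p]] by (auto simp: fiber_def)
qed

text \<open>Over a trivialization this is the section \<open>\<sigma>\<close> at the zero
  vector.\<close>

lemma zero_section_smap: "smap (base E) (mcarrier (base E)) (tot E) zero_section"
proof (rule smap_local[OF base_atlas])
  fix q assume q: "q \<in> mcarrier (base E)"
  let ?K = "Kspace_manifold (length (weights E)) :: (nat \<Rightarrow> 'k) manifold"
  obtain U \<psi> where U: "(U, \<psi>) \<in> trivs E" "q \<in> U" using trivs_cover[OF q] .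
  obtain \<sigma> where s: "coord_section (tot E) (base E) (proj E) (length (weights E)) U \<psi> \<sigma>"
    using coord_trivE[OF trivs_coord[OF U(1)]] .
  note oU = coord_trivD(1)[OF trivs_coord[OF U(1)]]
  have z: "(\<lambda>_. 0 :: 'k) \<in> Kspace (length (weights E))" by (simp add: Kspace_def)
  have "smap (base E) U ?K (\<lambda>_. (\<lambda>_. 0))" by (rule smap_const[OF base_atlas atlas_Kspace oU]) (simp add: z)
  from smap_pair[OF base_atlas atlas_Kspace base_atlas smap_id[OF base_atlas oU] this]
  have 1: "smap (base E) U (product_manifold (base E) ?K) (\<lambda>q. (q, \<lambda>_. 0))" .
  have "(\<lambda>q. (q, \<lambda>_. 0)) ` U \<subseteq> U \<times> (Kspace (length (weights E)) :: (nat \<Rightarrow> 'k) set)" using z by auto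
  from smap_compose[OF 1 coord_sectionD(1)[OF s] this]
  have "smap (base E) U (tot E) (\<lambda>q. \<sigma> q (\<lambda>_. 0))" by simp
  then have "smap (base E) U (tot E) zero_section"
  proof (rule smap_cong[OF base_atlas])
    fix q assume "q \<in> U"
    then have q: "q \<in> mcarrier (base E)" using openin_subset[OF oU] by auto
    show "\<sigma> q (\<lambda>_. 0) = zero_section q"
      unfolding zero_section_def
      by (rule zero_section_section[OF s U(1) \<open>q \<in> U\<close>, symmetric]) (use fiber_nonempty[OF q] in \<open>auto simp: fiber_def\<close>)
  qed
  then show "\<exists>W'. q \<in> W' \<and> W' \<subseteq> mcarrier (base E) \<and> smap (base E) W' (tot E) zero_section"
    using U(2) openin_subset[OF oU] by blast
qed

end

locale field_bundle = graded_field K + gr_bundle E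
  for K :: "'k::{real_normed_field, euclidean_space} itself" and E :: "('e, 'b, 'k) graded_bundle"
begin

text \<open>A trivialization that is homogeneous for \<open>h\<close> is compatible with the atlas,
  because smooth transition functions commuting with scaling are polynomial. By maximality the
  graded atlas is thus a function of the homotheties, and the uniqueness of the canonical bundle
  rests on this.\<close>

lemma trivs_iff:
  "(U, \<psi>) \<in> trivs E \<longleftrightarrow>
     coord_triv (tot E) (base E) (proj E) (length (weights E)) U \<psi> \<and> hom_coords (tot E) (proj E) (weights E) h U \<psi>"
proof
  assume R: "coord_triv (tot E) (base E) (proj E) (length (weights E)) U \<psi> \<and> hom_coords (tot E) (proj E) (weights E) h U \<psi>"
  have "trivs_compatible E (U, \<psi>) t" if "t \<in> trivs E" for t
    using hom_coords_compatible[OF tot_atlas base_atlas weights _ _ trivs_coord homothety_hom_coords homothety_fibered, of U \<psi> "fst t" "snd t"]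
      R that by simp
  moreover have "local_trivialization E (U, \<psi>)"
    using R local_trivialization_iff[OF tot_atlas base_atlas proj_smooth] by simp
  moreover have "\<forall>t. local_trivialization E t \<and> (\<forall>t'\<in>trivs E. trivs_compatible E t t') \<longrightarrow> t \<in> trivs E"
    using is_bundle unfolding is_graded_bundle_def by (elim conjE)
  ultimately show "(U, \<psi>) \<in> trivs E" by blast
qed (simp add: trivs_coord homothety_hom_coords)

end

section \<open>Bundles built from an action, and morphisms as intertwining maps\<close>

definition mk_bundle :: "'e manifold \<Rightarrow> 'b manifold \<Rightarrow> ('e \<Rightarrow> 'b) \<Rightarrow> nat list \<Rightarrow>
    ('k::{real_normed_field, euclidean_space} \<Rightarrow> 'e \<Rightarrow> 'e) \<Rightarrow> ('e, 'b, 'k) graded_bundle" where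
  "mk_bundle M B \<tau> ws h = \<lparr>tot = M, base = B, proj = \<tau>, weights = ws,
     trivs = {(U, \<psi>). coord_triv M B \<tau> (length ws) U \<psi> \<and> hom_coords M \<tau> ws h U \<psi>}\<rparr>"

lemma mk_bundle_simps [simp]:
  "tot (mk_bundle M B \<tau> ws h) = M" "base (mk_bundle M B \<tau> ws h) = B" "proj (mk_bundle M B \<tau> ws h) = \<tau>"
  "weights (mk_bundle M B \<tau> ws h) = ws"
  "(U, \<psi>) \<in> trivs (mk_bundle M B \<tau> ws h) \<longleftrightarrow> coord_triv M B \<tau> (length ws) U \<psi> \<and> hom_coords M \<tau> ws h U \<psi>"
  by (auto simp: mk_bundle_def)

context graded_field
begin

text \<open>The atlas of all homogeneous trivializations is compatible by
  \<open>hom_coords_compatible\<close>. It is maximal because a trivialization compatible with a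
  homogeneous one is homogeneous itself: transition functions commute with scaling.\<close>

lemma
  fixes h :: "'k \<Rightarrow> 'e \<Rightarrow> 'e" and \<tau> :: "'e \<Rightarrow> 'b"
  assumes M: "smooth_manifold M" and B: "smooth_manifold B" and \<tau>: "smooth_map M B \<tau>"
    and surj: "\<tau> ` mcarrier M = mcarrier B" and pext: "\<tau> \<in> extensional (mcarrier M)" and ws: "is_weights ws"
    and h: "fibered_action M \<tau> h" and hext: "\<And>\<xi>. h \<xi> \<in> extensional (mcarrier M)"
    and cover: "\<And>q. q \<in> mcarrier B \<Longrightarrow> \<exists>U \<psi>. q \<in> U \<and> coord_triv M B \<tau> (length ws) U \<psi> \<and> hom_coords M \<tau> ws h U \<psi>"
  shows mk_bundle: "is_graded_bundle (mk_bundle M B \<tau> ws h)"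
    and homothety_mk_bundle: "homothety (mk_bundle M B \<tau> ws h) = h"
proof -
  let ?E = "mk_bundle M B \<tau> ws h"
  have Ma: "atlas_manifold M" and Ba: "atlas_manifold B" using M B by auto
  note lt = local_trivialization_iff[of ?E, simplified, OF Ma Ba \<tau>]
  have comp: "trivs_compatible ?E (U, \<psi>) (V, \<theta>)" if "(U, \<psi>) \<in> trivs ?E" "(V, \<theta>) \<in> trivs ?E" for U \<psi> V \<theta>
    using hom_coords_compatible[of ?E U \<psi> h V \<theta>] that Ma Ba ws h by simp
  have "(U, \<psi>) \<in> trivs ?E" if L: "local_trivialization ?E (U, \<psi>)" and C: "\<forall>t'\<in>trivs ?E. trivs_compatible ?E (U, \<psi>) t'" for U \<psi>
  proof -
    have c: "coord_triv M B \<tau> (length ws) U \<psi>" using L lt by simp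
    have "\<psi> (h \<xi> p) = graded_scale ws \<xi> (\<psi> p)" if p: "p \<in> over M \<tau> U" for \<xi> p
    proof -
      have q: "\<tau> p \<in> mcarrier B" "\<tau> p \<in> U" using p surj by (auto simp: over_iff)
      obtain V \<theta> where V: "\<tau> p \<in> V" "coord_triv M B \<tau> (length ws) V \<theta>" "hom_coords M \<tau> ws h V \<theta>"
        using cover[OF q(1)] by blast
      have "trivs_compatible ?E (U, \<psi>) (V, \<theta>)" using C V by simp
      then have "\<exists>g. graded_space_isomorphism ws ws g \<and> (\<forall>p'\<in>fiber ?E (\<tau> p). \<theta> p' = g (\<psi> p'))"
        unfolding trivs_compatible_def split using q(2) V(1) by simp
      then obtain g where g: "graded_space_isomorphism ws ws g" "\<And>p'. p' \<in> fiber ?E (\<tau> p) \<Longrightarrow> \<theta> p' = g (\<psi> p')" by blast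
      then obtain g' where g': "graded_space_morphism ws ws g'" "\<And>z. z \<in> Kspace (length ws) \<Longrightarrow> g' (g z) = z"
        unfolding graded_space_isomorphism_def by blast
      have hp: "h \<xi> p \<in> over M \<tau> U" using fibered_action_over[OF h p] .
      have f: "p \<in> fiber ?E (\<tau> p)" "h \<xi> p \<in> fiber ?E (\<tau> p)"
        using p h by (auto simp: fiber_def over_iff fibered_action_def)
      have pV: "p \<in> over M \<tau> V" using p V(1) by (simp add: over_iff)
      have "\<psi> (h \<xi> p) = g' (\<theta> (h \<xi> p))" using g(2)[OF f(2)] g'(2)[OF coord_trivD(4)[OF c hp]] by simp
      also have "\<theta> (h \<xi> p) = graded_scale ws \<xi> (\<theta> p)" using V(3) pV by (simp add: hom_coords_def)
      also have "g' (graded_scale ws \<xi> (\<theta> p)) = graded_scale ws \<xi> (g' (\<theta> p))"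
        by (rule graded_space_morphism_scale[OF g'(1) coord_trivD(4)[OF V(2) pV]])
      also have "g' (\<theta> p) = \<psi> p" using g(2)[OF f(1)] g'(2)[OF coord_trivD(4)[OF c p]] by simp
      finally show ?thesis .
    qed
    then show ?thesis using c by (simp add: hom_coords_def)
  qed
  then have maximal: "\<forall>t. local_trivialization ?E t \<and> (\<forall>t'\<in>trivs ?E. trivs_compatible ?E t t') \<longrightarrow> t \<in> trivs ?E"
    by (metis surj_pair)
  have cov: "\<Union> (fst ` trivs ?E) = mcarrier B"
  proof
    show "\<Union> (fst ` trivs ?E) \<subseteq> mcarrier B"
    proof
      fix q assume "q \<in> \<Union> (fst ` trivs ?E)"
      then obtain U \<psi> where "(U, \<psi>) \<in> trivs ?E" "q \<in> U" by auto
      then show "q \<in> mcarrier B" using openin_subset[OF coord_trivD(1)[of M B \<tau> "length ws" U \<psi>]] by auto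
    qed
    show "mcarrier B \<subseteq> \<Union> (fst ` trivs ?E)"
    proof
      fix q assume q: "q \<in> mcarrier B"
      obtain U \<psi> where "q \<in> U" "(U, \<psi>) \<in> trivs ?E" using cover[OF q] by auto
      then show "q \<in> \<Union> (fst ` trivs ?E)" by (intro UnionI[of U]) (auto intro!: image_eqI[of _ _ "(U, \<psi>)"] simp del: mk_bundle_simps)
    qed
  qed
  have ltE: "\<forall>t\<in>trivs ?E. local_trivialization ?E t"
  proof
    fix t assume "t \<in> trivs ?E"
    then show "local_trivialization ?E t" by (cases t) (simp add: lt)
  qed
  have compE: "\<forall>t\<in>trivs ?E. \<forall>t'\<in>trivs ?E. trivs_compatible ?E t t'"
    using comp by (metis surj_pair)
  show gb: "is_graded_bundle ?E"
    unfolding is_graded_bundle_def mk_bundle_simps(1-4)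
    by (intro conjI M B \<tau> surj pext ws ltE compE maximal cov)
  interpret E: gr_bundle ?E by unfold_locales (rule gb)
  show "homothety ?E = h"
  proof (intro ext)
    fix \<xi> p
    show "homothety ?E \<xi> p = h \<xi> p"
    proof (cases "p \<in> mcarrier M")
      case True
      then have p: "p \<in> mcarrier (tot ?E)" by simp
      obtain U \<psi> where U: "(U, \<psi>) \<in> trivs ?E" "proj ?E p \<in> U" using E.trivs_cover[OF E.proj_base[OF p]] .
      show ?thesis
        by (rule E.homothety_eqI[OF p _ _ U])
          (use h True U in \<open>auto simp: fibered_action_def hom_coords_def over_iff\<close>)
    next
      case False
      then show ?thesis using hext[of \<xi>] by (simp add: homothety_def extensional_def)
    qed
  qed
qed

end

text \<open>On each fiber a morphism is polynomial with matching weights and hence commutes with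
  scaling, which is what the homotheties are in coordinates.\<close>

lemma graded_bundle_hom_intertwines:
  fixes E :: "('e, 'b, 'k::{real_normed_field, euclidean_space}) graded_bundle"
    and E' :: "('e2, 'b2, 'k) graded_bundle"
  assumes "is_graded_bundle E" "is_graded_bundle E'" and hom: "(\<Phi>, \<phi>) \<in> graded_bundle_hom E E'"
  shows "\<Phi> \<in> homogeneity_hom (tot E, homothety E) (tot E', homothety E')"
proof -
  interpret E: gr_bundle E by unfold_locales fact
  interpret E': gr_bundle E' by unfold_locales fact
  have \<Phi>: "smooth_map (tot E) (tot E') \<Phi>" "\<Phi> \<in> extensional (mcarrier (tot E))"
    and pr: "\<And>p. p \<in> mcarrier (tot E) \<Longrightarrow> proj E' (\<Phi> p) = \<phi> (proj E p)"
    and all: "\<forall>q\<in>mcarrier (base E). \<forall>(U, \<psi>)\<in>trivs E. \<forall>(V, \<theta>)\<in>trivs E'. q \<in> U \<and> \<phi> q \<in> V \<longrightarrow>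
        (\<exists>g. graded_space_morphism (weights E) (weights E') g \<and> (\<forall>p\<in>fiber E q. \<theta> (\<Phi> p) = g (\<psi> p)))"
    using hom unfolding graded_bundle_hom_def mem_Collect_eq prod.case by simp_all
  have g: "\<exists>g. graded_space_morphism (weights E) (weights E') g \<and> (\<forall>p\<in>fiber E q. \<theta> (\<Phi> p) = g (\<psi> p))"
    if "q \<in> mcarrier (base E)" and U: "(U, \<psi>) \<in> trivs E" and V: "(V, \<theta>) \<in> trivs E'" and "q \<in> U" "\<phi> q \<in> V" for q U \<psi> V \<theta>
  proof -
    have "\<forall>(V, \<theta>)\<in>trivs E'. q \<in> U \<and> \<phi> q \<in> V \<longrightarrow>
        (\<exists>g. graded_space_morphism (weights E) (weights E') g \<and> (\<forall>p\<in>fiber E q. \<theta> (\<Phi> p) = g (\<psi> p)))"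
      using bspec[OF bspec[OF all that(1)] U] by simp
    from bspec[OF this V] show ?thesis using that by simp
  qed
  have \<Phi>c: "\<Phi> p \<in> mcarrier (tot E')" if "p \<in> mcarrier (tot E)" for p
    using smap_image[OF \<Phi>(1)[unfolded smooth_map_iff_smap[OF E.tot_atlas E'.tot_atlas]] that] .
  have "\<Phi> (homothety E \<xi> p) = homothety E' \<xi> (\<Phi> p)" if p: "p \<in> mcarrier (tot E)" for \<xi> p
  proof -
    note hp = E.homothety_props[where \<xi> = \<xi>, OF p]
    obtain U \<psi> where U: "(U, \<psi>) \<in> trivs E" "proj E p \<in> U" using E.trivs_cover[OF E.proj_base[OF p]] .
    obtain V \<theta> where V: "(V, \<theta>) \<in> trivs E'" "proj E' (\<Phi> p) \<in> V" using E'.trivs_cover[OF E'.proj_base[OF \<Phi>c[OF p]]] .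
    obtain g where g: "graded_space_morphism (weights E) (weights E') g" "\<And>x. x \<in> fiber E (proj E p) \<Longrightarrow> \<theta> (\<Phi> x) = g (\<psi> x)"
      using g[OF E.proj_base[OF p] U(1) V(1) U(2)] V(2) pr[OF p] by auto
    have f: "p \<in> fiber E (proj E p)" "homothety E \<xi> p \<in> fiber E (proj E p)" using p hp by (auto simp: fiber_def)
    have pU: "p \<in> over (tot E) (proj E) U" using p U by (simp add: over_iff)
    have "homothety E' \<xi> (\<Phi> p) = \<Phi> (homothety E \<xi> p)"
    proof (rule E'.homothety_eqI[OF \<Phi>c[OF p] \<Phi>c[OF hp(1)] _ V])
      show "proj E' (\<Phi> (homothety E \<xi> p)) = proj E' (\<Phi> p)" using pr[OF p] pr[OF hp(1)] hp(2) by simp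
      show "\<theta> (\<Phi> (homothety E \<xi> p)) = graded_scale (weights E') \<xi> (\<theta> (\<Phi> p))"
        using g(2)[OF f(1)] g(2)[OF f(2)] hp(3)[OF U] graded_space_morphism_scale[OF g(1) coord_trivD(4)[OF E.trivs_coord[OF U(1)] pU]]
        by simp
    qed
    then show ?thesis by simp
  qed
  then show ?thesis using \<Phi> by (simp add: homogeneity_hom_def)
qed

context graded_field
begin

text \<open>The base map is forced: it is \<open>\<Phi>\<close> seen along the zero section, and
  smooth because the zero section is. Intertwining at the scalar 0 shows that \<open>\<Phi>\<close>
  respects the fibers, and \<open>intertwining_polynomial\<close> makes it polynomial on
  them.\<close>

lemma
  fixes E :: "('e, 'b, 'k) graded_bundle" and E' :: "('e2, 'b2, 'k) graded_bundle"
  assumes E: "is_graded_bundle E" and E': "is_graded_bundle E'"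
    and hom: "\<Phi> \<in> homogeneity_hom (tot E, homothety E) (tot E', homothety E')"
  shows homogeneity_hom_graded_bundle_hom:
      "(\<Phi>, restrict (\<lambda>q. proj E' (\<Phi> (gr_bundle.zero_section E q))) (mcarrier (base E))) \<in> graded_bundle_hom E E'"
proof -
  interpret E: field_bundle K E by unfold_locales fact
  interpret E': field_bundle K E' by unfold_locales fact
  have \<Phi>: "smooth_map (tot E) (tot E') \<Phi>" "\<Phi> \<in> extensional (mcarrier (tot E))"
    and int: "\<And>\<xi> p. p \<in> mcarrier (tot E) \<Longrightarrow> \<Phi> (homothety E \<xi> p) = homothety E' \<xi> (\<Phi> p)"
    using hom by (auto simp: homogeneity_hom_def)
  have s\<Phi>: "smap (tot E) (mcarrier (tot E)) (tot E') \<Phi>"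
    using \<Phi>(1) unfolding smooth_map_iff_smap[OF E.tot_atlas E'.tot_atlas] .
  have \<Phi>c: "\<Phi> p \<in> mcarrier (tot E')" if "p \<in> mcarrier (tot E)" for p using smap_image[OF s\<Phi> that] .
  define \<phi> where "\<phi> = restrict (\<lambda>q. proj E' (\<Phi> (E.zero_section q))) (mcarrier (base E))"
  have pr: "proj E' (\<Phi> p) = proj E' (\<Phi> (E.zero_section (proj E p)))" if p: "p \<in> mcarrier (tot E)" for p
    using int[OF p, of 0] E.homothety_zero[OF p] E'.homothety_props(2)[OF \<Phi>c[OF p], of 0] by simp
  have s1: "smap (base E) (mcarrier (base E)) (tot E') (\<lambda>q. \<Phi> (E.zero_section q))"
    by (rule smap_compose[OF E.zero_section_smap s\<Phi>]) (use E.zero_section_props in auto)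
  have "smap (base E) (mcarrier (base E)) (base E') (\<lambda>q. proj E' (\<Phi> (E.zero_section q)))"
    by (rule smap_compose[OF s1 E'.proj_smap]) (use smap_image[OF s1] in auto)
  then have "smap (base E) (mcarrier (base E)) (base E') \<phi>"
    by (rule smap_cong[OF E.base_atlas]) (simp add: \<phi>_def)
  then have \<phi>: "smooth_map (base E) (base E') \<phi>" unfolding smooth_map_iff_smap[OF E.base_atlas E'.base_atlas] .
  have pr\<phi>: "proj E' (\<Phi> p) = \<phi> (proj E p)" if "p \<in> mcarrier (tot E)" for p
    using pr[OF that] E.proj_base[OF that] by (simp add: \<phi>_def)
  have "\<exists>g. graded_space_morphism (weights E) (weights E') g \<and> (\<forall>p\<in>fiber E q. \<theta> (\<Phi> p) = g (\<psi> p))"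
    if q: "q \<in> mcarrier (base E)" and U: "(U, \<psi>) \<in> trivs E" and V: "(V, \<theta>) \<in> trivs E'" and qU: "q \<in> U" "\<phi> q \<in> V"
    for q U \<psi> V \<theta>
  proof -
    have "\<exists>g. graded_space_morphism (weights E) (weights E') g \<and>
        (\<forall>p\<in>mcarrier (tot E). proj E p = q \<longrightarrow> \<theta> (\<Phi> p) = g (\<psi> p))"
    proof (rule intertwining_polynomial[where h = "homothety E" and h' = "homothety E'" and U = U and \<psi> = \<psi> and \<theta> = \<theta>
          and V = "over (tot E') (proj E') V" and \<Phi> = \<Phi> and W = "mcarrier (tot E)" and q = q])
      show "\<theta> (homothety E' \<xi> p) = graded_scale (weights E') \<xi> (\<theta> p)" if "p \<in> over (tot E') (proj E') V" for \<xi> p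
        using E'.homothety_hom_coords[OF V] that by (simp add: hom_coords_def)
      show "p \<in> mcarrier (tot E) \<and> \<Phi> p \<in> over (tot E') (proj E') V" if "p \<in> mcarrier (tot E)" "proj E p = q" for p
        using that \<Phi>c pr\<phi> qU(2) by (simp add: over_iff)
      show "\<Phi> (homothety E \<xi> p) = homothety E' \<xi> (\<Phi> p)" if "p \<in> mcarrier (tot E)" for \<xi> p
        using int[OF that] .
      show "smap (tot E') (over (tot E') (proj E') V) (Kspace_manifold (length (weights E'))) \<theta>"
        using coord_trivD(2)[OF E'.trivs_coord[OF V]] .
    qed (use E.weights_pos E'.weights_pos E.trivs_coord[OF U] E.homothety_hom_coords[OF U] E.homothety_fibered s\<Phi> qU(1) in simp_all)
    then show ?thesis unfolding fiber_def by blast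
  qed
  then have "\<forall>q\<in>mcarrier (base E). \<forall>(U, \<psi>)\<in>trivs E. \<forall>(V, \<theta>)\<in>trivs E'. q \<in> U \<and> \<phi> q \<in> V \<longrightarrow>
        (\<exists>g. graded_space_morphism (weights E) (weights E') g \<and> (\<forall>p\<in>fiber E q. \<theta> (\<Phi> p) = g (\<psi> p)))"
    by fastforce
  moreover have "\<phi> \<in> extensional (mcarrier (base E))" by (simp add: \<phi>_def)
  moreover have "\<forall>p\<in>mcarrier (tot E). proj E' (\<Phi> p) = \<phi> (proj E p)" using pr\<phi> by blast
  ultimately show "(\<Phi>, \<phi>) \<in> graded_bundle_hom E E'"
    using \<Phi> \<phi> unfolding graded_bundle_hom_def mem_Collect_eq prod.case by (intro conjI)
qed

end

section \<open>The canonical bundle over the image of the zero section\<close>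

definition transport_manifold :: "'a manifold \<Rightarrow> ('a \<Rightarrow> 'b) \<Rightarrow> ('b \<Rightarrow> 'a) \<Rightarrow> 'b manifold" where
  "transport_manifold B s r = generated_manifold (pullback_topology (s ` mcarrier B) r (mtop B)) (mdim B)
     {(s ` U, \<phi> \<circ> r) | U \<phi>. (U, \<phi>) \<in> matlas B}"

text \<open>Since \<open>r\<close> inverts \<open>s\<close> on \<open>B\<close>, the pull-back
  topology along \<open>r\<close> on the image of \<open>s\<close> has exactly the images of open
  sets as its open sets, and the charts of \<open>B\<close> composed with \<open>r\<close> form an
  atlas.\<close>

lemma
  assumes B: "smooth_manifold B" and rs: "\<And>q. q \<in> mcarrier B \<Longrightarrow> r (s q) = q"
  shows transport_smooth_manifold: "smooth_manifold (transport_manifold B s r)"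
    and transport_carrier: "mcarrier (transport_manifold B s r) = s ` mcarrier B"
    and transport_smap: "smap B (mcarrier B) (transport_manifold B s r) s"
    and transport_smap_inverse: "smap (transport_manifold B s r) (s ` mcarrier B) B r"
proof -
  let ?C = "mcarrier B" and ?T = "pullback_topology (s ` mcarrier B) r (mtop B)" and ?n = "mdim B"
  let ?A = "{(s ` U, \<phi> \<circ> r) | U \<phi>. (U, \<phi>) \<in> matlas B}"
  have Ba: "atlas_manifold B" using B by simp
  have pre: "r -` U \<inter> s ` ?C = s ` U" if "U \<subseteq> ?C" for U using that rs by force
  have openT: "openin ?T S \<longleftrightarrow> (\<exists>U. openin (mtop B) U \<and> S = s ` U)" for S
    unfolding openin_pullback_topology using pre openin_subset by metis
  have tT: "topspace ?T = s ` ?C" using rs by (auto simp: topspace_pullback_topology)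
  have rimg: "r ` s ` U = U" if "U \<subseteq> ?C" for U using that rs by force
  have chart: "is_chart ?T ?n (s ` U, \<phi> \<circ> r)" if U: "(U, \<phi>) \<in> matlas B" for U \<phi>
  proof -
    note c = is_chartD[OF atlas_manifold_chart[OF Ba U]]
    have UC: "U \<subseteq> ?C" using openin_subset[OF c(1)] .
    show ?thesis
      unfolding is_chart_iff
    proof (intro conjI allI impI)
      show "openin ?T (s ` U)" using openT c(1) by blast
      show "inj_on (\<phi> \<circ> r) (s ` U)" using c(2) rs UC by (auto simp: inj_on_def subset_iff)
      fix W assume "openin ?T W \<and> W \<subseteq> s ` U"
      then obtain W0 where W0: "openin (mtop B) W0" "W = s ` W0" "W \<subseteq> s ` U" using openT by blast
      have "W0 \<subseteq> U" using W0(2,3) rimg[OF openin_subset[OF W0(1)]] rimg[OF UC] by (metis image_mono)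
      moreover have "(\<phi> \<circ> r) ` W = \<phi> ` W0" 
        unfolding W0(2) image_comp[symmetric] rimg[OF openin_subset[OF W0(1)]] ..
      ultimately show "openin (Euclidean_space ?n) ((\<phi> \<circ> r) ` W)" using c(3)[OF W0(1)] by (simp add: Int_absorb1)
    next
      fix V assume "openin (Euclidean_space ?n) V"
      from c(4)[OF this] have "openin ?T (s ` (U \<inter> \<phi> -` V))" using openT by blast
      moreover have "s ` (U \<inter> \<phi> -` V) = s ` U \<inter> (\<phi> \<circ> r) -` V" using UC rs by force
      ultimately show "openin ?T (s ` U \<inter> (\<phi> \<circ> r) -` V)" by simp
    qed
  qed
  have comp: "charts_compatible ?n (s ` U, \<phi> \<circ> r) (s ` V, \<psi> \<circ> r)" if U: "(U, \<phi>) \<in> matlas B" and V: "(V, \<psi>) \<in> matlas B" for U \<phi> V \<psi>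
  proof -
    have half: "smooth_on_coords ?n ?n ((\<phi> \<circ> r) ` (s ` U \<inter> s ` V)) (\<psi> \<circ> r \<circ> inv_into (s ` U) (\<phi> \<circ> r))"
      if U: "(U, \<phi>) \<in> matlas B" and V: "(V, \<psi>) \<in> matlas B" for U \<phi> V \<psi>
    proof -
      note c = is_chartD[OF atlas_manifold_chart[OF Ba U]] and d = is_chartD[OF atlas_manifold_chart[OF Ba V]]
      have UC: "U \<subseteq> ?C" "V \<subseteq> ?C" using openin_subset[OF c(1)] openin_subset[OF d(1)] .
      have "s ` U \<inter> s ` V = s ` (U \<inter> V)" using UC rs by (auto simp: subset_iff) (metis IntI imageI)
      then have e: "(\<phi> \<circ> r) ` (s ` U \<inter> s ` V) = \<phi> ` (U \<inter> V)"
        unfolding image_comp[symmetric] using rimg[of "U \<inter> V"] UC by (metis le_infI1)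
      have o: "openin (Euclidean_space ?n) (\<phi> ` (U \<inter> V))" using c(3)[OF d(1)] .
      have i: "inv_into (s ` U) (\<phi> \<circ> r) (\<phi> p) = s p" if "p \<in> U" for p
        using inv_into_f_f[OF is_chartD(2)[OF chart[OF U]], of "s p"] that UC rs by auto
      have sc: "smooth_on_coords ?n ?n (\<phi> ` (U \<inter> V)) (\<psi> \<circ> inv_into U \<phi>)"
        using atlas_manifold_compatible[OF Ba U V] by (simp add: charts_compatible_def)
      have "Ck_on k ?n (\<phi> ` (U \<inter> V)) (\<lambda>x. (\<psi> \<circ> r \<circ> inv_into (s ` U) (\<phi> \<circ> r)) x j)" if "j < ?n" for j k
      proof (rule Ck_on_cong[OF o])
        show "Ck_on k ?n (\<phi> ` (U \<inter> V)) (\<lambda>x. (\<psi> \<circ> inv_into U \<phi>) x j)" using sc that by (simp add: smooth_on_coords_def)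
        fix x assume "x \<in> \<phi> ` (U \<inter> V)"
        then obtain p where p: "p \<in> U" "x = \<phi> p" by blast
        then show "(\<psi> \<circ> inv_into U \<phi>) x j = (\<psi> \<circ> r \<circ> inv_into (s ` U) (\<phi> \<circ> r)) x j"
          using i[OF p(1)] c(2) UC rs by auto
      qed
      then show ?thesis unfolding e smooth_on_coords_def using o by blast
    qed
    show ?thesis using half[OF U V] half[OF V U] by (simp add: charts_compatible_def Int_commute)
  qed
  have A: "is_chart ?T ?n c" if "c \<in> ?A" for c using that chart by blast
  have A2: "charts_compatible ?n c c'" if "c \<in> ?A" "c' \<in> ?A" for c c' using that comp by blast
  have cov: "topspace ?T \<subseteq> \<Union> (fst ` ?A)"
  proof
    fix x assume "x \<in> topspace ?T"
    then obtain q where q: "q \<in> ?C" "x = s q" using tT by auto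
    obtain U \<phi> where "(U, \<phi>) \<in> matlas B" "q \<in> U" using atlas_manifold_cover[OF Ba q(1)] .
    then have "(s ` U, \<phi> \<circ> r) \<in> ?A" "x \<in> fst (s ` U, \<phi> \<circ> r)" using q by auto
    then show "x \<in> \<Union> (fst ` ?A)" by blast
  qed
  let ?N = "transport_manifold B s r"
  have Na: "atlas_manifold ?N" and sub: "?A \<subseteq> matlas ?N"
    unfolding transport_manifold_def
    by (rule atlas_generated_manifold[OF A cov A2], assumption+) (rule generated_manifold_charts[OF A cov A2], assumption+)
  have top: "mtop ?N = ?T" and dim: "mdim ?N = ?n" by (simp_all add: transport_manifold_def)
  show car: "mcarrier ?N = s ` ?C" by (simp add: top tT)
  have "homeomorphic_maps (mtop B) ?T s r"
    unfolding homeomorphic_maps_def continuous_map_def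
  proof (intro conjI allI impI ballI)
    fix U assume "openin ?T U"
    then obtain U0 where U0: "openin (mtop B) U0" "U = s ` U0" using openT by blast
    have "{q \<in> ?C. s q \<in> U} = U0"
      using U0 rs openin_subset[OF U0(1)] by (auto simp: subset_iff) (metis imageE)
    then show "openin (mtop B) {q \<in> ?C. s q \<in> U}" using U0 by simp
  next
    fix U assume U: "openin (mtop B) U"
    have "{x \<in> topspace ?T. r x \<in> U} = s ` U" unfolding tT using openin_subset[OF U] rs by force
    then show "openin ?T {x \<in> topspace ?T. r x \<in> U}" using openT U by blast
  qed (use rs tT in auto)
  then have "mtop B homeomorphic_space ?T" by (auto simp: homeomorphic_space_def)
  then have "Hausdorff_space ?T" "second_countable ?T"
    using homeomorphic_Hausdorff_space homeomorphic_space_second_countability B by (auto simp: smooth_manifold_iff)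
  then show "smooth_manifold ?N" using Na by (simp add: smooth_manifold_iff top)
  show "smap B ?C ?N s"
  proof (rule smapI_charts[OF Ba Na])
    fix q assume "q \<in> ?C"
    then obtain U \<phi> where U: "(U, \<phi>) \<in> matlas B" "q \<in> U" using atlas_manifold_cover[OF Ba] by metis
    note oU = is_chartD(1)[OF atlas_manifold_chart[OF Ba U(1)]]
    have "smf B U (\<lambda>p. (\<phi> \<circ> r) (s p) j)" for j
      by (rule smf_cong[OF Ba smf_chart_coord[OF Ba U(1)]]) (use rs openin_subset[OF oU] in auto)
    moreover have "(s ` U, \<phi> \<circ> r) \<in> matlas ?N" using sub U(1) by blast
    ultimately show "\<exists>W' V \<psi>. q \<in> W' \<and> W' \<subseteq> ?C \<and> openin (mtop B) W' \<and> (V, \<psi>) \<in> matlas ?N \<and> s ` W' \<subseteq> V \<and>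
       (\<forall>j<mdim ?N. smf B W' (\<lambda>p. \<psi> (s p) j))"
      using U(2) oU openin_subset[OF oU]
      by (intro exI[of _ U] exI[of _ "s ` U"] exI[of _ "\<phi> \<circ> r"]) simp
  qed
  show "smap ?N (s ` ?C) B r"
  proof (rule smapI_charts[OF Na Ba])
    fix x assume "x \<in> s ` ?C"
    then obtain q where q: "q \<in> ?C" "x = s q" by auto
    then obtain U \<phi> where U: "(U, \<phi>) \<in> matlas B" "q \<in> U" using atlas_manifold_cover[OF Ba] by metis
    note oU = is_chartD(1)[OF atlas_manifold_chart[OF Ba U(1)]]
    have c: "(s ` U, \<phi> \<circ> r) \<in> matlas ?N" using sub U(1) by blast
    have "smf ?N (s ` U) (\<lambda>p. \<phi> (r p) j)" for j using smf_chart_coord[OF Na c, of j] by (simp add: o_def)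
    moreover have "openin (mtop ?N) (s ` U)" using is_chartD(1)[OF atlas_manifold_chart[OF Na c]] .
    moreover have "r ` s ` U \<subseteq> U" using rimg[OF openin_subset[OF oU]] by simp
    ultimately show "\<exists>W' V \<psi>. x \<in> W' \<and> W' \<subseteq> s ` ?C \<and> openin (mtop ?N) W' \<and> (V, \<psi>) \<in> matlas B \<and> r ` W' \<subseteq> V \<and>
       (\<forall>j<mdim B. smf ?N W' (\<lambda>p. \<psi> (r p) j))"
      using U q openin_subset[OF oU]
      by (intro exI[of _ "s ` U"] exI[of _ U] exI[of _ \<phi>]) (simp add: image_mono)
  qed
qed

context field_bundle
begin

text \<open>Total space, weights and fiber coordinates are kept; only the base is replaced by the
  image of the zero section, so that the projection becomes \<open>h 0\<close>. The base of
  \<open>E\<close> itself may have nothing to do with the points of the total space.\<close>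

lemma bundle_over_zero_section: "\<exists>E'. bundle_of_structure (tot E) h E'"
proof -
  let ?M = "tot E" and ?B = "base E" and ?\<tau> = "proj E" and ?s = zero_section and ?ws = "weights E"
  let ?C = "mcarrier ?B"
  define B' where "B' = transport_manifold ?B ?s ?\<tau>"
  have rs: "?\<tau> (?s q) = q" if "q \<in> ?C" for q using zero_section_props[OF that] by simp
  note tr = transport_smooth_manifold[where s = ?s and r = ?\<tau>, OF base_smooth rs, folded B'_def]
    transport_carrier[where s = ?s and r = ?\<tau>, OF base_smooth rs, folded B'_def]
    transport_smap[where s = ?s and r = ?\<tau>, OF base_smooth rs, folded B'_def]
    transport_smap_inverse[where s = ?s and r = ?\<tau>, OF base_smooth rs, folded B'_def]
  have B'a: "atlas_manifold B'" using tr(1) by simp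
  have h0: "smap ?M (mcarrier ?M) B' (h 0)"
    by (rule smap_cong[OF tot_atlas smap_compose[OF proj_smap tr(3)]]) (use homothety_zero proj_base in auto)
  have surj: "h 0 ` mcarrier ?M = mcarrier B'"
  proof -
    have "h 0 ` mcarrier ?M = ?s ` ?\<tau> ` mcarrier ?M" using homothety_zero by (force simp: image_iff)
    then show ?thesis using proj_surj tr(2) by simp
  qed
  have fib: "fibered_action ?M (h 0) h"
    unfolding fibered_action_def using homothety_props(1) homothety_mult by simp
  have "\<exists>U \<psi>. x \<in> U \<and> coord_triv ?M B' (h 0) (length ?ws) U \<psi> \<and> hom_coords ?M (h 0) ?ws h U \<psi>" if x: "x \<in> mcarrier B'" for x
  proof -
    obtain q where q: "q \<in> ?C" "x = ?s q" using x tr(2) by auto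
    obtain U \<psi> where U: "(U, \<psi>) \<in> trivs E" "q \<in> U" using trivs_cover[OF q(1)] .
    note c = trivs_coord[OF U(1)]
    obtain \<sigma> where s: "coord_section ?M ?B ?\<tau> (length ?ws) U \<psi> \<sigma>" using coord_trivE[OF c] .
    have UC: "U \<subseteq> ?C" using openin_subset[OF coord_trivD(1)[OF c]] .
    \<comment> \<open>The zero section is injective, so the old and the new projection have the same
      preimages of corresponding sets, and all facts about \<open>\<psi>\<close> carry over.\<close>
    have ov: "over ?M (h 0) (?s ` U) = over ?M ?\<tau> U"
    proof -
      have "h 0 p \<in> ?s ` U \<longleftrightarrow> ?\<tau> p \<in> U" if "p \<in> mcarrier ?M" for p
        using homothety_zero[OF that] proj_base[OF that] UC rs by (auto simp: image_iff subset_iff) metis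
      then show ?thesis by (auto simp: over_def)
    qed
    let ?K = "Kspace_manifold (length ?ws) :: (nat \<Rightarrow> 'k) manifold"
    let ?P = "product_manifold B' ?K"
    have Pa: "atlas_manifold ?P" using B'a by (intro atlas_product_manifold) auto
    have oU': "openin (mtop B') (?s ` U)"
    proof -
      have "openin (mtop B') (?s ` ?C \<inter> ?\<tau> -` U)"
        using smap_open_preimage[OF tr(4) base_atlas coord_trivD(1)[OF c]] .
      moreover have "?s ` ?C \<inter> ?\<tau> -` U = ?s ` U" using UC rs by force
      ultimately show ?thesis by simp
    qed
    have W: "openin (mtop ?P) (?s ` U \<times> Kspace (length ?ws))"
      using oU' by (simp add: openin_prod_Times_iff)
    have "smap ?P (?s ` U \<times> Kspace (length ?ws)) ?B (\<lambda>x. ?\<tau> (fst x))"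
      by (rule smap_compose[OF smap_fst[OF B'a atlas_Kspace W] tr(4)]) (use UC in auto)
    from smap_pair[OF base_atlas atlas_Kspace Pa this smap_snd[OF B'a atlas_Kspace W]]
    have 1: "smap ?P (?s ` U \<times> Kspace (length ?ws)) (product_manifold ?B ?K) (\<lambda>x. (?\<tau> (fst x), snd x))" .
    have "(\<lambda>x. (?\<tau> (fst x), snd x)) ` (?s ` U \<times> Kspace (length ?ws)) \<subseteq> U \<times> (Kspace (length ?ws) :: (nat \<Rightarrow> 'k) set)"
      using UC rs by auto
    from smap_compose[OF 1 coord_sectionD(1)[OF s] this]
    have 2: "smap ?P (?s ` U \<times> Kspace (length ?ws)) ?M (\<lambda>x. \<sigma> (?\<tau> (fst x)) (snd x))" by simp
    have "coord_section ?M B' (h 0) (length ?ws) (?s ` U) \<psi> (\<lambda>q z. \<sigma> (?\<tau> q) z)"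
      unfolding coord_section_def ov
    proof (intro conjI ballI 2)
      fix x z assume "x \<in> ?s ` U" and z: "z \<in> (Kspace (length ?ws) :: (nat \<Rightarrow> 'k) set)"
      then obtain q where q: "q \<in> U" "x = ?s q" by auto
      have e: "?\<tau> x = q" using q rs UC by auto
      show "\<psi> (\<sigma> (?\<tau> x) z) = z" using coord_sectionD(3)[OF s q(1) z] e by simp
      show "h 0 (\<sigma> (?\<tau> x) z) = x"
        using homothety_zero[OF coord_sectionD(5)[OF s q(1) z]] coord_sectionD(2)[OF s q(1) z] e q(2) by simp
    next
      fix p assume p: "p \<in> over ?M ?\<tau> U"
      then have "p \<in> mcarrier ?M" by (simp add: over_iff)
      then show "\<sigma> (?\<tau> (h 0 p)) (\<psi> p) = p" using coord_sectionD(4)[OF s p] homothety_props(2) by simp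
    qed
    then have "coord_triv ?M B' (h 0) (length ?ws) (?s ` U) \<psi>"
      unfolding coord_triv_def ov using oU' coord_trivD(2)[OF c] by blast
    moreover have "hom_coords ?M (h 0) ?ws h (?s ` U) \<psi>"
      using homothety_hom_coords[OF U(1)] by (simp add: hom_coords_def ov)
    ultimately show ?thesis using q U(2) by blast
  qed
  note cover = this
  have h0': "smooth_map ?M B' (h 0)" unfolding smooth_map_iff_smap[OF tot_atlas B'a] by (rule h0)
  note mk = mk_bundle[OF tot_smooth tr(1) h0' surj homothety_ext weights fib homothety_ext cover]
    homothety_mk_bundle[OF tot_smooth tr(1) h0' surj homothety_ext weights fib homothety_ext cover]
  show ?thesis
    by (rule exI[of _ "mk_bundle ?M B' (h 0) ?ws h"]) (use mk surj in \<open>simp add: bundle_of_structure_def\<close>)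
qed

end

context graded_field
begin

lemma bundle_of_structure_zero_section:
  assumes "bundle_of_structure M (h :: 'k \<Rightarrow> 'e \<Rightarrow> 'e) E" and q: "q \<in> mcarrier (base E)"
  shows "gr_bundle.zero_section E q = q" "h 0 q = q" "q \<in> mcarrier M"
proof -
  have E: "is_graded_bundle E" "tot E = M" "mcarrier (base E) = h 0 ` mcarrier M" "proj E = h 0" "homothety E = h"
    using assms(1) by (auto simp: bundle_of_structure_def)
  interpret E: gr_bundle E by unfold_locales fact
  obtain p where p: "p \<in> mcarrier M" "q = h 0 p" using q E(3) by auto
  show "E.zero_section q = q" using E.homothety_zero[of p] p E by simp
  show "h 0 q = q" using E.homothety_mult[of p 0 0] p E by simp
  show "q \<in> mcarrier M" using E.homothety_props(1)[of p 0] p E by simp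
qed

text \<open>The projection of one candidate after the zero section of the other is the identity on
  the common base points, so both bases have the same smooth structure. The weights are compared on
  one fiber, which needs a point, and the atlases then agree by \<open>trivs_iff\<close>.\<close>

lemma bundle_of_structure_unique:
  assumes E: "bundle_of_structure M (h :: 'k \<Rightarrow> 'e \<Rightarrow> 'e) E" and E': "bundle_of_structure M h E'" and ne: "mcarrier M \<noteq> {}"
  shows "E = E'"
proof -
  have E1: "is_graded_bundle E" "tot E = M" "mcarrier (base E) = h 0 ` mcarrier M" "proj E = h 0" "homothety E = h"
    using E by (auto simp: bundle_of_structure_def)
  have E1': "is_graded_bundle E'" "tot E' = M" "mcarrier (base E') = h 0 ` mcarrier M" "proj E' = h 0" "homothety E' = h"
    using E' by (auto simp: bundle_of_structure_def)
  interpret E: field_bundle K E by unfold_locales fact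
  interpret E': field_bundle K E' by unfold_locales fact
  have id: "smap (base A) (mcarrier (base A)) (base A') (\<lambda>q. q)"
    if A: "bundle_of_structure M h A" and A': "bundle_of_structure M h A'" for A A'
  proof -
    have A1: "is_graded_bundle A" "tot A = M" "proj A = h 0" and A1': "is_graded_bundle A'" "tot A' = M" "proj A' = h 0"
      using A A' by (auto simp: bundle_of_structure_def)
    interpret A: gr_bundle A by unfold_locales fact
    interpret A': gr_bundle A' by unfold_locales fact
    have "smap (base A) (mcarrier (base A)) (base A') (\<lambda>q. h 0 (A.zero_section q))"
      using smap_compose[OF A.zero_section_smap, of "mcarrier M" "base A'" "h 0"] A'.proj_smap A.zero_section_props(1) A1 A1'
      by auto
    then show ?thesis
      by (rule smap_cong[OF A.base_atlas]) (use bundle_of_structure_zero_section[OF A] in simp)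
  qed
  have base: "base E = base E'"
    by (rule manifold_eqI[OF E.base_atlas E'.base_atlas _ _ id[OF E E'] id[OF E' E]]) (use E1 E1' ne in auto)
  obtain p where "p \<in> mcarrier M" using ne by blast
  then obtain q where q: "q \<in> mcarrier (base E)" using E1(3) by blast
  obtain U \<psi> where U: "(U, \<psi>) \<in> trivs E" "q \<in> U" using E.trivs_cover[OF q] .
  obtain V \<theta> where V: "(V, \<theta>) \<in> trivs E'" "q \<in> V" using E'.trivs_cover q base by metis
  have "\<exists>g. graded_space_isomorphism (weights E) (weights E') g \<and> (\<forall>p\<in>mcarrier M. h 0 p = q \<longrightarrow> \<theta> p = g (\<psi> p))"
  proof (rule hom_coords_isomorphism[OF E.tot_atlas E.base_atlas E.weights_pos E'.weights_pos, unfolded E1])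
    show "coord_triv M (base E) (h 0) (length (weights E)) U \<psi>" "hom_coords M (h 0) (weights E) h U \<psi>"
      using E.trivs_coord[OF U(1)] E.homothety_hom_coords[OF U(1)] by (simp_all add: E1)
    show "coord_triv M (base E) (h 0) (length (weights E')) V \<theta>" "hom_coords M (h 0) (weights E') h V \<theta>"
      using E'.trivs_coord[OF V(1)] E'.homothety_hom_coords[OF V(1)] by (simp_all add: E1' base)
    show "fibered_action M (h 0) h" using E.homothety_fibered by (simp add: E1)
  qed (use U V in auto)
  then have weights: "weights E = weights E'" using graded_isomorphic_weights[OF E.weights E'.weights] by blast
  have "trivs E = trivs E'"
  proof (rule set_eqI)
    fix t show "t \<in> trivs E \<longleftrightarrow> t \<in> trivs E'"
      using E.trivs_iff[of "fst t" "snd t"] E'.trivs_iff[of "fst t" "snd t"] by (simp add: E1 E1' base weights)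
  qed
  then show ?thesis using base weights E1 E1' by (cases E; cases E') simp
qed

end

section \<open>Complex homogeneity structures\<close>

text \<open>New fiber coordinates give a trivialization as soon as the old ones are recovered from
  them by a smooth \<open>Y\<close>: the new section is the old one after \<open>Y\<close>. The two
  fields may differ, which covers the passage between real and complex coordinates.\<close>

lemma coord_triv_change:
  fixes \<psi> :: "'e \<Rightarrow> nat \<Rightarrow> 'k::euclidean_space" and \<psi>' :: "'e \<Rightarrow> nat \<Rightarrow> 'l::euclidean_space"
  assumes M: "atlas_manifold M" and B: "atlas_manifold B" and c: "openin (mtop B) U"
    and s: "coord_section M B \<tau> N U \<psi> \<sigma>" and U': "openin (mtop B) U'" "U' \<subseteq> U"
    and \<psi>': "smap M (over M \<tau> U') (Kspace_manifold N') \<psi>'"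
    and Y: "smap (product_manifold B (Kspace_manifold N')) (U' \<times> Kspace N') (Kspace_manifold N) (\<lambda>x. Y (fst x) (snd x))"
    and Y1: "\<And>p. p \<in> over M \<tau> U' \<Longrightarrow> Y (\<tau> p) (\<psi>' p) = \<psi> p"
    and Y2: "\<And>q z. q \<in> U' \<Longrightarrow> z \<in> Kspace N' \<Longrightarrow> \<psi>' (\<sigma> q (Y q z)) = z"
  shows "coord_triv M B \<tau> N' U' \<psi>'"
proof -
  let ?K' = "Kspace_manifold N' :: (nat \<Rightarrow> 'l) manifold"
  let ?P = "product_manifold B ?K'" and ?W = "U' \<times> (Kspace N' :: (nat \<Rightarrow> 'l) set)"
  have P: "atlas_manifold ?P" using B by (intro atlas_product_manifold) auto
  have W: "openin (mtop ?P) ?W" using U'(1) by (simp add: openin_prod_Times_iff)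
  have YK: "Y q z \<in> Kspace N" if "q \<in> U'" "z \<in> Kspace N'" for q z
    using smap_image[OF Y, of "(q, z)"] that by simp
  have 1: "smap ?P ?W (product_manifold B (Kspace_manifold N)) (\<lambda>x. (fst x, Y (fst x) (snd x)))"
    by (rule smap_pair[OF B atlas_Kspace P smap_fst[OF B atlas_Kspace W] Y])
  have "(\<lambda>x. (fst x, Y (fst x) (snd x))) ` ?W \<subseteq> U \<times> Kspace N" using U'(2) YK by auto
  from smap_compose[OF 1 coord_sectionD(1)[OF s] this]
  have "smap ?P ?W M (\<lambda>x. \<sigma> (fst x) (Y (fst x) (snd x)))" by simp
  moreover have "\<tau> (\<sigma> q (Y q z)) = q" if "q \<in> U'" "z \<in> Kspace N'" for q z
    using coord_sectionD(2)[OF s _ YK[OF that]] U'(2) that by auto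
  moreover have "\<sigma> (\<tau> p) (Y (\<tau> p) (\<psi>' p)) = p" if p: "p \<in> over M \<tau> U'" for p
  proof -
    have "p \<in> over M \<tau> U" using p U'(2) by (auto simp: over_iff)
    then show ?thesis using Y1[OF p] coord_sectionD(4)[OF s] by simp
  qed
  ultimately have "coord_section M B \<tau> N' U' \<psi>' (\<lambda>q z. \<sigma> q (Y q z))"
    using Y2 by (simp add: coord_section_def)
  then show ?thesis using U'(1) \<psi>' by (auto simp: coord_triv_def)
qed

lemma smf_section:
  assumes B: "atlas_manifold B" and P: "atlas_manifold P" and s: "coord_section M B \<tau> N U \<psi> \<sigma>"
    and f: "smf M (over M \<tau> U) f" and q: "smap P W B q" and z: "smap P W (Kspace_manifold N) z"
    and qU: "\<And>x. x \<in> W \<Longrightarrow> q x \<in> U"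
  shows "smf P W (\<lambda>x. f (\<sigma> (q x) (z x)))"
proof -
  have zK: "z x \<in> Kspace N" if "x \<in> W" for x using smap_image[OF z that] by simp
  have "(\<lambda>x. (q x, z x)) ` W \<subseteq> U \<times> Kspace N" using qU zK by auto
  from smap_compose[OF smap_pair[OF B atlas_Kspace P q z] coord_sectionD(1)[OF s] this]
  have "smap P W M (\<lambda>x. \<sigma> (q x) (z x))" by simp
  then show ?thesis
    by (rule smap_pull_subset[OF _ f]) (use coord_sectionD(6)[OF s] qU zK in auto)
qed

lemma smap_Kspace_real:
  assumes "atlas_manifold P" "openin (mtop P) W" "\<And>x. x \<in> W \<Longrightarrow> f x \<in> Kspace N"
    "\<And>a. a < N \<Longrightarrow> smf P W (\<lambda>x. f x a :: real)"
  shows "smap P W (Kspace_manifold N) f"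
  using assms by (simp add: smap_Kspace_ksmf)

lemma smf_Kspace_comp:
  assumes "smap P W (Kspace_manifold N) f"
  shows "smf P W (\<lambda>x. f x a :: real)"
proof -
  have "smf (Kspace_manifold N) (Kspace N) (\<lambda>z. z a :: real)" using ksmf_Kspace_coord[of N a, where 'a = real] by simp
  from smap_pull_subset[OF assms this] show ?thesis using smap_image[OF assms] by auto
qed

lemma section_polynomial:
  fixes h :: "real \<Rightarrow> 'e \<Rightarrow> 'e"
  assumes B: "atlas_manifold B" and ws: "is_weights ws" and c: "openin (mtop B) U"
    and s: "coord_section M B \<tau> (length ws) U \<psi> \<sigma>" and hc: "hom_coords M \<tau> ws h U \<psi>" and fib: "fibered_action M \<tau> h"
    and f: "smf M (over M \<tau> U) f" and hf: "\<And>t p. p \<in> over M \<tau> U \<Longrightarrow> f (h t p) = t ^ j * f p" and j: "1 \<le> j"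
    and q: "q \<in> U"
  shows "homogeneous_polynomial ws j (\<lambda>z. f (\<sigma> q z))"
proof (rule real_field.smooth_homogeneous)
  show "1 \<le> v" if "v \<in> set ws" for v using ws that by (simp add: is_weights_def)
  show "1 \<le> j" by fact
  have "smf (Kspace_manifold (length ws)) (Kspace (length ws)) (\<lambda>z. f (\<sigma> q z))"
    by (rule smap_pull_subset[OF smap_section_fiber[OF B s c q] f]) (use coord_sectionD(6)[OF s q] in auto)
  then show "ksmf (Kspace_manifold (length ws)) (Kspace (length ws)) (\<lambda>z. f (\<sigma> q z))" by simp
  show "f (\<sigma> q (graded_scale ws \<xi> z)) = \<xi> ^ j * f (\<sigma> q z)" if "z \<in> Kspace (length ws)" for \<xi> z
    unfolding coord_section_scale[OF s fib hc q that] using hf coord_sectionD(6)[OF s q that] by simp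
qed

text \<open>In a monomial of weight \<open>j\<close> a letter of weight \<open>j\<close> stands
  alone. So \<open>F\<close> is affine in the coordinate \<open>b\<close>, with a slope that does
  not depend on the other coordinates.\<close>

lemma homogeneous_polynomial_affine:
  fixes F :: "(nat \<Rightarrow> 'k::comm_ring_1) \<Rightarrow> 'k"
  assumes ws: "\<And>v. v \<in> set ws \<Longrightarrow> 1 \<le> v" and F: "homogeneous_polynomial ws j F"
    and y: "y \<in> Kspace (length ws)" and b: "b < length ws" "ws ! b = j"
  shows "F y = F (y(b := 0)) + F (unit_vec b) * y b"
proof -
  have y0: "y(b := 0) \<in> Kspace (length ws)" using y by (simp add: Kspace_def)
  have low: "lower_part ws j (y(b := 0)) = lower_part ws j y" using b by (auto simp: lower_part_def)
  let ?S = "{a. a < length ws \<and> ws ! a = j}"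
  have fin: "finite ?S" by simp
  have bS: "b \<in> ?S" using b by simp
  have "(\<Sum>a\<in>?S. F (unit_vec a) * y a) = F (unit_vec b) * y b + (\<Sum>a\<in>?S - {b}. F (unit_vec a) * y a)"
    by (rule sum.remove[OF fin bS])
  moreover have "(\<Sum>a\<in>?S. F (unit_vec a) * (y(b := 0)) a) = (\<Sum>a\<in>?S - {b}. F (unit_vec a) * y a)"
    by (subst sum.remove[OF fin bS]) (auto intro: sum.cong)
  ultimately show ?thesis
    using homogeneous_polynomial_decomposition[OF ws F y] homogeneous_polynomial_decomposition[OF ws F y0] low by simp
qed

text \<open>The coordinate \<open>b\<close> is replaced by \<open>f\<close>, which is put in the place \<open>c\<close>, and the coordinate \<open>c\<close> is moved to the place \<open>b\<close>.\<close>

lemma exchange_coordinate: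
  fixes h :: "real \<Rightarrow> 'e \<Rightarrow> 'e"
  assumes M: "atlas_manifold M" and B: "atlas_manifold B" and \<tau>: "smap M (mcarrier M) B \<tau>" and ws: "is_weights ws"
    and cU: "coord_triv M B \<tau> (length ws) U \<psi>" and s: "coord_section M B \<tau> (length ws) U \<psi> \<sigma>"
    and hc: "hom_coords M \<tau> ws h U \<psi>" and fib: "fibered_action M \<tau> h"
    and f: "smf M (over M \<tau> U) f" and hf: "\<And>t p. p \<in> over M \<tau> U \<Longrightarrow> f (h t p) = t ^ j * f p"
    and bc: "b < length ws" "c < length ws" "ws ! b = j" "ws ! c = j"
    and q0: "q0 \<in> U" "f (\<sigma> q0 (unit_vec b)) \<noteq> 0"
  defines "\<psi>' \<equiv> \<lambda>p a. if a = c then f p else if a = b then \<psi> p c else \<psi> p a"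
  shows "\<exists>U'\<subseteq>U. q0 \<in> U' \<and> coord_triv M B \<tau> (length ws) U' \<psi>' \<and> hom_coords M \<tau> ws h U' \<psi>'"
proof -
  let ?N = "length ws"
  let ?K = "Kspace_manifold ?N :: (nat \<Rightarrow> real) manifold"
  have oU: "openin (mtop B) U" using coord_trivD(1)[OF cU] .
  have pos: "\<And>v. v \<in> set ws \<Longrightarrow> 1 \<le> v" using ws by (simp add: is_weights_def)
  have j1: "1 \<le> j" using pos[OF nth_mem[OF bc(1)]] bc(3) by simp
  have pol: "homogeneous_polynomial ws j (\<lambda>z. f (\<sigma> q z))" if "q \<in> U" for q
    by (rule section_polynomial[OF B ws oU s hc fib f _ j1 that]) (rule hf)
  have uK: "unit_vec b \<in> (Kspace ?N :: (nat \<Rightarrow> real) set)" by (rule unit_vec_Kspace[OF bc(1)])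
  have fb: "smf B U (\<lambda>q. f (\<sigma> q (unit_vec b)))"
    by (rule smf_section[OF B B s f smap_id[OF B oU] smap_const[OF B atlas_Kspace oU]]) (use uK in auto)
  \<comment> \<open>Over \<open>U'\<close> the slope of \<open>f\<close> in the coordinate
    \<open>b\<close> does not vanish, so this coordinate can be recovered from the value of
    \<open>f\<close>.\<close>
  define U' where "U' = {q \<in> U. f (\<sigma> q (unit_vec b)) \<in> - {0}}"
  have oU': "openin (mtop B) U'" unfolding U'_def by (rule smf_open_preimage[OF B fb]) auto
  have U'U: "U' \<subseteq> U" and nz: "\<And>q. q \<in> U' \<Longrightarrow> f (\<sigma> q (unit_vec b)) \<noteq> 0" by (auto simp: U'_def)
  have st: "over M \<tau> U' \<subseteq> over M \<tau> U" using U'U by (auto simp: over_iff)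
  \<comment> \<open>The old coordinates are rebuilt from the new ones \<open>z\<close>:
    \<open>u\<close> undoes the move and empties the place \<open>b\<close>, and \<open>Y\<close>
    fills it by solving the affine equation for \<open>f\<close>, whose value is \<open>z c\<close>.
    The order of the clauses also covers \<open>b = c\<close>.\<close>
  define u where "u = (\<lambda>(z :: nat \<Rightarrow> real) a. if a = b then 0 else if a = c then z b else z a)"
  define Y where "Y = (\<lambda>q z. (u z)(b := (z c - f (\<sigma> q (u z))) / f (\<sigma> q (unit_vec b))))"
  have uKs: "u z \<in> Kspace ?N" if "z \<in> Kspace ?N" for z using that bc by (auto simp: u_def Kspace_def)
  let ?P = "product_manifold B ?K" and ?W = "U' \<times> (Kspace ?N :: (nat \<Rightarrow> real) set)"
  have P: "atlas_manifold ?P" using B by (intro atlas_product_manifold) auto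
  have W: "openin (mtop ?P) ?W" using oU' by (simp add: openin_prod_Times_iff)
  have sn: "smf ?P ?W (\<lambda>x. snd x a)" for a by (rule smf_Kspace_comp[OF smap_snd[OF B atlas_Kspace W]])
  have uS: "smf ?P ?W (\<lambda>x. u (snd x) a)" for a
    using sn smf_const[OF P W] by (cases "a = b"; cases "a = c") (auto simp: u_def)
  have uM: "smap ?P ?W ?K (\<lambda>x. u (snd x))"
    by (rule smap_Kspace_real[OF P W _ uS]) (use uKs in auto)
  have fu: "smf ?P ?W (\<lambda>x. f (\<sigma> (fst x) (u (snd x))))"
    by (rule smf_section[OF B P s f smap_fst[OF B atlas_Kspace W] uM]) (use U'U in auto)
  have fe: "smf ?P ?W (\<lambda>x. f (\<sigma> (fst x) (unit_vec b)))"
    by (rule smf_section[OF B P s f smap_fst[OF B atlas_Kspace W] smap_const[OF P atlas_Kspace W]]) (use U'U uK in auto)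
  have "smf ?P ?W (\<lambda>x. (snd x c - f (\<sigma> (fst x) (u (snd x)))) / f (\<sigma> (fst x) (unit_vec b)))"
    by (rule smf_divide[OF P smf_diff[OF P sn fu] fe]) (use nz in auto)
  then have YS: "smf ?P ?W (\<lambda>x. Y (fst x) (snd x) a)" for a
    using uS[of a] by (cases "a = b") (auto simp: Y_def)
  have YK: "Y q z \<in> Kspace ?N" if "z \<in> Kspace ?N" for q z
    using uKs[OF that] bc(1) by (auto simp: Y_def Kspace_def)
  have YM: "smap ?P ?W ?K (\<lambda>x. Y (fst x) (snd x))"
    by (rule smap_Kspace_real[OF P W _ YS]) (use YK in auto)
  have \<psi>K: "\<psi> p \<in> Kspace ?N" if "p \<in> over M \<tau> U" for p using coord_trivD(4)[OF cU that] .
  have \<psi>S: "smf M (over M \<tau> U) (\<lambda>p. \<psi> p a)" for a by (rule smf_Kspace_comp[OF coord_trivD(2)[OF cU]])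
  have \<psi>'S: "smf M (over M \<tau> U) (\<lambda>p. \<psi>' p a)" for a
    using \<psi>S f by (cases "a = c"; cases "a = b") (auto simp: \<psi>'_def)
  have \<psi>'K: "\<psi>' p \<in> Kspace ?N" if "p \<in> over M \<tau> U" for p
    using \<psi>K[OF that] bc by (auto simp: \<psi>'_def Kspace_def)
  have "smap M (over M \<tau> U) ?K \<psi>'"
    by (rule smap_Kspace_real[OF M coord_trivD(3)[OF cU] \<psi>'K \<psi>'S])
  moreover have "openin (mtop M) (over M \<tau> U')"
  proof -
    have "over M \<tau> U' = mcarrier M \<inter> \<tau> -` U'" by (auto simp: over_def)
    then show ?thesis using smap_open_preimage[OF \<tau> B oU'] by simp
  qed
  ultimately have \<psi>'M: "smap M (over M \<tau> U') ?K \<psi>'" using smap_subset[OF M _ _ st] by blast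
  have aff: "f (\<sigma> q y) = f (\<sigma> q (y(b := 0))) + f (\<sigma> q (unit_vec b)) * y b" if "q \<in> U" "y \<in> Kspace ?N" for q y
    by (rule homogeneous_polynomial_affine[OF pos pol[OF that(1)] that(2) bc(1,3)])
  have "coord_triv M B \<tau> ?N U' \<psi>'"
  proof (rule coord_triv_change[OF M B oU s oU' U'U \<psi>'M YM])
    fix p assume p': "p \<in> over M \<tau> U'"
    then have p: "p \<in> over M \<tau> U" and q: "\<tau> p \<in> U'" "\<tau> p \<in> U" using st U'U by (auto simp: over_iff)
    have e: "u (\<psi>' p) = (\<psi> p)(b := 0)" by (auto simp: u_def \<psi>'_def)
    have "f p = f (\<sigma> (\<tau> p) ((\<psi> p)(b := 0))) + f (\<sigma> (\<tau> p) (unit_vec b)) * \<psi> p b"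
      using aff[OF q(2) \<psi>K[OF p]] coord_sectionD(4)[OF s p] by simp
    then show "Y (\<tau> p) (\<psi>' p) = \<psi> p"
      using nz[OF q(1)] unfolding Y_def e by (auto simp: \<psi>'_def)
  next
    fix q z assume q': "q \<in> U'" and z: "z \<in> (Kspace ?N :: (nat \<Rightarrow> real) set)"
    have q: "q \<in> U" using q' U'U by auto
    note y = coord_sectionD(3)[OF s q YK[OF z]]
    have e: "(Y q z)(b := 0) = u z" by (auto simp: Y_def u_def)
    have "f (\<sigma> q (Y q z)) = z c"
      unfolding aff[OF q YK[OF z]] e using nz[OF q'] by (simp add: Y_def)
    then show "\<psi>' (\<sigma> q (Y q z)) = z"
      unfolding \<psi>'_def y by (auto simp: Y_def u_def)
  qed
  moreover have "hom_coords M \<tau> ws h U' \<psi>'"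
    unfolding hom_coords_def
  proof (intro allI ballI)
    fix t p assume "p \<in> over M \<tau> U'"
    then have p: "p \<in> over M \<tau> U" using st by blast
    have hp: "\<psi> (h t p) = graded_scale ws t (\<psi> p)" using hc p by (simp add: hom_coords_def)
    show "\<psi>' (h t p) = graded_scale ws t (\<psi>' p)"
    proof
      fix a show "\<psi>' (h t p) a = graded_scale ws t (\<psi>' p) a"
        using hp hf[OF p] bc by (auto simp: \<psi>'_def graded_scale_def)
    qed
  qed
  moreover have "q0 \<in> U'" using q0 by (simp add: U'_def)
  ultimately show ?thesis using U'U by blast
qed

section \<open>Roots of unity and coefficients of polynomials\<close>

lemma root_of_unity_power:
  assumes "1 \<le> n"
  shows "exp (2 * of_real pi * \<i> / of_nat n) ^ i = 1 \<longleftrightarrow> n dvd i"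
proof -
  have "exp (2 * of_real pi * \<i> / of_nat n) ^ i = exp (2 * of_real pi * \<i> * of_nat i / of_nat n)"
    by (subst exp_of_nat_mult[symmetric]) (simp add: mult_ac)
  then show ?thesis using complex_root_unity_eq_1[OF assms] by simp
qed

text \<open>This root of unity acts as multiplication by \<open>\<i>\<close> on functions of complex
  weight \<open>j\<close> and so exchanges real and imaginary parts up to sign.\<close>

lemma exp_half_root_power:
  assumes "1 \<le> j"
  shows "exp (of_real pi * \<i> / of_nat (2 * j)) ^ j = \<i>"
proof -
  have "exp (of_real pi * \<i> / of_nat (2 * j)) ^ j = exp (of_real (pi / 2) * \<i>)"
    using assms by (subst exp_of_nat_mult[symmetric]) (simp add: field_simps)
  also have "\<dots> = \<i>" by (simp add: exp_eq_polar complex_eq_iff exp_Euler)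
  finally show ?thesis .
qed

lemma poly_upto:
  fixes x :: "'a::comm_semiring_1"
  assumes "degree P \<le> n"
  shows "poly P x = (\<Sum>i\<le>n. coeff P i * x ^ i)"
proof -
  have "poly P x = poly (\<Sum>i\<le>n. monom (coeff P i) i) x" by (simp add: poly_as_sum_of_monoms'[OF assms])
  then show ?thesis by (simp add: poly_sum poly_monom)
qed

text \<open>The sum runs over the roots of unity of order \<open>2 * j + 1\<close>. The factor
  \<open>\<zeta> ^ k\<close> raises the exponent \<open>i\<close> of a monomial to
  \<open>i + 1\<close>, which for \<open>i \<le> 2 * j\<close> is a multiple of the order only if
  \<open>i = 2 * j\<close>; all other monomials sum to zero.\<close>

lemma poly_average_top_coeff:
  assumes "degree P \<le> 2 * j"
  defines "\<zeta> \<equiv> exp (2 * of_real pi * \<i> / of_nat (2 * j + 1))"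
  shows "(\<Sum>k<2 * j + 1. \<zeta> ^ k * poly P (\<zeta> ^ k)) = of_nat (2 * j + 1) * coeff P (2 * j)"
proof -
  let ?N = "2 * j + 1"
  have unity: "\<zeta> ^ i = 1 \<longleftrightarrow> ?N dvd i" for i
    unfolding \<zeta>_def by (rule root_of_unity_power) simp
  have geo: "(\<Sum>k<?N. (\<zeta> ^ (i + 1)) ^ k) = (if i = 2 * j then of_nat ?N else 0)" if "i \<le> 2 * j" for i
  proof (cases "i = 2 * j")
    case True
    then show ?thesis using unity[of ?N] by simp
  next
    case False
    have "\<not> ?N dvd i + 1" using that False by (auto dest: dvd_imp_le)
    then have ne: "\<zeta> ^ (i + 1) \<noteq> 1" using unity by blast
    have "(\<zeta> ^ (i + 1)) ^ ?N = \<zeta> ^ ((i + 1) * ?N)" by (simp only: power_mult)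
    then have "(\<zeta> ^ (i + 1)) ^ ?N = 1" using unity[of "(i + 1) * ?N"] by (simp only: dvd_triv_right simp_thms)
    then show ?thesis using geometric_sum[OF ne, of ?N] False by simp
  qed
  have "(\<Sum>k<?N. \<zeta> ^ k * poly P (\<zeta> ^ k)) = (\<Sum>k<?N. \<Sum>i\<le>2 * j. coeff P i * (\<zeta> ^ (i + 1)) ^ k)"
    by (intro sum.cong refl)
      (simp add: poly_upto[OF assms(1)] sum_distrib_left power_mult_distrib mult_ac flip: power_mult)
  also have "\<dots> = (\<Sum>i\<le>2 * j. coeff P i * (\<Sum>k<?N. (\<zeta> ^ (i + 1)) ^ k))"
    by (subst sum.swap) (simp only: sum_distrib_left)
  also have "\<dots> = (\<Sum>i\<le>2 * j. coeff P i * (if i = 2 * j then of_nat ?N else 0))"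
    by (intro sum.cong refl) (simp only: geo atMost_iff)
  also have "\<dots> = of_nat ?N * coeff P (2 * j)"
    by (subst sum.mono_neutral_right[of _ "{2 * j}"]) auto
  finally show ?thesis .
qed

section \<open>Complex homogeneity structures and holomorphic parts of real homogeneous
  functions\<close>

locale complex_structure =
  fixes M :: "'e manifold" and H :: "complex \<Rightarrow> 'e \<Rightarrow> 'e"
  assumes is_structure: "homogeneity_structure M H"
begin

lemma M_smooth: "smooth_manifold M" and H_ext: "H \<xi> \<in> extensional (mcarrier M)"
  and H_one: "p \<in> mcarrier M \<Longrightarrow> H 1 p = p" and H_mult: "p \<in> mcarrier M \<Longrightarrow> H \<xi> (H \<eta> p) = H (\<xi> * \<eta>) p"
  using is_structure by (auto simp: homogeneity_structure_def)

lemma M_atlas [simp]: "atlas_manifold M"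
  using M_smooth by simp

lemma H_smap: "smap (product_manifold field_manifold M) (mcarrier (product_manifold field_manifold M)) M (\<lambda>x. H (fst x) (snd x))"
proof -
  have "smooth_map (product_manifold field_manifold M) M (\<lambda>(\<xi>, p). H \<xi> p)"
    using is_structure by (simp add: homogeneity_structure_def)
  then show ?thesis
    unfolding smooth_map_iff_smap[OF atlas_product_manifold[OF atlas_field M_atlas] M_atlas] by (simp add: case_prod_beta')
qed

lemma H_carrier: "p \<in> mcarrier M \<Longrightarrow> H \<xi> p \<in> mcarrier M"
  using smap_image[OF H_smap, of "(\<xi>, p)"] by simp

lemma smap_H_compose:
  assumes P: "atlas_manifold P" and z: "smap P W field_manifold z" and p: "smap P W M p"
  shows "smap P W M (\<lambda>x. H (z x) (p x))"
proof -
  have "(\<lambda>x. (z x, p x)) ` W \<subseteq> mcarrier (product_manifold field_manifold M)"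
    using smap_image[OF p] by auto
  from smap_compose[OF smap_pair[OF atlas_field M_atlas P z p] H_smap this] show ?thesis by simp
qed

lemma H_fixed_smap: "smap M (mcarrier M) M (H \<xi>)"
  by (rule smap_H_compose[OF M_atlas smap_const[OF M_atlas atlas_field openin_topspace] smap_id[OF M_atlas openin_topspace]]) simp

text \<open>The complex line is taken as \<open>Kspace 1\<close>, a graded space with one coordinate
  of weight 1, so that the theory of homogeneous functions applies to orbits.\<close>

lemma orbit_smap:
  assumes "p \<in> mcarrier M"
  shows "smap (Kspace_manifold 1 :: (nat \<Rightarrow> complex) manifold) (Kspace 1) M (\<lambda>z. H (z 0) p)"
proof (rule smap_H_compose[OF atlas_Kspace])
  show "smap (Kspace_manifold 1 :: (nat \<Rightarrow> complex) manifold) (Kspace 1) field_manifold (\<lambda>z. z 0)"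
    by (simp add: smap_field_ksmf ksmf_Kspace_coord)
  show "smap (Kspace_manifold 1 :: (nat \<Rightarrow> complex) manifold) (Kspace 1) M (\<lambda>z. p)"
    by (rule smap_const) (use assms in simp_all)
qed

text \<open>For real \<open>y\<close> with \<open>y (H t p) = t ^ j * y p\<close>, the function \<open>\<xi> \<mapsto> y (H \<xi> p)\<close> is a polynomial in \<open>\<xi>\<close> and
  \<open>cnj \<xi>\<close> of total degree \<open>j\<close>; \<open>holo_part y j p\<close> is its coefficient at \<open>\<xi> ^ j\<close>.\<close>

definition holo_part :: "('e \<Rightarrow> real) \<Rightarrow> nat \<Rightarrow> 'e \<Rightarrow> complex" where
  "holo_part y j p = (\<Sum>k<2 * j + 1. exp (2 * of_real pi * \<i> / of_nat (2 * j + 1)) ^ (k * (j + 1)) *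
      of_real (y (H (exp (2 * of_real pi * \<i> / of_nat (2 * j + 1)) ^ k) p))) / of_nat (2 * j + 1)"

text \<open>A finite combination of the smooth functions \<open>y\<close> after
  \<open>H \<xi>\<close> is smooth; this is why the coefficient is extracted by a finite
  average.\<close>

lemma holo_part_smooth:
  assumes y: "smf M D y" and inv: "\<And>\<xi> p. p \<in> D \<Longrightarrow> H \<xi> p \<in> D"
  shows "ksmf M D (holo_part y j)"
proof -
  have o: "openin (mtop M) D" using smf_open[OF y] .
  have "smf M D (\<lambda>p. y (H \<xi> p))" for \<xi>
    by (rule smap_pull_subset[OF smap_subset[OF M_atlas H_fixed_smap o] y]) (use inv openin_subset[OF o] in auto)
  then have "ksmf M D (\<lambda>p. (\<Sum>k<2 * j + 1. exp (2 * of_real pi * \<i> / of_nat (2 * j + 1)) ^ (k * (j + 1)) *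
      of_real (y (H (exp (2 * of_real pi * \<i> / of_nat (2 * j + 1)) ^ k) p))) * (1 / of_nat (2 * j + 1)))"
    by (intro ksmf_mult[OF M_atlas] ksmf_sum[OF M_atlas o] ksmf_const[OF M_atlas o] ksmf_of_real[OF M_atlas])
  then show ?thesis by (rule ksmf_cong[OF M_atlas]) (simp add: holo_part_def)
qed

text \<open>Along the orbit of \<open>p\<close>, \<open>y\<close> is a smooth function of one
  complex variable of weight 1, homogeneous of degree \<open>j\<close> under real scalars;
  \<open>P\<close> is its circle polynomial.\<close>

lemma holo_part_polynomial:
  assumes y: "smf M D y" and inv: "\<And>\<xi> p. p \<in> D \<Longrightarrow> H \<xi> p \<in> D"
    and hom: "\<And>t p. p \<in> D \<Longrightarrow> y (H (of_real t) p) = t ^ j * y p" and p: "p \<in> D"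
  shows "\<exists>P. degree P \<le> 2 * j \<and> coeff P (2 * j) = holo_part y j p \<and>
    (\<forall>u. cmod u = 1 \<longrightarrow> u ^ j * of_real (y (H u p)) = poly P u)"
proof -
  have pM: "p \<in> mcarrier M" using p smf_subset_carrier[OF y] by auto
  let ?K = "Kspace_manifold 1 :: (nat \<Rightarrow> complex) manifold"
  define f where "f = (\<lambda>z :: nat \<Rightarrow> complex. complex_of_real (y (H (z 0) p)))"
  have "smf ?K (Kspace 1) (\<lambda>z. y (H (z 0) p))"
    by (rule smap_pull_subset[OF orbit_smap[OF pM] y]) (use inv p in auto)
  then have f: "ksmf ?K (Kspace 1) f" unfolding f_def by (rule ksmf_of_real[OF atlas_Kspace])
  have "f (graded_scale [1] (of_real t) z) = of_real t ^ j * f z" for t z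
  proof -
    have "H (of_real t * z 0) p = H (of_real t) (H (z 0) p)" using H_mult[OF pM] by simp
    then show ?thesis using hom[OF inv[OF p]] by (simp add: f_def graded_scale_def)
  qed
  then obtain c where "\<forall>z\<in>Kspace (length [1::nat]). \<exists>P. degree P \<le> 2 * j \<and>
     coeff P (2 * j) = (\<Sum>as\<in>index_lists (length [1::nat]) (\<lambda>a. [1] ! a) j. c as * (\<Prod>a\<leftarrow>as. z a)) \<and>
     (\<forall>u. cmod u = 1 \<longrightarrow> u ^ j * f (graded_scale [1] u z) = poly P u)"
    using real_homogeneous_circle_polynomial[of "[1]" f j] f by auto
  moreover have "unit_vec 0 \<in> (Kspace (length [1::nat]) :: (nat \<Rightarrow> complex) set)" by (rule unit_vec_Kspace) simp
  ultimately obtain P where P: "degree P \<le> 2 * j"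
      "\<And>u. cmod u = 1 \<Longrightarrow> u ^ j * f (graded_scale [1] u (unit_vec 0)) = poly P u" by blast
  have Pu: "u ^ j * of_real (y (H u p)) = poly P u" if "cmod u = 1" for u
    using P(2)[OF that] by (simp add: f_def graded_scale_def unit_vec_def)
  define \<zeta> where "\<zeta> = exp (2 * of_real pi * \<i> / of_nat (2 * j + 1))"
  have "cmod (\<zeta> ^ k) = 1" for k unfolding \<zeta>_def by (simp add: norm_power norm_exp_eq_Re)
  \<comment> \<open>The exponent \<open>k * (j + 1)\<close> in \<open>holo_part\<close> joins the
    factor \<open>\<zeta> ^ k\<close> of the average with the factor \<open>u ^ j\<close> at
    \<open>u = \<zeta> ^ k\<close>.\<close>
  then have "(\<Sum>k<2 * j + 1. \<zeta> ^ k * poly P (\<zeta> ^ k)) = (\<Sum>k<2 * j + 1. \<zeta> ^ (k * (j + 1)) * of_real (y (H (\<zeta> ^ k) p)))"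
    by (intro sum.cong refl) (simp add: Pu[symmetric] power_mult power_add)
  moreover have "(\<Sum>k<2 * j + 1. \<zeta> ^ k * poly P (\<zeta> ^ k)) = of_nat (2 * j + 1) * coeff P (2 * j)"
    unfolding \<zeta>_def by (rule poly_average_top_coeff[OF P(1)])
  moreover have "of_nat (2 * j + 1) \<noteq> (0 :: complex)" by (simp only: of_nat_eq_0_iff)
  ultimately have "coeff P (2 * j) = holo_part y j p"
    unfolding holo_part_def \<zeta>_def[symmetric] by (simp only: nonzero_mult_div_cancel_left eq_divide_eq mult.commute if_True not_False_eq_True)
  then show ?thesis using P(1) Pu by blast
qed

text \<open>Moving \<open>p\<close> by \<open>\<eta>\<close> on the circle substitutes
  \<open>u * \<eta>\<close> into its circle polynomial, and top coefficients give \<open>\<eta> ^ j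
  * holo_part y j (H \<eta> p) = \<eta> ^ (2 * j) * holo_part y j p\<close>. Real scalars pass
  through the average by assumption. Every nonzero \<open>\<xi>\<close> is a product of both kinds,
  and zero is real.\<close>

lemma holo_part_homogeneous:
  assumes y: "smf M D y" and inv: "\<And>\<xi> p. p \<in> D \<Longrightarrow> H \<xi> p \<in> D"
    and hom: "\<And>t p. p \<in> D \<Longrightarrow> y (H (of_real t) p) = t ^ j * y p" and p: "p \<in> D"
  shows "holo_part y j (H \<xi> p) = \<xi> ^ j * holo_part y j p"
proof -
  have pM: "p \<in> mcarrier M" if "p \<in> D" for p using that smf_subset_carrier[OF y] by auto
  have circle: "holo_part y j (H \<eta> p) = \<eta> ^ j * holo_part y j p" if \<eta>: "cmod \<eta> = 1" for \<eta>
  proof -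
    obtain P where P: "coeff P (2 * j) = holo_part y j p" "\<And>u. cmod u = 1 \<Longrightarrow> u ^ j * of_real (y (H u p)) = poly P u"
      using holo_part_polynomial[OF y inv hom p] by auto
    obtain Q where Q: "coeff Q (2 * j) = holo_part y j (H \<eta> p)"
      "\<And>u. cmod u = 1 \<Longrightarrow> u ^ j * of_real (y (H u (H \<eta> p))) = poly Q u"
      using holo_part_polynomial[OF y inv hom inv[OF p]] by auto
    have "smult (\<eta> ^ j) Q = pcompose P [:0, \<eta>:]"
    proof (rule poly_eq_on_unit_circle)
      fix u :: complex assume u: "cmod u = 1"
      have "poly (smult (\<eta> ^ j) Q) u = (u * \<eta>) ^ j * of_real (y (H (u * \<eta>) p))"
        by (simp add: Q(2)[OF u, symmetric] H_mult[OF pM[OF p]] power_mult_distrib mult_ac)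
      also have "\<dots> = poly P (u * \<eta>)" using u \<eta> by (intro P(2)) (simp add: norm_mult)
      finally show "poly (smult (\<eta> ^ j) Q) u = poly (pcompose P [:0, \<eta>:]) u" by (simp add: poly_pcompose)
    qed
    from arg_cong[OF this, of "\<lambda>R. coeff R (2 * j)"]
    have "\<eta> ^ j * holo_part y j (H \<eta> p) = \<eta> ^ j * (\<eta> ^ j * holo_part y j p)"
      unfolding coeff_smult coeff_pcompose_linear P(1) Q(1) by (simp add: mult_2 power_add)
    moreover have "\<eta> ^ j \<noteq> 0" using \<eta> by auto
    ultimately show ?thesis by (simp only: mult_cancel_left) blast
  qed
  have real: "holo_part y j (H (of_real t) p) = of_real t ^ j * holo_part y j p" if p: "p \<in> D" for t p
  proof -
    have "y (H \<xi> (H (of_real t) p)) = t ^ j * y (H \<xi> p)" for \<xi>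
    proof -
      have "H \<xi> (H (of_real t) p) = H (of_real t) (H \<xi> p)" using H_mult[OF pM[OF p]] by (simp add: mult.commute)
      then show ?thesis using hom[OF inv[OF p]] by simp
    qed
    moreover have "(\<Sum>k<n. a k * of_real (t ^ j * r k)) = of_real t ^ j * (\<Sum>k<n. a k * of_real (r k))"
      for n and a :: "nat \<Rightarrow> complex" and r
      by (simp add: sum_distrib_left mult_ac)
    ultimately show ?thesis by (simp only: holo_part_def times_divide_eq_right)
  qed
  show ?thesis
  proof (cases "\<xi> = 0")
    case True
    then show ?thesis using real[OF p, of 0] by simp
  next
    case False
    define \<eta> where "\<eta> = \<xi> / of_real (cmod \<xi>)"
    have \<eta>: "cmod \<eta> = 1" "\<xi> = of_real (cmod \<xi>) * \<eta>" using False by (simp_all add: \<eta>_def norm_divide)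
    have "H \<xi> p = H (of_real (cmod \<xi>)) (H \<eta> p)" using H_mult[OF pM[OF p]] \<eta>(2) by simp
    then have "holo_part y j (H \<xi> p) = of_real (cmod \<xi>) ^ j * (\<eta> ^ j * holo_part y j p)"
      using real[OF inv[OF p]] circle[OF \<eta>(1)] by simp
    also have "\<dots> = (of_real (cmod \<xi>) * \<eta>) ^ j * holo_part y j p" by (simp add: power_mult_distrib)
    finally show ?thesis using \<eta>(2) by simp
  qed
qed

text \<open>The assumption \<open>neg\<close> is made along the whole circle orbit of
  \<open>p\<close>, because an identity between polynomials in \<open>u\<close> is to be derived
  from it.\<close>

lemma Re_holo_part:
  assumes y: "smf M D y" and inv: "\<And>\<xi> p. p \<in> D \<Longrightarrow> H \<xi> p \<in> D"
    and hom: "\<And>t p. p \<in> D \<Longrightarrow> y (H (of_real t) p) = t ^ j * y p" and p: "p \<in> D" and j: "1 \<le> j"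
    and neg: "\<And>u. cmod u = 1 \<Longrightarrow> y (H (exp (2 * of_real pi * \<i> / of_nat (2 * j))) (H u p)) = - y (H u p)"
  shows "Re (holo_part y j p) = y p / 2"
proof -
  have pM: "p \<in> mcarrier M" using p smf_subset_carrier[OF y] by auto
  define \<epsilon> where "\<epsilon> = exp (2 * of_real pi * \<i> / of_nat (2 * j))"
  have e1: "cmod \<epsilon> = 1" by (simp add: \<epsilon>_def norm_exp_eq_Re)
  have ej: "\<epsilon> ^ j = -1"
    using j by (simp add: \<epsilon>_def exp_of_nat_mult[symmetric] mult_ac)
  obtain P where P: "degree P \<le> 2 * j" "coeff P (2 * j) = holo_part y j p"
      "\<And>u. cmod u = 1 \<Longrightarrow> u ^ j * of_real (y (H u p)) = poly P u"
    using holo_part_polynomial[OF y inv hom p] by auto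
  \<comment> \<open>The sign from \<open>neg\<close> cancels against
    \<open>\<epsilon> ^ j = -1\<close>, so \<open>P\<close> is invariant under multiplication of
    \<open>u\<close> by \<open>\<epsilon>\<close>. As \<open>\<epsilon>\<close> has order
    \<open>2 * j\<close>, only the coefficients of degree 0 and \<open>2 * j\<close>
    survive.\<close>
  have "pcompose P [:0, \<epsilon>:] = P"
  proof (rule poly_eq_on_unit_circle)
    fix u :: complex assume u: "cmod u = 1"
    have "poly P (u * \<epsilon>) = (u * \<epsilon>) ^ j * of_real (y (H (u * \<epsilon>) p))"
      using u e1 by (intro P(3)[symmetric]) (simp add: norm_mult)
    also have "H (u * \<epsilon>) p = H \<epsilon> (H u p)" using H_mult[OF pM] by (simp add: mult.commute)
    also have "y (H \<epsilon> (H u p)) = - y (H u p)" using neg[OF u] by (simp add: \<epsilon>_def)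
    also have "(u * \<epsilon>) ^ j * of_real (- y (H u p)) = poly P u"
      using P(3)[OF u] by (simp add: power_mult_distrib ej)
    finally show "poly (pcompose P [:0, \<epsilon>:]) u = poly P u" by (simp add: poly_pcompose)
  qed
  then have co: "\<epsilon> ^ i * coeff P i = coeff P i" for i by (metis coeff_pcompose_linear)
  have zero: "coeff P i = 0" if "i \<noteq> 0" "i < 2 * j" for i
  proof -
    have "\<not> 2 * j dvd i" using that by (auto dest: dvd_imp_le)
    then have "\<epsilon> ^ i \<noteq> 1" unfolding \<epsilon>_def using root_of_unity_power[of "2 * j" i] j by simp
    then show ?thesis using co[of i] by auto
  qed
  have poly: "poly P x = coeff P 0 + coeff P (2 * j) * x ^ (2 * j)" for x
  proof -
    have "poly P x = (\<Sum>i\<in>{0, 2 * j}. coeff P i * x ^ i)"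
      unfolding poly_upto[OF P(1)] by (rule sum.mono_neutral_right) (auto simp: zero)
    then show ?thesis using j by simp
  qed
  \<comment> \<open>Since \<open>v ^ (2 * j) = -1\<close> and \<open>v ^ j = \<i>\<close>, the
    values of \<open>P\<close> at 1 and at \<open>v\<close> give the sum and the difference of the
    two coefficients. As \<open>y\<close> is real, the difference is imaginary and drops out of the
    real part.\<close>
  define v where "v = exp (of_real pi * \<i> / of_nat (2 * j))"
  have v1: "cmod v = 1" by (simp add: v_def norm_exp_eq_Re)
  have v2: "v ^ (2 * j) = -1"
    unfolding v_def using j by (subst exp_of_nat_mult[symmetric]) simp
  have vj: "v ^ j = \<i>" unfolding v_def by (rule exp_half_root_power[OF j])
  have a: "complex_of_real (y p) = coeff P 0 + coeff P (2 * j)"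
    using P(3)[of 1] H_one[OF pM] by (simp add: poly)
  have b: "\<i> * complex_of_real (y (H v p)) = coeff P 0 - coeff P (2 * j)"
    using P(3)[OF v1] by (simp add: poly v2 vj)
  have "2 * coeff P (2 * j) = of_real (y p) - \<i> * of_real (y (H v p))" unfolding a b by simp
  then have "2 * Re (coeff P (2 * j)) = y p"
    by (metis Re_complex_of_real Re_i_times Im_complex_of_real minus_complex.simps(1) mult_2 plus_complex.simps(1) diff_zero neg_equal_zero)
  then show ?thesis using P(2) by simp
qed

end

section \<open>Nice structures\<close>

lemma homogeneous_polynomial_lower_zero:
  fixes f :: "(nat \<Rightarrow> 'k::comm_ring_1) \<Rightarrow> 'k"
  assumes ws: "\<And>v. v \<in> set ws \<Longrightarrow> 1 \<le> v" and f: "homogeneous_polynomial ws w f" and z: "z \<in> Kspace (length ws)"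
    and low: "\<And>a. a < length ws \<Longrightarrow> ws ! a < w \<Longrightarrow> z a = 0"
  shows "f z = (\<Sum>b | b < length ws \<and> ws ! b = w. f (unit_vec b) * z b)"
proof -
  have "lower_part ws w z = (\<lambda>_. 0)" using low by (auto simp: lower_part_def)
  then show ?thesis using homogeneous_polynomial_decomposition[OF ws f z] homogeneous_polynomial_zero[OF f] by simp
qed

section \<open>Cores, in terms of points of the total space\<close>

context gr_bundle
begin

text \<open>Representatives of the classes in \<open>core E j\<close>; calculations are done with
  these points instead of with classes.\<close>

definition core_point :: "nat \<Rightarrow> 'e \<Rightarrow> bool" where
  "core_point j p \<longleftrightarrow> p \<in> mcarrier (tot E) \<and> (\<forall>(U, \<psi>)\<in>trivs E. proj E p \<in> U \<longrightarrow>
     (\<forall>a<length (weights E). weights E ! a < j \<longrightarrow> \<psi> p a = 0))"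

lemma core_pointD:
  assumes "core_point j p" "(U, \<psi>) \<in> trivs E" "proj E p \<in> U" "a < length (weights E)" "weights E ! a < j"
  shows "\<psi> p a = 0"
proof -
  have "\<forall>(U, \<psi>)\<in>trivs E. proj E p \<in> U \<longrightarrow> (\<forall>a<length (weights E). weights E ! a < j \<longrightarrow> \<psi> p a = 0)"
    using assms(1) by (simp add: core_point_def)
  from bspec[OF this assms(2)] show ?thesis using assms(3-5) by simp
qed

lemma core_point_carrier: "core_point j p \<Longrightarrow> p \<in> mcarrier (tot E)"
  by (simp add: core_point_def)

text \<open>Where all coordinates below \<open>j\<close> vanish, a polynomial of weight at most
  \<open>j\<close> is reduced to its linear part. So on the core transition functions are linear,
  with a matrix depending on the fiber only.\<close>

lemma transition_core:
  assumes U: "(U, \<psi>) \<in> trivs E" "q \<in> U" and V: "(V, \<theta>) \<in> trivs E" "q \<in> V"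
  shows "\<exists>A. \<forall>p. p \<in> mcarrier (tot E) \<longrightarrow> proj E p = q \<longrightarrow>
     (\<forall>a<length (weights E). weights E ! a < j \<longrightarrow> \<psi> p a = 0) \<longrightarrow>
     (\<forall>a<length (weights E). weights E ! a \<le> j \<longrightarrow>
        \<theta> p a = (\<Sum>b | b < length (weights E) \<and> weights E ! b = weights E ! a. A a b * \<psi> p b))"
proof -
  let ?ws = "weights E"
  obtain g where g: "graded_space_isomorphism ?ws ?ws g" and \<theta>: "\<forall>p\<in>fiber E q. \<theta> p = g (\<psi> p)"
    using trivs_transition[OF U(1) V(1) U(2) V(2)] by blast
  have gm: "homogeneous_polynomial ?ws (?ws ! a) (\<lambda>z. g z a)" if "a < length ?ws" for a
    using g that by (simp add: graded_space_isomorphism_def graded_space_morphism_def)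
  have "\<theta> p a = (\<Sum>b | b < length ?ws \<and> ?ws ! b = ?ws ! a. g (unit_vec b) a * \<psi> p b)"
    if p: "p \<in> mcarrier (tot E)" "proj E p = q" and low: "\<And>a. a < length ?ws \<Longrightarrow> ?ws ! a < j \<Longrightarrow> \<psi> p a = 0"
      and a: "a < length ?ws" "?ws ! a \<le> j" for p a
  proof -
    have "\<psi> p \<in> Kspace (length ?ws)"
      by (rule coord_trivD(4)[OF trivs_coord[OF U(1)]]) (use p U(2) in \<open>simp add: over_iff\<close>)
    from homogeneous_polynomial_lower_zero[OF weights_pos gm[OF a(1)] this]
    have "g (\<psi> p) a = (\<Sum>b | b < length ?ws \<and> ?ws ! b = ?ws ! a. g (unit_vec b) a * \<psi> p b)" using low a(2) by simp
    then show ?thesis using \<theta> p by (simp add: fiber_def)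
  qed
  then show ?thesis by (intro exI[of _ "\<lambda>a b. g (unit_vec b) a"]) blast
qed

lemma core_pointI:
  assumes p: "p \<in> mcarrier (tot E)" and U: "(U, \<psi>) \<in> trivs E" "proj E p \<in> U"
    and low: "\<And>a. a < length (weights E) \<Longrightarrow> weights E ! a < j \<Longrightarrow> \<psi> p a = 0"
  shows "core_point j p"
  unfolding core_point_def
proof (intro conjI p ballI, clarify)
  fix V \<theta> a assume V: "(V, \<theta>) \<in> trivs E" "proj E p \<in> V" and a: "a < length (weights E)" "weights E ! a < j"
  obtain A where A: "\<forall>p'. p' \<in> mcarrier (tot E) \<longrightarrow> proj E p' = proj E p \<longrightarrow>
     (\<forall>a<length (weights E). weights E ! a < j \<longrightarrow> \<psi> p' a = 0) \<longrightarrow>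
     (\<forall>a<length (weights E). weights E ! a \<le> j \<longrightarrow>
        \<theta> p' a = (\<Sum>b | b < length (weights E) \<and> weights E ! b = weights E ! a. A a b * \<psi> p' b))"
    using transition_core[OF U V] by blast
  have "\<theta> p a = (\<Sum>b | b < length (weights E) \<and> weights E ! b = weights E ! a. A a b * \<psi> p b)"
    using A p low a by simp
  also have "\<dots> = 0" by (rule sum.neutral) (use low a in auto)
  finally show "\<theta> p a = 0" .
qed

text \<open>Transition functions being linear on the core, a scalar multiple in one trivialization
  is one in all of them. The scalars 1 and -1 occur below.\<close>

lemma core_scalar:
  assumes p: "core_point j p" "core_point j p'" "proj E p' = proj E p" and U: "(U, \<psi>) \<in> trivs E" "proj E p \<in> U"
    and s: "\<And>a. a < length (weights E) \<Longrightarrow> weights E ! a = j \<Longrightarrow> \<psi> p' a = s * \<psi> p a"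
    and V: "(V, \<theta>) \<in> trivs E" "proj E p \<in> V" and a: "a < length (weights E)" "weights E ! a = j"
  shows "\<theta> p' a = s * \<theta> p a"
proof -
  obtain A where A: "\<forall>p'. p' \<in> mcarrier (tot E) \<longrightarrow> proj E p' = proj E p \<longrightarrow>
     (\<forall>a<length (weights E). weights E ! a < j \<longrightarrow> \<psi> p' a = 0) \<longrightarrow>
     (\<forall>a<length (weights E). weights E ! a \<le> j \<longrightarrow>
        \<theta> p' a = (\<Sum>b | b < length (weights E) \<and> weights E ! b = weights E ! a. A a b * \<psi> p' b))"
    using transition_core[OF U V] by blast
  have x: "\<theta> x a = (\<Sum>b | b < length (weights E) \<and> weights E ! b = j. A a b * \<psi> x b)"
    if "core_point j x" "proj E x = proj E p" for x
    using A core_point_carrier[OF that(1)] that(2) core_pointD[OF that(1) U(1)] U(2) a by simp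
  have "\<theta> p' a = (\<Sum>b | b < length (weights E) \<and> weights E ! b = j. s * (A a b * \<psi> p b))"
    unfolding x[OF p(2,3)] by (rule sum.cong) (use s in \<open>auto simp: mult_ac\<close>)
  then show ?thesis unfolding x[OF p(1) refl] by (simp add: sum_distrib_left)
qed

lemma tower_rel_iff:
  "(p, p') \<in> tower_rel E j \<longleftrightarrow> p \<in> mcarrier (tot E) \<and> p' \<in> mcarrier (tot E) \<and> proj E p' = proj E p \<and>
     (\<forall>U \<psi> a. (U, \<psi>) \<in> trivs E \<longrightarrow> proj E p \<in> U \<longrightarrow> a < length (weights E) \<longrightarrow> weights E ! a \<le> j \<longrightarrow> \<psi> p a = \<psi> p' a)"
  by (auto simp: tower_rel_def fiber_def)

lemma equiv_tower_rel: "equiv (mcarrier (tot E)) (tower_rel E j)"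
proof (rule equivI)
  show "refl_on (mcarrier (tot E)) (tower_rel E j)" by (auto simp: refl_on_def tower_rel_iff)
  show "sym (tower_rel E j)"
  proof (rule symI)
    show "(y, x) \<in> tower_rel E j" if "(x, y) \<in> tower_rel E j" for x y
      using that unfolding tower_rel_iff by metis
  qed
  show "trans (tower_rel E j)"
  proof (rule transI)
    show "(x, z) \<in> tower_rel E j" if "(x, y) \<in> tower_rel E j" "(y, z) \<in> tower_rel E j" for x y z
      using that unfolding tower_rel_iff by metis
  qed
qed (auto simp: tower_rel_iff)

text \<open>The case of the scalar 1 in \<open>core_scalar\<close>: equality of the coordinates of
  weight \<open>j\<close> carries over from one trivialization to all.\<close>

lemma tower_rel_core:
  assumes p: "core_point j p" and U: "(U, \<psi>) \<in> trivs E" "proj E p \<in> U"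
  shows "(p, p') \<in> tower_rel E j \<longleftrightarrow> core_point j p' \<and> proj E p' = proj E p \<and>
     (\<forall>a<length (weights E). weights E ! a = j \<longrightarrow> \<psi> p' a = \<psi> p a)" (is "?L \<longleftrightarrow> ?R")
proof
  assume L: ?L
  have l: "p' \<in> mcarrier (tot E)" "proj E p' = proj E p" and
    eq: "\<And>a. a < length (weights E) \<Longrightarrow> weights E ! a \<le> j \<Longrightarrow> \<psi> p a = \<psi> p' a"
    using L U unfolding tower_rel_iff by auto
  have "core_point j p'"
    by (rule core_pointI[OF l(1) U(1)]) (use l U eq core_pointD[OF p U] in auto)
  then show ?R using l eq by simp
next
  assume R: ?R
  show ?L
    unfolding tower_rel_iff
  proof (intro conjI allI impI)
    fix V \<theta> a assume V: "(V, \<theta>) \<in> trivs E" "proj E p \<in> V" and a: "a < length (weights E)" "weights E ! a \<le> j"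
    show "\<theta> p a = \<theta> p' a"
    proof (cases "weights E ! a = j")
      case True
      have "\<theta> p' a = 1 * \<theta> p a" by (rule core_scalar[OF p _ _ U _ V a(1) True]) (use R in auto)
      then show ?thesis by simp
    next
      case False
      then show ?thesis using core_pointD[OF p V a(1)] core_pointD[of j p' V \<theta> a] R V a by simp
    qed
  qed (use R p core_point_carrier in auto)
qed

lemma core_class: "core_point j p \<Longrightarrow> tower_rel E j `` {p} \<in> core E j"
proof -
  assume p: "core_point j p"
  obtain U \<psi> where U: "(U, \<psi>) \<in> trivs E" "proj E p \<in> U" using trivs_cover[OF proj_base[OF core_point_carrier[OF p]]] .
  have "\<forall>p'\<in>tower_rel E j `` {p}. core_point j p'" using tower_rel_core[OF p U] by auto
  moreover have "tower_rel E j `` {p} \<in> tower E j"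
    unfolding tower_def by (rule quotientI) (rule core_point_carrier[OF p])
  ultimately show ?thesis unfolding core_def core_point_def by blast
qed

lemma core_classE:
  assumes "x \<in> core E j"
  obtains p where "core_point j p" "x = tower_rel E j `` {p}"
proof -
  have "x \<in> mcarrier (tot E) // tower_rel E j" using assms by (simp add: core_def tower_def)
  then obtain p where p: "p \<in> mcarrier (tot E)" "x = tower_rel E j `` {p}" by (rule quotientE)
  have "p \<in> x" using p equiv_class_self[OF equiv_tower_rel] by simp
  then have "core_point j p" using assms p(1) by (simp add: core_def core_point_def)
  then show ?thesis using that p(2) by blast
qed

text \<open>The class of \<open>p'\<close> has the property that describes
  \<open>core_uminus\<close>, and any other class with it shares the coordinates of weight
  \<open>j\<close> with \<open>p'\<close> in the trivialization at hand.\<close>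

lemma core_uminus_class:
  assumes p: "core_point j p" "core_point j p'" "proj E p' = proj E p" and U: "(U, \<psi>) \<in> trivs E" "proj E p \<in> U"
    and neg: "\<And>a. a < length (weights E) \<Longrightarrow> weights E ! a = j \<Longrightarrow> \<psi> p' a = - \<psi> p a"
  shows "core_uminus E j (tower_rel E j `` {p}) = tower_rel E j `` {p'}"
  unfolding core_uminus_def
proof (rule the_equality)
  have U': "proj E p' \<in> U" using U(2) p(3) by simp
  show "tower_rel E j `` {p'} \<in> core E j \<and> (\<forall>x\<in>tower_rel E j `` {p}. \<forall>x'\<in>tower_rel E j `` {p'}.
     proj E x' = proj E x \<and> (\<forall>(U, \<psi>)\<in>trivs E. proj E x \<in> U \<longrightarrow>
        (\<forall>a<length (weights E). weights E ! a = j \<longrightarrow> \<psi> x' a = - \<psi> x a)))"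
  proof (intro conjI core_class p(2) ballI, goal_cases)
    case (1 x x') then show ?case using p(3) by (simp add: tower_rel_iff)
  next
    case (2 x x' t)
    obtain V \<theta> where t: "t = (V, \<theta>)" by (cases t)
    have x: "core_point j x" "proj E x = proj E p" "\<And>a. a < length (weights E) \<Longrightarrow> weights E ! a = j \<Longrightarrow> \<psi> x a = \<psi> p a"
      using 2(1) tower_rel_core[OF p(1) U] by auto
    have x': "core_point j x'" "proj E x' = proj E p'" "\<And>a. a < length (weights E) \<Longrightarrow> weights E ! a = j \<Longrightarrow> \<psi> x' a = \<psi> p' a"
      using 2(2) tower_rel_core[OF p(2) U(1) U'] by auto
    have "\<theta> x' a = (-1) * \<theta> x a" if "proj E x \<in> V" "a < length (weights E)" "weights E ! a = j" for a
      by (rule core_scalar[OF x(1) x'(1) _ U(1) _ _ _ that(1-3)]) (use x x' p(3) U neg 2(3) t in auto)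
    then show ?case using t by simp
  qed
next
  fix y
  assume y: "y \<in> core E j \<and> (\<forall>x\<in>tower_rel E j `` {p}. \<forall>x'\<in>y.
     proj E x' = proj E x \<and> (\<forall>(U, \<psi>)\<in>trivs E. proj E x \<in> U \<longrightarrow>
        (\<forall>a<length (weights E). weights E ! a = j \<longrightarrow> \<psi> x' a = - \<psi> x a)))"
  obtain p2 where p2: "core_point j p2" "y = tower_rel E j `` {p2}" using core_classE[of y j] y by blast
  have pp: "p \<in> tower_rel E j `` {p}" "p2 \<in> y"
    using equiv_class_self[OF equiv_tower_rel] core_point_carrier p(1) p2 by simp_all
  have a1: "proj E p2 = proj E p \<and> (\<forall>(U, \<psi>)\<in>trivs E. proj E p \<in> U \<longrightarrow>
        (\<forall>a<length (weights E). weights E ! a = j \<longrightarrow> \<psi> p2 a = - \<psi> p a))"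
    using conjunct2[OF y] pp by blast
  have "proj E p \<in> U \<longrightarrow> (\<forall>a<length (weights E). weights E ! a = j \<longrightarrow> \<psi> p2 a = - \<psi> p a)"
    using bspec[OF conjunct2[OF a1] U(1)] by simp
  then have "(p', p2) \<in> tower_rel E j"
    using tower_rel_core[OF p(2) U(1), of p2] p2(1) p(3) a1 U(2) neg by simp
  then show "y = tower_rel E j `` {p'}" using equiv_class_eq[OF equiv_tower_rel] p2(2) by metis
qed

lemma core_negative_exists:
  assumes p: "core_point j p" and U: "(U, \<psi>) \<in> trivs E" "proj E p \<in> U"
  shows "\<exists>p'. core_point j p' \<and> proj E p' = proj E p \<and>
     (\<forall>a<length (weights E). weights E ! a = j \<longrightarrow> \<psi> p' a = - \<psi> p a)"
proof -
  obtain \<sigma> where s: "coord_section (tot E) (base E) (proj E) (length (weights E)) U \<psi> \<sigma>"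
    using coord_trivE[OF trivs_coord[OF U(1)]] .
  define z where "z = (\<lambda>a. if a < length (weights E) \<and> weights E ! a = j then - \<psi> p a else 0)"
  have z: "z \<in> Kspace (length (weights E))" by (simp add: z_def Kspace_def)
  note x = coord_sectionD[OF s]
  have "core_point j (\<sigma> (proj E p) z)"
    by (rule core_pointI[OF x(5)[OF U(2) z] U(1)]) (use x(2,3)[OF U(2) z] U(2) in \<open>auto simp: z_def\<close>)
  then show ?thesis using x(2,3)[OF U(2) z] by (intro exI[of _ "\<sigma> (proj E p) z"]) (simp add: z_def)
qed

text \<open>Turns niceness, an equation between classes, into one between coordinates: a negative of
  \<open>p\<close> exists in its fiber, and its class contains \<open>f p\<close>.\<close>

lemma core_uminus_coords:
  assumes nice: "\<forall>x\<in>core E j. tower_map E j f x = core_uminus E j x"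
    and p: "core_point j p" "f p \<in> mcarrier (tot E)" and U: "(U, \<psi>) \<in> trivs E" "proj E p \<in> U"
    and a: "a < length (weights E)" "weights E ! a = j"
  shows "\<psi> (f p) a = - \<psi> p a"
proof -
  obtain p' where p': "core_point j p'" "proj E p' = proj E p"
     "\<forall>a<length (weights E). weights E ! a = j \<longrightarrow> \<psi> p' a = - \<psi> p a"
    using core_negative_exists[OF p(1) U] by blast
  have "tower_map E j f (tower_rel E j `` {p}) = tower_rel E j `` {p'}"
    using nice core_class[OF p(1)] core_uminus_class[OF p(1) p'(1,2) U] p'(3) by simp
  moreover have "f p \<in> tower_map E j f (tower_rel E j `` {p})"
    unfolding tower_map_def
    using equiv_class_self[OF equiv_tower_rel core_point_carrier[OF p(1)]] equiv_class_self[OF equiv_tower_rel p(2)] by blast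
  ultimately have "(p', f p) \<in> tower_rel E j" by auto
  then show ?thesis using tower_rel_core[OF p'(1) U(1), of "f p"] p' U(2) a by simp
qed

text \<open>The converse passage, from coordinates to classes. The trivialization in
  \<open>neg\<close> may vary with the point; \<open>core_scalar\<close> carries the sign over to a
  common one.\<close>

lemma tower_map_core_uminus:
  assumes f: "\<And>p. core_point j p \<Longrightarrow> f p \<in> mcarrier (tot E) \<and> proj E (f p) = proj E p"
    and neg: "\<And>p. core_point j p \<Longrightarrow> \<exists>U \<psi>. (U, \<psi>) \<in> trivs E \<and> proj E p \<in> U \<and>
      (\<forall>a<length (weights E). weights E ! a \<le> j \<longrightarrow> weights E ! a = j \<or> \<psi> (f p) a = 0) \<and>
      (\<forall>a<length (weights E). weights E ! a = j \<longrightarrow> \<psi> (f p) a = - \<psi> p a)"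
    and x: "x \<in> core E j"
  shows "tower_map E j f x = core_uminus E j x"
proof -
  obtain p where p: "core_point j p" "x = tower_rel E j `` {p}" using core_classE[OF x] .
  have fc: "core_point j (f p)" if p: "core_point j p" for p
  proof -
    obtain U \<psi> where U: "(U, \<psi>) \<in> trivs E" "proj E p \<in> U"
      "\<forall>a<length (weights E). weights E ! a \<le> j \<longrightarrow> weights E ! a = j \<or> \<psi> (f p) a = 0" using neg[OF p] by blast
    show ?thesis by (rule core_pointI[OF _ U(1)]) (use U f[OF p] in auto)
  qed
  obtain U \<psi> where U: "(U, \<psi>) \<in> trivs E" "proj E p \<in> U"
    "\<forall>a<length (weights E). weights E ! a = j \<longrightarrow> \<psi> (f p) a = - \<psi> p a" using neg[OF p(1)] by blast
  have negU: "\<psi> (f p1) a = - \<psi> p1 a"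
    if p1: "core_point j p1" "proj E p1 = proj E p" and a: "a < length (weights E)" "weights E ! a = j" for p1 a
  proof -
    obtain V \<theta> where V: "(V, \<theta>) \<in> trivs E" "proj E p1 \<in> V"
      "\<forall>a<length (weights E). weights E ! a = j \<longrightarrow> \<theta> (f p1) a = - \<theta> p1 a" using neg[OF p1(1)] by blast
    have "\<psi> (f p1) a = (-1) * \<psi> p1 a"
      by (rule core_scalar[OF p1(1) fc[OF p1(1)] _ V(1,2) _ U(1) _ a]) (use f[OF p1(1)] V U p1 in auto)
    then show ?thesis by simp
  qed
  have u: "core_uminus E j x = tower_rel E j `` {f p}"
    unfolding p(2) by (rule core_uminus_class[OF p(1) fc[OF p(1)] _ U(1,2)]) (use f[OF p(1)] U in auto)
  \<comment> \<open>\<open>tower_map\<close> takes the union over all representatives, so every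
    \<open>f p1\<close> with \<open>p1\<close> in the class must land in the class of
    \<open>f p\<close>.\<close>
  have rel: "(f p, f p1) \<in> tower_rel E j" if "p1 \<in> x" for p1
  proof -
    have p1: "core_point j p1" "proj E p1 = proj E p" "\<forall>a<length (weights E). weights E ! a = j \<longrightarrow> \<psi> p1 a = \<psi> p a"
      using that tower_rel_core[OF p(1) U(1,2)] p(2) by auto
    have Uf: "proj E (f p) \<in> U" using f[OF p(1)] U(2) by simp
    show ?thesis
      using tower_rel_core[OF fc[OF p(1)] U(1) Uf] fc[OF p1(1)] f[OF p(1)] f[OF p1(1)] p1 negU[OF p1(1,2)] U(3) by simp
  qed
  have "p \<in> x" using p equiv_class_self[OF equiv_tower_rel core_point_carrier[OF p(1)]] by simp
  have "tower_rel E j `` {f p1} = tower_rel E j `` {f p}" if "p1 \<in> x" for p1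
    using equiv_class_eq[OF equiv_tower_rel rel[OF that]] by simp
  then have "tower_map E j f x = tower_rel E j `` {f p}"
    unfolding tower_map_def using \<open>p \<in> x\<close> by blast
  then show ?thesis using u by simp
qed

end

section \<open>Real and imaginary parts as real coordinates\<close>

definition realify_weights :: "nat list \<Rightarrow> nat list" where
  "realify_weights ws = map (\<lambda>a. ws ! (a div 2)) [0..<2 * length ws]"

text \<open>Real and imaginary part of one coordinate stand next to each other; since both have its
  weight, the list of weights remains sorted.\<close>

definition realify_coords :: "nat \<Rightarrow> (nat \<Rightarrow> complex) \<Rightarrow> nat \<Rightarrow> real" where
  "realify_coords N z a = (if a < 2 * N then if even a then Re (z (a div 2)) else Im (z (a div 2)) else 0)"

definition complexify_coords :: "nat \<Rightarrow> (nat \<Rightarrow> real) \<Rightarrow> nat \<Rightarrow> complex" where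
  "complexify_coords N x i = (if i < N then Complex (x (2 * i)) (x (2 * i + 1)) else 0)"

lemma realify_coords_Kspace: "realify_coords N z \<in> Kspace (2 * N)"
  by (simp add: realify_coords_def Kspace_def)

lemma complexify_coords_Kspace: "complexify_coords N x \<in> Kspace N"
  by (simp add: complexify_coords_def Kspace_def)

lemma complexify_realify: "z \<in> Kspace N \<Longrightarrow> complexify_coords N (realify_coords N z) = z"
  by (rule ext) (auto simp: complexify_coords_def realify_coords_def Kspace_def)

lemma realify_complexify:
  assumes "x \<in> Kspace (2 * N)"
  shows "realify_coords N (complexify_coords N x) = x"
proof
  fix a :: nat
  have "2 * (a div 2) = (if even a then a else a - 1)" by (auto elim!: oddE evenE)
  then show "realify_coords N (complexify_coords N x) a = x a"
    using assms by (auto simp: complexify_coords_def realify_coords_def Kspace_def elim!: oddE)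
qed

lemma smap_realify:
  assumes P: "atlas_manifold P" and f: "smap P W (Kspace_manifold N) f"
  shows "smap P W (Kspace_manifold (2 * N)) (\<lambda>x. realify_coords N (f x))"
proof (rule smap_Kspace_real[OF P smap_open[OF f] realify_coords_Kspace])
  fix a assume a: "a < 2 * N"
  then have "ksmf P W (\<lambda>x. f x (a div 2))" using f by (simp add: smap_Kspace_ksmf[OF P])
  then show "smf P W (\<lambda>x. realify_coords N (f x) a)"
    using a by (cases "even a") (auto simp: ksmf_complex realify_coords_def)
qed

lemma smap_complexify:
  assumes P: "atlas_manifold P" and f: "smap P W (Kspace_manifold (2 * N)) f"
  shows "smap P W (Kspace_manifold N) (\<lambda>x. complexify_coords N (f x))"
  unfolding smap_Kspace_ksmf[OF P]
proof (intro conjI ballI allI impI smap_open[OF f] complexify_coords_Kspace)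
  fix a assume "a < N"
  then show "ksmf P W (\<lambda>x. complexify_coords N (f x) a)"
    using smf_Kspace_comp[OF f] by (simp add: ksmf_complex complexify_coords_def)
qed

lemma coord_triv_realify:
  assumes M: "atlas_manifold M" and B: "atlas_manifold B" and c: "coord_triv M B \<tau> N U \<psi>"
  shows "coord_triv M B \<tau> (2 * N) U (\<lambda>p. realify_coords N (\<psi> p))"
proof -
  obtain \<sigma> where s: "coord_section M B \<tau> N U \<psi> \<sigma>" using coord_trivE[OF c] .
  let ?P = "product_manifold B (Kspace_manifold (2 * N) :: (nat \<Rightarrow> real) manifold)"
  let ?W = "U \<times> (Kspace (2 * N) :: (nat \<Rightarrow> real) set)"
  have P: "atlas_manifold ?P" using B by (intro atlas_product_manifold) auto
  have W: "openin (mtop ?P) ?W" using coord_trivD(1)[OF c] by (simp add: openin_prod_Times_iff)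
  show ?thesis
  proof (rule coord_triv_change[OF M B coord_trivD(1)[OF c] s coord_trivD(1)[OF c] subset_refl])
    show "smap M (over M \<tau> U) (Kspace_manifold (2 * N)) (\<lambda>p. realify_coords N (\<psi> p))"
      by (rule smap_realify[OF M coord_trivD(2)[OF c]])
    show "smap ?P ?W (Kspace_manifold N) (\<lambda>x. complexify_coords N (snd x))"
      by (rule smap_complexify[OF P smap_snd[OF B atlas_Kspace W]])
    show "complexify_coords N (realify_coords N (\<psi> p)) = \<psi> p" if "p \<in> over M \<tau> U" for p
      by (rule complexify_realify[OF coord_trivD(4)[OF c that]])
    show "realify_coords N (\<psi> (\<sigma> q (complexify_coords N z))) = z" if "q \<in> U" "z \<in> Kspace (2 * N)" for q z
      using coord_sectionD(3)[OF s that(1) complexify_coords_Kspace] realify_complexify[OF that(2)] by simp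
  qed
qed

lemma coord_triv_complexify:
  assumes M: "atlas_manifold M" and B: "atlas_manifold B" and c: "coord_triv M B \<tau> (2 * N) U \<psi>"
  shows "coord_triv M B \<tau> N U (\<lambda>p. complexify_coords N (\<psi> p))"
proof -
  obtain \<sigma> where s: "coord_section M B \<tau> (2 * N) U \<psi> \<sigma>" using coord_trivE[OF c] .
  let ?P = "product_manifold B (Kspace_manifold N :: (nat \<Rightarrow> complex) manifold)"
  let ?W = "U \<times> (Kspace N :: (nat \<Rightarrow> complex) set)"
  have P: "atlas_manifold ?P" using B by (intro atlas_product_manifold) auto
  have W: "openin (mtop ?P) ?W" using coord_trivD(1)[OF c] by (simp add: openin_prod_Times_iff)
  show ?thesis
  proof (rule coord_triv_change[OF M B coord_trivD(1)[OF c] s coord_trivD(1)[OF c] subset_refl])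
    show "smap M (over M \<tau> U) (Kspace_manifold N) (\<lambda>p. complexify_coords N (\<psi> p))"
      by (rule smap_complexify[OF M coord_trivD(2)[OF c]])
    show "smap ?P ?W (Kspace_manifold (2 * N)) (\<lambda>x. realify_coords N (snd x))"
      by (rule smap_realify[OF P smap_snd[OF B atlas_Kspace W]])
    show "realify_coords N (complexify_coords N (\<psi> p)) = \<psi> p" if "p \<in> over M \<tau> U" for p
      by (rule realify_complexify[OF coord_trivD(4)[OF c that]])
    show "complexify_coords N (\<psi> (\<sigma> q (realify_coords N z))) = z" if "q \<in> U" "z \<in> Kspace N" for q z
      using coord_sectionD(3)[OF s that(1) realify_coords_Kspace] complexify_realify[OF that(2)] by simp
  qed
qed

lemma is_weights_realify:
  assumes "is_weights ws"
  shows "is_weights (realify_weights ws)"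
  unfolding is_weights_def
proof
  show "sorted (realify_weights ws)"
    unfolding realify_weights_def sorted_iff_nth_mono
    using assms by (auto simp: is_weights_def intro!: sorted_nth_mono div_le_mono)
  show "\<forall>w\<in>set (realify_weights ws). 1 \<le> w"
    using assms by (auto simp: realify_weights_def is_weights_def)
qed

text \<open>The real bundle required by niceness arises from the complex one by taking real and
  imaginary parts of the coordinates. On its core the coordinates of weight \<open>j\<close> are
  multiplied by the \<open>j\<close>-th power of the root of unity, which is -1.\<close>

theorem homothety_nice:
  fixes E :: "('e, 'b, complex) graded_bundle"
  assumes "is_graded_bundle E"
  shows "nice_structure (tot E) (homothety E)"
proof -
  interpret E0: field_bundle "TYPE(complex)" E by unfold_locales fact
  \<comment> \<open>The real bundle has to lie over the image of \<open>homothety E 0\<close>, so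
    \<open>E\<close> is moved there first.\<close>
  obtain E' where E': "bundle_of_structure (tot E) (homothety E) E'" using E0.bundle_over_zero_section by blast
  let ?M = "tot E" and ?H = "homothety E" and ?B = "base E'" and ?ws = "weights E'"
  have e: "is_graded_bundle E'" "tot E' = ?M" "proj E' = ?H 0" "homothety E' = ?H" "mcarrier ?B = ?H 0 ` mcarrier ?M"
    using E' by (auto simp: bundle_of_structure_def)
  interpret E: field_bundle "TYPE(complex)" E' by unfold_locales fact
  let ?N = "length ?ws"
  define wr where "wr = realify_weights ?ws"
  have lwr: "length wr = 2 * ?N" and nwr: "\<And>a. a < 2 * ?N \<Longrightarrow> wr ! a = ?ws ! (a div 2)"
    by (simp_all add: wr_def realify_weights_def)
  define h where "h = restrict_real ?H"
  have h0: "h 0 = ?H 0" by (simp add: h_def restrict_real_def)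
  have fib: "fibered_action ?M (?H 0) h"
    using E.homothety_fibered by (simp add: e fibered_action_def h_def restrict_real_def)
  have real: "coord_triv ?M ?B (?H 0) (length wr) U (\<lambda>p. realify_coords ?N (\<psi> p))"
    "hom_coords ?M (?H 0) wr h U (\<lambda>p. realify_coords ?N (\<psi> p))" if U: "(U, \<psi>) \<in> trivs E'" for U \<psi>
  proof -
    show "coord_triv ?M ?B (?H 0) (length wr) U (\<lambda>p. realify_coords ?N (\<psi> p))"
      using coord_triv_realify[OF E.tot_atlas E.base_atlas E.trivs_coord[OF U]] by (simp add: e lwr)
    have "realify_coords ?N (graded_scale ?ws (of_real t) z) = graded_scale wr t (realify_coords ?N z)" for t z
      by (rule ext) (auto simp: realify_coords_def graded_scale_def lwr nwr simp flip: of_real_power)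
    then show "hom_coords ?M (?H 0) wr h U (\<lambda>p. realify_coords ?N (\<psi> p))"
      using E.homothety_hom_coords[OF U] by (simp add: hom_coords_def e h_def restrict_real_def)
  qed
  have cover: "\<exists>U \<psi>. q \<in> U \<and> coord_triv ?M ?B (?H 0) (length wr) U \<psi> \<and> hom_coords ?M (?H 0) wr h U \<psi>"
    if q: "q \<in> mcarrier ?B" for q
  proof -
    obtain U \<psi> where "(U, \<psi>) \<in> trivs E'" "q \<in> U" using E.trivs_cover[OF q] .
    then show ?thesis using real by blast
  qed
  have hext: "h t \<in> extensional (mcarrier ?M)" for t by (simp add: h_def restrict_real_def E0.homothety_ext)
  have wrw: "is_weights wr" unfolding wr_def by (rule is_weights_realify[OF E.weights])
  note mk = real_field.mk_bundle[OF E0.tot_smooth E.base_smooth E.proj_smooth[unfolded e] e(5)[symmetric] E0.homothety_ext wrw fib hext cover]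
    real_field.homothety_mk_bundle[OF E0.tot_smooth E.base_smooth E.proj_smooth[unfolded e] e(5)[symmetric] E0.homothety_ext wrw fib hext cover]
  define R where "R = mk_bundle ?M ?B (?H 0) wr h"
  have R: "tot R = ?M" "base R = ?B" "proj R = ?H 0" "weights R = wr"
    "\<And>U \<psi>. (U, \<psi>) \<in> trivs R \<longleftrightarrow> coord_triv ?M ?B (?H 0) (length wr) U \<psi> \<and> hom_coords ?M (?H 0) wr h U \<psi>"
    by (simp_all add: R_def)
  interpret R: field_bundle "TYPE(real)" R by unfold_locales (simp add: R_def mk(1))
  have bR: "bundle_of_structure ?M (restrict_real ?H) R"
    using mk e(5) h0 by (simp add: bundle_of_structure_def R_def h_def)
  have "tower_map R j (?H (exp (2 * of_real pi * \<i> / of_nat (2 * j)))) x = core_uminus R j x"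
    if j: "j \<in> {1..bundle_degree R}" and x: "x \<in> core R j" for j x
  proof (rule R.tower_map_core_uminus[OF _ _ x])
    let ?\<epsilon> = "exp (2 * of_real pi * \<i> / of_nat (2 * j))"
    have ej: "?\<epsilon> ^ j = -1" using j by (simp add: exp_of_nat_mult[symmetric] mult_ac)
    fix p assume p: "R.core_point j p"
    have pM: "p \<in> mcarrier ?M" using R.core_point_carrier[OF p] by (simp add: R)
    have pE: "p \<in> mcarrier (tot E')" using pM by (simp add: e)
    note hp = E.homothety_props[OF pE, unfolded e]
    show "?H ?\<epsilon> p \<in> mcarrier (tot R) \<and> proj R (?H ?\<epsilon> p) = proj R p" using hp(1,2) by (simp add: R)
    obtain U \<psi> where U: "(U, \<psi>) \<in> trivs E'" "?H 0 p \<in> U" using E.trivs_cover[OF E.proj_base[OF pE]] by (metis e(3))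
    let ?\<psi> = "\<lambda>p. realify_coords ?N (\<psi> p)"
    have UR: "(U, ?\<psi>) \<in> trivs R" using R(5) real[OF U(1)] by blast
    have \<psi>e: "\<psi> (?H ?\<epsilon> p) = graded_scale ?ws ?\<epsilon> (\<psi> p)" using hp(3)[OF U] .
    have low: "?\<psi> p a = 0" if "a < length wr" "wr ! a < j" for a
      using R.core_pointD[OF p UR, of a] U(2) that by (simp add: R)
    have neg: "?\<psi> (?H ?\<epsilon> p) a = - ?\<psi> p a" if "a < length wr" "wr ! a = j" for a
      using that ej unfolding \<psi>e by (auto simp: realify_coords_def graded_scale_def lwr nwr)
    \<comment> \<open>Multiplication by a complex number mixes the two real coordinates, so both
      must vanish. They stand at \<open>2 * (a div 2)\<close> and the next place and have the same
      weight.\<close>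
    have zero: "?\<psi> (?H ?\<epsilon> p) a = 0" if a: "a < length wr" "wr ! a < j" for a
    proof -
      have "a div 2 < ?N" using a(1) lwr by simp
      then have a2: "a div 2 < ?N" "2 * (a div 2) < length wr" "2 * (a div 2) + 1 < length wr"
        unfolding lwr by linarith+
      have "wr ! (2 * (a div 2)) < j" "wr ! (2 * (a div 2) + 1) < j" using a a2 by (simp_all add: nwr lwr)
      from low[OF a2(2) this(1)] low[OF a2(3) this(2)] have "\<psi> p (a div 2) = 0"
        using a2 by (auto simp: realify_coords_def lwr complex_eq_iff)
      then show ?thesis unfolding \<psi>e by (auto simp: realify_coords_def graded_scale_def)
    qed
    show "\<exists>U \<psi>. (U, \<psi>) \<in> trivs R \<and> proj R p \<in> U \<and>
      (\<forall>a<length (weights R). weights R ! a \<le> j \<longrightarrow> weights R ! a = j \<or> \<psi> (?H ?\<epsilon> p) a = 0) \<and>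
      (\<forall>a<length (weights R). weights R ! a = j \<longrightarrow> \<psi> (?H ?\<epsilon> p) a = - \<psi> p a)"
      using UR U(2) zero neg by (intro exI[of _ U] exI[of _ ?\<psi>]) (auto simp: R le_less)
  qed
  then show ?thesis
    unfolding nice_structure_def using E0.homothety_structure bR by blast
qed

section \<open>Complex coordinates on nice structures\<close>

locale nice_complex_structure = complex_structure M H + R: field_bundle "TYPE(real)" R
  for M :: "'e manifold" and H :: "complex \<Rightarrow> 'e \<Rightarrow> 'e" and R :: "('e, 'e, real) graded_bundle" +
  assumes R_bundle: "bundle_of_structure M (restrict_real H) R"
    and nice: "\<And>j. j \<in> {1..bundle_degree R} \<Longrightarrow> \<forall>x\<in>core R j.
      tower_map R j (H (exp (2 * of_real pi * \<i> / of_nat (2 * j)))) x = core_uminus R j x"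
begin

lemma R_simps: "tot R = M" "proj R = H 0" "homothety R = restrict_real H" "mcarrier (base R) = H 0 ` mcarrier M"
  using R_bundle by (auto simp: bundle_of_structure_def restrict_real_def)

lemma over_H: "p \<in> over M (H 0) U \<Longrightarrow> H \<xi> p \<in> over M (H 0) U"
  using H_carrier H_mult[of p 0 \<xi>] by (simp add: over_iff)

lemma trivs_real_scale:
  assumes "(U, \<psi>) \<in> trivs R" "p \<in> over M (H 0) U"
  shows "\<psi> (H (of_real t) p) = graded_scale (weights R) t (\<psi> p)"
  using R.homothety_hom_coords[OF assms(1)] assms(2) by (simp add: hom_coords_def R_simps restrict_real_def)

lemma trivs_coord_M: "(U, \<psi>) \<in> trivs R \<Longrightarrow> coord_triv M (base R) (H 0) (length (weights R)) U \<psi>"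
  using R.trivs_coord by (simp add: R_simps)

text \<open>\<open>H \<xi>\<close> commutes with the real homotheties and is therefore polynomial on
  fibers, with components of weight below \<open>j\<close> that vanish where all coordinates below
  \<open>j\<close> do. So the circle orbit on which \<open>Re_holo_part\<close> needs the sign stays
  in the core.\<close>

lemma core_point_H:
  assumes p: "R.core_point j p"
  shows "R.core_point j (H \<xi> p)"
proof -
  have pM: "p \<in> mcarrier M" using R.core_point_carrier[OF p] by (simp add: R_simps)
  obtain U \<psi> where U: "(U, \<psi>) \<in> trivs R" "H 0 p \<in> U"
    using R.trivs_cover[OF R.proj_base] pM by (metis R_simps(1,2))
  note c = trivs_coord_M[OF U(1)]
  have "\<exists>g. graded_space_morphism (weights R) (weights R) g \<and> (\<forall>x\<in>mcarrier M. H 0 x = H 0 p \<longrightarrow> \<psi> (H \<xi> x) = g (\<psi> x))"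
  proof (rule real_field.intertwining_polynomial[where h = "restrict_real H" and h' = "restrict_real H" and U = U and \<psi> = \<psi>
        and \<theta> = \<psi> and V = "over M (H 0) U" and \<Phi> = "H \<xi>" and W = "mcarrier M" and q = "H 0 p"])
    show "hom_coords M (H 0) (weights R) (restrict_real H) U \<psi>" "fibered_action M (H 0) (restrict_real H)"
      using R.homothety_hom_coords[OF U(1)] R.homothety_fibered by (simp_all add: R_simps)
    show "\<psi> (restrict_real H t x) = graded_scale (weights R) t (\<psi> x)" if "x \<in> over M (H 0) U" for t x
      using trivs_real_scale[OF U(1) that] by (simp add: restrict_real_def)
    show "x \<in> mcarrier M \<and> H \<xi> x \<in> over M (H 0) U" if "x \<in> mcarrier M" "H 0 x = H 0 p" for x
      using that U(2) over_H[of x U \<xi>] by (simp add: over_iff)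
    show "H \<xi> (restrict_real H t x) = restrict_real H t (H \<xi> x)" if "x \<in> mcarrier M" for t x
      using H_mult[OF that] by (simp add: restrict_real_def mult.commute)
  qed (use R.weights_pos c coord_trivD(2)[OF c] H_fixed_smap U(2) in simp_all)
  then obtain g where g: "graded_space_morphism (weights R) (weights R) g" "\<psi> (H \<xi> p) = g (\<psi> p)"
    using pM by blast
  have pU: "p \<in> over M (H 0) U" using pM U(2) by (simp add: over_iff)
  show ?thesis
  proof (rule R.core_pointI[OF _ U(1)])
    show "H \<xi> p \<in> mcarrier (tot R)" "proj R (H \<xi> p) \<in> U" using over_H[OF pU] by (simp_all add: R_simps over_iff)
    fix a assume a: "a < length (weights R)" "weights R ! a < j"
    have ga: "homogeneous_polynomial (weights R) (weights R ! a) (\<lambda>z. g z a)"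
      using g(1) a(1) by (simp add: graded_space_morphism_def)
    have low: "\<psi> p b = 0" if "b < length (weights R)" "weights R ! b < j" for b
      using R.core_pointD[OF p U(1) _ that] U(2) by (simp add: R_simps)
    have "g (\<psi> p) a = (\<Sum>b | b < length (weights R) \<and> weights R ! b = weights R ! a. g (unit_vec b) a * \<psi> p b)"
      by (rule homogeneous_polynomial_lower_zero[OF R.weights_pos ga coord_trivD(4)[OF c pU]]) (use low a in auto)
    also have "\<dots> = 0" by (rule sum.neutral) (use low a in auto)
    finally show "\<psi> (H \<xi> p) a = 0" using g(2) by simp
  qed
qed

text \<open>Niceness speaks of the weights up to the degree, which is the maximum of the
  list.\<close>

lemma weight_in_range: "a < length (weights R) \<Longrightarrow> weights R ! a \<in> {1..bundle_degree R}"
  using R.weights_pos[OF nth_mem] by (auto simp: bundle_degree_def weights_degree_def intro!: Max_ge)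

lemma nice_coords:
  assumes p: "R.core_point j p" and U: "(U, \<psi>) \<in> trivs R" "H 0 p \<in> U" and a: "a < length (weights R)" "weights R ! a = j"
  shows "\<psi> (H (exp (2 * of_real pi * \<i> / of_nat (2 * j))) p) a = - \<psi> p a"
proof (rule R.core_uminus_coords[OF nice p _ U(1) _ a])
  show "j \<in> {1..bundle_degree R}" using weight_in_range[OF a(1)] a(2) by simp
  show "H (exp (2 * of_real pi * \<i> / of_nat (2 * j))) p \<in> mcarrier (tot R)"
    using R.core_point_carrier[OF p] H_carrier by (simp add: R_simps)
qed (use U in \<open>simp add: R_simps\<close>)

text \<open>Progress of the construction: pairs are formed from the left, and as the list of weights
  is sorted this treats the weights in increasing order. The bound
  \<open>2 * i + 1 < length (weights R)\<close> will show that the number of coordinates is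
  even.\<close>

definition paired :: "nat \<Rightarrow> 'e set \<Rightarrow> ('e \<Rightarrow> nat \<Rightarrow> real) \<Rightarrow> bool" where
  "paired m U \<psi> \<longleftrightarrow> (\<forall>i<m. 2 * i + 1 < length (weights R) \<and> weights R ! (2 * i + 1) = weights R ! (2 * i) \<and>
     (\<forall>\<xi>. \<forall>p\<in>over M (H 0) U. Complex (\<psi> (H \<xi> p) (2 * i)) (\<psi> (H \<xi> p) (2 * i + 1)) =
        \<xi> ^ (weights R ! (2 * i)) * Complex (\<psi> p (2 * i)) (\<psi> p (2 * i + 1))))"

lemma exchange:
  assumes U: "(U, \<psi>) \<in> trivs R" "q0 \<in> U" and s: "coord_section M (base R) (H 0) (length (weights R)) U \<psi> \<sigma>"
    and f: "smf M (over M (H 0) U) f" "\<And>t p. p \<in> over M (H 0) U \<Longrightarrow> f (H (of_real t) p) = t ^ j * f p"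
    and bc: "b < length (weights R)" "c < length (weights R)" "weights R ! b = j" "weights R ! c = j"
    and nz: "f (\<sigma> q0 (unit_vec b)) \<noteq> 0"
  shows "\<exists>U'\<subseteq>U. q0 \<in> U' \<and> (U', \<lambda>p a. if a = c then f p else if a = b then \<psi> p c else \<psi> p a) \<in> trivs R"
proof -
  have "\<exists>U'\<subseteq>U. q0 \<in> U' \<and>
     coord_triv M (base R) (H 0) (length (weights R)) U' (\<lambda>p a. if a = c then f p else if a = b then \<psi> p c else \<psi> p a) \<and>
     hom_coords M (H 0) (weights R) (restrict_real H) U' (\<lambda>p a. if a = c then f p else if a = b then \<psi> p c else \<psi> p a)"
  proof (rule exchange_coordinate[OF M_atlas R.base_atlas _ R.weights trivs_coord_M[OF U(1)] s _ _ f(1) _ bc U(2) nz])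
    show "smap M (mcarrier M) (base R) (H 0)" using R.proj_smap by (simp add: R_simps)
    show "hom_coords M (H 0) (weights R) (restrict_real H) U \<psi>" "fibered_action M (H 0) (restrict_real H)"
      using R.homothety_hom_coords[OF U(1)] R.homothety_fibered by (simp_all add: R_simps)
    show "f (restrict_real H t p) = t ^ j * f p" if "p \<in> over M (H 0) U" for t p
      using f(2)[OF that] by (simp add: restrict_real_def)
  qed
  then show ?thesis unfolding R.trivs_iff R_simps .
qed

text \<open>The next two coordinates are replaced by the real and imaginary parts of \<open>z = holo_part y j\<close>, where \<open>y\<close> is
  the first of them. On the core \<open>Re z = y / 2\<close>. If \<open>Im z\<close> depended there on \<open>Re z\<close> and on the coordinates
  already paired only, \<open>z\<close> would have values in a real line, which multiplication by \<open>\<i>\<close> does not preserve.\<close>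

lemma paired_step:
  assumes U: "(U, \<psi>) \<in> trivs R" "q0 \<in> U" and pm: "paired m U \<psi>" and m: "2 * m < length (weights R)"
  shows "\<exists>U' \<psi>'. (U', \<psi>') \<in> trivs R \<and> q0 \<in> U' \<and> paired (Suc m) U' \<psi>'"
proof -
  let ?ws = "weights R" and ?N = "length (weights R)"
  define j where "j = ?ws ! (2 * m)"
  have j1: "1 \<le> j" using R.weights_pos[OF nth_mem[OF m]] by (simp add: j_def)
  let ?D = "over M (H 0) U"
  note c = trivs_coord_M[OF U(1)]
  obtain \<sigma> where s: "coord_section M (base R) (H 0) ?N U \<psi> \<sigma>" using coord_trivE[OF c] .
  define y where "y = (\<lambda>p. \<psi> p (2 * m))"
  have y: "smf M ?D y" unfolding y_def by (rule smf_Kspace_comp[OF coord_trivD(2)[OF c]])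
  have yh: "y (H (of_real t) p) = t ^ j * y p" if "p \<in> ?D" for t p
    unfolding y_def trivs_real_scale[OF U(1) that] using m by (simp add: graded_scale_def j_def)
  define z where "z = holo_part y j"
  have zs: "smf M ?D (\<lambda>p. Re (z p))" "smf M ?D (\<lambda>p. Im (z p))"
    using holo_part_smooth[OF y over_H] by (auto simp: z_def ksmf_complex)
  have zh: "z (H \<xi> p) = \<xi> ^ j * z p" if "p \<in> ?D" for \<xi> p
    unfolding z_def by (rule holo_part_homogeneous[OF y over_H yh that])
  have zr: "Re (z (H (of_real t) p)) = t ^ j * Re (z p)" "Im (z (H (of_real t) p)) = t ^ j * Im (z p)"
    if "p \<in> ?D" for t p
    unfolding zh[OF that] by (simp_all flip: of_real_power)
  have uK: "unit_vec b \<in> (Kspace ?N :: (nat \<Rightarrow> real) set)" if "b < ?N" for b by (rule unit_vec_Kspace[OF that])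
  \<comment> \<open>The point whose only nonzero coordinate is the one in place \<open>2 * m\<close>
    lies on the core, so \<open>Re_holo_part\<close> applies and gives the slope 1/2.\<close>
  have Re0: "Re (z (\<sigma> q0 (unit_vec (2 * m)))) \<noteq> 0"
  proof -
    define p where "p = \<sigma> q0 (unit_vec (2 * m))"
    note x = coord_sectionD(2,3,5,6)[OF s U(2) uK[OF m], folded p_def]
    have core: "R.core_point j p"
      by (rule R.core_pointI[OF _ U(1)]) (use x U(2) in \<open>auto simp: R_simps unit_vec_def j_def\<close>)
    have "Re (holo_part y j p) = y p / 2"
    proof (rule Re_holo_part[OF y over_H yh x(4) j1])
      fix u
      have "H 0 (H u p) \<in> U" using over_H[OF x(4), of u] by (simp add: over_iff)
      then show "y (H (exp (2 * of_real pi * \<i> / of_nat (2 * j))) (H u p)) = - y (H u p)"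
        unfolding y_def by (intro nice_coords[OF core_point_H[OF core] U(1) _ m]) (simp_all add: j_def)
    qed
    moreover have "y p = 1" using x(2) by (simp add: y_def unit_vec_def)
    ultimately have "Re (z p) \<noteq> 0" by (simp add: z_def)
    then show ?thesis unfolding p_def .
  qed
  \<comment> \<open>With \<open>b = c = 2 * m\<close> nothing is moved: \<open>Re (z p)\<close>
    takes the place of the coordinate \<open>2 * m\<close>.\<close>
  obtain U1 where U1: "U1 \<subseteq> U" "q0 \<in> U1"
    "(U1, \<lambda>p a. if a = 2 * m then Re (z p) else if a = 2 * m then \<psi> p (2 * m) else \<psi> p a) \<in> trivs R"
    using exchange[OF U s zs(1) zr(1) m m j_def[symmetric] j_def[symmetric] Re0] by blast
  define \<psi>1 where "\<psi>1 = (\<lambda>p a. if a = 2 * m then Re (z p) else \<psi> p a)"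
  have "(\<lambda>p a. if a = 2 * m then Re (z p) else if a = 2 * m then \<psi> p (2 * m) else \<psi> p a) = \<psi>1"
    by (auto simp: \<psi>1_def fun_eq_iff)
  then have t1: "(U1, \<psi>1) \<in> trivs R" using U1(3) by simp
  note c1 = trivs_coord_M[OF t1]
  obtain \<sigma>1 where s1: "coord_section M (base R) (H 0) ?N U1 \<psi>1 \<sigma>1" using coord_trivE[OF c1] .
  let ?D1 = "over M (H 0) U1"
  have D1: "?D1 \<subseteq> ?D" using U1(1) by (auto simp: over_iff)
  have zi: "smf M ?D1 (\<lambda>p. Im (z p))" by (rule smf_subset[OF M_atlas zs(2) coord_trivD(3)[OF c1] D1])
  \<comment> \<open>The lower bound on \<open>b\<close> protects the pairs already formed, and the
    new real part in place \<open>2 * m\<close>, from the next exchange.\<close>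
  have "\<exists>b\<ge>2 * m + 1. b < ?N \<and> ?ws ! b = j \<and> Im (z (\<sigma>1 q0 (unit_vec b))) \<noteq> 0"
  proof (rule ccontr)
    assume "\<not> ?thesis"
    then have none: "Im (z (\<sigma>1 q0 (unit_vec b))) = 0" if "b \<ge> 2 * m + 1" "b < ?N" "?ws ! b = j" for b using that by blast
    define p1 where "p1 = \<sigma>1 q0 (unit_vec (2 * m))"
    note x1 = coord_sectionD(2,3,5,6)[OF s1 U1(2) uK[OF m], folded p1_def]
    define \<kappa> where "\<kappa> = Im (z p1)"
    have z1: "z p1 = Complex 1 \<kappa>"
      using fun_cong[OF x1(2), of "2 * m"] by (simp add: \<psi>1_def unit_vec_def \<kappa>_def complex_eq_iff)
    \<comment> \<open>Moving \<open>p1\<close> by \<open>u\<close> multiplies \<open>z\<close> by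
      \<open>\<i>\<close>, so that \<open>Complex 1 \<kappa>\<close> becomes
      \<open>Complex (- \<kappa>) 1\<close>.\<close>
    define u where "u = exp (of_real pi * \<i> / of_nat (2 * j))"
    have uj: "u ^ j = \<i>" unfolding u_def by (rule exp_half_root_power[OF j1])
    define p2 where "p2 = H u p1"
    have p2D: "p2 \<in> ?D1" unfolding p2_def by (rule over_H[OF x1(4)])
    have z2: "z p2 = Complex (- \<kappa>) 1"
      using zh[of p1 u] x1(4) D1 by (auto simp: p2_def uj z1 complex_eq_iff)
    have q2: "H 0 p2 = q0" using x1(1) H_mult[OF x1(3), of 0 u] by (simp add: p2_def)
    have core1: "R.core_point j p1"
      by (rule R.core_pointI[OF _ t1]) (use x1 U1(2) in \<open>auto simp: R_simps unit_vec_def j_def\<close>)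
    have core2: "R.core_point j p2" unfolding p2_def by (rule core_point_H[OF core1])
    let ?G = "\<lambda>y. Im (z (\<sigma>1 q0 y))"
    have G: "homogeneous_polynomial ?ws j ?G"
    proof (rule section_polynomial[OF R.base_atlas R.weights coord_trivD(1)[OF c1] s1 _ _ zi _ j1 U1(2)])
      show "hom_coords M (H 0) ?ws (restrict_real H) U1 \<psi>1" "fibered_action M (H 0) (restrict_real H)"
        using R.homothety_hom_coords[OF t1] R.homothety_fibered by (simp_all add: R_simps)
      show "Im (z (restrict_real H t p)) = t ^ j * Im (z p)" if "p \<in> ?D1" for t p
        using zr(2)[of p t] that D1 by (auto simp: restrict_real_def)
    qed
    have K2: "\<psi>1 p2 \<in> Kspace ?N" by (rule coord_trivD(4)[OF c1 p2D])
    have "?G (\<psi>1 p2) = (\<Sum>b | b < ?N \<and> ?ws ! b = j. ?G (unit_vec b) * \<psi>1 p2 b)"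
    proof (rule homogeneous_polynomial_lower_zero[OF R.weights_pos G K2])
      show "\<psi>1 p2 a = 0" if "a < ?N" "?ws ! a < j" for a
        using R.core_pointD[OF core2 t1 _ that] p2D by (simp add: R_simps over_iff)
    qed
    \<comment> \<open>Later coordinates have slope zero by the assumption to be refuted. Earlier
      ones belong to pairs which vanish at \<open>p1\<close> and, being multiplied by a power of
      \<open>u\<close>, also at \<open>p2\<close>.\<close>
    also have "\<dots> = (\<Sum>b\<in>{2 * m}. ?G (unit_vec b) * \<psi>1 p2 b)"
    proof (rule sum.mono_neutral_right)
      show "\<forall>b\<in>{b. b < ?N \<and> ?ws ! b = j} - {2 * m}. ?G (unit_vec b) * \<psi>1 p2 b = 0"
      proof
        fix b assume b: "b \<in> {b. b < ?N \<and> ?ws ! b = j} - {2 * m}"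
        show "?G (unit_vec b) * \<psi>1 p2 b = 0"
        proof (cases "b < 2 * m")
          case False then show ?thesis using none[of b] b by simp
        next
          case True
          define i where "i = b div 2"
          have i: "i < m" "b = 2 * i \<or> b = 2 * i + 1" using True by (auto simp: i_def)
          have p1i: "\<psi> p1 (2 * i) = 0" "\<psi> p1 (2 * i + 1) = 0"
            using fun_cong[OF x1(2), of "2 * i"] fun_cong[OF x1(2), of "2 * i + 1"] i(1)
            by (auto simp: \<psi>1_def unit_vec_def split: if_splits)
          have p1D: "p1 \<in> ?D" using x1(4) D1 by blast
          have "Complex (\<psi> p2 (2 * i)) (\<psi> p2 (2 * i + 1)) = u ^ (?ws ! (2 * i)) * Complex (\<psi> p1 (2 * i)) (\<psi> p1 (2 * i + 1))"
            using pm i(1) p1D unfolding paired_def p2_def by blast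
          then have "\<psi> p2 (2 * i) = 0" "\<psi> p2 (2 * i + 1) = 0" unfolding p1i by (simp_all add: complex_eq_iff)
          then have "\<psi> p2 b = 0" using i(2) by auto
          then show ?thesis using True by (simp add: \<psi>1_def)
        qed
      qed
    qed (use m in \<open>auto simp: j_def\<close>)
    also have "\<dots> = \<kappa> * - \<kappa>"
      using z2 by (simp add: \<psi>1_def \<kappa>_def p1_def)
    finally have "?G (\<psi>1 p2) = - (\<kappa> * \<kappa>)" by simp
    \<comment> \<open>The imaginary part of \<open>z\<close> at \<open>p2\<close> is 1, but its
      linear expression gives minus a square.\<close>
    moreover have "?G (\<psi>1 p2) = 1" using coord_sectionD(4)[OF s1 p2D] by (simp add: q2 z2)
    ultimately show False using zero_le_square[of \<kappa>] by linarith
  qed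
  then obtain b where b: "2 * m + 1 \<le> b" "b < ?N" "?ws ! b = j" "Im (z (\<sigma>1 q0 (unit_vec b))) \<noteq> 0" by blast
  have c1N: "2 * m + 1 < ?N" using b by simp
  have srt: "sorted ?ws" using R.weights by (simp add: is_weights_def)
  \<comment> \<open>In a sorted list the place \<open>2 * m + 1\<close> lies between
    \<open>2 * m\<close> and \<open>b\<close>, both of weight \<open>j\<close>.\<close>
  have wc: "?ws ! (2 * m + 1) = j"
    using sorted_nth_mono[OF srt, of "2 * m" "2 * m + 1"] sorted_nth_mono[OF srt b(1,2)] c1N b(3) by (simp add: j_def)
  have zr1: "Im (z (H (of_real t) p)) = t ^ j * Im (z p)" if "p \<in> ?D1" for t p using zr(2) that D1 by blast
  obtain U2 where U2: "U2 \<subseteq> U1" "q0 \<in> U2"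
    "(U2, \<lambda>p a. if a = 2 * m + 1 then Im (z p) else if a = b then \<psi>1 p (2 * m + 1) else \<psi>1 p a) \<in> trivs R"
    using exchange[OF t1 U1(2) s1 zi zr1 b(2) c1N b(3) wc b(4)] by blast
  define \<psi>2 where "\<psi>2 = (\<lambda>p a. if a = 2 * m + 1 then Im (z p) else if a = b then \<psi>1 p (2 * m + 1) else \<psi>1 p a)"
  have "paired (Suc m) U2 \<psi>2"
    unfolding paired_def
  proof (intro allI impI conjI ballI)
    fix i assume i: "i < Suc m"
    show "2 * i + 1 < ?N" using i c1N by simp
    show "?ws ! (2 * i + 1) = ?ws ! (2 * i)"
      using i pm wc by (cases "i = m") (auto simp: paired_def j_def)
    fix \<xi> p assume "p \<in> over M (H 0) U2"
    then have p: "p \<in> ?D" using U1(1) U2(1) by (auto simp: over_iff)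
    show "Complex (\<psi>2 (H \<xi> p) (2 * i)) (\<psi>2 (H \<xi> p) (2 * i + 1)) =
        \<xi> ^ (?ws ! (2 * i)) * Complex (\<psi>2 p (2 * i)) (\<psi>2 p (2 * i + 1))"
    proof (cases "i = m")
      case True
      have "Complex (\<psi>2 x (2 * m)) (\<psi>2 x (2 * m + 1)) = z x" for x
        using b(1) by (simp add: \<psi>2_def \<psi>1_def)
      then show ?thesis using zh[OF p] True by (simp add: j_def)
    next
      case False
      have "\<psi>2 x (2 * i) = \<psi> x (2 * i)" "\<psi>2 x (2 * i + 1) = \<psi> x (2 * i + 1)" for x
        using i False b(1) by (auto simp: \<psi>2_def \<psi>1_def)
      then show ?thesis using pm i False p unfolding paired_def by simp
    qed
  qed
  then show ?thesis using U2(2,3) unfolding \<psi>2_def by blast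
qed

lemma paired_exists:
  assumes q: "q \<in> mcarrier (base R)"
  shows "2 * m \<le> length (weights R) + 1 \<Longrightarrow> \<exists>U \<psi>. (U, \<psi>) \<in> trivs R \<and> q \<in> U \<and> paired m U \<psi>"
proof (induction m)
  case 0
  obtain U \<psi> where "(U, \<psi>) \<in> trivs R" "q \<in> U" using R.trivs_cover[OF q] .
  then show ?case by (auto simp: paired_def)
next
  case (Suc m)
  then obtain U \<psi> where "(U, \<psi>) \<in> trivs R" "q \<in> U" "paired m U \<psi>" by auto
  from paired_step[OF this] Suc.prems show ?case by simp
qed

lemma complex_bundle_exists: "\<exists>E :: ('e, 'e, complex) graded_bundle. bundle_of_structure M H E"
proof -
  let ?ws = "weights R" and ?B = "base R"
  define n where "n = length ?ws div 2"
  define wc where "wc = map (\<lambda>i. ?ws ! (2 * i)) [0..<n]"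
  have lwc: "length wc = n" by (simp add: wc_def)
  have wcw: "is_weights wc"
    unfolding is_weights_def
  proof
    have srt: "sorted ?ws" using R.weights by (simp add: is_weights_def)
    show "sorted wc" unfolding sorted_iff_nth_mono
      by (auto simp: wc_def n_def intro!: sorted_nth_mono[OF srt])
    show "\<forall>w\<in>set wc. 1 \<le> w" using R.weights_pos[OF nth_mem] by (force simp: wc_def n_def)
  qed
  have cover: "\<exists>U \<theta>. q \<in> U \<and> coord_triv M ?B (H 0) (length wc) U \<theta> \<and> hom_coords M (H 0) wc H U \<theta>"
    if q: "q \<in> mcarrier ?B" for q
  proof -
    \<comment> \<open>Rounded up: if the number of real coordinates were odd, \<open>paired\<close>
      would provide a partner beyond the last of them. So it is even, and all coordinates are
      paired.\<close>
    define m where "m = (length ?ws + 1) div 2"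
    have "2 * m \<le> length ?ws + 1" by (simp add: m_def)
    then obtain U \<psi> where U: "(U, \<psi>) \<in> trivs R" "q \<in> U" "paired m U \<psi>" using paired_exists[OF q] by blast
    have le: "2 * m \<le> length ?ws"
    proof (cases m)
      case (Suc k)
      then have "2 * k + 1 < length ?ws" using U(3) by (simp add: paired_def)
      then show ?thesis using Suc by simp
    qed simp
    have len: "length ?ws = 2 * n" using le unfolding m_def n_def by presburger
    have mn: "m = n" using le unfolding m_def n_def by presburger
    let ?c = "\<lambda>p. complexify_coords n (\<psi> p)"
    have "coord_triv M ?B (H 0) (length wc) U ?c"
      using coord_triv_complexify[OF M_atlas R.base_atlas, of "H 0" n U \<psi>] trivs_coord_M[OF U(1)] by (simp add: len lwc)
    moreover have "hom_coords M (H 0) wc H U ?c"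
      unfolding hom_coords_def
    proof (intro allI ballI ext)
      fix \<xi> p i assume p: "p \<in> over M (H 0) U"
      show "complexify_coords n (\<psi> (H \<xi> p)) i = graded_scale wc \<xi> (complexify_coords n (\<psi> p)) i"
        using U(3) p unfolding paired_def mn
        by (auto simp: complexify_coords_def graded_scale_def lwc wc_def)
    qed
    ultimately show ?thesis using U(2) by blast
  qed
  have fib: "fibered_action M (H 0) H"
    using H_carrier H_mult by (simp add: fibered_action_def)
  have pr: "smooth_map M ?B (H 0)" using R.proj_smooth by (simp add: R_simps)
  note mk = complex_field.mk_bundle[OF M_smooth R.base_smooth pr R_simps(4)[symmetric] H_ext wcw fib H_ext cover]
    complex_field.homothety_mk_bundle[OF M_smooth R.base_smooth pr R_simps(4)[symmetric] H_ext wcw fib H_ext cover]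
  show ?thesis
    by (rule exI[of _ "mk_bundle M ?B (H 0) wc H"]) (use mk R_simps(4) in \<open>simp add: bundle_of_structure_def\<close>)
qed

end

theorem nice_bundle_exists:
  assumes "nice_structure M H"
  shows "\<exists>E. bundle_of_structure M H E"
proof -
  obtain R :: "('a, 'a, real) graded_bundle" where R: "bundle_of_structure M (restrict_real H) R"
    "\<forall>j\<in>{1..bundle_degree R}. \<forall>x\<in>core R j.
           tower_map R j (H (exp (2 * of_real pi * \<i> / of_nat (2 * j)))) x = core_uminus R j x"
    and H: "homogeneity_structure M H" using assms unfolding nice_structure_def by blast
  interpret complex_structure M H by unfold_locales (rule H)
  interpret RR: field_bundle "TYPE(real)" R
    by unfold_locales (use R(1) in \<open>simp add: bundle_of_structure_def\<close>)
  interpret nice_complex_structure M H R by unfold_locales (use R in auto)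
  show ?thesis by (rule complex_bundle_exists)
qed

section \<open>Equivalence of the categories\<close>

lemma homogeneity_hom_carrier:
  assumes "smooth_manifold (fst X)" "smooth_manifold (fst Y)" "f \<in> homogeneity_hom X Y" "p \<in> mcarrier (fst X)"
  shows "f p \<in> mcarrier (fst Y)"
proof -
  have "smooth_map (fst X) (fst Y) f" using assms(3) by (simp add: homogeneity_hom_def)
  then have "smap (fst X) (mcarrier (fst X)) (fst Y) f" using smooth_map_iff_smap[of "fst X" "fst Y" f] assms(1,2) by simp
  then show ?thesis using assms(4) by (rule smap_image)
qed

lemma homogeneity_hom_compose:
  assumes X: "smooth_manifold (fst X)" and Y: "smooth_manifold (fst Y)" and Z: "smooth_manifold (fst Z)"
    and f: "f \<in> homogeneity_hom X Y" and g: "g \<in> homogeneity_hom Y Z"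
    and hX: "\<And>\<xi> p. p \<in> mcarrier (fst X) \<Longrightarrow> snd X \<xi> p \<in> mcarrier (fst X)"
  shows "compose (mcarrier (fst X)) g f \<in> homogeneity_hom X Z"
proof -
  note fc = homogeneity_hom_carrier[OF X Y f]
  have sf: "smap (fst X) (mcarrier (fst X)) (fst Y) f" and sg: "smap (fst Y) (mcarrier (fst Y)) (fst Z) g"
    using f g smooth_map_iff_smap[of "fst X" "fst Y" f] smooth_map_iff_smap[of "fst Y" "fst Z" g] X Y Z
    by (simp_all add: homogeneity_hom_def)
  have "f ` mcarrier (fst X) \<subseteq> mcarrier (fst Y)" using fc by blast
  from smap_compose[OF sf sg this] have "smap (fst X) (mcarrier (fst X)) (fst Z) (compose (mcarrier (fst X)) g f)"
    by (rule smap_cong[rotated]) (use X in \<open>simp_all add: compose_def\<close>)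
  then have "smooth_map (fst X) (fst Z) (compose (mcarrier (fst X)) g f)"
    using smooth_map_iff_smap[of "fst X" "fst Z"] X Z by simp
  moreover have "compose (mcarrier (fst X)) g f (snd X \<xi> p) = snd Z \<xi> (compose (mcarrier (fst X)) g f p)"
    if p: "p \<in> mcarrier (fst X)" for \<xi> p
    using f g p hX[OF p] fc[OF p] by (simp add: compose_def homogeneity_hom_def)
  ultimately show ?thesis by (simp add: homogeneity_hom_def)
qed

lemma homogeneity_hom_id:
  assumes X: "smooth_manifold (fst X)" and hX: "\<And>\<xi> p. p \<in> mcarrier (fst X) \<Longrightarrow> snd X \<xi> p \<in> mcarrier (fst X)"
  shows "(\<lambda>p\<in>mcarrier (fst X). p) \<in> homogeneity_hom X X"
proof -
  have "smap (fst X) (mcarrier (fst X)) (fst X) (\<lambda>p. p)" using X by (intro smap_id) simp_all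
  then have "smap (fst X) (mcarrier (fst X)) (fst X) (\<lambda>p\<in>mcarrier (fst X). p)"
    by (rule smap_cong[rotated]) (use X in simp_all)
  then show ?thesis
    using smooth_map_iff_smap[of "fst X" "fst X"] X hX by (simp add: homogeneity_hom_def)
qed

lemma homogeneity_structure_carrier:
  fixes H :: "complex \<Rightarrow> 'a \<Rightarrow> 'a"
  assumes "homogeneity_structure M H" "p \<in> mcarrier M"
  shows "H \<xi> p \<in> mcarrier M"
proof -
  interpret complex_structure M H by unfold_locales fact
  show ?thesis by (rule H_carrier) fact
qed

lemma nice_structure_homogeneity: "nice_structure M H \<Longrightarrow> homogeneity_structure M H"
  by (simp add: nice_structure_def)

lemma nice_structure_smooth: "nice_structure M H \<Longrightarrow> smooth_manifold M"
  by (simp add: nice_structure_def homogeneity_structure_def)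

lemma graded_bundle_hom_base:
  fixes E :: "('e, 'b, 'k::{real_normed_field, euclidean_space}) graded_bundle" and E' :: "('e2, 'b2, 'k) graded_bundle"
  assumes E: "is_graded_bundle E" and hom: "(\<Phi>, \<phi>) \<in> graded_bundle_hom E E'"
  shows "\<phi> = restrict (\<lambda>q. proj E' (\<Phi> (gr_bundle.zero_section E q))) (mcarrier (base E))"
proof
  interpret E: gr_bundle E by unfold_locales fact
  have \<phi>: "\<phi> \<in> extensional (mcarrier (base E))" "\<And>p. p \<in> mcarrier (tot E) \<Longrightarrow> proj E' (\<Phi> p) = \<phi> (proj E p)"
    using hom by (auto simp: graded_bundle_hom_def)
  fix q show "\<phi> q = restrict (\<lambda>q. proj E' (\<Phi> (E.zero_section q))) (mcarrier (base E)) q"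
    using \<phi>(2)[OF E.zero_section_props(1)] E.zero_section_props(2) \<phi>(1) by (auto simp: extensional_def)
qed

text \<open>The projection is surjective, so the map of total spaces determines that of the bases.
  Equations between base maps are obtained from this instead of by computation.\<close>

lemma graded_bundle_hom_unique:
  fixes E :: "('e, 'b, 'k::{real_normed_field, euclidean_space}) graded_bundle" and E' :: "('e2, 'b2, 'k) graded_bundle"
  assumes "is_graded_bundle E" "(\<Phi>, \<phi>) \<in> graded_bundle_hom E E'" "(\<Phi>, \<phi>') \<in> graded_bundle_hom E E'"
  shows "\<phi> = \<phi>'"
  using graded_bundle_hom_base[OF assms(1,2)] graded_bundle_hom_base[OF assms(1,3)] by simp

lemma is_graded_bundle_facts:
  assumes "is_graded_bundle E"
  shows "smooth_manifold (tot E)" "smooth_manifold (base E)"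
    "\<And>\<xi> p. p \<in> mcarrier (tot E) \<Longrightarrow> homothety E \<xi> p \<in> mcarrier (tot E)"
proof -
  interpret E: gr_bundle E by unfold_locales fact
  show "smooth_manifold (tot E)" "smooth_manifold (base E)" by (rule E.tot_smooth E.base_smooth)+
  show "\<And>\<xi> p. p \<in> mcarrier (tot E) \<Longrightarrow> homothety E \<xi> p \<in> mcarrier (tot E)" by (rule E.homothety_props(1))
qed

lemma graded_bundle_hom_maps:
  fixes E :: "('e, 'b, 'k::{real_normed_field, euclidean_space}) graded_bundle" and E' :: "('e2, 'b2, 'k) graded_bundle"
  assumes E: "is_graded_bundle E" "is_graded_bundle E'" and hom: "(\<Phi>, \<phi>) \<in> graded_bundle_hom E E'"
  shows "\<Phi> \<in> extensional (mcarrier (tot E))" "\<phi> \<in> extensional (mcarrier (base E))"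
    "\<Phi> \<in> mcarrier (tot E) \<rightarrow> mcarrier (tot E')" "\<phi> \<in> mcarrier (base E) \<rightarrow> mcarrier (base E')"
    "\<And>p. p \<in> mcarrier (tot E) \<Longrightarrow> proj E' (\<Phi> p) = \<phi> (proj E p)"
proof -
  have "smooth_map (tot E) (tot E') \<Phi>" "smooth_map (base E) (base E') \<phi>"
    using hom by (auto simp: graded_bundle_hom_def)
  then show "\<Phi> \<in> mcarrier (tot E) \<rightarrow> mcarrier (tot E')" "\<phi> \<in> mcarrier (base E) \<rightarrow> mcarrier (base E')"
    by (auto simp: smooth_map_def continuous_map_def)
  show "\<Phi> \<in> extensional (mcarrier (tot E))" "\<phi> \<in> extensional (mcarrier (base E))"
    "\<And>p. p \<in> mcarrier (tot E) \<Longrightarrow> proj E' (\<Phi> p) = \<phi> (proj E p)"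
    using hom by (auto simp: graded_bundle_hom_def)
qed

text \<open>Reduces a morphism of bundles to its map of total spaces, for which identities and
  composition are settled on the side of homogeneity structures.\<close>

lemma complex_graded_bundle_hom_iff:
  fixes E :: "('e, 'b, complex) graded_bundle" and E' :: "('e2, 'b2, complex) graded_bundle"
  assumes E: "is_graded_bundle E" and E': "is_graded_bundle E'"
  shows "(\<Phi>, \<phi>) \<in> graded_bundle_hom E E' \<longleftrightarrow>
    \<Phi> \<in> homogeneity_hom (tot E, homothety E) (tot E', homothety E') \<and>
    \<phi> = restrict (\<lambda>q. proj E' (\<Phi> (gr_bundle.zero_section E q))) (mcarrier (base E))"
  (is "?L \<longleftrightarrow> ?R")
proof
  assume h: ?L
  show ?R by (intro conjI graded_bundle_hom_intertwines[OF E E' h] graded_bundle_hom_base[OF E h])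
next
  assume ?R
  then show ?L using complex_field.homogeneity_hom_graded_bundle_hom[OF E E', of \<Phi>] by simp
qed

lemma complex_graded_bundle_hom_id:
  fixes E :: "('e, 'b, complex) graded_bundle"
  assumes E: "is_graded_bundle E"
  shows "(\<lambda>p\<in>mcarrier (tot E). p, \<lambda>q\<in>mcarrier (base E). q) \<in> graded_bundle_hom E E"
proof -
  interpret E: gr_bundle E by unfold_locales fact
  have "(\<lambda>p\<in>mcarrier (tot E). p) \<in> homogeneity_hom (tot E, homothety E) (tot E, homothety E)"
    using homogeneity_hom_id[of "(tot E, homothety E)"] is_graded_bundle_facts[OF E] by simp
  then show ?thesis
    unfolding complex_graded_bundle_hom_iff[OF E E]
    using E.zero_section_props by (auto intro!: restrict_ext)
qed

lemma complex_graded_bundle_hom_compose: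
  fixes E :: "('e, 'b, complex) graded_bundle" and E' :: "('e2, 'b2, complex) graded_bundle"
    and E'' :: "('e3, 'b3, complex) graded_bundle"
  assumes E: "is_graded_bundle E" and E': "is_graded_bundle E'" and E'': "is_graded_bundle E''"
    and f: "(\<Phi>, \<phi>) \<in> graded_bundle_hom E E'" and g: "(\<Psi>, \<psi>) \<in> graded_bundle_hom E' E''"
  shows "(compose (mcarrier (tot E)) \<Psi> \<Phi>, compose (mcarrier (base E)) \<psi> \<phi>) \<in> graded_bundle_hom E E''"
proof -
  interpret E: gr_bundle E by unfold_locales fact
  note F = graded_bundle_hom_maps[OF E E' f] and G = graded_bundle_hom_maps[OF E' E'' g]
  have "compose (mcarrier (tot E)) \<Psi> \<Phi> \<in> homogeneity_hom (tot E, homothety E) (tot E'', homothety E'')"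
    using homogeneity_hom_compose[of "(tot E, homothety E)" "(tot E', homothety E')" "(tot E'', homothety E'')" \<Phi> \<Psi>]
      is_graded_bundle_facts[OF E] is_graded_bundle_facts[OF E'] is_graded_bundle_facts[OF E'']
      f g complex_graded_bundle_hom_iff[OF E E'] complex_graded_bundle_hom_iff[OF E' E''] by simp
  moreover have "\<psi> (\<phi> q) = proj E'' (compose (mcarrier (tot E)) \<Psi> \<Phi> (E.zero_section q))" if q: "q \<in> mcarrier (base E)" for q
  proof -
    note z = E.zero_section_props[OF q]
    have "\<Phi> (E.zero_section q) \<in> mcarrier (tot E')" using F(3) z(1) by auto
    from G(5)[OF this] F(5)[OF z(1)] show ?thesis using z by (simp add: compose_def)
  qed
  ultimately show ?thesis
    unfolding complex_graded_bundle_hom_iff[OF E E''] by (auto simp: compose_def intro!: restrict_ext)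
qed

lemma compose_id_right: "f \<in> extensional A \<Longrightarrow> compose A f (\<lambda>x\<in>A. x) = f"
  by (auto simp: compose_def extensional_def fun_eq_iff)

lemma compose_id_left: "f \<in> extensional A \<Longrightarrow> f \<in> A \<rightarrow> B \<Longrightarrow> compose A (\<lambda>x\<in>B. x) f = f"
  by (auto simp: compose_def extensional_def fun_eq_iff)

section \<open>The two categories and the functors between them\<close>

lemma is_category_bundles: "is_category (connected_complex_graded_bundles :: (('a, 'a, complex) graded_bundle, _) cat)"
  (is "is_category ?C")
proof -
  have obj: "is_graded_bundle E" if "E \<in> Obj ?C" for E
    using that by (simp add: connected_complex_graded_bundles_def)
  have C: "Hom ?C = graded_bundle_hom" "Ident ?C = (\<lambda>E. (\<lambda>p\<in>mcarrier (tot E). p, \<lambda>q\<in>mcarrier (base E). q))"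
    "\<And>E E' E'' \<Psi> \<psi> \<Phi> \<phi>. Comp ?C E E' E'' (\<Psi>, \<psi>) (\<Phi>, \<phi>) = (compose (mcarrier (tot E)) \<Psi> \<Phi>, compose (mcarrier (base E)) \<psi> \<phi>)"
    by (simp_all add: connected_complex_graded_bundles_def)
  show ?thesis
    unfolding is_category_def C(1,2)
  proof (intro conjI ballI, goal_cases)
    case (1 E) show ?case by (rule complex_graded_bundle_hom_id[OF obj[OF 1]])
  next
    case (2 E E' E'' f g)
    obtain \<Phi> \<phi> \<Psi> \<psi> where e: "f = (\<Phi>, \<phi>)" "g = (\<Psi>, \<psi>)" by (cases f; cases g) auto
    show ?case
      using complex_graded_bundle_hom_compose[OF obj[OF 2(1)] obj[OF 2(2)] obj[OF 2(3)] 2(4,5)[unfolded e]]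
      unfolding e C(3) .
  next
    case (3 E E' f)
    obtain \<Phi> \<phi> where e: "f = (\<Phi>, \<phi>)" by (cases f)
    note m = graded_bundle_hom_maps[OF obj[OF 3(1)] obj[OF 3(2)] 3(3)[unfolded e]]
    show ?case unfolding e C(3) compose_id_right[OF m(1)] compose_id_right[OF m(2)] ..
  next
    case (4 E E' f)
    obtain \<Phi> \<phi> where e: "f = (\<Phi>, \<phi>)" by (cases f)
    note m = graded_bundle_hom_maps[OF obj[OF 4(1)] obj[OF 4(2)] 4(3)[unfolded e]]
    show ?case unfolding e C(3) compose_id_left[OF m(1,3)] compose_id_left[OF m(2,4)] ..
  next
    case (5 E E' E'' E''' f g k)
    obtain \<Phi> \<phi> \<Psi> \<psi> \<Theta> \<theta> where e: "f = (\<Phi>, \<phi>)" "g = (\<Psi>, \<psi>)" "k = (\<Theta>, \<theta>)"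
      by (cases f; cases g; cases k) auto
    note m = graded_bundle_hom_maps[OF obj[OF 5(1)] obj[OF 5(2)] 5(5)[unfolded e]]
    show ?case unfolding e C(3) compose_assoc[OF m(3)] compose_assoc[OF m(4)] ..
  qed
qed

lemma is_category_structures: "is_category (connected_nice_structures :: ('a manifold \<times> _, _) cat)"
  (is "is_category ?D")
proof -
  have obj: "smooth_manifold (fst X)" "homogeneity_structure (fst X) (snd X)" if "X \<in> Obj ?D" for X
    using that nice_structure_smooth nice_structure_homogeneity by (auto simp: connected_nice_structures_def)
  have D: "Hom ?D = homogeneity_hom" "Ident ?D = (\<lambda>X. \<lambda>p\<in>mcarrier (fst X). p)"
    "Comp ?D = (\<lambda>X _ _ g f. compose (mcarrier (fst X)) g f)"
    by (auto simp: connected_nice_structures_def fun_eq_iff)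
  have car: "snd X \<xi> p \<in> mcarrier (fst X)" if "X \<in> Obj ?D" "p \<in> mcarrier (fst X)" for X \<xi> p
    using homogeneity_structure_carrier[OF obj(2)[OF that(1)] that(2)] .
  have ext: "f \<in> extensional (mcarrier (fst X))" if "f \<in> homogeneity_hom X Y" for f X Y
    using that by (simp add: homogeneity_hom_def)
  have map: "f \<in> mcarrier (fst X) \<rightarrow> mcarrier (fst Y)" if "X \<in> Obj ?D" "Y \<in> Obj ?D" "f \<in> homogeneity_hom X Y" for X Y f
    using homogeneity_hom_carrier[OF obj(1)[OF that(1)] obj(1)[OF that(2)] that(3)] by auto
  show ?thesis
    unfolding is_category_def D
  proof (intro conjI ballI, goal_cases)
    case (1 X) show ?case by (rule homogeneity_hom_id[OF obj(1)[OF 1] car[OF 1]])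
  next
    case (2 X Y Z f g)
    show ?case by (rule homogeneity_hom_compose[OF obj(1)[OF 2(1)] obj(1)[OF 2(2)] obj(1)[OF 2(3)] 2(4,5) car[OF 2(1)]])
  next
    case (3 X Y f) show ?case by (rule compose_id_right[OF ext[OF 3(3)]])
  next
    case (4 X Y f) show ?case by (rule compose_id_left[OF ext[OF 4(3)] map[OF 4]])
  next
    case (5 X Y Z W f g k) show ?case by (rule compose_assoc[OF map[OF 5(1,2,5)]])
  qed
qed

lemma canonical_bundle:
  assumes "nice_structure M H" "connected_manifold M"
  shows "bundle_of_structure M H (canonical_bundle M H)" "\<exists>!E. bundle_of_structure M H E"
proof -
  have ne: "mcarrier M \<noteq> {}" using assms(2) by (simp add: connected_manifold_def)
  show ex1: "\<exists>!E. bundle_of_structure M H E"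
    using nice_bundle_exists[OF assms(1)] complex_field.bundle_of_structure_unique[OF _ _ ne] by blast
  show "bundle_of_structure M H (canonical_bundle M H)"
    unfolding canonical_bundle_def by (rule theI'[OF ex1])
qed

lemma canonical_bundle_simps:
  assumes "nice_structure M H" "connected_manifold M"
  shows "is_graded_bundle (canonical_bundle M H)" "tot (canonical_bundle M H) = M"
    "mcarrier (base (canonical_bundle M H)) = H 0 ` mcarrier M" "proj (canonical_bundle M H) = H 0"
    "homothety (canonical_bundle M H) = H"
  using canonical_bundle(1)[OF assms] by (simp_all add: bundle_of_structure_def)

text \<open>The points of the base are fixed by \<open>H 0\<close>, so the zero section is the
  inclusion and the forced base map is the restriction of \<open>f\<close>.\<close>

lemma canonical_bundle_hom:
  assumes M: "nice_structure M H" "connected_manifold M" and M': "nice_structure M' H'" "connected_manifold M'"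
    and f: "f \<in> homogeneity_hom (M, H) (M', H')"
  shows "(f, restrict f (H 0 ` mcarrier M)) \<in> graded_bundle_hom (canonical_bundle M H) (canonical_bundle M' H')"
proof -
  let ?E = "canonical_bundle M H" and ?E' = "canonical_bundle M' H'"
  note E = canonical_bundle_simps[OF M] and E' = canonical_bundle_simps[OF M']
  have "H' 0 (f (gr_bundle.zero_section ?E q)) = f q" if q: "q \<in> H 0 ` mcarrier M" for q
  proof -
    have "q \<in> mcarrier (base ?E)" using q E(3) by simp
    note z = complex_field.bundle_of_structure_zero_section[OF canonical_bundle(1)[OF M] this]
    have "H' 0 (f q) = f (H 0 q)" using f z(3) by (simp add: homogeneity_hom_def)
    then show ?thesis using z by simp
  qed
  then have "restrict f (H 0 ` mcarrier M) =
      restrict (\<lambda>q. proj ?E' (f (gr_bundle.zero_section ?E q))) (mcarrier (base ?E))"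
    unfolding E(3) E'(4) by (auto intro!: restrict_ext)
  then show ?thesis
    unfolding complex_graded_bundle_hom_iff[OF E(1) E'(1)] using f by (simp add: E(2,5) E'(2,5))
qed

lemma homothety_is_functor:
  "is_functor (connected_complex_graded_bundles :: (('a, 'a, complex) graded_bundle, _) cat) connected_nice_structures homothety_functor"
  unfolding is_functor_def
proof (intro conjI ballI, goal_cases)
  case (1 E)
  then show ?case
    using homothety_nice[of E]
    by (simp add: connected_complex_graded_bundles_def connected_nice_structures_def homothety_functor_def)
next
  case (2 E E' f)
  obtain \<Phi> \<phi> where f: "f = (\<Phi>, \<phi>)" by (cases f)
  from 2 show ?case
    using graded_bundle_hom_intertwines[of E E' \<Phi> \<phi>]
    by (simp add: f connected_complex_graded_bundles_def connected_nice_structures_def homothety_functor_def)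
next
  case (3 E)
  show ?case by (simp add: connected_complex_graded_bundles_def connected_nice_structures_def homothety_functor_def)
next
  case (4 E E' E'' f g)
  obtain \<Phi> \<phi> \<Psi> \<psi> where "f = (\<Phi>, \<phi>)" "g = (\<Psi>, \<psi>)" by (cases f; cases g) auto
  then show ?case by (simp add: connected_complex_graded_bundles_def connected_nice_structures_def homothety_functor_def)
qed

lemma canonical_bundle_is_functor:
  "is_functor connected_nice_structures (connected_complex_graded_bundles :: (('a, 'a, complex) graded_bundle, _) cat) canonical_bundle_functor"
  unfolding is_functor_def
proof (intro conjI ballI, goal_cases)
  case (1 X)
  then show ?case
    by (auto simp: connected_complex_graded_bundles_def connected_nice_structures_def canonical_bundle_functor_def canonical_bundle_simps)
next
  case (2 X Y f)
  obtain M H where X: "X = (M, H)" "nice_structure M H" "connected_manifold M"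
    using 2(1) by (auto simp: connected_nice_structures_def)
  obtain M' H' where Y: "Y = (M', H')" "nice_structure M' H'" "connected_manifold M'"
    using 2(2) by (auto simp: connected_nice_structures_def)
  have "f \<in> homogeneity_hom (M, H) (M', H')" using 2(3) X Y by (simp add: connected_nice_structures_def)
  from canonical_bundle_hom[OF X(2,3) Y(2,3) this] show ?case
    by (simp add: X Y connected_complex_graded_bundles_def canonical_bundle_functor_def)
next
  case (3 X)
  obtain M H where X: "X = (M, H)" "nice_structure M H" "connected_manifold M"
    using 3 by (auto simp: connected_nice_structures_def)
  have "H 0 ` mcarrier M \<subseteq> mcarrier M"
    using homogeneity_structure_carrier[OF nice_structure_homogeneity[OF X(2)]] by blast
  then have "mcarrier M \<inter> H 0 ` mcarrier M = H 0 ` mcarrier M" by (rule Int_absorb1)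
  then show ?case
    by (simp add: X connected_complex_graded_bundles_def connected_nice_structures_def canonical_bundle_functor_def
        canonical_bundle_simps)
next
  case (4 X Y Z f g)
  obtain M H where X: "X = (M, H)" "nice_structure M H" "connected_manifold M"
    using 4(1) by (auto simp: connected_nice_structures_def)
  obtain M' H' where Y: "Y = (M', H')" "nice_structure M' H'" "connected_manifold M'"
    using 4(2) by (auto simp: connected_nice_structures_def)
  have f: "f \<in> homogeneity_hom (M, H) (M', H')" using 4(4) X Y by (simp add: connected_nice_structures_def)
  have fc: "f p \<in> mcarrier M'" if "p \<in> mcarrier M" for p
    using homogeneity_hom_carrier[OF _ _ f] that nice_structure_smooth[OF X(2)] nice_structure_smooth[OF Y(2)] by simp
  have Hc: "H 0 p \<in> mcarrier M" if "p \<in> mcarrier M" for p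
    using homogeneity_structure_carrier[OF nice_structure_homogeneity[OF X(2)] that] .
  \<comment> \<open>A morphism maps base points to base points, so restricting \<open>g\<close> to
    the base of the middle bundle loses no value of the composite.\<close>
  have "f (H 0 p) \<in> H' 0 ` mcarrier M'" if "p \<in> mcarrier M" for p
    using f that fc by (auto simp: homogeneity_hom_def)
  then have "restrict (compose (mcarrier M) g f) (H 0 ` mcarrier M) =
      compose (H 0 ` mcarrier M) (restrict g (H' 0 ` mcarrier M')) (restrict f (H 0 ` mcarrier M))"
    using Hc by (auto simp: compose_def fun_eq_iff restrict_def)
  then show ?case
    using X Y by (simp add: connected_complex_graded_bundles_def connected_nice_structures_def canonical_bundle_functor_def
        canonical_bundle_simps)
qed

text \<open>Both bundles have the same total space and the same homotheties, so the identity of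
  total spaces is an isomorphism, over the forced map from the old base to the image of the zero
  section. The equations between base maps follow from
  \<open>graded_bundle_hom_unique\<close>.\<close>

lemma unit_isomorphism:
  "\<exists>\<eta>. natural_isomorphism (connected_complex_graded_bundles :: (('a, 'a, complex) graded_bundle, _) cat)
     connected_complex_graded_bundles id_functor (comp_functor canonical_bundle_functor homothety_functor) \<eta>"
proof -
  let ?C = "connected_complex_graded_bundles :: (('a, 'a, complex) graded_bundle, _) cat"
  define G where "G = (\<lambda>E :: ('a, 'a, complex) graded_bundle. canonical_bundle (tot E) (homothety E))"
  \<comment> \<open>The base map forced by the identity of total spaces; one formula serves for both
    directions.\<close>
  define bm where "bm = (\<lambda>(E :: ('a, 'a, complex) graded_bundle) (E' :: ('a, 'a, complex) graded_bundle).
      restrict (\<lambda>q. proj E' (restrict (\<lambda>p. p) (mcarrier (tot E)) (gr_bundle.zero_section E q))) (mcarrier (base E)))"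
  define \<eta> where "\<eta> = (\<lambda>E. (\<lambda>p\<in>mcarrier (tot E). p, bm E (G E)))"
  have obj: "is_graded_bundle E" "connected_manifold (tot E)" if "E \<in> Obj ?C" for E
    using that by (simp_all add: connected_complex_graded_bundles_def)
  have GE: "is_graded_bundle (G E)" "tot (G E) = tot E" "homothety (G E) = homothety E" if "E \<in> Obj ?C" for E
    using canonical_bundle_simps[OF homothety_nice[OF obj(1)[OF that]] obj(2)[OF that]] by (simp_all add: G_def)
  have C: "Hom ?C = graded_bundle_hom" "Ident ?C = (\<lambda>E. (\<lambda>p\<in>mcarrier (tot E). p, \<lambda>q\<in>mcarrier (base E). q))"
    "\<And>E E' E'' \<Psi> \<psi> \<Phi> \<phi>. Comp ?C E E' E'' (\<Psi>, \<psi>) (\<Phi>, \<phi>) = (compose (mcarrier (tot E)) \<Psi> \<Phi>, compose (mcarrier (base E)) \<psi> \<phi>)"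
    by (simp_all add: connected_complex_graded_bundles_def)
  have idhom: "(\<lambda>p\<in>mcarrier (tot E). p, bm E E') \<in> graded_bundle_hom E E'"
    if "is_graded_bundle E" "is_graded_bundle E'" "tot E = tot E'" "homothety E = homothety E'" for E E'
  proof -
    have "(\<lambda>p\<in>mcarrier (tot E). p) \<in> homogeneity_hom (tot E, homothety E) (tot E', homothety E')"
      using homogeneity_hom_id[of "(tot E, homothety E)"] is_graded_bundle_facts[OF that(1)] that(3,4) by simp
    then show ?thesis unfolding complex_graded_bundle_hom_iff[OF that(1,2)] bm_def by simp
  qed
  have idid: "compose A (\<lambda>p\<in>A. p) (\<lambda>p\<in>A. p) = (\<lambda>p\<in>A. p)" for A :: "'a set"
    by (rule compose_id_right) simp
  have inverse: "(compose (mcarrier (tot E)) (\<lambda>p\<in>mcarrier (tot E). p) (\<lambda>p\<in>mcarrier (tot E). p), compose (mcarrier (base E)) (bm E' E) (bm E E')) =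
      (\<lambda>p\<in>mcarrier (tot E). p, \<lambda>q\<in>mcarrier (base E). q)"
    if e: "is_graded_bundle E" "is_graded_bundle E'" "tot E = tot E'" "homothety E = homothety E'" for E E'
  proof -
    have "(\<lambda>p\<in>mcarrier (tot E). p, compose (mcarrier (base E)) (bm E' E) (bm E E')) \<in> graded_bundle_hom E E"
      using complex_graded_bundle_hom_compose[OF e(1,2,1) idhom[OF e] idhom[OF e(2,1) e(3,4)[symmetric]]] e(3)
      by (simp add: idid)
    then show ?thesis
      using graded_bundle_hom_unique[OF e(1) _ complex_graded_bundle_hom_id[OF e(1)]] by (simp add: idid)
  qed
  have "natural_isomorphism ?C ?C id_functor (comp_functor canonical_bundle_functor homothety_functor) \<eta>"
    unfolding natural_isomorphism_def
  proof (intro conjI ballI, goal_cases)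
    case (1 E)
    note g = GE[OF 1] and o = obj(1)[OF 1]
    have "iso_in ?C E (G E) (\<eta> E)"
      unfolding iso_in_def C(1,2)
    proof (intro conjI bexI[of _ "(\<lambda>p\<in>mcarrier (tot (G E)). p, bm (G E) E)"])
      show "\<eta> E \<in> graded_bundle_hom E (G E)"
        unfolding \<eta>_def by (rule idhom[OF o g(1) g(2,3)[symmetric]])
      show "(\<lambda>p\<in>mcarrier (tot (G E)). p, bm (G E) E) \<in> graded_bundle_hom (G E) E"
        by (rule idhom[OF g(1) o g(2,3)])
      show "Comp ?C E (G E) E (\<lambda>p\<in>mcarrier (tot (G E)). p, bm (G E) E) (\<eta> E) = (\<lambda>p\<in>mcarrier (tot E). p, \<lambda>q\<in>mcarrier (base E). q)"
        unfolding \<eta>_def C(3) g(2) by (rule inverse[OF o g(1) g(2,3)[symmetric]])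
      show "Comp ?C (G E) E (G E) (\<eta> E) (\<lambda>p\<in>mcarrier (tot (G E)). p, bm (G E) E) =
          (\<lambda>p\<in>mcarrier (tot (G E)). p, \<lambda>q\<in>mcarrier (base (G E)). q)"
        unfolding \<eta>_def C(3) using inverse[OF g(1) o g(2,3)] by (simp add: g(2))
    qed
    then show ?case
      by (simp add: id_functor_def comp_functor_def canonical_bundle_functor_def homothety_functor_def G_def)
  next
    case (2 E E' f)
    note o = obj(1)[OF 2(1)] obj(1)[OF 2(2)] and g = GE[OF 2(1)] and g' = GE[OF 2(2)]
    obtain \<Phi> \<phi> where f: "f = (\<Phi>, \<phi>)" by (cases f)
    have hom: "(\<Phi>, \<phi>) \<in> graded_bundle_hom E E'" using 2(3) f C(1) by simp
    \<comment> \<open>The base map that \<open>canonical_bundle_functor\<close> assigns to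
      \<open>\<Phi>\<close>. It enters below through the fact that it completes
      \<open>\<Phi>\<close> to a morphism of the canonical bundles.\<close>
    define \<phi>' where "\<phi>' = restrict \<Phi> (homothety E 0 ` mcarrier (tot E))"
    have hom': "(\<Phi>, \<phi>') \<in> graded_bundle_hom (G E) (G E')"
      unfolding \<phi>'_def G_def
      by (rule canonical_bundle_hom[OF homothety_nice[OF o(1)] obj(2)[OF 2(1)] homothety_nice[OF o(2)] obj(2)[OF 2(2)]
            graded_bundle_hom_intertwines[OF o hom]])
    note m = graded_bundle_hom_maps[OF o hom]
    have e: "compose (mcarrier (tot E)) (\<lambda>p\<in>mcarrier (tot E'). p) \<Phi> = \<Phi>" "compose (mcarrier (tot E)) \<Phi> (\<lambda>p\<in>mcarrier (tot E). p) = \<Phi>"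
      using compose_id_left[OF m(1,3)] compose_id_right[OF m(1)] by auto
    have "(\<Phi>, compose (mcarrier (base E)) (bm E' (G E')) \<phi>) \<in> graded_bundle_hom E (G E')"
      using complex_graded_bundle_hom_compose[OF o(1,2) g'(1) hom idhom[OF o(2) g'(1) g'(2,3)[symmetric]]] by (simp add: e)
    moreover have "(\<Phi>, compose (mcarrier (base E)) \<phi>' (bm E (G E))) \<in> graded_bundle_hom E (G E')"
      using complex_graded_bundle_hom_compose[OF o(1) g(1) g'(1) idhom[OF o(1) g(1) g(2,3)[symmetric]] hom'] by (simp add: e)
    ultimately have b: "compose (mcarrier (base E)) (bm E' (G E')) \<phi> = compose (mcarrier (base E)) \<phi>' (bm E (G E))"
      by (rule graded_bundle_hom_unique[OF o(1)])
    have "Comp ?C E E' (G E') (\<eta> E') f = Comp ?C E (G E) (G E') (\<Phi>, \<phi>') (\<eta> E)"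
      unfolding \<eta>_def f C(3) e b ..
    then show ?case
      by (simp add: id_functor_def comp_functor_def canonical_bundle_functor_def homothety_functor_def G_def f \<phi>'_def)
  qed
  then show ?thesis by blast
qed

text \<open>The homotheties of a canonical bundle are the structure it comes from, so this composite
  fixes objects and morphisms, and identities form the isomorphism.\<close>

lemma counit_isomorphism:
  "\<exists>\<epsilon>. natural_isomorphism (connected_nice_structures :: ('a manifold \<times> _, _) cat) connected_nice_structures
     (comp_functor homothety_functor canonical_bundle_functor) id_functor \<epsilon>"
proof -
  let ?D = "connected_nice_structures :: ('a manifold \<times> _, _) cat"
  let ?FG = "comp_functor homothety_functor canonical_bundle_functor ::
    ('a manifold \<times> (complex \<Rightarrow> 'a \<Rightarrow> 'a), 'a \<Rightarrow> 'a, 'a manifold \<times> (complex \<Rightarrow> 'a \<Rightarrow> 'a), 'a \<Rightarrow> 'a) cat_functor"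
  have FG: "on_obj ?FG X = X" if "X \<in> Obj ?D" for X
    using that by (auto simp: comp_functor_def homothety_functor_def canonical_bundle_functor_def connected_nice_structures_def
        canonical_bundle_simps)
  have FGh: "on_hom ?FG X Y f = f" for X Y f
    by (simp add: comp_functor_def homothety_functor_def canonical_bundle_functor_def case_prod_beta)
  note cat = is_category_structures[where 'a = 'a, unfolded is_category_def]
  have id: "Ident ?D X \<in> Hom ?D X X" if "X \<in> Obj ?D" for X using conjunct1[OF cat] that by (rule bspec)
  note u = conjunct1[OF conjunct2[OF conjunct2[OF cat]]]
  have unit: "Comp ?D X X Y f (Ident ?D X) = f" "Comp ?D X Y Y (Ident ?D Y) f = f"
    if "X \<in> Obj ?D" "Y \<in> Obj ?D" "f \<in> Hom ?D X Y" for X Y f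
    using bspec[OF bspec[OF bspec[OF u that(1)] that(2)] that(3)] by simp_all
  have "natural_isomorphism ?D ?D ?FG id_functor (Ident ?D)"
    unfolding natural_isomorphism_def
  proof (intro conjI ballI)
    fix X assume X: "X \<in> Obj ?D"
    show "iso_in ?D (on_obj ?FG X) (on_obj id_functor X) (Ident ?D X)"
      unfolding iso_in_def FG[OF X] id_functor_def cat_functor.simps
      using id[OF X] unit(1)[OF X X id[OF X]] by (intro conjI bexI[of _ "Ident ?D X"])
  next
    fix X Y f assume X: "X \<in> Obj ?D" and Y: "Y \<in> Obj ?D" and f: "f \<in> Hom ?D X Y"
    show "Comp ?D (on_obj ?FG X) (on_obj ?FG Y) (on_obj id_functor Y) (Ident ?D Y) (on_hom ?FG X Y f) =
        Comp ?D (on_obj ?FG X) (on_obj id_functor X) (on_obj id_functor Y) (on_hom id_functor X Y f) (Ident ?D X)"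
      unfolding FG[OF X] FG[OF Y] FGh id_functor_def cat_functor.simps unit[OF X Y f] ..
  qed
  then show ?thesis by blast
qed

text \<open>The objects of a category share one type, hence the single universe of points in the
  first clause. The clauses on objects and morphisms allow different types of points for different
  objects.\<close>

theorem theorem3p18:
  shows "equivalence_of_categories
           (connected_complex_graded_bundles ::
              (('a, 'a, complex) graded_bundle, ('a \<Rightarrow> 'a) \<times> ('a \<Rightarrow> 'a)) cat)
           connected_nice_structures
           homothety_functor
           canonical_bundle_functor
    \<and> (\<forall>E :: ('a, 'b, complex) graded_bundle.
         is_graded_bundle E \<and> connected_manifold (tot E) \<longrightarrow>
         nice_structure (tot E) (homothety E))
    \<and> (\<forall>(M :: 'a manifold) h. nice_structure M h \<and> connected_manifold M \<longrightarrow>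
         (\<exists>!E. bundle_of_structure M h E))
    \<and> (\<forall>(E :: ('a, 'b, complex) graded_bundle) (E' :: ('c, 'd, complex) graded_bundle) \<Phi> \<phi>.
         is_graded_bundle E \<and> connected_manifold (tot E) \<and>
         is_graded_bundle E' \<and> connected_manifold (tot E') \<and>
         (\<Phi>, \<phi>) \<in> graded_bundle_hom E E' \<longrightarrow>
         \<Phi> \<in> homogeneity_hom (tot E, homothety E) (tot E', homothety E'))
    \<and> (\<forall>(M :: 'a manifold) h (M' :: 'c manifold) h' f.
         nice_structure M h \<and> connected_manifold M \<and>
         nice_structure M' h' \<and> connected_manifold M' \<and>
         f \<in> homogeneity_hom (M, h) (M', h') \<longrightarrow>
         (f, restrict f (h 0 ` mcarrier M)) \<in>
           graded_bundle_hom (canonical_bundle M h) (canonical_bundle M' h'))"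
proof (intro conjI allI impI, goal_cases)
  case 1
  show ?case
    unfolding equivalence_of_categories_def
    by (intro conjI is_category_bundles is_category_structures homothety_is_functor canonical_bundle_is_functor
        unit_isomorphism counit_isomorphism)
next
  case (2 E) then show ?case using homothety_nice by blast
next
  case (3 M h) then show ?case using canonical_bundle(2) by blast
next
  case (4 E E' \<Phi> \<phi>) then show ?case using graded_bundle_hom_intertwines by blast
next
  case (5 M h M' h' f) then show ?case using canonical_bundle_hom by blast
qed

end
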